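(* Let $\widetilde{H}$ be the affine Hecke algebra of type $G_2$. Assume $q^2\neq\pm1$ and that $q^2$ is not a primitive third root of unity. Let $t=t_{q^2,1}$ and $w_0=s_1s_2s_1s_2s_1s_2$. Let $\mathbb{C}v_t$ and $\mathbb{C}v_{w_0t}$ be the $1$-dimensional $\widetilde{H}_{\{1\}}$-modules given by $T_1v_t=qv_t$, $X^\lambda v_t=t(X^\lambda)v_t$, and $T_1v_{w_0t}=-q^{-1}v_{w_0t}$, $X^\lambda v_{w_0t}=(w_0t)(X^\lambda)v_{w_0t}$, and let $M=\widetilde{H}\otimes_{\widetilde{H}_{\{1\}}}\mathbb{C}v_t$ and $N=\widetilde{H}\otimes_{\widetilde{H}_{\{1\}}}\mathbb{C}v_{w_0t}$. (a) If $q^2$ is a primitive fourth root of unity, then $M_{s_2s_1s_2s_1t}$ is a $1$-dimensional submodule of $M$, and $M'$, the image of the weight spaces $M_{s_1s_2s_1t}$ and $M_{s_2s_1t}$ (i.e. of their sum) in $M/M_{s_2s_1s_2s_1t}$, is an irreducible submodule of $M/M_{s_2s_1s_2s_1t}$. The resulting quotient of $M$ is irreducible. (b) If $q^2$ is a primitive fourth root of unity, then $N_{s_1t}$ is a $1$-dimensional submodule of $N$, and $N'$, the image of the weight spaces $N_{s_2s_1t}$ and $N_{s_1s_2s_1t}$ in $N/N_{s_1t}$, is an irreducible submodule of $N/N_{s_1t}$. The resulting quotient of $N$ is irreducible. (c) The composition factors of $M$ and $N$ are the only composition factors of the principal series module $M(t)=\widetilde{H}\otimes_{\mathbb{C}[X]}\mathbb{C}_t$.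 (d) If $q^2$ is not a primitive third or fourth root of unity, then $M$ and $N$ are irreducible, and are the only irreducible modules with central character $t$.
   Context: The type $G_2$ root system has simple roots $\alpha_1,\alpha_2$ with $\langle\alpha_1,\alpha_2^\vee\rangle=-1$, $\langle\alpha_2,\alpha_1^\vee\rangle=-3$; $s_i\lambda=\lambda-\langle\lambda,\alpha_i^\vee\rangle\alpha_i$, and $W_0=\langle s_1,s_2\rangle$. $P=\mathbb{Z}\alpha_1+\mathbb{Z}\alpha_2$ is the weight lattice; $X=\{X^\lambda\mid\lambda\in P\}$, $X^\lambda X^\mu=X^{\lambda+\mu}$. For $q\in\mathbb{C}^\times$, $\widetilde{H}$ is the $\mathbb{C}$-algebra generated by $T_1,T_2$ and $X^\lambda$ ($\lambda\in P$), with the group algebra $\mathbb{C}[X]$ a subalgebra, subject to $T_i^2=(q-q^{-1})T_i+1$, $T_1T_2T_1T_2T_1T_2=T_2T_1T_2T_1T_2T_1$, and $X^\lambda T_i=T_iX^{s_i\lambda}+(q-q^{-1})\frac{X^\lambda-X^{s_i\lambda}}{1-X^{-\alpha_i}}$. $\widetilde{H}_{\{i\}}$ is the subalgebra generated by $T_i$ and $\mathbb{C}[X]$. Weights are elements of $T=\mathrm{Hom}(X,\mathbb{C}^\times)$, with $W_0$-action $(wt)(X^\lambda)=t(X^{w^{-1}\lambda})$; $t_{z,w}\in T$ is given by $t_{z,w}(X^{\alpha_1})=z$, $t_{z,w}(X^{\alpha_2})=w$. $\mathbb{C}_t$ is the $1$-dimensional $\mathbb{C}[X]$-module on which $X^\lambda$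 acts by $t(X^\lambda)$. For a finite-dimensional $\widetilde{H}$-module $M$, $M_t=\{m\mid X^\lambda m=t(X^\lambda)m\ \forall\lambda\in P\}$ and $M_t^{\mathrm{gen}}=\{m\mid\forall\lambda\ \exists k>0:(X^\lambda-t(X^\lambda))^km=0\}$; $t$ is a weight of $M$ if $M_t^{\mathrm{gen}}\neq0$. The weights of an irreducible $\widetilde{H}$-module lie in a single $W_0$-orbit; this orbit (or any element of it) is called its central character. (Irreducible $\widetilde{H}$-modules are finite-dimensional.) *)

theory Defs
  imports
    Complex_Main
    "HOL-Library.Poly_Mapping"
    "HOL-Library.Product_Plus"
    "HOL-Algebra.Bij"
    "HOL-Algebra.Free_Abelian_Groups"
    "HOL-Algebra.Generated_Rings"
    "HOL-Algebra.Module"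
    "HOL-Algebra.QuotRing"
begin

section \<open>Left modules over a (not necessarily commutative) ring\<close>

text \<open>
  The locale \<open>module\<close> of the library assumes a commutative ring; its record type and its
  locale \<open>submodule\<close> do not, and are used below.
\<close>

locale left_module = R?: ring R + M?: abelian_group M
    for R :: "('a, 'r) ring_scheme" (structure) and M :: "('a, 'b, 'm) module_scheme" (structure) +
  assumes lsmult_closed:
      "\<lbrakk>a \<in> carrier R; x \<in> carrier M\<rbrakk> \<Longrightarrow> a \<odot>\<^bsub>M\<^esub> x \<in> carrier M"
    and lsmult_l_distr:
      "\<lbrakk>a \<in> carrier R; b \<in> carrier R; x \<in> carrier M\<rbrakk> \<Longrightarrow>
        (a \<oplus>\<^bsub>R\<^esub> b) \<odot>\<^bsub>M\<^esub> x = a \<odot>\<^bsub>M\<^esub> x \<oplus>\<^bsub>M\<^esub> b \<odot>\<^bsub>M\<^esub> x"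
    and lsmult_r_distr:
      "\<lbrakk>a \<in> carrier R; x \<in> carrier M; y \<in> carrier M\<rbrakk> \<Longrightarrow>
        a \<odot>\<^bsub>M\<^esub> (x \<oplus>\<^bsub>M\<^esub> y) = a \<odot>\<^bsub>M\<^esub> x \<oplus>\<^bsub>M\<^esub> a \<odot>\<^bsub>M\<^esub> y"
    and lsmult_assoc:
      "\<lbrakk>a \<in> carrier R; b \<in> carrier R; x \<in> carrier M\<rbrakk> \<Longrightarrow>
        (a \<otimes>\<^bsub>R\<^esub> b) \<odot>\<^bsub>M\<^esub> x = a \<odot>\<^bsub>M\<^esub> (b \<odot>\<^bsub>M\<^esub> x)"
    and lsmult_one: "x \<in> carrier M \<Longrightarrow> \<one>\<^bsub>R\<^esub> \<odot>\<^bsub>M\<^esub> x = x"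

definition quot_module :: "('r, 'm) module \<Rightarrow> 'm set \<Rightarrow> ('r, 'm set) module" where
  "quot_module M S =
    \<lparr>carrier = a_rcosets\<^bsub>M\<^esub> S, monoid.mult = undefined, one = undefined, zero = S, add = set_add M,
     smult = (\<lambda>r C. \<Union>m\<in>C. S +>\<^bsub>M\<^esub> (r \<odot>\<^bsub>M\<^esub> m))\<rparr>"

definition module_iso :: "'r ring \<Rightarrow> ('r, 'm) module \<Rightarrow> ('r, 'n) module \<Rightarrow> bool" where
  "module_iso R M N \<longleftrightarrow> (\<exists>\<phi>. bij_betw \<phi> (carrier M) (carrier N) \<and>
     (\<forall>x\<in>carrier M. \<forall>y\<in>carrier M. \<phi> (x \<oplus>\<^bsub>M\<^esub> y) = \<phi> x \<oplus>\<^bsub>N\<^esub> \<phi> y) \<and>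
     (\<forall>r\<in>carrier R. \<forall>x\<in>carrier M. \<phi> (r \<odot>\<^bsub>M\<^esub> x) = r \<odot>\<^bsub>N\<^esub> \<phi> x))"

definition irreducible_module :: "'r ring \<Rightarrow> ('r, 'm) module \<Rightarrow> bool" where
  "irreducible_module R M \<longleftrightarrow> left_module R M \<and> carrier M \<noteq> {\<zero>\<^bsub>M\<^esub>} \<and>
     (\<forall>S. submodule S R M \<longrightarrow> S = {\<zero>\<^bsub>M\<^esub>} \<or> S = carrier M)"

definition composition_series :: "'r ring \<Rightarrow> ('r, 'm) module \<Rightarrow> nat \<Rightarrow> (nat \<Rightarrow> 'm set) \<Rightarrow> bool" where
  "composition_series R M n V \<longleftrightarrow>
     V 0 = {\<zero>\<^bsub>M\<^esub>} \<and> V n = carrier M \<and> (\<forall>i\<le>n. submodule (V i) R M) \<and>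
     (\<forall>i<n. V i \<subseteq> V (Suc i) \<and>
        irreducible_module R (quot_module (M\<lparr>carrier := V (Suc i)\<rparr>) (V i)))"

text \<open>\<open>L\<close> is (isomorphic to) a composition factor of \<open>M\<close>.\<close>

definition composition_factor :: "'r ring \<Rightarrow> ('r, 'm) module \<Rightarrow> ('r, 'l) module \<Rightarrow> bool" where
  "composition_factor R M L \<longleftrightarrow> (\<exists>n V. composition_series R M n V \<and>
     (\<exists>i<n. module_iso R L (quot_module (M\<lparr>carrier := V (Suc i)\<rparr>) (V i))))"


section \<open>Induced modules\<close>

text \<open>
  The tensor product of \<open>R\<close> and \<open>V\<close> over a subring \<open>A\<close> of \<open>R\<close>: the free abelian group on
  \<open>carrier R \<times> carrier V\<close> modulo biadditivity and \<open>A\<close>-balancedness, with \<open>R\<close> acting on the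
  left factor.
\<close>

definition balanced_relations ::
    "'r ring \<Rightarrow> 'r set \<Rightarrow> ('r, 'v) module \<Rightarrow> ('r \<times> 'v \<Rightarrow>\<^sub>0 int) set" where
  "balanced_relations R A V =
     {frag_of (g \<oplus>\<^bsub>R\<^esub> h, v) - frag_of (g, v) - frag_of (h, v) | g h v.
        g \<in> carrier R \<and> h \<in> carrier R \<and> v \<in> carrier V} \<union>
     {frag_of (g, v \<oplus>\<^bsub>V\<^esub> w) - frag_of (g, v) - frag_of (g, w) | g v w.
        g \<in> carrier R \<and> v \<in> carrier V \<and> w \<in> carrier V} \<union>
     {frag_of (g \<otimes>\<^bsub>R\<^esub> a, v) - frag_of (g, a \<odot>\<^bsub>V\<^esub> v) | g a v.
        g \<in> carrier R \<and> a \<in> A \<and> v \<in> carrier V}"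

definition balanced_subgroup ::
    "'r ring \<Rightarrow> 'r set \<Rightarrow> ('r, 'v) module \<Rightarrow> ('r \<times> 'v \<Rightarrow>\<^sub>0 int) set" where
  "balanced_subgroup R A V =
     generate (free_Abelian_group (carrier R \<times> carrier V)) (balanced_relations R A V)"

definition left_mult_frag :: "'r ring \<Rightarrow> 'r \<Rightarrow> ('r \<times> 'v \<Rightarrow>\<^sub>0 int) \<Rightarrow> ('r \<times> 'v \<Rightarrow>\<^sub>0 int)" where
  "left_mult_frag R r = frag_extend (\<lambda>(g, v). frag_of (r \<otimes>\<^bsub>R\<^esub> g, v))"

definition induced_module ::
    "'r ring \<Rightarrow> 'r set \<Rightarrow> ('r, 'v) module \<Rightarrow> ('r, ('r \<times> 'v \<Rightarrow>\<^sub>0 int) set) module" where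
  "induced_module R A V =
    (let F = free_Abelian_group (carrier R \<times> carrier V); K = balanced_subgroup R A V in
     \<lparr>carrier = rcosets\<^bsub>F\<^esub> K, monoid.mult = undefined, one = undefined, zero = K, add = set_mult F,
      smult = (\<lambda>r C. \<Union>c\<in>C. K #>\<^bsub>F\<^esub> left_mult_frag R r c)\<rparr>)"

lemma left_mult_frag_simps:
  "left_mult_frag R r (frag_of (g, v)) = frag_of (r \<otimes>\<^bsub>R\<^esub> g, v)"
  "left_mult_frag R r 0 = 0"
  "left_mult_frag R r (a + b) = left_mult_frag R r a + left_mult_frag R r b"
  "left_mult_frag R r (a - b) = left_mult_frag R r a - left_mult_frag R r b"
  "left_mult_frag R r (- a) = - left_mult_frag R r a"
  by (simp_all add: left_mult_frag_def frag_extend_add frag_extend_diff frag_extend_minus)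

lemma left_module_induced_module:
  fixes R :: "'r ring" and V :: "('r, 'v) module"
  assumes R: "ring R" and A: "A \<subseteq> carrier R"
    and V: "\<And>v w. v \<in> carrier V \<Longrightarrow> w \<in> carrier V \<Longrightarrow> v \<oplus>\<^bsub>V\<^esub> w \<in> carrier V"
      "\<And>a v. a \<in> A \<Longrightarrow> v \<in> carrier V \<Longrightarrow> a \<odot>\<^bsub>V\<^esub> v \<in> carrier V"
  shows "left_module R (induced_module R A V)"
proof -
  interpret R: ring R by (rule R)
  define F where "F = free_Abelian_group (carrier R \<times> carrier V)"
  define B where "B = balanced_relations R A V"
  define K where "K = balanced_subgroup R A V"
  define l where "l = (left_mult_frag R :: _ \<Rightarrow> ('r \<times> 'v \<Rightarrow>\<^sub>0 int) \<Rightarrow> _)"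
  have Kg: "K = generate F B" by (simp add: K_def F_def B_def balanced_subgroup_def)
  interpret F: comm_group F unfolding F_def by (rule abelian_free_Abelian_group)
  have Fc: "carrier F = {c. Poly_Mapping.keys c \<subseteq> carrier R \<times> carrier V}"
    and Fm: "\<And>x y. x \<otimes>\<^bsub>F\<^esub> y = x + y" and F1: "\<one>\<^bsub>F\<^esub> = 0"
    by (auto simp: F_def free_Abelian_group_def)
  have Fi: "inv\<^bsub>F\<^esub> x = - x" if "x \<in> carrier F" for x
    using that by (simp add: F_def)
  have fo: "frag_of (g, v) \<in> carrier F" if "g \<in> carrier R" "v \<in> carrier V" for g v
    using that by (simp add: Fc)
  have Fd: "x - y \<in> carrier F" if "x \<in> carrier F" "y \<in> carrier F" for x y
    using F.m_closed[OF that(1) F.inv_closed[OF that(2)]] that by (simp add: Fm Fi)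
  have BF: "B \<subseteq> carrier F"
    unfolding B_def balanced_relations_def using A V
    by (auto intro!: Fd fo)
  have K: "subgroup K F" unfolding Kg by (rule F.generate_is_subgroup[OF BF])
  interpret K: normal K F by (rule F.subgroup_imp_normal[OF K])
  have KF: "K \<subseteq> carrier F" by (rule K.subset)
  have l_simps: "l r (frag_of (g, v)) = frag_of (r \<otimes>\<^bsub>R\<^esub> g, v)" "l r 0 = 0"
    "l r (a + b) = l r a + l r b" "l r (a - b) = l r a - l r b" "l r (- a) = - l r a" for r a b g v
    by (simp_all add: l_def left_mult_frag_simps)
  have lF: "l r c \<in> carrier F" if "r \<in> carrier R" "c \<in> carrier F" for r c
  proof -
    have "Poly_Mapping.keys c \<subseteq> carrier R \<times> carrier V" using that by (simp add: Fc)
    then show ?thesis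
    proof (induction c rule: frag_induction)
      case zero then show ?case using F.one_closed by (simp add: l_simps F1)
    next
      case (one x) then show ?case using that by (cases x) (auto simp: l_simps intro!: fo)
    next
      case (diff a b) then show ?case by (simp add: l_simps Fd)
    qed
  qed
  have B1: "frag_of (g \<oplus>\<^bsub>R\<^esub> h, v) - frag_of (g, v) - frag_of (h, v) \<in> B"
    if "g \<in> carrier R" "h \<in> carrier R" "v \<in> carrier V" for g h v
    using that unfolding B_def balanced_relations_def by blast
  have B2: "frag_of (g, v \<oplus>\<^bsub>V\<^esub> w) - frag_of (g, v) - frag_of (g, w) \<in> B"
    if "g \<in> carrier R" "v \<in> carrier V" "w \<in> carrier V" for g v w
    using that unfolding B_def balanced_relations_def by blast
  have B3: "frag_of (g \<otimes>\<^bsub>R\<^esub> a, v) - frag_of (g, a \<odot>\<^bsub>V\<^esub> v) \<in> B"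
    if "g \<in> carrier R" "a \<in> A" "v \<in> carrier V" for g a v
    using that unfolding B_def balanced_relations_def by blast
  have lB: "l r b \<in> B" if r: "r \<in> carrier R" and b: "b \<in> B" for r b
  proof -
    consider (1) g h v where "b = frag_of (g \<oplus>\<^bsub>R\<^esub> h, v) - frag_of (g, v) - frag_of (h, v)"
        "g \<in> carrier R" "h \<in> carrier R" "v \<in> carrier V"
      | (2) g v w where "b = frag_of (g, v \<oplus>\<^bsub>V\<^esub> w) - frag_of (g, v) - frag_of (g, w)"
        "g \<in> carrier R" "v \<in> carrier V" "w \<in> carrier V"
      | (3) g a v where "b = frag_of (g \<otimes>\<^bsub>R\<^esub> a, v) - frag_of (g, a \<odot>\<^bsub>V\<^esub> v)"
        "g \<in> carrier R" "a \<in> A" "v \<in> carrier V"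
      using b unfolding B_def balanced_relations_def by blast
    then show ?thesis
    proof cases
      case 1
      then show ?thesis using B1[of "r \<otimes>\<^bsub>R\<^esub> g" "r \<otimes>\<^bsub>R\<^esub> h" v] r by (simp add: l_simps R.r_distr)
    next
      case 2
      then show ?thesis using B2[of "r \<otimes>\<^bsub>R\<^esub> g" v w] r by (simp add: l_simps)
    next
      case 3
      then have "r \<otimes>\<^bsub>R\<^esub> (g \<otimes>\<^bsub>R\<^esub> a) = (r \<otimes>\<^bsub>R\<^esub> g) \<otimes>\<^bsub>R\<^esub> a"
        using r A by (simp add: R.m_assoc subset_iff)
      then show ?thesis using B3[of "r \<otimes>\<^bsub>R\<^esub> g" a v] r 3 by (simp add: l_simps)
    qed
  qed
  have lK: "l r k \<in> K" if "r \<in> carrier R" "k \<in> K" for r k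
    using that(2) unfolding Kg
  proof (induction rule: generate.induct)
    case one then show ?case using generate.one[of F B] by (simp add: F1 l_simps)
  next
    case (incl h) then show ?case using lB[OF that(1)] by (auto intro: generate.incl)
  next
    case (inv h)
    then have "l r (inv\<^bsub>F\<^esub> h) = inv\<^bsub>F\<^esub> (l r h)"
      using BF lF[OF that(1)] by (auto simp: Fi l_simps subset_iff)
    then show ?case using lB[OF that(1) inv] by (auto intro: generate.inv)
  next
    case (eng h1 h2) then show ?case using generate.eng[of _ F B] by (simp add: Fm l_simps)
  qed
  define W where "W = induced_module R A V"
  have Wc: "carrier W = rcosets\<^bsub>F\<^esub> K" and W0: "\<zero>\<^bsub>W\<^esub> = K" and Wa: "add W = set_mult F"
    and Ws: "\<And>r C. r \<odot>\<^bsub>W\<^esub> C = (\<Union>c\<in>C. K #>\<^bsub>F\<^esub> l r c)"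
    by (simp_all add: W_def induced_module_def Let_def F_def K_def l_def)
  have Q: "comm_group (F Mod K)"
    by (rule F.abelian_FactGroup[OF K])
  have ab: "abelian_group W"
  proof (rule abelian_groupI)
    fix x y z assume x: "x \<in> carrier W" and y: "y \<in> carrier W" and z: "z \<in> carrier W"
    interpret Q: comm_group "F Mod K" by (rule Q)
    have WQ: "carrier (F Mod K) = carrier W" "mult (F Mod K) = add W" "\<one>\<^bsub>F Mod K\<^esub> = \<zero>\<^bsub>W\<^esub>"
      by (simp_all add: Wc W0 Wa FactGroup_def fun_eq_iff)
    show "x \<oplus>\<^bsub>W\<^esub> y \<in> carrier W" by (rule Q.m_closed[unfolded WQ, OF x y])
    show "x \<oplus>\<^bsub>W\<^esub> y \<oplus>\<^bsub>W\<^esub> z = x \<oplus>\<^bsub>W\<^esub> (y \<oplus>\<^bsub>W\<^esub> z)"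
      by (rule Q.m_assoc[unfolded WQ, OF x y z])
    show "x \<oplus>\<^bsub>W\<^esub> y = y \<oplus>\<^bsub>W\<^esub> x" by (rule Q.m_comm[unfolded WQ, OF x y])
    show "\<zero>\<^bsub>W\<^esub> \<oplus>\<^bsub>W\<^esub> x = x" by (rule Q.l_one[unfolded WQ, OF x])
    show "\<exists>y\<in>carrier W. y \<oplus>\<^bsub>W\<^esub> x = \<zero>\<^bsub>W\<^esub>" by (rule Q.l_inv_ex[unfolded WQ, OF x])
  next
    show "\<zero>\<^bsub>W\<^esub> \<in> carrier W"
      using comm_group.axioms(1)[OF Q, THEN comm_monoid.axioms(1), THEN monoid.one_closed]
      by (simp add: Wc W0 FactGroup_def)
  qed
  have coset: "K #>\<^bsub>F\<^esub> x = K #>\<^bsub>F\<^esub> y" if "x \<in> carrier F" "y \<in> carrier F" "x - y \<in> K" for x y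
  proof -
    have "x \<in> K #>\<^bsub>F\<^esub> y" using that(3) by (auto simp: r_coset_def Fm intro!: bexI[of _ "x - y"])
    then show ?thesis using F.repr_independence[OF _ that(2) K] by simp
  qed
  have act: "r \<odot>\<^bsub>W\<^esub> (K #>\<^bsub>F\<^esub> c) = K #>\<^bsub>F\<^esub> l r c" if "r \<in> carrier R" "c \<in> carrier F" for r c
  proof -
    have "K #>\<^bsub>F\<^esub> l r d = K #>\<^bsub>F\<^esub> l r c" if "d \<in> K #>\<^bsub>F\<^esub> c" for d
    proof -
      from that obtain k where k: "k \<in> K" "d = k + c" by (auto simp: r_coset_def Fm)
      then have "d \<in> carrier F"
        using F.m_closed[of k c] KF \<open>c \<in> carrier F\<close> by (auto simp: Fm)
      then show ?thesis
        using \<open>r \<in> carrier R\<close> \<open>c \<in> carrier F\<close> k lK[of r k]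
        by (intro coset lF) (auto simp: l_simps)
    qed
    moreover have "K #>\<^bsub>F\<^esub> c \<noteq> {}" using K.one_closed unfolding r_coset_def by blast
    ultimately show ?thesis by (auto simp: Ws)
  qed
  have rep: "\<exists>c\<in>carrier F. C = K #>\<^bsub>F\<^esub> c" if "C \<in> carrier W" for C
    using that by (auto simp: Wc RCOSETS_def)
  have repI: "K #>\<^bsub>F\<^esub> c \<in> carrier W" if "c \<in> carrier F" for c
    using that by (auto simp: Wc RCOSETS_def)
  have plus: "(K #>\<^bsub>F\<^esub> c) \<oplus>\<^bsub>W\<^esub> (K #>\<^bsub>F\<^esub> d) = K #>\<^bsub>F\<^esub> (c + d)" if "c \<in> carrier F" "d \<in> carrier F" for c d
    using K.rcos_sum[OF that] by (simp add: Wa Fm)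
  have ldist: "l (a \<oplus>\<^bsub>R\<^esub> b) c - (l a c + l b c) \<in> K"
    if ab: "a \<in> carrier R" "b \<in> carrier R" and "c \<in> carrier F" for a b c
  proof -
    have "Poly_Mapping.keys c \<subseteq> carrier R \<times> carrier V" using that by (simp add: Fc)
    then show ?thesis
    proof (induction c rule: frag_induction)
      case zero then show ?case using K.one_closed by (simp add: l_simps F1)
    next
      case (one x)
      then obtain g v where "x = (g, v)" "g \<in> carrier R" "v \<in> carrier V" by (cases x) auto
      moreover from this have "frag_of ((a \<otimes>\<^bsub>R\<^esub> g) \<oplus>\<^bsub>R\<^esub> (b \<otimes>\<^bsub>R\<^esub> g), v) - frag_of (a \<otimes>\<^bsub>R\<^esub> g, v)
          - frag_of (b \<otimes>\<^bsub>R\<^esub> g, v) \<in> B"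
        unfolding B_def balanced_relations_def using ab R.m_closed by blast
      ultimately show ?case
        using ab by (auto simp: l_simps R.l_distr Kg algebra_simps intro: generate.incl)
    next
      case (diff c d)
      then have "(l (a \<oplus>\<^bsub>R\<^esub> b) c - (l a c + l b c)) \<otimes>\<^bsub>F\<^esub> inv\<^bsub>F\<^esub> (l (a \<oplus>\<^bsub>R\<^esub> b) d - (l a d + l b d)) \<in> K"
        by (intro K.m_closed K.m_inv_closed)
      moreover have "inv\<^bsub>F\<^esub> (l (a \<oplus>\<^bsub>R\<^esub> b) d - (l a d + l b d)) = - (l (a \<oplus>\<^bsub>R\<^esub> b) d - (l a d + l b d))"
        using diff KF by (intro Fi) auto
      ultimately show ?case by (simp add: l_simps Fm algebra_simps)
    qed
  qed
  have lassoc: "l (a \<otimes>\<^bsub>R\<^esub> b) c = l a (l b c)" and lone: "l \<one>\<^bsub>R\<^esub> c = c"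
    if ab: "a \<in> carrier R" "b \<in> carrier R" and "c \<in> carrier F" for a b c
  proof -
    have c: "Poly_Mapping.keys c \<subseteq> carrier R \<times> carrier V" using that by (simp add: Fc)
    show "l (a \<otimes>\<^bsub>R\<^esub> b) c = l a (l b c)"
      using c by (induction c rule: frag_induction) (auto simp: l_simps R.m_assoc ab)
    show "l \<one>\<^bsub>R\<^esub> c = c"
      using c by (induction c rule: frag_induction) (auto simp: l_simps)
  qed
  have lm: "left_module R W"
  proof (intro left_module.intro R ab left_module_axioms.intro)
    fix a b C D assume a: "a \<in> carrier R" and C: "C \<in> carrier W"
    from rep[OF C] obtain c where c: "c \<in> carrier F" "C = K #>\<^bsub>F\<^esub> c" by blast
    show "a \<odot>\<^bsub>W\<^esub> C \<in> carrier W" using a c by (simp add: act repI lF)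
    show "a \<odot>\<^bsub>W\<^esub> (C \<oplus>\<^bsub>W\<^esub> D) = a \<odot>\<^bsub>W\<^esub> C \<oplus>\<^bsub>W\<^esub> a \<odot>\<^bsub>W\<^esub> D" if D: "D \<in> carrier W"
    proof -
      from rep[OF D] obtain d where d: "d \<in> carrier F" "D = K #>\<^bsub>F\<^esub> d" by blast
      have "c + d \<in> carrier F" using F.m_closed[OF c(1) d(1)] by (simp add: Fm)
      then show ?thesis using a c d by (simp add: act plus lF l_simps)
    qed
    show "(a \<oplus>\<^bsub>R\<^esub> b) \<odot>\<^bsub>W\<^esub> C = a \<odot>\<^bsub>W\<^esub> C \<oplus>\<^bsub>W\<^esub> b \<odot>\<^bsub>W\<^esub> C" if b: "b \<in> carrier R"
    proof -
      have "l a c + l b c \<in> carrier F" using F.m_closed[OF lF[OF a c(1)] lF[OF b c(1)]] by (simp add: Fm)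
      then show ?thesis using a b c ldist[OF a b c(1)] by (simp add: act plus lF coset)
    qed
    show "(a \<otimes>\<^bsub>R\<^esub> b) \<odot>\<^bsub>W\<^esub> C = a \<odot>\<^bsub>W\<^esub> (b \<odot>\<^bsub>W\<^esub> C)" if b: "b \<in> carrier R"
      using a b c by (simp add: act lF lassoc)
  next
    fix C assume C: "C \<in> carrier W"
    from rep[OF C] obtain c where c: "c \<in> carrier F" "C = K #>\<^bsub>F\<^esub> c" by blast
    then show "\<one>\<^bsub>R\<^esub> \<odot>\<^bsub>W\<^esub> C = C" by (simp add: act lone[OF R.one_closed R.one_closed])
  qed
  then show ?thesis by (simp add: W_def)
qed


section \<open>The root system of type G2\<close>

datatype idx = I1 | I2

text \<open>The pair \<open>(a, b)\<close> stands for \<open>a \<alpha>\<^sub>1 + b \<alpha>\<^sub>2\<close>.\<close>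

type_synonym lattice = "int \<times> int"

fun simple_root :: "idx \<Rightarrow> lattice" where
  "simple_root I1 = (1, 0)"
| "simple_root I2 = (0, 1)"

text \<open>\<open>cartan i j\<close> is the pairing of \<open>\<alpha>\<^sub>i\<close> with the coroot of \<open>\<alpha>\<^sub>j\<close>.\<close>

fun cartan :: "idx \<Rightarrow> idx \<Rightarrow> int" where
  "cartan I1 I1 = 2"
| "cartan I1 I2 = -1"
| "cartan I2 I1 = -3"
| "cartan I2 I2 = 2"

definition coroot_pairing :: "lattice \<Rightarrow> idx \<Rightarrow> int" where
  "coroot_pairing \<nu> i = fst \<nu> * cartan I1 i + snd \<nu> * cartan I2 i"

definition lattice_scale :: "int \<Rightarrow> lattice \<Rightarrow> lattice" where
  "lattice_scale n \<nu> = (n * fst \<nu>, n * snd \<nu>)"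

definition simple_reflection :: "idx \<Rightarrow> lattice \<Rightarrow> lattice" where
  "simple_reflection i \<nu> = \<nu> - lattice_scale (coroot_pairing \<nu> i) (simple_root i)"

abbreviation s1 :: "lattice \<Rightarrow> lattice" where "s1 \<equiv> simple_reflection I1"
abbreviation s2 :: "lattice \<Rightarrow> lattice" where "s2 \<equiv> simple_reflection I2"

definition weyl_group :: "(lattice \<Rightarrow> lattice) set" where
  "weyl_group = generate (BijGroup UNIV) {s1, s2}"

definition torus :: "(lattice \<Rightarrow> complex) set" where
  "torus = {t. (\<forall>\<nu>. t \<nu> \<noteq> 0) \<and> (\<forall>\<nu> \<mu>. t (\<nu> + \<mu>) = t \<nu> * t \<mu>)}"

definition weyl_act :: "(lattice \<Rightarrow> lattice) \<Rightarrow> (lattice \<Rightarrow> complex) \<Rightarrow> (lattice \<Rightarrow> complex)"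
    (infixr \<open>\<cdot>\<^sub>W\<close> 75) where
  "w \<cdot>\<^sub>W t = t \<circ> inv_into UNIV w"

definition weyl_orbit :: "(lattice \<Rightarrow> complex) \<Rightarrow> (lattice \<Rightarrow> complex) set" where
  "weyl_orbit t = (\<lambda>w. w \<cdot>\<^sub>W t) ` weyl_group"

definition t_of :: "complex \<Rightarrow> complex \<Rightarrow> lattice \<Rightarrow> complex" where
  "t_of z w \<nu> = z powi fst \<nu> * w powi snd \<nu>"


section \<open>The affine Hecke algebra\<close>

text \<open>
  The group algebra of the lattice. The quotient of \<open>X\<^sup>\<nu> - X\<^bsup>s\<nu>\<^esup>\<close> by \<open>1 - X\<^bsup>-\<alpha>\<^esup>\<close> exists in it
  and is unique (\<open>divided_difference_unique\<close> below).
\<close>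

type_synonym group_algebra = "lattice \<Rightarrow>\<^sub>0 complex"

definition gX :: "lattice \<Rightarrow> group_algebra" where
  "gX \<nu> = Poly_Mapping.single \<nu> 1"

definition divided_difference :: "idx \<Rightarrow> lattice \<Rightarrow> group_algebra" where
  "divided_difference i \<nu> = (THE f. f * (1 - gX (- simple_root i)) = gX \<nu> - gX (simple_reflection i \<nu>))"

lemma gX_simps: "gX \<nu> * gX \<mu> = gX (\<nu> + \<mu>)" "gX 0 = 1"
  by (simp_all add: gX_def mult_single)

lemma divided_difference_exists:
  "\<exists>f. f * (1 - gX (- simple_root i)) = gX \<nu> - gX (simple_reflection i \<nu>)"
proof -
  let ?a = "- simple_root i"
  have *: "(\<Sum>j<k. gX (\<mu> + lattice_scale (int j) ?a)) * (1 - gX ?a) = gX \<mu> - gX (\<mu> + lattice_scale (int k) ?a)" for \<mu> k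
  proof (induction k)
    case 0 show ?case by (simp add: lattice_scale_def flip: zero_prod_def)
  next
    case (Suc k)
    have "lattice_scale (int k) ?a + ?a = lattice_scale (int (Suc k)) ?a"
      by (simp add: lattice_scale_def prod_eq_iff algebra_simps)
    then have "gX (\<mu> + lattice_scale (int k) ?a) * gX ?a = gX (\<mu> + lattice_scale (int (Suc k)) ?a)"
      by (metis add.assoc gX_simps(1))
    then show ?case using Suc by (simp only: sum.lessThan_Suc distrib_right right_diff_distrib mult_1_right) (simp add: algebra_simps)
  qed
  define n where "n = coroot_pairing \<nu> i"
  show ?thesis
  proof (cases "n \<ge> 0")
    case True
    then have "\<nu> + lattice_scale (int (nat n)) ?a = simple_reflection i \<nu>"
      by (simp add: simple_reflection_def n_def lattice_scale_def prod_eq_iff)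
    with *[where \<mu>=\<nu> and k="nat n"] show ?thesis by metis
  next
    case False
    then have "simple_reflection i \<nu> + lattice_scale (int (nat (- n))) ?a = \<nu>"
      by (simp add: simple_reflection_def n_def lattice_scale_def prod_eq_iff)
    with *[where \<mu>="simple_reflection i \<nu>" and k="nat (- n)"] show ?thesis
      by (metis minus_diff_eq mult_minus_left)
  qed
qed

lemma divided_difference_cancel:
  fixes f :: group_algebra
  assumes "f * (1 - gX (- simple_root i)) = 0"
  shows "f = 0"
proof (rule ccontr)
  assume "f \<noteq> 0"
  then obtain \<nu> where \<nu>: "\<nu> \<in> Poly_Mapping.keys f" by (metis all_not_in_conv keys_eq_empty)
  let ?a = "simple_root i"
  have f: "f = f * gX (- ?a)" using assms by (simp add: right_diff_distrib)
  have step: "\<mu> + ?a \<in> Poly_Mapping.keys f" if "\<mu> \<in> Poly_Mapping.keys f" for \<mu>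
  proof -
    have "Poly_Mapping.keys f \<subseteq> (\<lambda>k. k + - ?a) ` Poly_Mapping.keys f"
      using keys_mult[of f "gX (- ?a)"] f by (auto simp: gX_def image_iff simp del: add_uminus_conv_diff split_paired_All split_paired_Ex)
    with that obtain \<kappa> where "\<kappa> \<in> Poly_Mapping.keys f" "\<mu> = \<kappa> + - ?a" by blast
    then show ?thesis by simp
  qed
  have "\<nu> + lattice_scale (int n) ?a \<in> Poly_Mapping.keys f" for n
  proof (induction n)
    case 0 then show ?case using \<nu> by (simp add: lattice_scale_def flip: zero_prod_def)
  next
    case (Suc n)
    have "\<nu> + lattice_scale (int n) ?a + ?a = \<nu> + lattice_scale (int (Suc n)) ?a"
      by (simp add: lattice_scale_def prod_eq_iff algebra_simps)
    with step[OF Suc] show ?case by simp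
  qed
  moreover have "inj (\<lambda>n. \<nu> + lattice_scale (int n) ?a)"
    by (cases i) (auto simp: inj_def lattice_scale_def prod_eq_iff)
  ultimately have "infinite (Poly_Mapping.keys f)"
    by (metis (no_types, lifting) finite_subset image_subsetI infinite_UNIV_nat finite_imageD)
  then show False by simp
qed

lemma divided_difference_unique:
  "\<exists>!f. f * (1 - gX (- simple_root i)) = gX \<nu> - gX (simple_reflection i \<nu>)"
proof (rule ex_ex1I[OF divided_difference_exists])
  fix f g assume "f * (1 - gX (- simple_root i)) = gX \<nu> - gX (simple_reflection i \<nu>)"
    and "g * (1 - gX (- simple_root i)) = gX \<nu> - gX (simple_reflection i \<nu>)"
  then have "(f - g) * (1 - gX (- simple_root i)) = 0" by (simp add: left_diff_distrib)
  then show "f = g" using divided_difference_cancel by fastforce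
qed

text \<open>
  The free complex algebra on the generators is the monoid algebra of the free monoid of words,
  written additively so that the convolution product on \<open>poly_mapping\<close> applies.
\<close>

datatype gen = GT idx | GX lattice

datatype gen_word = Word (letters: "gen list")

instantiation gen_word :: monoid_add
begin
definition zero_gen_word :: gen_word where "0 = Word []"
definition plus_gen_word :: "gen_word \<Rightarrow> gen_word \<Rightarrow> gen_word" where
  "u + v = Word (letters u @ letters v)"
instance
  by standard (simp_all add: zero_gen_word_def plus_gen_word_def)
end

type_synonym free_algebra = "gen_word \<Rightarrow>\<^sub>0 complex"

definition fC :: "complex \<Rightarrow> free_algebra" where "fC c = Poly_Mapping.single 0 c"
definition fT :: "idx \<Rightarrow> free_algebra" where "fT i = Poly_Mapping.single (Word [GT i]) 1"
definition fX :: "lattice \<Rightarrow> free_algebra" where "fX \<nu> = Poly_Mapping.single (Word [GX \<nu>]) 1"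

definition group_algebra_lift :: "group_algebra \<Rightarrow> free_algebra" where
  "group_algebra_lift f = (\<Sum>\<mu>\<in>Poly_Mapping.keys f. fC (Poly_Mapping.lookup f \<mu>) * fX \<mu>)"

definition type_ring :: "'a::ring_1 ring" where
  "type_ring = \<lparr>carrier = UNIV, monoid.mult = (*), one = 1, zero = 0, add = (+)\<rparr>"

definition hecke_relations :: "complex \<Rightarrow> free_algebra set" where
  "hecke_relations q =
     {fX 0 - 1} \<union>
     {fX \<nu> * fX \<mu> - fX (\<nu> + \<mu>) | \<nu> \<mu>. True} \<union>
     {fT i * fT i - (fC (q - inverse q) * fT i + 1) | i. True} \<union>
     {fT I1 * fT I2 * fT I1 * fT I2 * fT I1 * fT I2 -
      fT I2 * fT I1 * fT I2 * fT I1 * fT I2 * fT I1} \<union>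
     {fX \<nu> * fT i - (fT i * fX (simple_reflection i \<nu>) +
        fC (q - inverse q) * group_algebra_lift (divided_difference i \<nu>)) | \<nu> i. True}"

definition hecke_ideal :: "complex \<Rightarrow> free_algebra set" where
  "hecke_ideal q = genideal type_ring (hecke_relations q)"

type_synonym hecke = "free_algebra set"

definition hecke_algebra :: "complex \<Rightarrow> hecke ring" where
  "hecke_algebra q = type_ring Quot hecke_ideal q"

lemma ring_type_ring: "ring (type_ring :: 'a::ring_1 ring)"
proof -
  have "\<exists>y. y + x = 0" for x :: 'a by (rule exI[of _ "- x"]) simp
  then show ?thesis
    by unfold_locales (auto simp: type_ring_def Units_def algebra_simps intro: exI[of _ "- x" for x])
qed

lemma ideal_hecke_ideal: "ideal (hecke_ideal q) type_ring"
  unfolding hecke_ideal_def by (intro ring.genideal_ideal ring_type_ring) (simp add: type_ring_def)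

lemma ring_hecke_algebra: "ring (hecke_algebra q)"
  unfolding hecke_algebra_def by (intro ideal.quotient_is_ring ideal_hecke_ideal)

definition hC :: "complex \<Rightarrow> complex \<Rightarrow> hecke" where
  "hC q c = hecke_ideal q +>\<^bsub>type_ring\<^esub> fC c"
definition hT :: "complex \<Rightarrow> idx \<Rightarrow> hecke" where
  "hT q i = hecke_ideal q +>\<^bsub>type_ring\<^esub> fT i"
definition hX :: "complex \<Rightarrow> lattice \<Rightarrow> hecke" where
  "hX q \<nu> = hecke_ideal q +>\<^bsub>type_ring\<^esub> fX \<nu>"

text \<open>Subalgebras contain the scalars, so they are the subrings generated together with them.\<close>

definition subalgebra_generated :: "complex \<Rightarrow> hecke set \<Rightarrow> hecke set" where
  "subalgebra_generated q S = generate_ring (hecke_algebra q) (range (hC q) \<union> S)"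

definition H_X :: "complex \<Rightarrow> hecke set" where
  "H_X q = subalgebra_generated q (range (hX q))"

definition H_par :: "complex \<Rightarrow> idx \<Rightarrow> hecke set" where
  "H_par q i = subalgebra_generated q (insert (hT q i) (H_X q))"


section \<open>One-dimensional modules of subalgebras\<close>

text \<open>
  A module structure on the complex line over a subalgebra is given by a character, i.e. a
  unital homomorphism of complex algebras; extensionality makes it unique once its values on
  generators are prescribed.
\<close>

definition characters :: "complex \<Rightarrow> hecke set \<Rightarrow> (hecke \<Rightarrow> complex) set" where
  "characters q A = {\<chi> \<in> ring_hom ((hecke_algebra q)\<lparr>carrier := A\<rparr>) type_ring.
     \<chi> \<in> extensional A \<and> (\<forall>c. \<chi> (hC q c) = c)}"

definition line_module :: "(hecke \<Rightarrow> complex) \<Rightarrow> (hecke, complex) module" where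
  "line_module \<chi> =
    \<lparr>carrier = UNIV, monoid.mult = undefined, one = undefined, zero = 0, add = (+),
     smult = (\<lambda>a z. \<chi> a * z)\<rparr>"

text \<open>\<open>C_t\<close>: the line on which \<open>X\<^sup>\<nu>\<close> acts by \<open>t \<nu>\<close>.\<close>

definition line_X :: "complex \<Rightarrow> (lattice \<Rightarrow> complex) \<Rightarrow> (hecke, complex) module" where
  "line_X q t = line_module (THE \<chi>. \<chi> \<in> characters q (H_X q) \<and> (\<forall>\<nu>. \<chi> (hX q \<nu>) = t \<nu>))"

text \<open>The line on which \<open>T\<^sub>i\<close> acts by \<open>c\<close> and \<open>X\<^sup>\<nu>\<close> by \<open>t \<nu>\<close>.\<close>

definition line_par ::
    "complex \<Rightarrow> idx \<Rightarrow> complex \<Rightarrow> (lattice \<Rightarrow> complex) \<Rightarrow> (hecke, complex) module" where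
  "line_par q i c t = line_module (THE \<chi>. \<chi> \<in> characters q (H_par q i) \<and>
     \<chi> (hT q i) = c \<and> (\<forall>\<nu>. \<chi> (hX q \<nu>) = t \<nu>))"

definition principal_series ::
    "complex \<Rightarrow> (lattice \<Rightarrow> complex) \<Rightarrow> (hecke, (hecke \<times> complex \<Rightarrow>\<^sub>0 int) set) module" where
  "principal_series q t = induced_module (hecke_algebra q) (H_X q) (line_X q t)"


section \<open>Weights\<close>

definition weight_space :: "complex \<Rightarrow> (hecke, 'm) module \<Rightarrow> (lattice \<Rightarrow> complex) \<Rightarrow> 'm set" where
  "weight_space q M t =
     {m \<in> carrier M. \<forall>\<nu>. hX q \<nu> \<odot>\<^bsub>M\<^esub> m = hC q (t \<nu>) \<odot>\<^bsub>M\<^esub> m}"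

definition gen_weight_space ::
    "complex \<Rightarrow> (hecke, 'm) module \<Rightarrow> (lattice \<Rightarrow> complex) \<Rightarrow> 'm set" where
  "gen_weight_space q M t =
     {m \<in> carrier M. \<forall>\<nu>. \<exists>k>0.
        ((hX q \<nu> \<ominus>\<^bsub>hecke_algebra q\<^esub> hC q (t \<nu>)) [^]\<^bsub>hecke_algebra q\<^esub> (k::nat)) \<odot>\<^bsub>M\<^esub> m = \<zero>\<^bsub>M\<^esub>}"

definition weights :: "complex \<Rightarrow> (hecke, 'm) module \<Rightarrow> (lattice \<Rightarrow> complex) set" where
  "weights q M = {t \<in> torus. gen_weight_space q M t \<noteq> {\<zero>\<^bsub>M\<^esub>}}"

definition has_central_character ::
    "complex \<Rightarrow> (hecke, 'm) module \<Rightarrow> (lattice \<Rightarrow> complex) \<Rightarrow> bool" where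
  "has_central_character q M t \<longleftrightarrow> weights q M \<noteq> {} \<and> weights q M \<subseteq> weyl_orbit t"

definition one_dimensional :: "complex \<Rightarrow> (hecke, 'm) module \<Rightarrow> 'm set \<Rightarrow> bool" where
  "one_dimensional q M S \<longleftrightarrow> (\<exists>v\<in>S. v \<noteq> \<zero>\<^bsub>M\<^esub> \<and> S = {hC q c \<odot>\<^bsub>M\<^esub> v | c. True})"

definition primitive_root_of_unity :: "nat \<Rightarrow> complex \<Rightarrow> bool" where
  "primitive_root_of_unity n z \<longleftrightarrow> z ^ n = 1 \<and> (\<forall>m. 0 < m \<and> m < n \<longrightarrow> z ^ m \<noteq> 1)"

end

theory Submission
  imports Defs
begin

text \<open>
  The orbit of \<open>t\<close> has six elements \<open>r0 = t, r1, \<dots>, r5 = w\<^sub>0t\<close>, arranged in a chain in which consecutive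
  ones are exchanged alternately by \<open>s\<^sub>1\<close> and \<open>s\<^sub>2\<close>, while \<open>s\<^sub>2\<close> fixes both ends. On a weight vector of
  weight \<open>r\<close> the intertwiner \<open>T\<^sub>i - (q - q\<^sup>-\<^sup>1) / (1 - r(X\<^bsup>-\<alpha>\<^esup>))\<close> produces a weight vector of weight \<open>s\<^sub>ir\<close>, and
  going forth and back along an edge multiplies by a scalar. This scalar vanishes on the two outer edges, is
  nonzero on the middle edge, and on the edges between \<open>r1, r2\<close> and between \<open>r3, r4\<close> it vanishes
  exactly when \<open>q\<^sup>4 = -1\<close>, that is when \<open>q\<^sup>2\<close> is a primitive fourth root of unity.

  Modules are presented as quotients of left ideals of the free algebra on the generators (\<open>presents\<close>), so that
  statements about submodules become statements about left ideals. In particular \<open>M\<close> is the free algebra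
  modulo the smallest left ideal containing \<open>T\<^sub>1 - q\<close> and all \<open>X\<^sup>\<nu> - t(X\<^sup>\<nu>)\<close> (\<open>induced_presents\<close>,
  \<open>presents_M\<close>). The generator \<open>1\<close> and \<open>T\<^sub>2\<close> span a Jordan block of weight \<open>r0\<close>, and successive intertwiners
  lead from it to weight vectors \<open>b1, b2, b3, b4\<close> of weights \<open>r1, \<dots>, r4\<close>. The braid relation forces
  \<open>T\<^sub>1b4 = q b4\<close> (\<open>T1_b4\<close>), so the chain stops and these six vectors span \<open>M\<close>.
  That \<open>b4\<close> is not zero is read off from an explicit module of dimension twelve over which the chain is visible;
  its coordinates are dual numbers, because the weight spaces at the ends of the chain are not semisimple, and
  it is generated by a vector of weight \<open>t\<close>, hence is a quotient of \<open>M(t)\<close>.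

  A proper submodule of \<open>M\<close> avoids the Jordan block and is therefore spanned by some of the \<open>b\<^sub>k\<close>. Going down the
  chain from \<open>b\<^sub>k\<close> reaches the generator unless a scalar vanishes. For \<open>q\<^sup>4 \<noteq> -1\<close> this makes \<open>M\<close> irreducible
  (\<open>generic_maximal\<close>). For \<open>q\<^sup>4 = -1\<close> the chain is cut at two edges, and the submodules spanned by \<open>b4\<close> and by
  \<open>b4, b3, b2\<close> give the filtration of (a) (\<open>weight_filtration\<close>). The defining relations depend on \<open>q\<close>
  only through \<open>q - q\<^sup>-\<^sup>1\<close>, and \<open>w\<^sub>0t\<close> is obtained from \<open>t\<close> by replacing \<open>q\<close> by \<open>-q\<^sup>-\<^sup>1\<close>; so \<open>N\<close> is the
  module \<open>M\<close> of the parameter \<open>-q\<^sup>-\<^sup>1\<close>, and (b) is (a) for that parameter.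

  For (c) and the uniqueness in (d), start from any weight vector of an irreducible module with weight in the
  orbit and move it along the chain until an intertwiner kills it. This yields a vector satisfying one of a
  few short lists of relations (\<open>extremal_exists\<close>): type A for \<open>q\<close> or \<open>-q\<^sup>-\<^sup>1\<close>, that is the relations of the
  generator of \<open>M\<close> or \<open>N\<close>, and for \<open>q\<^sup>4 = -1\<close> also type B, a vector spanning a submodule of dimension one,
  or type C, one generating a submodule of dimension at most two. Each list determines the annihilator and hence
  the irreducible module (\<open>type_unique\<close>). All types allowed by \<open>q\<close> occur in \<open>M(t)\<close>, and each of them occurs
  in \<open>M\<close> or in \<open>N\<close>; as the composition factors of a module of finite length are the irreducible modules that
  occur as its subquotients (\<open>composition_factorI\<close>), the two sides of (c) agree.
\<close>


section \<open>Linear extension and evaluation of group algebra elements\<close>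

text \<open>Functions on a monoid algebra are defined on monomials. The map on monomials depends on the coefficient as well,
  so that both additive maps and maps linear over the scalars are covered.\<close>

definition pm_extend :: "('k \<Rightarrow> 'c \<Rightarrow> 'v) \<Rightarrow> ('k \<Rightarrow>\<^sub>0 'c::zero) \<Rightarrow> 'v::comm_monoid_add" where
  "pm_extend \<phi> f = (\<Sum>k\<in>Poly_Mapping.keys f. \<phi> k (Poly_Mapping.lookup f k))"

lemma pm_extend_superset:
  assumes "\<And>k. \<phi> k 0 = 0" "finite S" "Poly_Mapping.keys f \<subseteq> S"
  shows "pm_extend \<phi> f = (\<Sum>k\<in>S. \<phi> k (Poly_Mapping.lookup f k))"
  unfolding pm_extend_def using assms
  by (intro sum.mono_neutral_left) (auto simp: in_keys_iff)

lemma pm_extend_single: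
  assumes "\<And>k. \<phi> k 0 = 0"
  shows "pm_extend \<phi> (Poly_Mapping.single k c) = \<phi> k c"
  using pm_extend_superset[of \<phi> "{k}" "Poly_Mapping.single k c"] assms by simp

lemma pm_extend_zero [simp]: "pm_extend \<phi> 0 = 0"
  by (simp add: pm_extend_def)

lemma pm_extend_add:
  fixes f g :: "'k \<Rightarrow>\<^sub>0 'c::comm_monoid_add"
  assumes "\<And>k. \<phi> k 0 = 0" "\<And>k a b. \<phi> k (a + b) = \<phi> k a + \<phi> k b"
  shows "pm_extend \<phi> (f + g) = pm_extend \<phi> f + pm_extend \<phi> g"
proof -
  let ?S = "Poly_Mapping.keys f \<union> Poly_Mapping.keys g"
  have "Poly_Mapping.keys (f + g) \<subseteq> ?S" by (rule Poly_Mapping.keys_add)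
  then show ?thesis
    using assms by (simp add: pm_extend_superset[where S = ?S] lookup_add sum.distrib)
qed

lemma poly_mapping_add_induct [case_names zero single add]:
  fixes f :: "'k \<Rightarrow>\<^sub>0 'c::comm_monoid_add"
  assumes "P 0" "\<And>k c. P (Poly_Mapping.single k c)" "\<And>f g. P f \<Longrightarrow> P g \<Longrightarrow> P (f + g)"
  shows "P f"
proof (induction f rule: Poly_Mapping.update_induct)
  case const then show ?case by (rule assms)
next
  case (update f a b)
  have "Poly_Mapping.update a b f = f + Poly_Mapping.single a b"
    using update.hyps by (intro poly_mapping_eqI) (auto simp: lookup_update lookup_add lookup_single in_keys_iff when_def)
  then show ?case using assms update.IH by simp
qed

lemma group_algebra_lift_pm_extend:
  "group_algebra_lift f = pm_extend (\<lambda>\<mu> c. fC c * fX \<mu>) f"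
  by (simp add: group_algebra_lift_def pm_extend_def)

lemma fC_simps:
  "fC 0 = 0" "fC 1 = 1" "fC (a + b) = fC a + fC b" "fC (a * b) = fC a * fC b"
  "fC (- a) = - fC a" "fC (a - b) = fC a - fC b"
  by (simp_all add: fC_def single_add mult_single single_uminus single_diff)

lemma fC_central: "x * fC c = fC c * x"
proof (induction x rule: poly_mapping_add_induct)
  case (single w d)
  show ?case by (simp add: fC_def mult_single mult.commute)
qed (simp_all add: algebra_simps)

text \<open>The coefficients of the modules below are complex numbers or dual numbers, so evaluation
  takes values in any commutative ring receiving the complex numbers.\<close>

locale scalar_hom =
  fixes h :: "complex \<Rightarrow> 'r::comm_ring_1"
  assumes h_add: "h (a + b) = h a + h b" and h_mult: "h (a * b) = h a * h b" and h_one: "h 1 = 1"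
begin

lemma h_zero: "h 0 = 0"
  using h_add[of 0 0] by simp

definition ev :: "(lattice \<Rightarrow> 'r) \<Rightarrow> group_algebra \<Rightarrow> 'r" where
  "ev \<theta> = pm_extend (\<lambda>\<mu> c. h c * \<theta> \<mu>)"

lemma ev_simps:
  "ev \<theta> 0 = 0" "ev \<theta> (f + g) = ev \<theta> f + ev \<theta> g" "ev \<theta> (Poly_Mapping.single \<mu> c) = h c * \<theta> \<mu>"
  "ev \<theta> (- f) = - ev \<theta> f" "ev \<theta> (f - g) = ev \<theta> f - ev \<theta> g"
proof -
  show z: "ev \<theta> 0 = 0" by (simp add: ev_def)
  show a: "ev \<theta> (f + g) = ev \<theta> f + ev \<theta> g" for f g
    unfolding ev_def by (rule pm_extend_add) (simp_all add: h_zero h_add distrib_right)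
  show "ev \<theta> (Poly_Mapping.single \<mu> c) = h c * \<theta> \<mu>"
    unfolding ev_def by (rule pm_extend_single) (simp add: h_zero)
  show u: "ev \<theta> (- f) = - ev \<theta> f" for f using a[of "- f" f] z by (simp add: eq_neg_iff_add_eq_0)
  show "ev \<theta> (f - g) = ev \<theta> f - ev \<theta> g" using a[of f "- g"] u by simp
qed

end

text \<open>A multiplicative function on the lattice; over a field this is a point of the torus.\<close>

definition lattice_char :: "(lattice \<Rightarrow> 'r::comm_ring_1) \<Rightarrow> bool" where
  "lattice_char \<theta> \<longleftrightarrow> \<theta> 0 = 1 \<and> (\<forall>\<nu> \<mu>. \<theta> (\<nu> + \<mu>) = \<theta> \<nu> * \<theta> \<mu>)"

lemma lattice_charD:
  assumes "lattice_char \<theta>"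
  shows "\<theta> 0 = 1" "\<theta> (\<nu> + \<mu>) = \<theta> \<nu> * \<theta> \<mu>"
  using assms unfolding lattice_char_def by blast+

context scalar_hom begin

lemma ev_gX: "ev \<theta> (gX \<nu>) = \<theta> \<nu>"
  by (simp add: gX_def ev_simps h_one)

lemma ev_mult:
  assumes "lattice_char \<theta>"
  shows "ev \<theta> (f * g) = ev \<theta> f * ev \<theta> g"
proof (induction f rule: poly_mapping_add_induct)
  case (single \<mu> c)
  show ?case
  proof (induction g rule: poly_mapping_add_induct)
    case (single \<nu> d)
    then show ?case using lattice_charD(2)[OF assms, of \<mu> \<nu>] by (simp add: mult_single ev_simps h_mult mult_ac)
  qed (simp_all add: ev_simps algebra_simps)
qed (simp_all add: ev_simps algebra_simps)

lemma divided_difference_eq: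
  "divided_difference i \<nu> * (1 - gX (- simple_root i)) = gX \<nu> - gX (simple_reflection i \<nu>)"
  unfolding divided_difference_def by (rule theI'[OF divided_difference_unique])

lemma ev_divided_difference:
  assumes "lattice_char \<theta>"
  shows "ev \<theta> (divided_difference i \<nu>) * (1 - \<theta> (- simple_root i)) = \<theta> \<nu> - \<theta> (simple_reflection i \<nu>)"
proof -
  have "ev \<theta> 1 = 1" using ev_gX[of \<theta> 0] lattice_charD(1)[OF assms] by (simp add: gX_simps)
  then show ?thesis
    using arg_cong[OF divided_difference_eq[of i \<nu>], of "ev \<theta>"]
    by (simp add: ev_mult[OF assms] ev_simps ev_gX)
qed

text \<open>The quotient by \<open>1 - X\<^bsup>-\<alpha>\<^esup>\<close> is a geometric sum. It is needed explicitly only where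
  the value of \<open>1 - X\<^bsup>-\<alpha>\<^esup>\<close> is a zero divisor.\<close>

lemma ev_divided_difference_sum:
  assumes \<theta>: "lattice_char \<theta>"
  shows "coroot_pairing \<nu> i = int n \<Longrightarrow>
      ev \<theta> (divided_difference i \<nu>) = (\<Sum>j<n. \<theta> \<nu> * \<theta> (- simple_root i) ^ j)" (is "_ \<Longrightarrow> ?A")
    and "coroot_pairing \<nu> i = - int n \<Longrightarrow>
      ev \<theta> (divided_difference i \<nu>) = - (\<Sum>j<n. \<theta> (simple_reflection i \<nu>) * \<theta> (- simple_root i) ^ j)"
      (is "_ \<Longrightarrow> ?B")
proof -
  let ?a = "- simple_root i"
  have pw: "\<theta> (lattice_scale (int j) ?a) = \<theta> ?a ^ j" for j
  proof (induction j)
    case 0 show ?case using lattice_charD(1)[OF \<theta>] by (simp add: lattice_scale_def flip: zero_prod_def)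
  next
    case (Suc j)
    have "lattice_scale (int (Suc j)) ?a = ?a + lattice_scale (int j) ?a"
      by (simp add: lattice_scale_def prod_eq_iff algebra_simps)
    then show ?case using lattice_charD(2)[OF \<theta>, of ?a "lattice_scale (int j) ?a"] Suc by simp
  qed
  have geo: "(\<Sum>j<k. gX (\<mu> + lattice_scale (int j) ?a)) * (1 - gX ?a) = gX \<mu> - gX (\<mu> + lattice_scale (int k) ?a)" for \<mu> k
  proof (induction k)
    case 0 show ?case by (simp add: lattice_scale_def flip: zero_prod_def)
  next
    case (Suc k)
    have "lattice_scale (int k) ?a + ?a = lattice_scale (int (Suc k)) ?a"
      by (simp add: lattice_scale_def prod_eq_iff algebra_simps)
    then have "gX (\<mu> + lattice_scale (int k) ?a) * gX ?a = gX (\<mu> + lattice_scale (int (Suc k)) ?a)"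
      by (metis add.assoc gX_simps(1))
    then show ?case using Suc by (simp only: sum.lessThan_Suc distrib_right right_diff_distrib mult_1_right) (simp add: algebra_simps)
  qed
  have evs: "ev \<theta> (\<Sum>j<k. gX (\<mu> + lattice_scale (int j) ?a)) = (\<Sum>j<k. \<theta> \<mu> * \<theta> ?a ^ j)" for \<mu> k
    by (induction k) (simp_all add: ev_simps ev_gX lattice_charD(2)[OF \<theta>] pw)
  have uniq: "f = divided_difference i \<nu>" if "f * (1 - gX ?a) = gX \<nu> - gX (simple_reflection i \<nu>)" for f
    using divided_difference_unique[of i \<nu>] that divided_difference_eq by blast
  show ?A if n: "coroot_pairing \<nu> i = int n"
  proof -
    have "\<nu> + lattice_scale (int n) ?a = simple_reflection i \<nu>"
      by (simp add: simple_reflection_def n lattice_scale_def prod_eq_iff)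
    then have "(\<Sum>j<n. gX (\<nu> + lattice_scale (int j) ?a)) = divided_difference i \<nu>"
      using geo[of \<nu> n] by (intro uniq) simp
    then show ?thesis using evs[of \<nu> n] by simp
  qed
  show ?B if n: "coroot_pairing \<nu> i = - int n"
  proof -
    have "simple_reflection i \<nu> + lattice_scale (int n) ?a = \<nu>"
      by (simp add: simple_reflection_def n lattice_scale_def prod_eq_iff)
    then have "- (\<Sum>j<n. gX (simple_reflection i \<nu> + lattice_scale (int j) ?a)) = divided_difference i \<nu>"
      using geo[of "simple_reflection i \<nu>" n] by (intro uniq) (simp add: algebra_simps)
    then show ?thesis using evs[of "simple_reflection i \<nu>" n] ev_simps(4)[of \<theta>] by metis
  qed
qed

end

interpretation complex_scalars: scalar_hom "\<lambda>c::complex. c"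
  by standard simp_all

section \<open>Dual numbers\<close>

datatype dual = Dual (std: complex) (eps: complex)

instantiation dual :: comm_ring_1
begin
definition "0 = Dual 0 0"
definition "1 = Dual 1 0"
definition "x + y = Dual (std x + std y) (eps x + eps y)"
definition "x - y = Dual (std x - std y) (eps x - eps y)"
definition "- x = Dual (- std x) (- eps x)"
definition "x * y = Dual (std x * std y) (std x * eps y + eps x * std y)"
instance
  by standard (auto simp: zero_dual_def one_dual_def plus_dual_def minus_dual_def uminus_dual_def
      times_dual_def algebra_simps dual.expand)
end

lemma dual_simps [simp]:
  "std 0 = 0" "eps 0 = 0" "std 1 = 1" "eps 1 = 0"
  "std (x + y) = std x + std y" "eps (x + y) = eps x + eps y"
  "std (x - y) = std x - std y" "eps (x - y) = eps x - eps y"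
  "std (- x) = - std x" "eps (- x) = - eps x"
  "std (x * y) = std x * std y" "eps (x * y) = std x * eps y + eps x * std y"
  by (simp_all add: zero_dual_def one_dual_def plus_dual_def minus_dual_def uminus_dual_def times_dual_def)

lemma dual_eq_iff: "x = y \<longleftrightarrow> std x = std y \<and> eps x = eps y"
  by (auto intro: dual.expand)

abbreviation dC :: "complex \<Rightarrow> dual" where "dC c \<equiv> Dual c 0"

interpretation dual_scalars: scalar_hom dC
  by standard (simp_all add: dual_eq_iff)

section \<open>Points of the torus\<close>

lemma t_of_simps:
  assumes "z \<noteq> 0" "w \<noteq> 0"
  shows "lattice_char (t_of z w)" "t_of z w \<in> torus"
    "t_of z w (1, 0) = z" "t_of z w (0, 1) = w" "t_of z w (- 1, 0) = inverse z" "t_of z w (0, - 1) = inverse w"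
  using assms by (auto simp: lattice_char_def t_of_def torus_def power_int_add mult_ac zero_prod_def power_int_minus)

lemma torus_char:
  assumes "s \<in> torus"
  shows "lattice_char s"
proof -
  have m: "s (\<nu> + \<mu>) = s \<nu> * s \<mu>" and nz: "s \<nu> \<noteq> 0" for \<nu> \<mu>
    using assms unfolding torus_def by blast+
  have "s 0 = 1" using m[of 0 0] nz[of 0] by simp
  with m show ?thesis unfolding lattice_char_def by blast
qed

lemma t_of_eq_iff:
  assumes "z \<noteq> 0" "w \<noteq> 0" "z' \<noteq> 0" "w' \<noteq> 0"
  shows "t_of z w = t_of z' w' \<longleftrightarrow> z = z' \<and> w = w'"
  using t_of_simps[OF assms(1,2)] t_of_simps[OF assms(3,4)] by metis

lemma simple_reflection_simps:
  "simple_reflection I1 (m, n) = (3 * n - m, n)" "simple_reflection I2 (m, n) = (m, m - n)"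
  by (simp_all add: simple_reflection_def coroot_pairing_def lattice_scale_def)

lemma simple_reflection_involution: "simple_reflection i (simple_reflection i \<nu>) = \<nu>"
  by (cases i; cases \<nu>) (simp_all add: simple_reflection_simps)

lemma simple_reflection_add: "simple_reflection i (\<nu> + \<mu>) = simple_reflection i \<nu> + simple_reflection i \<mu>"
  by (cases i; cases \<nu>; cases \<mu>) (simp_all add: simple_reflection_simps)

lemma t_of_reflection:
  assumes "z \<noteq> 0" "w \<noteq> 0"
  shows "t_of z w \<circ> simple_reflection I1 = t_of (inverse z) (z ^ 3 * w)"
    and "t_of z w \<circ> simple_reflection I2 = t_of (z * w) (inverse w)"
proof -
  have cube: "z powi (3 * n) = (z ^ 3) powi n" for n
    by (simp add: power_int_mult)
  show "t_of z w \<circ> simple_reflection I1 = t_of (inverse z) (z ^ 3 * w)"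
    using assms
    by (auto simp: fun_eq_iff t_of_def simple_reflection_simps power_int_diff cube power_int_mult_distrib
      power_int_inverse divide_inverse)
  show "t_of z w \<circ> simple_reflection I2 = t_of (z * w) (inverse w)"
    using assms
    by (auto simp: fun_eq_iff t_of_def simple_reflection_simps power_int_diff power_int_mult_distrib
      power_int_inverse divide_inverse)
qed

lemma lattice_char_reflection: "lattice_char \<theta> \<Longrightarrow> lattice_char (\<theta> \<circ> simple_reflection i)"
  by (cases i) (simp_all add: lattice_char_def simple_reflection_add zero_prod_def simple_reflection_simps)

section \<open>Representations of the affine Hecke algebra\<close>

text \<open>A module given by the operators of the generators. Since the algebra is presented by generators and
  relations, it is enough to check the relations; \<open>act_hecke_ideal\<close> below is the resulting statement for the free algebra.\<close>

locale hecke_rep =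
  fixes q :: complex and sc :: "complex \<Rightarrow> 'v \<Rightarrow> 'v::ab_group_add"
    and T :: "idx \<Rightarrow> 'v \<Rightarrow> 'v" and X :: "lattice \<Rightarrow> 'v \<Rightarrow> 'v"
  assumes sc_add: "sc c (x + y) = sc c x + sc c y" "sc (a + b) x = sc a x + sc b x"
    and sc_mult: "sc a (sc b x) = sc (a * b) x" and sc_one: "sc 1 x = x"
    and T_linear: "T i (x + y) = T i x + T i y" "T i (sc c x) = sc c (T i x)"
    and X_linear: "X \<nu> (x + y) = X \<nu> x + X \<nu> y" "X \<nu> (sc c x) = sc c (X \<nu> x)"
    and X_mult: "X 0 x = x" "X \<nu> (X \<mu> x) = X (\<nu> + \<mu>) x"
    and quadratic: "T i (T i x) = sc (q - inverse q) (T i x) + x"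
    and braid: "T I1 (T I2 (T I1 (T I2 (T I1 (T I2 x))))) = T I2 (T I1 (T I2 (T I1 (T I2 (T I1 x)))))"
    and cross: "X \<nu> (T i x) = T i (X (simple_reflection i \<nu>) x) +
      sc (q - inverse q) (pm_extend (\<lambda>\<mu> c. sc c (X \<mu> x)) (divided_difference i \<nu>))"
begin

lemma sc_zero: "sc 0 x = 0" "sc c 0 = 0"
  using sc_add(2)[of 0 0 x] sc_add(1)[of c 0 0] by simp_all

primrec op_gen :: "gen \<Rightarrow> 'v \<Rightarrow> 'v" where
  "op_gen (GT i) = T i"
| "op_gen (GX \<nu>) = X \<nu>"

definition op_word :: "gen_word \<Rightarrow> 'v \<Rightarrow> 'v" where
  "op_word w v = foldr op_gen (letters w) v"

definition act :: "free_algebra \<Rightarrow> 'v \<Rightarrow> 'v" where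
  "act a v = pm_extend (\<lambda>w c. sc c (op_word w v)) a"

lemma op_gen_linear: "op_gen g (x + y) = op_gen g x + op_gen g y" "op_gen g (sc c x) = sc c (op_gen g x)"
  by (cases g; simp add: T_linear X_linear)+

lemma op_word_linear: "op_word w (x + y) = op_word w x + op_word w y" "op_word w (sc c x) = sc c (op_word w x)"
proof -
  have "foldr op_gen gs (x + y) = foldr op_gen gs x + foldr op_gen gs y"
    "foldr op_gen gs (sc c x) = sc c (foldr op_gen gs x)" for gs
    by (induction gs) (simp_all add: op_gen_linear)
  then show "op_word w (x + y) = op_word w x + op_word w y" "op_word w (sc c x) = sc c (op_word w x)"
    by (simp_all add: op_word_def)
qed

lemma act_add: "act (a + b) v = act a v + act b v"
  unfolding act_def by (rule pm_extend_add) (simp_all add: sc_zero sc_add)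

lemma act_single: "act (Poly_Mapping.single w c) v = sc c (op_word w v)"
  unfolding act_def by (rule pm_extend_single) (simp add: sc_zero)

lemma act_zero: "act 0 v = 0"
  by (simp add: act_def)

lemma act_minus: "act (- a) v = - act a v"
  using act_add[of "- a" a v] by (simp add: act_zero eq_neg_iff_add_eq_0)

lemma act_diff: "act (a - b) v = act a v - act b v"
  using act_add[of a "- b" v] by (simp add: act_minus)

lemma act_linear: "act a (x + y) = act a x + act a y" "act a (sc c x) = sc c (act a x)"
  by (induction a rule: poly_mapping_add_induct)
    (simp_all add: act_add act_zero act_single op_word_linear sc_add sc_zero sc_mult mult_ac algebra_simps)

lemma act_zero_right: "act a 0 = 0"
  using act_linear(1)[of a 0 0] by simp

lemma act_mult: "act (a * b) v = act a (act b v)"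
proof (induction a rule: poly_mapping_add_induct)
  case (single u c)
  show ?case
  proof (induction b rule: poly_mapping_add_induct)
    case (single w d)
    show ?case
      by (simp add: mult_single act_single op_word_linear sc_mult[symmetric] del: sc_mult)
        (simp add: op_word_def plus_gen_word_def)
  qed (simp_all add: act_add act_zero act_single distrib_left op_word_linear sc_add act_zero_right
      flip: act_linear)
qed (simp_all add: act_add act_zero distrib_right)

lemma act_generators: "act (fT i) v = T i v" "act (fX \<nu>) v = X \<nu> v" "act (fC c) v = sc c v" "act 1 v = v"
proof -
  show "act (fT i) v = T i v" "act (fX \<nu>) v = X \<nu> v" "act (fC c) v = sc c v" for c
    by (simp_all add: fT_def fX_def fC_def act_single op_word_def zero_gen_word_def sc_one)
  from this(3)[of 1] show "act 1 v = v" by (simp add: fC_simps sc_one)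
qed

lemma act_lift: "act (group_algebra_lift f) v = pm_extend (\<lambda>\<mu> c. sc c (X \<mu> v)) f"
proof (induction f rule: poly_mapping_add_induct)
  case (single \<mu> c)
  show ?case unfolding group_algebra_lift_pm_extend
    by (subst (1 2) pm_extend_single) (simp_all add: act_mult act_generators fC_simps sc_zero)
next
  case (add f g)
  then show ?case unfolding group_algebra_lift_pm_extend
    by (subst (1 2) pm_extend_add) (simp_all add: act_add fC_simps distrib_right sc_add sc_zero)
qed (simp add: group_algebra_lift_pm_extend act_zero)

end

lemma hecke_ideal_closed:
  shows "0 \<in> hecke_ideal q" and "\<lbrakk>x \<in> hecke_ideal q; y \<in> hecke_ideal q\<rbrakk> \<Longrightarrow> x + y \<in> hecke_ideal q"
    and "x \<in> hecke_ideal q \<Longrightarrow> a * x \<in> hecke_ideal q" and "x \<in> hecke_ideal q \<Longrightarrow> x * a \<in> hecke_ideal q"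
    and "x \<in> hecke_relations q \<Longrightarrow> x \<in> hecke_ideal q"
proof -
  interpret I: ideal "hecke_ideal q" type_ring by (rule ideal_hecke_ideal)
  show "0 \<in> hecke_ideal q"
    using additive_subgroup.zero_closed[OF I.additive_subgroup_axioms] by (simp add: type_ring_def)
  show "\<lbrakk>x \<in> hecke_ideal q; y \<in> hecke_ideal q\<rbrakk> \<Longrightarrow> x + y \<in> hecke_ideal q"
    using additive_subgroup.a_closed[OF I.additive_subgroup_axioms] by (simp add: type_ring_def)
  show "x \<in> hecke_ideal q \<Longrightarrow> a * x \<in> hecke_ideal q" "x \<in> hecke_ideal q \<Longrightarrow> x * a \<in> hecke_ideal q"
    using I.I_l_closed[of x a] I.I_r_closed[of x a] by (simp_all add: type_ring_def)
  have "hecke_relations q \<subseteq> hecke_ideal q"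
    unfolding hecke_ideal_def
    using ring.genideal_self[OF ring_type_ring, of "hecke_relations q"] by (simp add: type_ring_def)
  then show "x \<in> hecke_relations q \<Longrightarrow> x \<in> hecke_ideal q" by blast
qed

lemma hecke_ideal_minimal:
  assumes "hecke_relations q \<subseteq> S" "0 \<in> S" "\<And>x y. \<lbrakk>x \<in> S; y \<in> S\<rbrakk> \<Longrightarrow> x + y \<in> S"
    "\<And>a x. x \<in> S \<Longrightarrow> a * x \<in> S" "\<And>a x. x \<in> S \<Longrightarrow> x * a \<in> S"
  shows "hecke_ideal q \<subseteq> S"
proof -
  interpret R: ring type_ring by (rule ring_type_ring)
  have minus: "\<ominus>\<^bsub>type_ring\<^esub> x = - x" for x :: free_algebra
    using R.minus_unique[of "- x" x] R.minus_equality[of "- x" x] by (simp add: type_ring_def)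
  have "ideal S type_ring"
  proof (intro idealI R.ring_axioms)
    show "subgroup S (add_monoid type_ring)"
    proof (rule R.add.subgroupI)
      show "\<ominus>\<^bsub>type_ring\<^esub> x \<in> S" if "x \<in> S" for x
        using assms(4)[OF that, of "- 1"] by (simp add: minus)
    qed (use assms in \<open>auto simp: type_ring_def\<close>)
  qed (use assms in \<open>auto simp: type_ring_def\<close>)
  then show ?thesis
    unfolding hecke_ideal_def using assms(1) by (simp add: R.genideal_minimal)
qed

context hecke_rep begin

lemma act_hecke_ideal:
  assumes "a \<in> hecke_ideal q"
  shows "act a v = 0"
proof -
  have "hecke_ideal q \<subseteq> {a. \<forall>v. act a v = 0}"
  proof (rule hecke_ideal_minimal)
    show "hecke_relations q \<subseteq> {a. \<forall>v. act a v = 0}"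
      by (auto simp: hecke_relations_def act_diff act_add act_mult act_generators act_lift X_mult quadratic
          cross braid)
  qed (simp_all add: act_zero act_add act_mult act_zero_right)
  then show ?thesis using assms by blast
qed

end

section \<open>A module of dimension twelve\<close>

text \<open>The conditions on the parameter, in the form in which they occur as denominators: the last one
  excludes that \<open>q\<^sup>2\<close> is a primitive third root of unity.\<close>

locale hecke_param =
  fixes q :: complex
  assumes q0: "q \<noteq> 0" and D1: "q ^ 2 - 1 \<noteq> 0" and D2: "q ^ 2 + 1 \<noteq> 0" and D3: "q ^ 4 + q ^ 2 + 1 \<noteq> 0"
begin

definition p :: complex where "p = q - inverse q"
text \<open>The values of \<open>(q - q\<^sup>-\<^sup>1) / (1 - X\<^bsup>-\<alpha>\<^esup>)\<close> at the weights of the chain: \<open>G\<close> on the two edges crossed by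
  \<open>s\<^sub>2\<close>, \<open>E\<close> on the middle edge.\<close>

definition G :: complex where "G = q ^ 5 / (q ^ 4 + q ^ 2 + 1)"
definition E :: complex where "E = q ^ 3 / (q ^ 2 + 1)"

lemma p_eq: "p = (q ^ 2 - 1) / q"
  using q0 by (simp add: p_def field_simps power2_eq_square)

lemma p0: "p \<noteq> 0"
  using q0 D1 by (simp add: p_eq)

lemma q6: "q ^ 6 \<noteq> 1"
proof -
  have "q ^ 6 - 1 = (q ^ 2 - 1) * (q ^ 4 + q ^ 2 + 1)" by (simp add: eval_nat_numeral algebra_simps)
  then show ?thesis using D1 D3 by (metis diff_self mult_eq_0_iff)
qed

text \<open>Lifts of \<open>q, G, E, G, q\<close> to the dual numbers: the values of \<open>(q - q\<^sup>-\<^sup>1) / (1 - X\<^bsup>-\<alpha>\<^esup>)\<close> at first-order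
  deformations of the weights of the chain (\<open>edge_coefficients\<close> below).\<close>

definition d0 :: dual where "d0 = Dual q (1 / p)"
definition d1 :: dual where "d1 = Dual G (G * (G - p) / p)"
definition d2 :: dual where "d2 = dC E"
definition d3 :: dual where "d3 = Dual G (- (G * (G - p) / p))"
definition d4 :: dual where "d4 = Dual q (- 1 / p)"

definition off :: "dual \<Rightarrow> dual" where "off g = 1 + dC p * g - g * g"

lemma d_values:
  "d0 = Dual q (q / (q ^ 2 - 1))" "d1 = Dual (q ^ 5 / (q ^ 4 + q ^ 2 + 1)) (q ^ 5 / ((q ^ 2 - 1) * (q ^ 4 + q ^ 2 + 1) ^ 2))"
  "d2 = Dual (q ^ 3 / (q ^ 2 + 1)) 0"
  "d3 = Dual (q ^ 5 / (q ^ 4 + q ^ 2 + 1)) (- (q ^ 5) / ((q ^ 2 - 1) * (q ^ 4 + q ^ 2 + 1) ^ 2))"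
  "d4 = Dual q (- q / (q ^ 2 - 1))"
  using q0 D1 D2 D3
  by (simp_all add: dual_eq_iff d0_def d1_def d2_def d3_def d4_def p_eq G_def E_def divide_simps;
      (simp add: eval_nat_numeral algebra_simps)?)+

lemma off_values:
  "off d0 = Dual 0 (- (q ^ 2 + 1) / (q ^ 2 - 1))"
  "off d1 = Dual ((q ^ 8 + 2 * q ^ 6 + 2 * q ^ 4 + 2 * q ^ 2 + 1) / (q ^ 4 + q ^ 2 + 1) ^ 2)
      (- (q ^ 4 + q ^ 10) / ((q ^ 2 - 1) * (q ^ 4 + q ^ 2 + 1) ^ 3))"
  "off d2 = Dual ((q ^ 4 + q ^ 2 + 1) / (q ^ 2 + 1) ^ 2) 0"
  "off d3 = Dual ((q ^ 8 + 2 * q ^ 6 + 2 * q ^ 4 + 2 * q ^ 2 + 1) / (q ^ 4 + q ^ 2 + 1) ^ 2)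
      ((q ^ 4 + q ^ 10) / ((q ^ 2 - 1) * (q ^ 4 + q ^ 2 + 1) ^ 3))"
  "off d4 = Dual 0 ((q ^ 2 + 1) / (q ^ 2 - 1))"
  using q0 D1 D2 D3 unfolding off_def d_values p_eq
  by (simp_all add: dual_eq_iff divide_simps; (simp add: eval_nat_numeral algebra_simps)?)+

text \<open>Coordinate \<open>j\<close> carries a deformation of the weight \<open>r\<^sub>j\<close>. On two coordinates joined by an edge of the chain the
  operator is normalised so that the intertwiner from the lower to the higher one is the identity of the
  dual numbers; the opposite one is then multiplication by \<open>off g\<close>. At both ends of the chain \<open>s\<^sub>2\<close> fixes
  the weight, the intertwiner has a pole, and \<open>T\<^sub>2\<close> mixes the two components of the dual number.\<close>

fun T12 :: "idx \<Rightarrow> dual \<times> dual \<times> dual \<times> dual \<times> dual \<times> dual \<Rightarrow> dual \<times> dual \<times> dual \<times> dual \<times> dual \<times> dual" where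
  "T12 I1 (x0, x1, x2, x3, x4, x5) =
     (d0 * x0 + off d0 * x1, x0 + (dC p - d0) * x1,
      d2 * x2 + off d2 * x3, x2 + (dC p - d2) * x3,
      d4 * x4 + off d4 * x5, x4 + (dC p - d4) * x5)"
| "T12 I2 (x0, x1, x2, x3, x4, x5) =
     (Dual (p * std x0 + p * eps x0) (std x0 / p),
      d1 * x1 + off d1 * x2, x1 + (dC p - d1) * x2,
      d3 * x3 + off d3 * x4, x3 + (dC p - d3) * x4,
      Dual (p * std x5 + p * eps x5) (std x5 / p))"

text \<open>The intermediate vectors along both paths are written out, so that every step is a comparison of rational
  functions of \<open>q\<close>.\<close>

lemma braid_generator:
  "T12 I1 (T12 I2 (T12 I1 (T12 I2 (T12 I1 (T12 I2 (Dual 0 1, 0, 0, 0, 0, 0)))))) =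
   T12 I2 (T12 I1 (T12 I2 (T12 I1 (T12 I2 (T12 I1 (Dual 0 1, 0, 0, 0, 0, 0))))))"
proof -
  have A1: "T12 I2 (Dual 0 1, 0, 0, 0, 0, 0) = (Dual ((q^2 - 1) / q) (0), 0, 0, 0, 0, 0)"
    using D1 D2 D3 q0 unfolding T12.simps off_values unfolding d_values p_eq prod.inject dual_eq_iff
    by (intro conjI; simp add: divide_simps; (simp add: eval_nat_numeral algebra_simps)?)
  have A2: "T12 I1 (Dual ((q^2 - 1) / q) (0), 0, 0, 0, 0, 0) = (Dual (q^2 - 1) (1), Dual ((q^2 - 1) / q) (0), 0, 0, 0, 0)"
    using D1 D2 D3 q0 unfolding T12.simps off_values unfolding d_values p_eq prod.inject dual_eq_iff
    by (intro conjI; simp add: divide_simps; (simp add: eval_nat_numeral algebra_simps)?)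
  have A3: "T12 I2 (Dual (q^2 - 1) (1), Dual ((q^2 - 1) / q) (0), 0, 0, 0, 0) = (Dual (q^3 - q) (q), Dual ((q^6 - q^4) / (q^4 + q^2 + 1)) (q^4 / (q^4 + q^2 + 1)^2), Dual ((q^2 - 1) / q) (0), 0, 0, 0)"
    using D1 D2 D3 q0 unfolding T12.simps off_values unfolding d_values p_eq prod.inject dual_eq_iff
    by (intro conjI; simp add: divide_simps; (simp add: eval_nat_numeral algebra_simps)?)
  have A4: "T12 I1 (Dual (q^3 - q) (q), Dual ((q^6 - q^4) / (q^4 + q^2 + 1)) (q^4 / (q^4 + q^2 + 1)^2), Dual ((q^2 - 1) / q) (0), 0, 0, 0) = (Dual (q^4 - q^2) ((2*q^2 + q^4 + q^6) / (q^4 + q^2 + 1)), Dual ((q^3 + q^7 - q - q^5) / (q^4 + q^2 + 1)) ((q + q^3 + 2*q^5 + q^7) / (q^4 + q^2 + 1)^2), Dual ((q^4 - q^2) / (q^2 + 1)) (0), Dual ((q^2 - 1) / q) (0), 0, 0)"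
    using D1 D2 D3 q0 unfolding T12.simps off_values unfolding d_values p_eq prod.inject dual_eq_iff
    by (intro conjI; simp add: divide_simps; (simp add: eval_nat_numeral algebra_simps)?)
  have A5: "T12 I2 (Dual (q^4 - q^2) ((2*q^2 + q^4 + q^6) / (q^4 + q^2 + 1)), Dual ((q^3 + q^7 - q - q^5) / (q^4 + q^2 + 1)) ((q + q^3 + 2*q^5 + q^7) / (q^4 + q^2 + 1)^2), Dual ((q^4 - q^2) / (q^2 + 1)) (0), Dual ((q^2 - 1) / q) (0), 0, 0) = (Dual ((q^9 - q) / (q^4 + q^2 + 1)) (q^3), Dual ((q^4 + q^8 - q^2 - q^6) / (q^4 + q^2 + 1)) ((q^6 + q^8) / (q^4 + q^2 + 1)^2), Dual ((q^5 - q^3) / (q^2 + 1)) (q / (q^2 + 1)), Dual ((q^6 - q^4) / (q^4 + q^2 + 1)) (-(q^4) / (q^4 + q^2 + 1)^2), Dual ((q^2 - 1) / q) (0), 0)"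
    using D1 D2 D3 q0 unfolding T12.simps off_values unfolding d_values p_eq prod.inject dual_eq_iff
    by (intro conjI; simp add: divide_simps; (simp add: eval_nat_numeral algebra_simps)?)
  have A6: "T12 I1 (Dual ((q^9 - q) / (q^4 + q^2 + 1)) (q^3), Dual ((q^4 + q^8 - q^2 - q^6) / (q^4 + q^2 + 1)) ((q^6 + q^8) / (q^4 + q^2 + 1)^2), Dual ((q^5 - q^3) / (q^2 + 1)) (q / (q^2 + 1)), Dual ((q^6 - q^4) / (q^4 + q^2 + 1)) (-(q^4) / (q^4 + q^2 + 1)^2), Dual ((q^2 - 1) / q) (0), 0) = (Dual ((q^10 - q^2) / (q^4 + q^2 + 1)) (q^4), Dual ((q^5 + q^9 - q^3 - q^7) / (q^4 + q^2 + 1)) (q^9 / (q^4 + q^2 + 1)^2), Dual ((q^6 - q^4) / (q^2 + 1)) (q^6 / ((q^2 + 1) * (q^4 + q^2 + 1))), Dual ((q^7 - q^5) / (q^4 + q^2 + 1)) ((q + 2*q^3 + q^5 + q^7) / (q^4 + q^2 + 1)^2), Dual (q^2 - 1) (-(1)), Dual ((q^2 - 1) / q) (0))"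
    using D1 D2 D3 q0 unfolding T12.simps off_values unfolding d_values p_eq prod.inject dual_eq_iff
    by (intro conjI; simp add: divide_simps; (simp add: eval_nat_numeral algebra_simps)?)
  have B1: "T12 I1 (Dual 0 1, 0, 0, 0, 0, 0) = (Dual (0) (q), Dual (0) (1), 0, 0, 0, 0)"
    using D1 D2 D3 q0 unfolding T12.simps off_values unfolding d_values p_eq prod.inject dual_eq_iff
    by (intro conjI; simp add: divide_simps; (simp add: eval_nat_numeral algebra_simps)?)
  have B2: "T12 I2 (Dual (0) (q), Dual (0) (1), 0, 0, 0, 0) = (Dual (q^2 - 1) (0), Dual (0) (q^5 / (q^4 + q^2 + 1)), Dual (0) (1), 0, 0, 0)"
    using D1 D2 D3 q0 unfolding T12.simps off_values unfolding d_values p_eq prod.inject dual_eq_iff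
    by (intro conjI; simp add: divide_simps; (simp add: eval_nat_numeral algebra_simps)?)
  have B3: "T12 I1 (Dual (q^2 - 1) (0), Dual (0) (q^5 / (q^4 + q^2 + 1)), Dual (0) (1), 0, 0, 0) = (Dual (q^3 - q) (q), Dual (q^2 - 1) (-(q^4) / (q^4 + q^2 + 1)), Dual (0) (q^3 / (q^2 + 1)), Dual (0) (1), 0, 0)"
    using D1 D2 D3 q0 unfolding T12.simps off_values unfolding d_values p_eq prod.inject dual_eq_iff
    by (intro conjI; simp add: divide_simps; (simp add: eval_nat_numeral algebra_simps)?)
  have B4: "T12 I2 (Dual (q^3 - q) (q), Dual (q^2 - 1) (-(q^4) / (q^4 + q^2 + 1)), Dual (0) (q^3 / (q^2 + 1)), Dual (0) (1), 0, 0) = (Dual (q^4 - q^2) (q^2), Dual ((q^7 - q^5) / (q^4 + q^2 + 1)) ((q^3 + 2*q^5 + q^7) / (q^4 + q^2 + 1)^2), Dual (q^2 - 1) (-(q^2) / (q^2 + 1)), Dual (0) (q^5 / (q^4 + q^2 + 1)), Dual (0) (1), 0)"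
    using D1 D2 D3 q0 unfolding T12.simps off_values unfolding d_values p_eq prod.inject dual_eq_iff
    by (intro conjI; simp add: divide_simps; (simp add: eval_nat_numeral algebra_simps)?)
  have B5: "T12 I1 (Dual (q^4 - q^2) (q^2), Dual ((q^7 - q^5) / (q^4 + q^2 + 1)) ((q^3 + 2*q^5 + q^7) / (q^4 + q^2 + 1)^2), Dual (q^2 - 1) (-(q^2) / (q^2 + 1)), Dual (0) (q^5 / (q^4 + q^2 + 1)), Dual (0) (1), 0) = (Dual (q^5 - q^3) ((2*q^3 + q^5 + q^7) / (q^4 + q^2 + 1)), Dual ((q^4 + q^8 - q^2 - q^6) / (q^4 + q^2 + 1)) ((q^6 + q^8) / (q^4 + q^2 + 1)^2), Dual ((q^5 - q^3) / (q^2 + 1)) (0), Dual (q^2 - 1) ((-(q^2) - q^4) / (q^4 + q^2 + 1)), Dual (0) (q), Dual (0) (1))"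
    using D1 D2 D3 q0 unfolding T12.simps off_values unfolding d_values p_eq prod.inject dual_eq_iff
    by (intro conjI; simp add: divide_simps; (simp add: eval_nat_numeral algebra_simps)?)
  have B6: "T12 I2 (Dual (q^5 - q^3) ((2*q^3 + q^5 + q^7) / (q^4 + q^2 + 1)), Dual ((q^4 + q^8 - q^2 - q^6) / (q^4 + q^2 + 1)) ((q^6 + q^8) / (q^4 + q^2 + 1)^2), Dual ((q^5 - q^3) / (q^2 + 1)) (0), Dual (q^2 - 1) ((-(q^2) - q^4) / (q^4 + q^2 + 1)), Dual (0) (q), Dual (0) (1)) = (Dual ((q^10 - q^2) / (q^4 + q^2 + 1)) (q^4), Dual ((q^5 + q^9 - q^3 - q^7) / (q^4 + q^2 + 1)) (q^9 / (q^4 + q^2 + 1)^2), Dual ((q^6 - q^4) / (q^2 + 1)) (q^6 / ((q^2 + 1) * (q^4 + q^2 + 1))), Dual ((q^7 - q^5) / (q^4 + q^2 + 1)) ((q + 2*q^3 + q^5 + q^7) / (q^4 + q^2 + 1)^2), Dual (q^2 - 1) (-(1)), Dual ((q^2 - 1) / q) (0))"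
    using D1 D2 D3 q0 unfolding T12.simps off_values unfolding d_values p_eq prod.inject dual_eq_iff
    by (intro conjI; simp add: divide_simps; (simp add: eval_nat_numeral algebra_simps)?)

  show ?thesis by (simp only: A1 A2 A3 A4 A5 A6 B1 B2 B3 B4 B5 B6)
qed

end

text \<open>The point \<open>t_of z w\<close> of the torus moved to first order in the direction \<open>(a, b)\<close>.\<close>

definition theta :: "complex \<Rightarrow> complex \<Rightarrow> int \<Rightarrow> int \<Rightarrow> lattice \<Rightarrow> dual" where
  "theta z w a b \<nu> = Dual (t_of z w \<nu>) (t_of z w \<nu> * of_int (a * fst \<nu> + b * snd \<nu>))"

lemma theta_char:
  assumes "z \<noteq> 0" "w \<noteq> 0"
  shows "lattice_char (theta z w a b)"
proof -
  have "t_of z w 0 = 1" "t_of z w (\<nu> + \<mu>) = t_of z w \<nu> * t_of z w \<mu>" for \<nu> \<mu>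
    using lattice_charD[OF t_of_simps(1)[OF assms]] by auto
  then show ?thesis
    unfolding lattice_char_def by (auto simp: theta_def dual_eq_iff algebra_simps simp del: split_paired_All)
qed

lemma simple_reflection_coords:
  "fst (simple_reflection I1 \<nu>) = 3 * snd \<nu> - fst \<nu>" "snd (simple_reflection I1 \<nu>) = snd \<nu>"
  "fst (simple_reflection I2 \<nu>) = fst \<nu>" "snd (simple_reflection I2 \<nu>) = fst \<nu> - snd \<nu>"
  by (cases \<nu>; simp add: simple_reflection_simps)+

lemma theta_reflection:
  assumes "z \<noteq> 0" "w \<noteq> 0"
  shows "theta z w a b \<circ> simple_reflection I1 = theta (inverse z) (z ^ 3 * w) (- a) (3 * a + b)"
    and "theta z w a b \<circ> simple_reflection I2 = theta (z * w) (inverse w) (a + b) (- b)"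
proof -
  have "t_of z w (simple_reflection I1 \<nu>) = t_of (inverse z) (z ^ 3 * w) \<nu>"
    "t_of z w (simple_reflection I2 \<nu>) = t_of (z * w) (inverse w) \<nu>" for \<nu>
    using t_of_reflection[OF assms] by (metis comp_apply)+
  then show "theta z w a b \<circ> simple_reflection I1 = theta (inverse z) (z ^ 3 * w) (- a) (3 * a + b)"
    "theta z w a b \<circ> simple_reflection I2 = theta (z * w) (inverse w) (a + b) (- b)"
    by (auto simp: fun_eq_iff theta_def simple_reflection_coords algebra_simps)
qed

context hecke_param begin

text \<open>At a point fixed by \<open>s\<^sub>2\<close>, deformed in the direction of the coroot, \<open>1 - X\<^bsup>-\<alpha>\<^esup>\<close> becomes nilpotent and
  division by it is impossible; the geometric sum is evaluated instead.\<close>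

lemma theta_divided_difference:
  assumes "z \<noteq> 0"
  shows "dual_scalars.ev (theta z 1 (- 1) 2) (divided_difference I2 \<nu>) =
    dC (t_of z 1 \<nu> * of_int (coroot_pairing \<nu> I2)) * Dual 1 1"
proof -
  let ?\<theta> = "theta z 1 (- 1) 2"
  have ch: "lattice_char ?\<theta>" using assms by (intro theta_char) auto
  have th: "?\<theta> \<nu> = Dual (t_of z 1 \<nu>) (t_of z 1 \<nu> * of_int (coroot_pairing \<nu> I2))"
    by (simp add: theta_def coroot_pairing_def algebra_simps)
  have "?\<theta> (simple_reflection I2 \<nu>) = Dual (t_of z 1 \<nu>) (- t_of z 1 \<nu> * of_int (coroot_pairing \<nu> I2))"
    by (cases \<nu>) (simp add: theta_def t_of_def simple_reflection_simps coroot_pairing_def algebra_simps)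
  note ths = this
  have sr: "?\<theta> (- simple_root I2) ^ j = Dual 1 (- 2 * of_nat j)" for j
    by (induction j) (simp_all add: dual_eq_iff theta_def t_of_def algebra_simps)
  have sum: "(\<Sum>j<n. Dual t (t * of_nat n) * Dual 1 (- 2 * of_nat j)) = dC (t * of_nat n) * Dual 1 1" for t n
  proof -
    have "(\<Sum>j<m. Dual t s * Dual 1 (- 2 * of_nat j)) = Dual (of_nat m * t) (of_nat m * s - t * of_nat m * (of_nat m - 1))" for m s
      by (induction m) (simp_all add: dual_eq_iff algebra_simps)
    note gen = this
    show ?thesis unfolding gen by (simp add: dual_eq_iff algebra_simps)
  qed
  define n where "n = nat \<bar>coroot_pairing \<nu> I2\<bar>"
  consider "coroot_pairing \<nu> I2 = int n" | "coroot_pairing \<nu> I2 = - int n"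
    by (cases "coroot_pairing \<nu> I2 \<ge> 0") (auto simp: n_def)
  then show ?thesis
  proof cases
    case 1
    from dual_scalars.ev_divided_difference_sum(1)[OF ch 1] sum[where n = n and t = "t_of z 1 \<nu>"] show ?thesis
      by (simp only: th sr 1 of_int_of_nat_eq)
  next
    case 2
    from dual_scalars.ev_divided_difference_sum(2)[OF ch 2] sum[where n = n and t = "t_of z 1 \<nu>"] show ?thesis
      by (simp only: ths sr 2 of_int_minus of_int_of_nat_eq mult_minus_right mult_minus_left minus_minus)
       (simp add: dual_eq_iff)
  qed
qed

text \<open>The cross relation on a pair of coordinates joined by an edge. Multiplying the divided difference by
  \<open>p = g (1 - \<theta>(-\<alpha>))\<close> removes its denominator; for the opposite direction the same holds with \<open>p - g\<close>, because
  the two values of \<open>X\<^bsup>-\<alpha>\<^esup>\<close> are inverse to each other.\<close>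

lemma edge_cross:
  assumes \<theta>: "lattice_char \<theta>" and g: "g * (1 - \<theta> (- simple_root i)) = dC p"
    and \<theta>': "\<theta>' = \<theta> \<circ> simple_reflection i"
  shows "\<theta> \<nu> * (g * x + off g * y) = (g * (\<theta> (simple_reflection i \<nu>) * x) + off g * (\<theta>' (simple_reflection i \<nu>) * y))
      + dC p * (dual_scalars.ev \<theta> (divided_difference i \<nu>) * x)" (is ?A)
    and "\<theta>' \<nu> * (x + (dC p - g) * y) = (\<theta> (simple_reflection i \<nu>) * x + (dC p - g) * (\<theta>' (simple_reflection i \<nu>) * y))
      + dC p * (dual_scalars.ev \<theta>' (divided_difference i \<nu>) * y)" (is ?B)
proof -
  have \<theta>'c: "lattice_char \<theta>'" using \<theta> \<theta>' by (simp add: lattice_char_reflection)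
  have e: "dual_scalars.ev \<theta> (divided_difference i \<nu>) * (1 - \<theta> (- simple_root i)) = \<theta> \<nu> - \<theta> (simple_reflection i \<nu>)"
    by (rule dual_scalars.ev_divided_difference[OF \<theta>])
  have e': "dual_scalars.ev \<theta>' (divided_difference i \<nu>) * (1 - \<theta>' (- simple_root i)) = \<theta>' \<nu> - \<theta>' (simple_reflection i \<nu>)"
    by (rule dual_scalars.ev_divided_difference[OF \<theta>'c])
  have s: "\<theta>' (simple_reflection i \<nu>) = \<theta> \<nu>" "\<theta>' \<nu> = \<theta> (simple_reflection i \<nu>)"
    by (simp_all add: \<theta>' simple_reflection_involution)
  have "\<theta>' (- simple_root i) * \<theta> (- simple_root i) = 1"
  proof -
    have "simple_reflection i (- simple_root i) + - simple_root i = 0"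
      by (cases i) (simp_all add: simple_reflection_simps zero_prod_def)
    then show ?thesis using lattice_charD[OF \<theta>] by (metis \<theta>' comp_apply)
  qed
  then have g': "(dC p - g) * (1 - \<theta>' (- simple_root i)) = dC p"
  proof -
    have "(dC p - g) * (1 - \<theta>' (- simple_root i)) =
      dC p - (dC p - g * (1 - \<theta> (- simple_root i))) * \<theta>' (- simple_root i)
      - g * (1 - \<theta>' (- simple_root i) * \<theta> (- simple_root i))" by (simp add: algebra_simps)
    then show ?thesis using g \<open>_ = 1\<close> by simp
  qed
  have 1: "dC p * (dual_scalars.ev \<theta> (divided_difference i \<nu>) * x) = g * (\<theta> \<nu> - \<theta> (simple_reflection i \<nu>)) * x"
    unfolding e[symmetric] g[symmetric] by (simp add: mult_ac)
  have 2: "dC p * (dual_scalars.ev \<theta>' (divided_difference i \<nu>) * y) = (dC p - g) * (\<theta>' \<nu> - \<theta>' (simple_reflection i \<nu>)) * y"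
    unfolding e'[symmetric] by (subst g'[symmetric]) (simp only: mult_ac)
  show ?A unfolding 1 s by (simp add: algebra_simps)
  show ?B unfolding 2 s by (simp add: algebra_simps)
qed

text \<open>The direction of the deformation at \<open>r0\<close> is the coroot of \<open>\<alpha>\<^sub>2\<close>, which makes the lattice act on the first coordinate
  by Jordan blocks; the directions at the other weights are its images under the reflections.\<close>

definition x0 :: "lattice \<Rightarrow> dual" where "x0 = theta (q ^ 2) 1 (- 1) 2"
definition x1 :: "lattice \<Rightarrow> dual" where "x1 = theta (inverse (q ^ 2)) (q ^ 6) 1 (- 1)"
definition x2 :: "lattice \<Rightarrow> dual" where "x2 = theta (q ^ 4) (inverse (q ^ 6)) 0 1"
definition x3 :: "lattice \<Rightarrow> dual" where "x3 = theta (inverse (q ^ 4)) (q ^ 6) 0 1"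
definition x4 :: "lattice \<Rightarrow> dual" where "x4 = theta (q ^ 2) (inverse (q ^ 6)) 1 (- 1)"
definition x5 :: "lattice \<Rightarrow> dual" where "x5 = theta (inverse (q ^ 2)) 1 (- 1) 2"

lemmas x_defs = x0_def x1_def x2_def x3_def x4_def x5_def

lemma x_char: "lattice_char x0" "lattice_char x1" "lattice_char x2" "lattice_char x3" "lattice_char x4" "lattice_char x5"
  using q0 by (simp_all add: x_defs theta_char)

lemma x_reflection:
  "x1 = x0 \<circ> simple_reflection I1" "x2 = x1 \<circ> simple_reflection I2" "x3 = x2 \<circ> simple_reflection I1"
  "x4 = x3 \<circ> simple_reflection I2" "x5 = x4 \<circ> simple_reflection I1"
proof -
  have "(q ^ 4) ^ 3 * inverse (q ^ 6) = q ^ 6" "(q ^ 2) ^ 3 * inverse (q ^ 6) = 1"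
    "inverse (q ^ 2) * q ^ 6 = q ^ 4" "inverse (q ^ 4) * q ^ 6 = q ^ 2"
    using q0 by (simp_all add: field_simps flip: power_mult power_add)
  then show "x1 = x0 \<circ> simple_reflection I1" "x2 = x1 \<circ> simple_reflection I2" "x3 = x2 \<circ> simple_reflection I1"
  "x4 = x3 \<circ> simple_reflection I2" "x5 = x4 \<circ> simple_reflection I1"
    using q0 by (simp_all add: x_defs theta_reflection power_mult[symmetric])
qed

lemma edge_coefficients:
  "d0 * (1 - x0 (- simple_root I1)) = dC p" "d1 * (1 - x1 (- simple_root I2)) = dC p"
  "d2 * (1 - x2 (- simple_root I1)) = dC p" "d3 * (1 - x3 (- simple_root I2)) = dC p"
  "d4 * (1 - x4 (- simple_root I1)) = dC p"
  using q0 D1 D2 D3 unfolding d_values p_eq x_defs theta_def t_of_def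
  by (simp_all add: dual_eq_iff power_int_minus divide_simps; (simp add: eval_nat_numeral algebra_simps)?)+

lemma singular_cross:
  assumes "z \<noteq> 0" and \<theta>: "\<theta> = theta z 1 (- 1) 2"
  shows "\<theta> \<nu> * Dual (p * std x + p * eps x) (std x / p) =
    (let y = \<theta> (simple_reflection I2 \<nu>) * x in Dual (p * std y + p * eps y) (std y / p))
    + dC p * (dual_scalars.ev \<theta> (divided_difference I2 \<nu>) * x)"
proof -
  have "\<theta> \<nu> = Dual (t_of z 1 \<nu>) (t_of z 1 \<nu> * of_int (coroot_pairing \<nu> I2))"
    "\<theta> (simple_reflection I2 \<nu>) = Dual (t_of z 1 \<nu>) (- t_of z 1 \<nu> * of_int (coroot_pairing \<nu> I2))"
    unfolding \<theta> by (cases \<nu>, simp add: theta_def t_of_def simple_reflection_simps coroot_pairing_def algebra_simps)+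
  then show ?thesis
    unfolding \<theta> theta_divided_difference[OF assms(1)] Let_def
    using p0 by (simp add: dual_eq_iff \<theta> field_simps)
qed

fun X12 :: "lattice \<Rightarrow> dual \<times> dual \<times> dual \<times> dual \<times> dual \<times> dual \<Rightarrow> dual \<times> dual \<times> dual \<times> dual \<times> dual \<times> dual" where
  "X12 \<nu> (a, b, c, d, e, f) = (x0 \<nu> * a, x1 \<nu> * b, x2 \<nu> * c, x3 \<nu> * d, x4 \<nu> * e, x5 \<nu> * f)"

fun sc12 :: "complex \<Rightarrow> dual \<times> dual \<times> dual \<times> dual \<times> dual \<times> dual \<Rightarrow> dual \<times> dual \<times> dual \<times> dual \<times> dual \<times> dual" where
  "sc12 k (a, b, c, d, e, f) = (dC k * a, dC k * b, dC k * c, dC k * d, dC k * e, dC k * f)"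

lemma dC_simps: "dC (a * b) = dC a * dC b" "dC (a + b) = dC a + dC b" "dC 1 = 1" "dC 0 = 0"
  by (simp_all add: dual_eq_iff)

lemma linear12:
  "sc12 k (v + w) = sc12 k v + sc12 k w" "sc12 (a + b) v = sc12 a v + sc12 b v"
  "sc12 a (sc12 b v) = sc12 (a * b) v" "sc12 1 v = v"
  "T12 i (v + w) = T12 i v + T12 i w" "T12 i (sc12 k v) = sc12 k (T12 i v)"
  "X12 \<nu> (v + w) = X12 \<nu> v + X12 \<nu> w" "X12 \<nu> (sc12 k v) = sc12 k (X12 \<nu> v)"
     apply (cases v; cases w; simp add: algebra_simps)
    apply (cases v; simp add: algebra_simps dC_simps)
   apply (cases v; simp add: dC_simps mult_ac)
  apply (cases v; simp add: dC_simps)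
     apply (cases v; cases w; cases i; simp add: algebra_simps add_divide_distrib dual_eq_iff)
    apply (cases v; cases i; simp add: algebra_simps dual_eq_iff)
   apply (cases v; cases w; simp add: algebra_simps)
  apply (cases v; simp add: mult_ac)
  done

lemma X12_mult: "X12 0 v = v" "X12 \<nu> (X12 \<mu> v) = X12 (\<nu> + \<mu>) v"
  by (cases v; simp add: lattice_charD[OF x_char(1)] lattice_charD[OF x_char(2)] lattice_charD[OF x_char(3)]
      lattice_charD[OF x_char(4)] lattice_charD[OF x_char(5)] lattice_charD[OF x_char(6)] mult_ac)+

lemma edge_quadratic:
  "g * (g * x + off g * y) + off g * (x + (dC p - g) * y) = dC p * (g * x + off g * y) + x"
  "(g * x + off g * y) + (dC p - g) * (x + (dC p - g) * y) = dC p * (x + (dC p - g) * y) + y"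
  by (simp_all add: off_def algebra_simps)

lemma quadratic12: "T12 i (T12 i v) = sc12 (q - inverse q) (T12 i v) + v"
proof (cases v)
  case (fields a b c d e f)
  have s: "Dual (p * std y + p * eps y) (std y / p) = dC p * y + x"
    if "y = Dual (p * std x + p * eps x) (std x / p)" for x y
    using that p0 by (simp add: dual_eq_iff field_simps)
  show ?thesis unfolding fields p_def[symmetric]
    by (cases i) (simp_all only: T12.simps sc12.simps plus_prod_def fst_conv snd_conv edge_quadratic s[OF refl])
qed

lemma lift12:
  "pm_extend (\<lambda>\<mu> k. sc12 k (X12 \<mu> (a, b, c, d, e, f))) g =
    (dual_scalars.ev x0 g * a, dual_scalars.ev x1 g * b, dual_scalars.ev x2 g * c,
     dual_scalars.ev x3 g * d, dual_scalars.ev x4 g * e, dual_scalars.ev x5 g * f)"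
proof (induction g rule: poly_mapping_add_induct)
  case zero then show ?case by (simp add: dual_scalars.ev_simps zero_prod_def)
next
  case (single \<mu> k)
  show ?case by (subst pm_extend_single) (simp_all add: dual_scalars.ev_simps mult_ac dC_simps zero_prod_def)
next
  case (add g h)
  then show ?case
    by (subst pm_extend_add) (simp_all add: dual_scalars.ev_simps dC_simps zero_prod_def algebra_simps)
qed

lemma cross12:
  "X12 \<nu> (T12 i v) = T12 i (X12 (simple_reflection i \<nu>) v) +
    sc12 (q - inverse q) (pm_extend (\<lambda>\<mu> c. sc12 c (X12 \<mu> v)) (divided_difference i \<nu>))"
proof (cases v)
  case (fields a b c d e f)
  note edges = edge_cross[OF x_char(1) edge_coefficients(1) x_reflection(1)]
    edge_cross[OF x_char(2) edge_coefficients(2) x_reflection(2)]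
    edge_cross[OF x_char(3) edge_coefficients(3) x_reflection(3)]
    edge_cross[OF x_char(4) edge_coefficients(4) x_reflection(4)]
    edge_cross[OF x_char(5) edge_coefficients(5) x_reflection(5)]
  have nz: "q ^ 2 \<noteq> 0" "inverse (q ^ 2) \<noteq> 0" using q0 by auto
  note sing = singular_cross[OF nz(1) x0_def, unfolded Let_def] singular_cross[OF nz(2) x5_def, unfolded Let_def]
  show ?thesis unfolding fields p_def[symmetric] lift12
    by (cases i) (simp_all only: T12.simps X12.simps sc12.simps plus_prod_def fst_conv snd_conv edges sing)
qed

text \<open>The module is generated by the first basis vector: crossing an edge of the chain of weights
  is, in one direction, the identity up to a multiple of what is already there.\<close>

lemma generation12:
  assumes gen: "(Dual 0 1, 0, 0, 0, 0, 0) \<in> S"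
    and add: "\<And>v w. \<lbrakk>v \<in> S; w \<in> S\<rbrakk> \<Longrightarrow> v + w \<in> S" and sc: "\<And>k v. v \<in> S \<Longrightarrow> sc12 k v \<in> S"
    and T: "\<And>i v. v \<in> S \<Longrightarrow> T12 i v \<in> S"
  shows "v \<in> S"
proof -
  have E0: "(x, 0, 0, 0, 0, 0) \<in> S" for x
  proof -
    have "sc12 (eps x) (Dual 0 1, 0, 0, 0, 0, 0) + sc12 (std x / p) (T12 I2 (Dual 0 1, 0, 0, 0, 0, 0)) = (x, 0, 0, 0, 0, 0)"
      using p0 by (simp add: dual_eq_iff)
    then show ?thesis using add[OF sc[OF gen] sc[OF T[OF gen]]] by metis
  qed
  have E1: "(0, x, 0, 0, 0, 0) \<in> S" for x
    using add[OF T[OF E0[of x], of I1] E0[of "- d0 * x"]] by simp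
  have E2: "(0, 0, x, 0, 0, 0) \<in> S" for x
    using add[OF T[OF E1[of x], of I2] E1[of "- d1 * x"]] by (simp flip: zero_dual_def)
  have E3: "(0, 0, 0, x, 0, 0) \<in> S" for x
    using add[OF T[OF E2[of x], of I1] E2[of "- d2 * x"]] by simp
  have E4: "(0, 0, 0, 0, x, 0) \<in> S" for x
    using add[OF T[OF E3[of x], of I2] E3[of "- d3 * x"]] by (simp flip: zero_dual_def)
  have E5: "(0, 0, 0, 0, 0, x) \<in> S" for x
    using add[OF T[OF E4[of x], of I1] E4[of "- d4 * x"]] by simp
  obtain a b c d e f where v: "v = (a, b, c, d, e, f)" by (cases v)
  show ?thesis
    using add[OF E0[of a] add[OF E1[of b] add[OF E2[of c] add[OF E3[of d] add[OF E4[of e] E5[of f]]]]]]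
    by (simp add: v)
qed

text \<open>Both sides of the braid relation satisfy the same recursion under right multiplication
  by \<open>T\<^sub>1\<close> and \<open>T\<^sub>2\<close>, so they agree everywhere as soon as they agree on a generator.\<close>

lemma braid12:
  "T12 I1 (T12 I2 (T12 I1 (T12 I2 (T12 I1 (T12 I2 v))))) = T12 I2 (T12 I1 (T12 I2 (T12 I1 (T12 I2 (T12 I1 v)))))"
proof -
  let ?S = "{v. T12 I1 (T12 I2 (T12 I1 (T12 I2 (T12 I1 (T12 I2 v))))) = T12 I2 (T12 I1 (T12 I2 (T12 I1 (T12 I2 (T12 I1 v)))))}"
  have "v \<in> ?S"
  proof (rule generation12)
    show "T12 i w \<in> ?S" if "w \<in> ?S" for i w
    proof (cases i)
      case I1
      then show ?thesis using that
        by (simp only: mem_Collect_eq quadratic12[of I1] linear12) (metis quadratic12[of I1])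
    next
      case I2
      then show ?thesis using that
        by (simp only: mem_Collect_eq quadratic12[of I2] linear12)
    qed
  qed (use braid_generator in \<open>simp_all add: linear12\<close>)
  then show ?thesis by simp
qed

sublocale V: hecke_rep q sc12 T12 X12
  by unfold_locales (simp_all only: linear12 X12_mult quadratic12[symmetric] braid12 cross12[symmetric])

end

section \<open>Left ideals and weight vectors\<close>

declare split_paired_All [simp del] split_paired_Ex [simp del]

text \<open>Left ideals of the free algebra containing the relations correspond to left ideals of the Hecke algebra.
  Working in the free algebra keeps all computations in a ring type.\<close>

definition left_ideal :: "complex \<Rightarrow> free_algebra set \<Rightarrow> bool" where
  "left_ideal q I \<longleftrightarrow> hecke_ideal q \<subseteq> I \<and> (\<forall>x\<in>I. \<forall>y\<in>I. x + y \<in> I) \<and> (\<forall>a. \<forall>x\<in>I. a * x \<in> I)"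

definition lin_space :: "free_algebra set \<Rightarrow> bool" where
  "lin_space U \<longleftrightarrow> 0 \<in> U \<and> (\<forall>x\<in>U. \<forall>y\<in>U. x + y \<in> U) \<and> (\<forall>c. \<forall>x\<in>U. fC c * x \<in> U)"

text \<open>Weight arguments only use the action of the lattice, so they are carried out for subspaces stable under it,
  which need not be left ideals.\<close>

definition x_space :: "complex \<Rightarrow> free_algebra set \<Rightarrow> bool" where
  "x_space q U \<longleftrightarrow> lin_space U \<and> hecke_ideal q \<subseteq> U \<and> (\<forall>\<nu>. \<forall>x\<in>U. fX \<nu> * x \<in> U)"

definition wt :: "free_algebra set \<Rightarrow> (lattice \<Rightarrow> complex) \<Rightarrow> free_algebra \<Rightarrow> bool" where
  "wt U s z \<longleftrightarrow> (\<forall>\<nu>. fX \<nu> * z - fC (s \<nu>) * z \<in> U)"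

lemma lin_spaceD:
  assumes "lin_space U"
  shows "0 \<in> U" "x \<in> U \<Longrightarrow> y \<in> U \<Longrightarrow> x + y \<in> U" "x \<in> U \<Longrightarrow> fC c * x \<in> U" "x \<in> U \<Longrightarrow> - x \<in> U"
    "x \<in> U \<Longrightarrow> y \<in> U \<Longrightarrow> x - y \<in> U"
proof -
  show a: "x \<in> U \<Longrightarrow> y \<in> U \<Longrightarrow> x + y \<in> U" for x y using assms by (simp add: lin_space_def)
  show "0 \<in> U" "x \<in> U \<Longrightarrow> fC c * x \<in> U" using assms by (simp_all add: lin_space_def)
  show m: "x \<in> U \<Longrightarrow> - x \<in> U" for x
    using assms lin_space_def[of U] by (metis fC_simps(2,5) mult_1_left mult_minus_left)
  show "x \<in> U \<Longrightarrow> y \<in> U \<Longrightarrow> x - y \<in> U" using a[of x "- y"] m[of y] by simp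
qed

lemma lin_space_diff_iff:
  assumes "lin_space U" "x - y \<in> U"
  shows "x \<in> U \<longleftrightarrow> y \<in> U"
  using lin_spaceD(2)[OF assms(1), of "x - y" y] lin_spaceD(5)[OF assms(1), of x "x - y"] assms(2) by auto

lemma lin_space_scale_iff:
  assumes "lin_space U" "c \<noteq> 0"
  shows "fC c * x \<in> U \<longleftrightarrow> x \<in> U"
proof
  assume "fC c * x \<in> U"
  then have "fC (inverse c) * (fC c * x) \<in> U" by (rule lin_spaceD(3)[OF assms(1)])
  moreover have "fC (inverse c) * (fC c * x) = fC (inverse c * c) * x" by (simp add: fC_simps mult.assoc)
  ultimately show "x \<in> U" using assms(2) by (simp add: fC_simps)
qed (rule lin_spaceD(3)[OF assms(1)])

lemma left_idealD:
  assumes "left_ideal q I"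
  shows "x \<in> hecke_ideal q \<Longrightarrow> x \<in> I" "x \<in> I \<Longrightarrow> a * x \<in> I" "lin_space I" "x_space q I"
proof -
  show "x \<in> hecke_ideal q \<Longrightarrow> x \<in> I" "x \<in> I \<Longrightarrow> a * x \<in> I" using assms by (auto simp: left_ideal_def)
  show l: "lin_space I"
    using assms hecke_ideal_closed(1)[of q] by (auto simp: left_ideal_def lin_space_def)
  show "x_space q I" using assms l by (simp add: left_ideal_def x_space_def)
qed

lemma x_spaceD:
  assumes "x_space q U"
  shows "x \<in> hecke_ideal q \<Longrightarrow> x \<in> U" "lin_space U" "x \<in> U \<Longrightarrow> fX \<nu> * x \<in> U"
  using assms by (auto simp: x_space_def)

lemma wt_mono: "wt U s z \<Longrightarrow> U \<subseteq> V \<Longrightarrow> wt V s z"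
  by (auto simp: wt_def)

text \<open>Oriented so that simplification collects the scalars on the left.\<close>

lemma fC_move:
  "fT i * fC c = fC c * fT i" "fX \<nu> * fC c = fC c * fX \<nu>"
  "fT i * (fC c * z) = fC c * (fT i * z)" "fX \<nu> * (fC c * z) = fC c * (fX \<nu> * z)"
  by (simp_all add: fC_central[of _ c] flip: mult.assoc)

lemma fC_merge: "fC a * fC b = fC (a * b)" "fC a * (fC b * z) = fC (a * b) * z"
  by (simp_all add: fC_simps mult.assoc)

lemma fC_swap: "fC a * (fC b * z) = fC b * (fC a * z)"
  by (simp add: fC_merge mult.commute)

lemma wt_zero: "lin_space U \<Longrightarrow> z \<in> U \<Longrightarrow> x_space q U \<Longrightarrow> wt U s z"
  by (simp add: wt_def lin_spaceD x_spaceD)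

lemma wt_add:
  assumes "lin_space U" "wt U s y" "wt U s z"
  shows "wt U s (y + z)"
  unfolding wt_def
proof
  fix \<nu>
  have "fX \<nu> * (y + z) - fC (s \<nu>) * (y + z) = (fX \<nu> * y - fC (s \<nu>) * y) + (fX \<nu> * z - fC (s \<nu>) * z)"
    by (simp add: algebra_simps)
  then show "fX \<nu> * (y + z) - fC (s \<nu>) * (y + z) \<in> U"
    using lin_spaceD(2)[OF assms(1)] assms(2,3) by (simp add: wt_def)
qed

lemma wt_scale: "lin_space U \<Longrightarrow> wt U s z \<Longrightarrow> wt U s (fC c * z)"
  unfolding wt_def
proof
  fix \<nu> assume U: "lin_space U" and z: "\<forall>\<nu>. fX \<nu> * z - fC (s \<nu>) * z \<in> U"
  have "fX \<nu> * (fC c * z) - fC (s \<nu>) * (fC c * z) = fC c * (fX \<nu> * z - fC (s \<nu>) * z)"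
    by (simp add: fC_move fC_merge right_diff_distrib mult.commute)
  then show "fX \<nu> * (fC c * z) - fC (s \<nu>) * (fC c * z) \<in> U" using U z by (simp add: lin_spaceD)
qed

lemma hecke_ideal_relations:
  "fX 0 * z - z \<in> hecke_ideal q"
  "fX \<nu> * (fX \<mu> * z) - fX (\<nu> + \<mu>) * z \<in> hecke_ideal q"
  "fT i * (fT i * z) - (fC (q - inverse q) * (fT i * z) + z) \<in> hecke_ideal q"
  "fT I1 * (fT I2 * (fT I1 * (fT I2 * (fT I1 * (fT I2 * z))))) -
   fT I2 * (fT I1 * (fT I2 * (fT I1 * (fT I2 * (fT I1 * z))))) \<in> hecke_ideal q"
  "fX \<nu> * (fT i * z) - (fT i * (fX (simple_reflection i \<nu>) * z) +
      fC (q - inverse q) * (group_algebra_lift (divided_difference i \<nu>) * z)) \<in> hecke_ideal q"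
proof -
  have "(fX 0 - 1) * z \<in> hecke_ideal q"
    "(fX \<nu> * fX \<mu> - fX (\<nu> + \<mu>)) * z \<in> hecke_ideal q"
    "(fT i * fT i - (fC (q - inverse q) * fT i + 1)) * z \<in> hecke_ideal q"
    "(fT I1 * fT I2 * fT I1 * fT I2 * fT I1 * fT I2 - fT I2 * fT I1 * fT I2 * fT I1 * fT I2 * fT I1) * z \<in> hecke_ideal q"
    "(fX \<nu> * fT i - (fT i * fX (simple_reflection i \<nu>) +
        fC (q - inverse q) * group_algebra_lift (divided_difference i \<nu>))) * z \<in> hecke_ideal q"
    by (rule hecke_ideal_closed(4), rule hecke_ideal_closed(5), unfold hecke_relations_def, blast)+
  then show "fX 0 * z - z \<in> hecke_ideal q"
  "fX \<nu> * (fX \<mu> * z) - fX (\<nu> + \<mu>) * z \<in> hecke_ideal q"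
  "fT i * (fT i * z) - (fC (q - inverse q) * (fT i * z) + z) \<in> hecke_ideal q"
  "fT I1 * (fT I2 * (fT I1 * (fT I2 * (fT I1 * (fT I2 * z))))) -
   fT I2 * (fT I1 * (fT I2 * (fT I1 * (fT I2 * (fT I1 * z))))) \<in> hecke_ideal q"
  "fX \<nu> * (fT i * z) - (fT i * (fX (simple_reflection i \<nu>) * z) +
      fC (q - inverse q) * (group_algebra_lift (divided_difference i \<nu>) * z)) \<in> hecke_ideal q"
    by (simp_all only: left_diff_distrib distrib_right mult.assoc mult_1_left)
qed

context scalar_hom begin

text \<open>An additive family \<open>f\<close> of vectors indexed by the coefficient ring on which the lattice acts
  through the ring-valued character \<open>\<theta>\<close>. Over the complex numbers this is one weight vector with its
  multiples, over the dual numbers it is a pair spanning a Jordan block.\<close>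

definition rwt :: "free_algebra set \<Rightarrow> (lattice \<Rightarrow> 'r) \<Rightarrow> ('r \<Rightarrow> free_algebra) \<Rightarrow> bool" where
  "rwt U \<theta> f \<longleftrightarrow> (\<forall>x y. f (x + y) = f x + f y) \<and> (\<forall>c x. f (h c * x) = fC c * f x) \<and>
     (\<forall>\<nu> x. fX \<nu> * f x - f (\<theta> \<nu> * x) \<in> U)"

lemma rwt_simps:
  assumes "rwt U \<theta> f"
  shows "f (x + y) = f x + f y" "f 0 = 0" "f (- x) = - f x" "f (x - y) = f x - f y" "f (h c * x) = fC c * f x"
    "fX \<nu> * f x - f (\<theta> \<nu> * x) \<in> U"
proof -
  show a: "f (x + y) = f x + f y" for x y using assms unfolding rwt_def by blast
  show z: "f 0 = 0" using a[of 0 0] by simp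
  show m: "f (- x) = - f x" for x using a[of "- x" x] z by (simp add: eq_neg_iff_add_eq_0)
  show "f (x - y) = f x - f y" using a[of x "- y"] m[of y] by simp
  show "f (h c * x) = fC c * f x" "fX \<nu> * f x - f (\<theta> \<nu> * x) \<in> U" using assms unfolding rwt_def by blast+
qed

lemma rwt_lift:
  assumes U: "lin_space U" and f: "rwt U \<theta> f"
  shows "group_algebra_lift g * f x - f (ev \<theta> g * x) \<in> U"
proof (induction g rule: poly_mapping_add_induct)
  case zero
  then show ?case using U by (simp add: group_algebra_lift_pm_extend ev_simps rwt_simps[OF f] lin_spaceD)
next
  case (single \<mu> c)
  have "group_algebra_lift (Poly_Mapping.single \<mu> c) = fC c * fX \<mu>"
    unfolding group_algebra_lift_pm_extend by (rule pm_extend_single) (simp add: fC_simps)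
  then have "group_algebra_lift (Poly_Mapping.single \<mu> c) * f x - f (ev \<theta> (Poly_Mapping.single \<mu> c) * x)
    = fC c * (fX \<mu> * f x - f (\<theta> \<mu> * x))"
    by (simp add: ev_simps rwt_simps[OF f] mult.assoc right_diff_distrib)
  then show ?case using U rwt_simps(6)[OF f] by (simp add: lin_spaceD)
next
  case (add g h)
  have "group_algebra_lift (g + h) = group_algebra_lift g + group_algebra_lift h"
    unfolding group_algebra_lift_pm_extend by (rule pm_extend_add) (simp_all add: fC_simps distrib_right)
  then have "group_algebra_lift (g + h) * f x - f (ev \<theta> (g + h) * x) =
    (group_algebra_lift g * f x - f (ev \<theta> g * x)) + (group_algebra_lift h * f x - f (ev \<theta> h * x))"
    by (simp add: ev_simps rwt_simps[OF f] distrib_right)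
  then show ?case using add lin_spaceD(2)[OF U] by simp
qed

text \<open>The operator \<open>T\<^sub>i - g\<close> is an intertwiner because the correction term of the cross relation, multiplied out by
  means of \<open>g (1 - \<theta>(-\<alpha>)) = q - q\<^sup>-\<^sup>1\<close>, is what is needed to replace \<open>\<theta>\<close> by its reflection. Stating the condition
  on \<open>g\<close> as an equation rather than a quotient admits dual numbers as coefficients.\<close>

lemma intertwiner:
  assumes I: "left_ideal q I" and \<theta>: "lattice_char \<theta>" and f: "rwt I \<theta> f"
    and g: "g * (1 - \<theta> (- simple_root i)) = h (q - inverse q)"
  shows "rwt I (\<theta> \<circ> simple_reflection i) (\<lambda>x. fT i * f x - f (g * x))"
  unfolding rwt_def
proof (intro conjI allI)
  let ?s = "simple_reflection i" let ?p = "q - inverse q"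
  note L = left_idealD(3)[OF I]
  show "fT i * f (x + y) - f (g * (x + y)) = fT i * f x - f (g * x) + (fT i * f y - f (g * y))" for x y
    by (simp add: rwt_simps[OF f] algebra_simps)
  show "fT i * f (h c * x) - f (g * (h c * x)) = fC c * (fT i * f x - f (g * x))" for c x
    using rwt_simps(5)[OF f, of c "g * x"]
    by (simp add: rwt_simps(5)[OF f] fC_move right_diff_distrib mult.left_commute)
  fix \<nu> x
  let ?D = "ev \<theta> (divided_difference i \<nu>)"
  have e: "h ?p * (?D * x) = g * (\<theta> \<nu> * x) - g * (\<theta> (?s \<nu>) * x)"
  proof -
    have "h ?p * (?D * x) = g * (?D * (1 - \<theta> (- simple_root i))) * x"
      unfolding g[symmetric] by (simp only: mult_ac)
    also have "\<dots> = g * (\<theta> \<nu> - \<theta> (?s \<nu>)) * x" by (simp only: ev_divided_difference[OF \<theta>])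
    finally show ?thesis by (simp add: algebra_simps)
  qed
  define A where "A = fX \<nu> * (fT i * f x) - (fT i * (fX (?s \<nu>) * f x) + fC ?p * (group_algebra_lift (divided_difference i \<nu>) * f x))"
  define B where "B = fX (?s \<nu>) * f x - f (\<theta> (?s \<nu>) * x)"
  define C where "C = group_algebra_lift (divided_difference i \<nu>) * f x - f (?D * x)"
  define D where "D = fX \<nu> * f (g * x) - f (\<theta> \<nu> * (g * x))"
  have ABCD: "A \<in> I" "B \<in> I" "C \<in> I" "D \<in> I"
    unfolding A_def B_def C_def D_def
    using left_idealD(1)[OF I hecke_ideal_relations(5)] rwt_simps(6)[OF f] rwt_lift[OF L f] by auto
  have "fC ?p * f (?D * x) = f (g * (\<theta> \<nu> * x)) - f (g * (\<theta> (?s \<nu>) * x))"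
    unfolding rwt_simps(5)[OF f, symmetric] e by (rule rwt_simps[OF f])
  then have "fX \<nu> * (fT i * f x - f (g * x)) - (fT i * f ((\<theta> \<circ> ?s) \<nu> * x) - f (g * ((\<theta> \<circ> ?s) \<nu> * x)))
    = A + fT i * B + fC ?p * C - D"
    unfolding A_def B_def C_def D_def by (simp add: right_diff_distrib distrib_left mult.left_commute[of "\<theta> \<nu>"])
  then show "fX \<nu> * (fT i * f x - f (g * x)) - (fT i * f ((\<theta> \<circ> ?s) \<nu> * x) - f (g * ((\<theta> \<circ> ?s) \<nu> * x))) \<in> I"
    using ABCD L left_idealD(2)[OF I] by (simp add: lin_spaceD)
qed

end

lemma wt_rwt:
  assumes "wt U s z" "lin_space U"
  shows "complex_scalars.rwt U s (\<lambda>x. fC x * z)"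
  unfolding complex_scalars.rwt_def
proof (intro conjI allI)
  fix \<nu> x
  have "fX \<nu> * (fC x * z) - fC (s \<nu> * x) * z = fC x * (fX \<nu> * z - fC (s \<nu>) * z)"
    by (simp add: fC_simps fC_move fC_swap right_diff_distrib mult.assoc)
  then show "fX \<nu> * (fC x * z) - fC (s \<nu> * x) * z \<in> U" using assms by (simp add: wt_def lin_spaceD)
qed (simp_all add: fC_simps distrib_right mult.assoc)

lemma wt_intertwiner:
  assumes I: "left_ideal q I" and s: "lattice_char s" and z: "wt I s z"
    and g: "g * (1 - s (- simple_root i)) = q - inverse q"
  shows "wt I (s \<circ> simple_reflection i) (fT i * z - fC g * z)"
proof -
  have r: "complex_scalars.rwt I (s \<circ> simple_reflection i) (\<lambda>x. fT i * (fC x * z) - fC (g * x) * z)"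
    using complex_scalars.intertwiner[OF I s wt_rwt[OF z left_idealD(3)[OF I]] g] by simp
  show ?thesis
    unfolding wt_def
  proof
    fix \<nu>
    have "fT i * (fC ((s \<circ> simple_reflection i) \<nu> * 1) * z) - fC (g * ((s \<circ> simple_reflection i) \<nu> * 1)) * z =
      fC ((s \<circ> simple_reflection i) \<nu>) * (fT i * z - fC g * z)"
      by (simp add: fC_move fC_merge right_diff_distrib mult.commute)
    then show "fX \<nu> * (fT i * z - fC g * z) - fC ((s \<circ> simple_reflection i) \<nu>) * (fT i * z - fC g * z) \<in> I"
      using complex_scalars.rwt_simps(6)[OF r, of \<nu> 1] by (simp add: fC_simps)
  qed
qed

text \<open>The quadratic relation, rewritten for the intertwiner with coefficient \<open>g\<close> followed by the opposite one, whose
  coefficient is \<open>q - q\<^sup>-\<^sup>1 - g\<close>. A submodule containing a vector on one side of an edge contains the one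
  on the other side unless the scalar \<open>1 + (q - q\<^sup>-\<^sup>1) g - g\<^sup>2\<close> vanishes.\<close>

lemma intertwiner_square:
  "fT i * (fT i * z - fC g * z) -
     (fC (q - inverse q - g) * (fT i * z - fC g * z) + fC (1 + (q - inverse q) * g - g * g) * z) \<in> hecke_ideal q"
proof -
  let ?p = "q - inverse q"
  have "fT i * (fT i * z - fC g * z) - (fC (?p - g) * (fT i * z - fC g * z) + fC (1 + ?p * g - g * g) * z) =
    fT i * (fT i * z) - (fC ?p * (fT i * z) + z)"
    by (simp add: fC_simps fC_move fC_swap algebra_simps)
  then show ?thesis using hecke_ideal_relations(3)[of i z q] by simp
qed

section \<open>Spans\<close>

fun cspan :: "free_algebra set \<Rightarrow> free_algebra list \<Rightarrow> free_algebra set" where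
  "cspan U [] = U"
| "cspan U (z # zs) = {x + fC c * z | x c. x \<in> cspan U zs}"

lemma cspan_ConsI: "x - fC c * z \<in> cspan U zs \<Longrightarrow> x \<in> cspan U (z # zs)"
  by (auto intro!: exI[of _ "x - fC c * z"] exI[of _ c])

lemma cspan_ConsE:
  assumes "x \<in> cspan U (z # zs)"
  obtains c where "x - fC c * z \<in> cspan U zs"
proof -
  from assms obtain y c where "y \<in> cspan U zs" "x = y + fC c * z" by auto
  then show ?thesis by (intro that[of c]) simp
qed

declare cspan.simps(2) [simp del]

lemma cspan_lin_space: "lin_space U \<Longrightarrow> lin_space (cspan U zs)"
proof (induction zs)
  case (Cons z zs)
  then have L: "lin_space (cspan U zs)" by simp
  show ?case unfolding lin_space_def
  proof (intro conjI ballI allI)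
    show "0 \<in> cspan U (z # zs)" by (rule cspan_ConsI[of _ 0]) (simp add: fC_simps lin_spaceD(1)[OF L])
    fix x c assume "x \<in> cspan U (z # zs)"
    then obtain a where a: "x - fC a * z \<in> cspan U zs" by (rule cspan_ConsE)
    have "fC c * x - fC (c * a) * z = fC c * (x - fC a * z)"
      by (simp add: fC_simps right_diff_distrib mult.assoc)
    then show "fC c * x \<in> cspan U (z # zs)" by (intro cspan_ConsI[of _ "c * a"]) (simp add: lin_spaceD(3)[OF L a])
    fix y assume "y \<in> cspan U (z # zs)"
    then obtain b where b: "y - fC b * z \<in> cspan U zs" by (rule cspan_ConsE)
    have "x + y - fC (a + b) * z = (x - fC a * z) + (y - fC b * z)"
      by (simp add: fC_simps algebra_simps)
    then show "x + y \<in> cspan U (z # zs)" by (intro cspan_ConsI[of _ "a + b"]) (simp only: lin_spaceD(2)[OF L a b])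
  qed
qed simp

lemma cspan_base: "lin_space U \<Longrightarrow> U \<subseteq> cspan U zs"
proof (induction zs)
  case (Cons z zs)
  then show ?case by (auto intro!: cspan_ConsI[of _ 0] simp: fC_simps)
qed simp

lemma cspan_mem: "lin_space U \<Longrightarrow> z \<in> set zs \<Longrightarrow> z \<in> cspan U zs"
proof (induction zs)
  case (Cons y zs)
  note L = cspan_lin_space[OF Cons.prems(1), of zs]
  show ?case
  proof (cases "z = y")
    case True
    then show ?thesis by (intro cspan_ConsI[of _ 1]) (simp add: fC_simps lin_spaceD(1)[OF L])
  next
    case False
    then show ?thesis using Cons by (intro cspan_ConsI[of _ 0]) (simp add: fC_simps)
  qed
qed simp

lemma cspan_image_subset:
  assumes "lin_space W" "\<And>x. x \<in> U \<Longrightarrow> a * x \<in> W" "\<And>z. z \<in> set zs \<Longrightarrow> a * z \<in> W"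
  shows "x \<in> cspan U zs \<Longrightarrow> a * x \<in> W"
  using assms(3)
proof (induction zs arbitrary: x)
  case (Cons z zs)
  from Cons.prems(1) obtain c where "x - fC c * z \<in> cspan U zs" by (rule cspan_ConsE)
  then have "a * (x - fC c * z) \<in> W" using Cons by simp
  moreover have "fC c * (a * z) \<in> W" using Cons.prems(2)[of z] lin_spaceD(3)[OF assms(1)] by simp
  moreover have "a * x = a * (x - fC c * z) + fC c * (a * z)"
    by (simp add: right_diff_distrib fC_central[of a c] flip: mult.assoc)
  ultimately show ?case using lin_spaceD(2)[OF assms(1)] by simp
qed (use assms(2) in simp)

lemma cspan_subset: "lin_space W \<Longrightarrow> U \<subseteq> W \<Longrightarrow> set zs \<subseteq> W \<Longrightarrow> cspan U zs \<subseteq> W"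
  using cspan_image_subset[of W U 1 zs] by (simp add: subset_iff)

text \<open>In general there is no basis of weight vectors, but the lattice can be made to act triangularly.\<close>

fun flag :: "free_algebra set \<Rightarrow> (free_algebra \<times> (lattice \<Rightarrow> complex)) list \<Rightarrow> bool" where
  "flag U [] = True"
| "flag U ((z, s) # zs) = (wt (cspan U (map fst zs)) s z \<and> flag U zs)"

lemma flag_x_space: "x_space q U \<Longrightarrow> flag U zs \<Longrightarrow> x_space q (cspan U (map fst zs))"
proof (induction zs)
  case (Cons a zs)
  obtain z s where a: "a = (z, s)" by (cases a)
  from Cons have X: "x_space q (cspan U (map fst zs))" and w: "wt (cspan U (map fst zs)) s z"
    by (auto simp: a)
  note L = x_spaceD(2)[OF X]
  show ?case unfolding x_space_def
  proof (intro conjI allI ballI)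
    show L': "lin_space (cspan U (map fst (a # zs)))"
      by (rule cspan_lin_space[OF x_spaceD(2)[OF Cons.prems(1)]])
    show "hecke_ideal q \<subseteq> cspan U (map fst (a # zs))"
      using Cons.prems(1) cspan_base[OF x_spaceD(2)[OF Cons.prems(1)]] unfolding x_space_def by blast
    fix \<nu> x assume "x \<in> cspan U (map fst (a # zs))"
    then have "x \<in> cspan U (z # map fst zs)" by (simp add: a)
    then obtain c where c: "x - fC c * z \<in> cspan U (map fst zs)" by (rule cspan_ConsE)
    have "fX \<nu> * x - fC (c * s \<nu>) * z = fX \<nu> * (x - fC c * z) + fC c * (fX \<nu> * z - fC (s \<nu>) * z)"
      by (simp add: right_diff_distrib fC_move fC_merge)
    also have "\<dots> \<in> cspan U (map fst zs)"
      using w c by (intro lin_spaceD(2,3)[OF L] x_spaceD(3)[OF X]) (simp_all add: wt_def)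
    finally show "fX \<nu> * x \<in> cspan U (map fst (a # zs))" by (simp only: a list.map fst_conv cspan_ConsI)
  qed
qed simp

text \<open>Weight vectors of different weights are independent: a weight vector in the span of a space and
  a vector of another weight lies in the space.\<close>

lemma drop_other_weight:
  assumes U: "x_space q U" and b: "wt U s b" and z: "wt U s' z" and "s \<noteq> s'" and zb: "z - fC c * b \<in> U"
  shows "z \<in> U"
proof -
  obtain \<nu> where \<nu>: "s \<nu> \<noteq> s' \<nu>" using \<open>s \<noteq> s'\<close> by blast
  note L = x_spaceD(2)[OF U]
  have 1: "fX \<nu> * z - fC (s' \<nu>) * z \<in> U" "fC c * (fX \<nu> * b - fC (s \<nu>) * b) \<in> U"
    using z b by (simp_all add: wt_def lin_spaceD(3)[OF L])
  have 2: "fX \<nu> * (z - fC c * b) - fC (s \<nu>) * (z - fC c * b) \<in> U"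
    by (intro lin_spaceD(5,3)[OF L] x_spaceD(3)[OF U] zb)
  have "fC (s' \<nu> - s \<nu>) * z = (fX \<nu> * (z - fC c * b) - fC (s \<nu>) * (z - fC c * b))
      + fC c * (fX \<nu> * b - fC (s \<nu>) * b) - (fX \<nu> * z - fC (s' \<nu>) * z)"
    by (simp add: fC_simps(6) fC_move left_diff_distrib right_diff_distrib fC_swap[of c "s \<nu>"])
  also have "\<dots> \<in> U" by (intro lin_spaceD(2,5)[OF L] 1 2)
  finally show ?thesis using lin_space_scale_iff[OF L] \<nu> by (metis right_minus_eq)
qed

text \<open>By the independence of different weights, the vectors at the head of a flag cannot contribute to a vector
  whose weight differs from theirs.\<close>

lemma flag_drop:
  assumes U: "x_space q U" and f: "flag U (ys @ zs)" and z: "wt U s z" and "z \<in> cspan U (map fst (ys @ zs))"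
    and "s \<notin> snd ` set ys"
  shows "z \<in> cspan U (map fst zs)"
  using f assms(4,5)
proof (induction ys)
  case (Cons a ys)
  obtain b r where a: "a = (b, r)" by (cases a)
  let ?W = "cspan U (map fst (ys @ zs))"
  have "flag U ((b, r) # (ys @ zs))" using Cons.prems(1) unfolding a append_Cons .
  then have fl: "wt ?W r b" "flag U (ys @ zs)" unfolding flag.simps by (rule conjunct1, rule conjunct2)
  have X: "x_space q ?W" by (rule flag_x_space[OF U fl(2)])
  have "z \<in> cspan U (b # map fst (ys @ zs))" using Cons.prems(2) unfolding a append_Cons list.map fst_conv .
  then obtain c where c: "z - fC c * b \<in> ?W" by (rule cspan_ConsE)
  have r: "r \<noteq> s" and s: "s \<notin> snd ` set ys" using Cons.prems(3) unfolding a by auto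
  have "wt ?W s z" by (rule wt_mono[OF z cspan_base[OF x_spaceD(2)[OF U]]])
  then have "z \<in> ?W" by (rule drop_other_weight[OF X fl(1) _ r c])
  then show ?case by (rule Cons.IH[OF fl(2) _ s])
qed simp

lemma flag_of_weight_vectors:
  assumes U: "lin_space U" and "\<And>b r. (b, r) \<in> set zs \<Longrightarrow> wt U r b"
  shows "flag U zs"
  using assms(2)
proof (induction zs)
  case (Cons a zs)
  obtain b r where a: "a = (b, r)" by (cases a)
  show ?case unfolding a flag.simps using Cons by (auto simp: a intro: wt_mono[OF _ cspan_base[OF U]])
qed simp

lemma weight_vector_span:
  assumes U: "x_space q U" and b: "\<And>b r. (b, r) \<in> set zs \<Longrightarrow> wt U r b" and z: "wt U s z"
    and "z \<in> cspan U (map fst zs)"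
  shows "z \<in> cspan U (map fst (filter (\<lambda>(b, r). r = s) zs))"
  using b z assms(4)
proof (induction zs arbitrary: z)
  case (Cons a zs)
  note LU = x_spaceD(2)[OF U]
  obtain b r where a: "a = (b, r)" by (cases a)
  note fl = flag_of_weight_vectors[OF LU]
  have zs: "\<And>b r. (b, r) \<in> set zs \<Longrightarrow> wt U r b" using Cons.prems(1) by simp
  have b: "wt U r b" using Cons.prems(1) by (simp add: a)
  show ?case
  proof (cases "r = s")
    case True
    from Cons.prems(3) have "z \<in> cspan U (b # map fst zs)" by (simp add: a)
    then obtain c where c: "z - fC c * b \<in> cspan U (map fst zs)" by (rule cspan_ConsE)
    have "wt U s (z - fC c * b)"
      using wt_add[OF LU Cons.prems(2) wt_scale[OF LU b[unfolded True], of "- c"]] by (simp add: fC_simps)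
    from Cons.IH[OF zs this c] have "z - fC c * b \<in> cspan U (map fst (filter (\<lambda>(b, r). r = s) zs))" .
    from cspan_ConsI[OF this] show ?thesis using True by (simp add: a)
  next
    case False
    have "flag U ([a] @ zs)" by (rule fl) (use Cons.prems(1) in simp)
    then have "z \<in> cspan U (map fst zs)"
      by (rule flag_drop[OF U _ Cons.prems(2)]) (use Cons.prems(3) False in \<open>simp_all add: a\<close>)
    from Cons.IH[OF zs Cons.prems(2) this] show ?thesis using False by (simp add: a)
  qed
qed simp

section \<open>Weight vectors whose weight is in the orbit\<close>

text \<open>The relations that single out the vectors used to recognise irreducible modules: in type A those of the generator
  of \<open>M\<close>, in type B those of a vector spanning a one-dimensional module, in type C those of a vector \<open>z\<close>
  that together with its image \<open>z'\<close> under an intertwiner spans a module.\<close>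

definition type_A :: "complex \<Rightarrow> free_algebra set \<Rightarrow> free_algebra \<Rightarrow> bool" where
  "type_A q J z \<longleftrightarrow> wt J (t_of (q ^ 2) 1) z \<and> fT I1 * z - fC q * z \<in> J"

definition type_B :: "complex \<Rightarrow> free_algebra set \<Rightarrow> free_algebra \<Rightarrow> bool" where
  "type_B q J z \<longleftrightarrow> wt J (t_of (q ^ 2) (inverse (q ^ 6))) z \<and> (\<forall>i. fT i * z - fC q * z \<in> J)"

definition type_C :: "complex \<Rightarrow> free_algebra set \<Rightarrow> free_algebra \<Rightarrow> bool" where
  "type_C q J z \<longleftrightarrow> wt J (t_of (q ^ 4) (inverse (q ^ 6))) z \<and> fT I2 * z - fC q * z \<in> J \<and>
     (let z' = fT I1 * z - fC (q ^ 3 / (q ^ 2 + 1)) * z in fT I2 * z' - fC (- inverse q) * z' \<in> J)"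

lemma hecke_ideal_swap: "hecke_ideal (- inverse q) = hecke_ideal q"
  by (simp add: hecke_ideal_def hecke_relations_def)

lemma left_ideal_swap: "left_ideal (- inverse q) = left_ideal q"
  by (simp add: fun_eq_iff left_ideal_def hecke_ideal_swap)

context hecke_param begin

definition r0 :: "lattice \<Rightarrow> complex" where "r0 = t_of (q ^ 2) 1"
definition r1 :: "lattice \<Rightarrow> complex" where "r1 = t_of (inverse (q ^ 2)) (q ^ 6)"
definition r2 :: "lattice \<Rightarrow> complex" where "r2 = t_of (q ^ 4) (inverse (q ^ 6))"
definition r3 :: "lattice \<Rightarrow> complex" where "r3 = t_of (inverse (q ^ 4)) (q ^ 6)"
definition r4 :: "lattice \<Rightarrow> complex" where "r4 = t_of (q ^ 2) (inverse (q ^ 6))"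
definition r5 :: "lattice \<Rightarrow> complex" where "r5 = t_of (inverse (q ^ 2)) 1"

lemmas r_defs = r0_def r1_def r2_def r3_def r4_def r5_def

lemma swap: "hecke_param (- inverse q)"
proof -
  have "inverse q ^ 2 - 1 = - (q ^ 2 - 1) / q ^ 2" "inverse q ^ 2 + 1 = (q ^ 2 + 1) / q ^ 2"
    "inverse q ^ 4 + inverse q ^ 2 + 1 = (q ^ 4 + q ^ 2 + 1) / q ^ 4"
    using q0 by (simp_all add: field_simps flip: power_add)
  then show ?thesis using q0 D1 D2 D3 by unfold_locales auto
qed

lemma r_swap:
  "hecke_param.r0 (- inverse q) = r5" "hecke_param.r1 (- inverse q) = r4" "hecke_param.r2 (- inverse q) = r3"
  "hecke_param.r3 (- inverse q) = r2" "hecke_param.r4 (- inverse q) = r1" "hecke_param.r5 (- inverse q) = r0"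
  by (simp_all add: r_defs hecke_param.r0_def[OF swap] hecke_param.r1_def[OF swap] hecke_param.r2_def[OF swap]
    hecke_param.r3_def[OF swap] hecke_param.r4_def[OF swap] hecke_param.r5_def[OF swap] power_inverse)

lemma r_char: "lattice_char r0" "lattice_char r1" "lattice_char r2" "lattice_char r3" "lattice_char r4" "lattice_char r5"
  using q0 by (simp_all add: r_defs t_of_simps)

lemma r_reflection:
  "r0 \<circ> simple_reflection I1 = r1" "r1 \<circ> simple_reflection I2 = r2" "r2 \<circ> simple_reflection I1 = r3"
  "r3 \<circ> simple_reflection I2 = r4" "r4 \<circ> simple_reflection I1 = r5"
  "r1 \<circ> simple_reflection I1 = r0" "r2 \<circ> simple_reflection I2 = r1" "r3 \<circ> simple_reflection I1 = r2"
  "r4 \<circ> simple_reflection I2 = r3" "r5 \<circ> simple_reflection I1 = r4"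
  "r0 \<circ> simple_reflection I2 = r0" "r5 \<circ> simple_reflection I2 = r5"
proof -
  have e: "q ^ 12 * inverse (q ^ 6) = q ^ 6" "(q ^ 2) ^ 3 * inverse (q ^ 6) = 1"
    "inverse (q ^ 2) * q ^ 6 = q ^ 4" "inverse (q ^ 4) * q ^ 6 = q ^ 2" "inverse (q ^ 2) ^ 3 * q ^ 6 = 1"
    "inverse (q ^ 4) ^ 3 * q ^ 6 = inverse (q ^ 6)" "inverse (q ^ 2) ^ 3 = inverse (q ^ 6)"
    "q ^ 4 * inverse (q ^ 6) = inverse (q ^ 2)" "q ^ 2 * inverse (q ^ 6) = inverse (q ^ 4)"
    using q0 by (simp_all add: field_simps flip: power_mult power_add)
  show "r0 \<circ> simple_reflection I1 = r1" "r1 \<circ> simple_reflection I2 = r2" "r2 \<circ> simple_reflection I1 = r3"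
  "r3 \<circ> simple_reflection I2 = r4" "r4 \<circ> simple_reflection I1 = r5"
  "r1 \<circ> simple_reflection I1 = r0" "r2 \<circ> simple_reflection I2 = r1" "r3 \<circ> simple_reflection I1 = r2"
  "r4 \<circ> simple_reflection I2 = r3" "r5 \<circ> simple_reflection I1 = r4"
  "r0 \<circ> simple_reflection I2 = r0" "r5 \<circ> simple_reflection I2 = r5"
    using q0 by (simp_all add: r_defs t_of_reflection e power_mult[symmetric])
qed

lemma q4: "q ^ 4 \<noteq> 1"
proof -
  have "q ^ 4 - 1 = (q ^ 2 - 1) * (q ^ 2 + 1)" by (simp add: eval_nat_numeral algebra_simps)
  then show ?thesis using D1 D2 by (metis diff_self mult_eq_0_iff)
qed

lemma r_distinct:
  "r0 \<noteq> r1" "r0 \<noteq> r2" "r0 \<noteq> r3" "r0 \<noteq> r4" "r0 \<noteq> r5" "r1 \<noteq> r2" "r1 \<noteq> r3" "r1 \<noteq> r4" "r1 \<noteq> r5"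
  "r2 \<noteq> r3" "r2 \<noteq> r4" "r2 \<noteq> r5" "r3 \<noteq> r4" "r3 \<noteq> r5" "r4 \<noteq> r5"
proof -
  have sq: "q ^ 2 \<noteq> 1" using D1 by auto
  have 6: "inverse (q ^ 6) \<noteq> 1" "q ^ 6 \<noteq> 1" using q6 by (simp_all add: inverse_eq_1_iff)
  have 4: "q ^ 2 \<noteq> inverse (q ^ 2)" using q4 q0 by (simp add: field_simps flip: power_add)
  have 2: "q ^ 4 \<noteq> q ^ 2" using q0 sq by (simp add: power4_eq_xxxx power2_eq_square)
  have 62: "q ^ 2 \<noteq> inverse (q ^ 4)" "inverse (q ^ 2) \<noteq> q ^ 4" using q6 q0 by (simp_all add: field_simps flip: power_add)
  have 23: "\<not> (q ^ 4 = inverse (q ^ 4) \<and> inverse (q ^ 6) = q ^ 6)"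
  proof
    assume "q ^ 4 = inverse (q ^ 4) \<and> inverse (q ^ 6) = q ^ 6"
    then have "q ^ 4 * q ^ 4 = 1" "q ^ 6 * q ^ 6 = 1" using q0 by (auto simp: field_simps)
    moreover have "q ^ 6 * q ^ 6 = (q ^ 4 * q ^ 4) * q ^ 4" by (simp flip: power_add)
    ultimately show False using q4 by simp
  qed
  show "r0 \<noteq> r1" "r0 \<noteq> r2" "r0 \<noteq> r3" "r0 \<noteq> r4" "r0 \<noteq> r5" "r1 \<noteq> r2" "r1 \<noteq> r3" "r1 \<noteq> r4" "r1 \<noteq> r5"
  "r2 \<noteq> r3" "r2 \<noteq> r4" "r2 \<noteq> r5" "r3 \<noteq> r4" "r3 \<noteq> r5" "r4 \<noteq> r5"
    using 6 4 2 62 23 q0 unfolding r_defs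
    by (simp_all add: t_of_eq_iff)
qed

text \<open>The scalars by which opposite intertwiners compose on the edges with coefficients \<open>G\<close> and \<open>E\<close>.
  On the outer edges, where the coefficient is \<open>q\<close>, this scalar is zero.\<close>

definition cG :: complex where "cG = 1 + p * G - G * G"
definition cE :: complex where "cE = 1 + p * E - E * E"

lemma cG_zero_iff: "cG = 0 \<longleftrightarrow> q ^ 4 = - 1"
proof -
  have "cG = (q ^ 4 + 1) * (q ^ 2 + 1) ^ 2 / (q ^ 4 + q ^ 2 + 1) ^ 2"
    using q0 D3 unfolding cG_def p_eq G_def
    by (simp add: divide_simps) (simp add: eval_nat_numeral algebra_simps)
  then have "cG = 0 \<longleftrightarrow> q ^ 4 + 1 = 0" using D2 D3 by simp
  then show ?thesis by (simp add: eq_neg_iff_add_eq_0)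
qed

lemma cE_nonzero: "cE \<noteq> 0"
proof -
  have "cE = (q ^ 4 + q ^ 2 + 1) / (q ^ 2 + 1) ^ 2"
    using q0 D2 unfolding cE_def p_eq E_def
    by (simp add: divide_simps) (simp add: eval_nat_numeral algebra_simps)
  then show ?thesis using D2 D3 by simp
qed

lemma G_special:
  assumes "q ^ 4 = - 1"
  shows "G = - inverse q" "p - G = q"
proof -
  have "q ^ 5 = - q" using assms by (simp add: eval_nat_numeral)
  then show G: "G = - inverse q" using assms q0 by (simp add: G_def power2_eq_square divide_simps)
  show "p - G = q" by (simp add: G p_def)
qed

lemma p_minus: "p - q = - inverse q" "p + inverse q = q"
  by (simp_all add: p_def)

text \<open>The chain is \<open>r0 - r1 - r2 - r3 - r4 - r5\<close>, with \<open>s\<^sub>1\<close> crossing the first, middle and last edge and \<open>s\<^sub>2\<close> the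
  two others.\<close>

lemma edge:
  assumes "left_ideal q J"
  shows "wt J r0 z \<Longrightarrow> wt J r1 (fT I1 * z - fC q * z)"
    and "wt J r1 z \<Longrightarrow> wt J r0 (fT I1 * z - fC (- inverse q) * z)"
    and "wt J r1 z \<Longrightarrow> wt J r2 (fT I2 * z - fC G * z)"
    and "wt J r2 z \<Longrightarrow> wt J r1 (fT I2 * z - fC (p - G) * z)"
    and "wt J r2 z \<Longrightarrow> wt J r3 (fT I1 * z - fC E * z)"
    and "wt J r3 z \<Longrightarrow> wt J r4 (fT I2 * z - fC G * z)"
    and "wt J r4 z \<Longrightarrow> wt J r5 (fT I1 * z - fC q * z)"
proof -
  have c: "q * (1 - r0 (- simple_root I1)) = q - inverse q" "- inverse q * (1 - r1 (- simple_root I1)) = q - inverse q"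
    "G * (1 - r1 (- simple_root I2)) = q - inverse q" "(p - G) * (1 - r2 (- simple_root I2)) = q - inverse q"
    "E * (1 - r2 (- simple_root I1)) = q - inverse q" "G * (1 - r3 (- simple_root I2)) = q - inverse q"
    "q * (1 - r4 (- simple_root I1)) = q - inverse q"
    using q0 D1 D2 D3 unfolding r_defs p_eq G_def E_def t_of_def
    by (simp_all add: power_int_minus divide_simps; (simp add: eval_nat_numeral algebra_simps)?)+
  note w = wt_intertwiner[OF assms]
  show "wt J r0 z \<Longrightarrow> wt J r1 (fT I1 * z - fC q * z)"
    "wt J r1 z \<Longrightarrow> wt J r0 (fT I1 * z - fC (- inverse q) * z)"
    "wt J r1 z \<Longrightarrow> wt J r2 (fT I2 * z - fC G * z)"
    "wt J r2 z \<Longrightarrow> wt J r1 (fT I2 * z - fC (p - G) * z)"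
    "wt J r2 z \<Longrightarrow> wt J r3 (fT I1 * z - fC E * z)"
    "wt J r3 z \<Longrightarrow> wt J r4 (fT I2 * z - fC G * z)"
    "wt J r4 z \<Longrightarrow> wt J r5 (fT I1 * z - fC q * z)"
    using w[OF r_char(1) _ c(1)] w[OF r_char(2) _ c(2)] w[OF r_char(2) _ c(3)] w[OF r_char(3) _ c(4)]
      w[OF r_char(3) _ c(5)] w[OF r_char(4) _ c(6)] w[OF r_char(5) _ c(7)] by (simp_all only: r_reflection)
qed

lemma edge_back:
  assumes "left_ideal q J" "z' = fT i * z - fC g * z"
  shows "fT i * z' - (fC (p - g) * z' + fC (1 + p * g - g * g) * z) \<in> J"
  using left_idealD(1)[OF assms(1) intertwiner_square[of i z g q]] unfolding assms(2) p_def .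

text \<open>A chain of weight vectors cannot close up at both ends, with eigenvalue \<open>-q\<^sup>-\<^sup>1\<close> of \<open>T\<^sub>1\<close> at \<open>z1\<close> and \<open>q\<close> at \<open>z4\<close>.
  By the braid relation \<open>x = T\<^sub>2T\<^sub>1T\<^sub>2T\<^sub>1T\<^sub>2z1\<close> is again an eigenvector for \<open>-q\<^sup>-\<^sup>1\<close>. Its coefficient at \<open>z4\<close> is \<open>-1\<close>,
  so comparing coefficients expresses \<open>z4\<close> by \<open>z1, z2, z3\<close>, which have other weights.\<close>

lemma chain_does_not_close:
  assumes J: "left_ideal q J" and w: "wt J r1 z1" and T1: "fT I1 * z1 - fC (- inverse q) * z1 \<in> J"
    and z2: "z2 = fT I2 * z1 - fC G * z1" and z3: "z3 = fT I1 * z2 - fC E * z2" and z4: "z4 = fT I2 * z3 - fC G * z3"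
    and T4: "fT I1 * z4 - fC q * z4 \<in> J"
  shows "z4 \<in> J"
proof -
  note L = left_idealD(3)[OF J]
  define f where "f a b c d = fC a * z1 + fC b * z2 + fC c * z3 + fC d * z4" for a b c d
  have T2f: "fT I2 * f a b c d - f (G * a + cG * b) (a + (p - G) * b) (G * c + cG * d) (c + (p - G) * d) \<in> J" for a b c d
  proof -
    have "fT I2 * f a b c d - f (G * a + cG * b) (a + (p - G) * b) (G * c + cG * d) (c + (p - G) * d) =
      fC b * (fT I2 * z2 - (fC (p - G) * z2 + fC (1 + p * G - G * G) * z1)) +
      fC d * (fT I2 * z4 - (fC (p - G) * z4 + fC (1 + p * G - G * G) * z3)) +
      fC a * (fT I2 * z1 - fC G * z1 - z2) + fC c * (fT I2 * z3 - fC G * z3 - z4)"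
      unfolding f_def cG_def[symmetric]
      by (simp add: fC_simps fC_move distrib_left distrib_right left_diff_distrib right_diff_distrib mult.assoc fC_swap)
    then show ?thesis
      using edge_back[OF J z2] edge_back[OF J z4] z2 z4 by (simp add: lin_spaceD[OF L])
  qed
  have T1f: "fT I1 * f a b c d - f (- inverse q * a) (E * b + cE * c) (b + (p - E) * c) (q * d) \<in> J" for a b c d
  proof -
    have "fT I1 * f a b c d - f (- inverse q * a) (E * b + cE * c) (b + (p - E) * c) (q * d) =
      fC c * (fT I1 * z3 - (fC (p - E) * z3 + fC (1 + p * E - E * E) * z2)) +
      fC a * (fT I1 * z1 - fC (- inverse q) * z1) + fC d * (fT I1 * z4 - fC q * z4) + fC b * (fT I1 * z2 - fC E * z2 - z3)"
      unfolding f_def cE_def[symmetric]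
      by (simp add: fC_simps fC_move distrib_left distrib_right left_diff_distrib right_diff_distrib mult.assoc fC_swap)
    then show ?thesis
      using edge_back[OF J z3] z3 T1 T4 by (simp add: lin_spaceD[OF L])
  qed
  have step2: "fT I2 * x - f (G * a + cG * b) (a + (p - G) * b) (G * c + cG * d) (c + (p - G) * d) \<in> J"
    if "x - f a b c d \<in> J" for x a b c d
    using lin_spaceD(2)[OF L left_idealD(2)[OF J that, of "fT I2"] T2f[of a b c d]] by (simp add: right_diff_distrib)
  have step1: "fT I1 * x - f (- inverse q * a) (E * b + cE * c) (b + (p - E) * c) (q * d) \<in> J"
    if "x - f a b c d \<in> J" for x a b c d
    using lin_spaceD(2)[OF L left_idealD(2)[OF J that, of "fT I1"] T1f[of a b c d]] by (simp add: right_diff_distrib)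
  define x where "x = fT I2 * (fT I1 * (fT I2 * (fT I1 * (fT I2 * z1))))"
  have "z1 - f 1 0 0 0 \<in> J" by (simp add: f_def fC_simps lin_spaceD[OF L])
  note expansion = step2[OF step1[OF step2[OF step1[OF step2[OF this]]]], folded x_def]
  obtain a b c d where x: "x - f a b c d \<in> J"
    and d: "d = G * (- inverse q) + (p - G) * E + (p - E) * G + (p - G) * q"
    by (rule that[OF expansion]) (simp add: algebra_simps)
  have d1: "d = - 1"
    using q0 D1 D2 D3 unfolding d p_eq G_def E_def
    by (simp add: divide_simps) (simp add: eval_nat_numeral algebra_simps)
  have "fT I1 * x - fC (- inverse q) * x \<in> J"
  proof -
    have "fT I1 * x - fT I2 * (fT I1 * (fT I2 * (fT I1 * (fT I2 * (fT I1 * z1))))) \<in> J"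
      unfolding x_def by (rule left_idealD(1)[OF J hecke_ideal_relations(4)])
    moreover have "fT I2 * (fT I1 * (fT I2 * (fT I1 * (fT I2 * (fT I1 * z1 - fC (- inverse q) * z1))))) \<in> J"
      by (intro left_idealD(2)[OF J] T1)
    ultimately have "fT I1 * x - fT I2 * (fT I1 * (fT I2 * (fT I1 * (fT I2 * (fT I1 * z1))))) +
      fT I2 * (fT I1 * (fT I2 * (fT I1 * (fT I2 * (fT I1 * z1 - fC (- inverse q) * z1))))) \<in> J"
      by (rule lin_spaceD(2)[OF L])
    then show ?thesis by (simp add: x_def fC_move right_diff_distrib)
  qed
  then have "f (- inverse q * a) (E * b + cE * c) (b + (p - E) * c) (q * d) - fC (- inverse q) * f a b c d \<in> J"
  proof -
    assume 1: "fT I1 * x - fC (- inverse q) * x \<in> J"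
    have "fC (- inverse q) * (x - f a b c d) \<in> J" by (rule lin_spaceD(3)[OF L x])
    from lin_spaceD(2)[OF L lin_spaceD(5)[OF L 1 step1[OF x]] this] show ?thesis by (simp add: algebra_simps)
  qed
  moreover have "f (- inverse q * a) (E * b + cE * c) (b + (p - E) * c) (q * d) - fC (- inverse q) * f a b c d
    = fC ((q + inverse q) * d) * z4 - (fC (- (E * b + cE * c) - inverse q * b) * z2
      + fC (- (b + (p - E) * c) - inverse q * c) * z3 + fC 0 * z1)"
    unfolding f_def by (simp add: fC_simps fC_swap algebra_simps)
  ultimately obtain b' c' where "fC ((q + inverse q) * d) * z4 - (fC b' * z2 + fC c' * z3 + fC 0 * z1) \<in> J"
    by metis
  then have "fC ((q + inverse q) * d) * z4 - fC c' * z3 - fC b' * z2 - fC 0 * z1 \<in> cspan J []"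
    by (simp add: algebra_simps)
  then have "fC ((q + inverse q) * d) * z4 \<in> cspan J (map fst [(z3, r3), (z2, r2), (z1, r1)])"
    unfolding list.map fst_conv by (intro cspan_ConsI[OF cspan_ConsI[OF cspan_ConsI]])
  moreover have nz: "(q + inverse q) * d \<noteq> 0"
    using q0 D2 unfolding d1 by (auto simp: field_simps power2_eq_square add_eq_0_iff)
  ultimately have "z4 \<in> cspan J (map fst ([(z3, r3), (z2, r2), (z1, r1)] @ []))"
    using lin_space_scale_iff[OF cspan_lin_space[OF L] nz] by simp
  moreover have w2: "wt J r2 z2" unfolding z2 by (rule edge(3)[OF J w])
  moreover have w3: "wt J r3 z3" unfolding z3 by (rule edge(5)[OF J w2])
  moreover have w4: "wt J r4 z4" unfolding z4 by (rule edge(6)[OF J w3])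
  moreover have "flag J ([(z3, r3), (z2, r2), (z1, r1)] @ [])"
    by (rule flag_of_weight_vectors[OF L]) (use w w2 w3 in auto)
  ultimately show "z4 \<in> J"
    using flag_drop[OF left_idealD(4)[OF J], of "[(z3, r3), (z2, r2), (z1, r1)]" "[]" r4 z4] r_distinct by auto
qed

text \<open>A vector from which the irreducible module generated by it can be recognised.\<close>

definition extremal :: "free_algebra set \<Rightarrow> free_algebra \<Rightarrow> bool" where
  "extremal J z \<longleftrightarrow> z \<notin> J \<and> (type_A q J z \<or> type_A (- inverse q) J z \<or>
     q ^ 4 = - 1 \<and> (type_B q J z \<or> type_B (- inverse q) J z \<or> type_C q J z))"

lemma scale_diff: "lin_space U \<Longrightarrow> x - (fC a * y + fC c * z) \<in> U \<Longrightarrow> y \<in> U \<Longrightarrow> x \<in> U \<Longrightarrow> c \<noteq> 0 \<Longrightarrow> z \<in> U"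
proof -
  assume L: "lin_space U" and x: "x - (fC a * y + fC c * z) \<in> U" "y \<in> U" "x \<in> U" and c: "c \<noteq> 0"
  have "fC c * z = x - (x - (fC a * y + fC c * z)) - fC a * y" by simp
  also have "\<dots> \<in> U" by (intro lin_spaceD(5,3)[OF L] x)
  finally show "z \<in> U" using lin_space_scale_iff[OF L c] by simp
qed

text \<open>Follow the chain from \<open>z\<close> in both directions until an intertwiner vanishes. If a vector at one of the ends is
  reached, it has type A; they do not both vanish by \<open>chain_does_not_close\<close>. If the chain breaks
  earlier, the scalar of that edge is zero, and \<open>z\<close> has type B or its successor type C.\<close>

lemma extremal_from_r1:
  assumes J: "left_ideal q J" and z: "z \<notin> J" and w: "wt J r1 z"
  shows "\<exists>z'. extremal J z'"
proof -
  note L = left_idealD(3)[OF J]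
  define y where "y = fT I1 * z - fC (- inverse q) * z"
  define z2 where "z2 = fT I2 * z - fC G * z"
  define z3 where "z3 = fT I1 * z2 - fC E * z2"
  define z4 where "z4 = fT I2 * z3 - fC G * z3"
  define z5 where "z5 = fT I1 * z4 - fC q * z4"
  have wy: "wt J r0 y" unfolding y_def by (rule edge(2)[OF J w])
  have w2: "wt J r2 z2" unfolding z2_def by (rule edge(3)[OF J w])
  have w3: "wt J r3 z3" unfolding z3_def by (rule edge(5)[OF J w2])
  have w4: "wt J r4 z4" unfolding z4_def by (rule edge(6)[OF J w3])
  have w5: "wt J r5 z5" unfolding z5_def by (rule edge(7)[OF J w4])
  note b2 = edge_back[OF J z2_def, folded cG_def] and b3 = edge_back[OF J z3_def, folded cE_def]
    and b4 = edge_back[OF J z4_def, folded cG_def]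
  have c0: "1 + p * q - q * q = 0" "1 + p * (- inverse q) - (- inverse q) * (- inverse q) = 0"
    using q0 by (simp_all add: p_def field_simps)
  note by1 = edge_back[OF J y_def, unfolded c0 fC_simps(1) mult_zero_left add_0_right]
    and b5 = edge_back[OF J z5_def, unfolded c0 fC_simps(1) mult_zero_left add_0_right p_minus]
  have r: "type_A q J y \<longleftrightarrow> fT I1 * y - fC q * y \<in> J" if "wt J r0 y" for y
    using that by (simp add: type_A_def r0_def)
  have r': "type_A (- inverse q) J y \<longleftrightarrow> fT I1 * y - fC (- inverse q) * y \<in> J" if "wt J r5 y" for y
    using that by (simp add: type_A_def r5_def power_inverse)
  show ?thesis
  proof (cases "y \<in> J")
    case False
    then have "extremal J y" using by1 r[OF wy] unfolding extremal_def by (simp add: p_def)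
    then show ?thesis ..
  next
    case y: True
    show ?thesis
    proof (cases "z2 \<in> J")
      case True
      then have "cG = 0" using scale_diff[OF L b2] z left_idealD(2)[OF J] by blast
      then have s: "q ^ 4 = - 1" by (simp add: cG_zero_iff)
      have "type_B (- inverse q) J z"
        unfolding type_B_def
      proof (intro conjI allI)
        show "wt J (t_of ((- inverse q) ^ 2) (inverse ((- inverse q) ^ 6))) z"
          using w by (simp add: r1_def power_inverse)
        show "fT i * z - fC (- inverse q) * z \<in> J" for i
          using y True by (cases i) (simp_all add: y_def z2_def G_special[OF s])
      qed
      then have "extremal J z" using z s unfolding extremal_def by simp
      then show ?thesis ..
    next
      case z2: False
      have z3: "z3 \<notin> J"
        using scale_diff[OF L b3 _ left_idealD(2)[OF J] cE_nonzero] z2 by blast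
      show ?thesis
      proof (cases "z4 \<in> J")
        case True
        then have "cG = 0" using scale_diff[OF L b4] z3 left_idealD(2)[OF J] by blast
        then have s: "q ^ 4 = - 1" by (simp add: cG_zero_iff)
        have "type_C q J z2"
          using w2 b2 True unfolding type_C_def Let_def E_def[symmetric] z3_def[symmetric] \<open>cG = 0\<close>
          by (simp add: r2_def z4_def G_special[OF s] p_minus fC_simps(1))
        then have "extremal J z2" using z2 s unfolding extremal_def by simp
        then show ?thesis ..
      next
        case z4: False
        show ?thesis
        proof (cases "z5 \<in> J")
          case False
          then have "extremal J z5" using b5 r'[OF w5] unfolding extremal_def by simp
          then show ?thesis ..
        next
          case True
          then show ?thesis
            using chain_does_not_close[OF J w _ z2_def z3_def z4_def] y z4 by (simp add: y_def z5_def)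
        qed
      qed
    qed
  qed
qed

end

context hecke_param begin

text \<open>Only type C is not symmetric in the two parameters; a vector of type C for \<open>-q\<^sup>-\<^sup>1\<close> is exchanged with
  one of type C for \<open>q\<close> by the intertwiner on the middle edge.\<close>

lemma extremal_swap:
  assumes J: "left_ideal q J" and z: "hecke_param.extremal (- inverse q) J z"
  shows "\<exists>z'. extremal J z'"
proof -
  note L = left_idealD(3)[OF J]
  have inv: "- inverse (- inverse q) = q" by simp
  have "(- inverse q) ^ 4 = - 1 \<longleftrightarrow> q ^ 4 = - 1"
    using q0 by (auto simp: power_inverse inverse_eq_iff_eq[of "q ^ 4" "- 1", simplified] dest: arg_cong[of _ _ inverse])
  then have z: "z \<notin> J" and "type_A q J z \<or> type_A (- inverse q) J z \<or>
     q ^ 4 = - 1 \<and> (type_B q J z \<or> type_B (- inverse q) J z \<or> type_C (- inverse q) J z)"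
    using z unfolding hecke_param.extremal_def[OF swap] inv by auto
  then consider "extremal J z" | "q ^ 4 = - 1" "type_C (- inverse q) J z"
    unfolding extremal_def by auto
  then show ?thesis
  proof cases
    case 2
    have E': "(- inverse q) ^ 3 / ((- inverse q) ^ 2 + 1) = p - E"
      using q0 D2 unfolding p_eq E_def by (simp add: divide_simps) (simp add: eval_nat_numeral algebra_simps)
    define y where "y = fT I1 * z - fC (p - E) * z"
    have w: "wt J r3 z" and T2z: "fT I2 * z - fC (- inverse q) * z \<in> J"
      and T2y: "fT I2 * y - fC q * y \<in> J"
      using 2(2) unfolding type_C_def Let_def E' y_def[symmetric] r3_def by (simp_all add: power_inverse)
    have w2: "wt J r2 y"
      unfolding y_def r_reflection(8)[symmetric]
    proof (rule wt_intertwiner[OF J r_char(4) w])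
      show "(p - E) * (1 - r3 (- simple_root I1)) = q - inverse q"
        using q0 D1 D2 D3 unfolding r_defs p_eq E_def t_of_def
        by (simp add: power_int_minus divide_simps) (simp add: eval_nat_numeral algebra_simps)
    qed
    have "1 + p * (p - E) - (p - E) * (p - E) = cE" "p - (p - E) = E" by (simp_all add: cE_def algebra_simps)
    then have square: "fT I1 * y - (fC E * y + fC cE * z) \<in> J"
      using edge_back[OF J y_def] by simp
    have y: "y \<notin> J"
      using scale_diff[OF L square _ left_idealD(2)[OF J] cE_nonzero] z by blast
    let ?y = "fT I1 * y - fC E * y"
    have "fT I2 * ?y - fC (- inverse q) * ?y =
      fT I2 * (fT I1 * y - (fC E * y + fC cE * z)) - fC (- inverse q) * (fT I1 * y - (fC E * y + fC cE * z))
      + fC cE * (fT I2 * z - fC (- inverse q) * z)"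
      by (simp add: fC_move fC_swap algebra_simps)
    also have "\<dots> \<in> J" by (intro lin_spaceD(2,3,5)[OF L] left_idealD(2)[OF J] square T2z)
    finally have "type_C q J y"
      using w2 T2y unfolding type_C_def Let_def E_def[symmetric] r2_def by simp
    then have "extremal J y" using y 2(1) unfolding extremal_def by simp
    then show ?thesis ..
  qed auto
qed

lemma extremal_from_r0:
  assumes J: "left_ideal q J" and z: "z \<notin> J" and w: "wt J r0 z"
  shows "\<exists>z'. extremal J z'"
proof (cases "fT I1 * z - fC q * z \<in> J")
  case True
  then have "extremal J z" using z w unfolding extremal_def type_A_def by (simp add: r0_def)
  then show ?thesis ..
next
  case False
  then show ?thesis using extremal_from_r1[OF J _ edge(1)[OF J w]] by simp
qed

text \<open>By the symmetry between \<open>q\<close> and \<open>-q\<^sup>-\<^sup>1\<close>, which reverses the chain, it is enough to start at \<open>r0, r1\<close> or in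
  the middle. A vector in the middle is moved to \<open>r1\<close> or \<open>r4\<close>, and if it cannot be moved it has type C.\<close>

lemma extremal_exists:
  assumes J: "left_ideal q J" and z: "z \<notin> J" and w: "wt J r z" and r: "r \<in> {r0, r1, r2, r3, r4, r5}"
  shows "\<exists>z'. extremal J z'"
proof -
  note L = left_idealD(3)[OF J]
  have J': "left_ideal (- inverse q) J" using J by (simp add: left_ideal_swap)
  have from_r4: "\<exists>z'. extremal J z'" if "z \<notin> J" "wt J r4 z" for z
    using extremal_swap[OF J] hecke_param.extremal_from_r1[OF swap J', of z] that r_swap by metis
  have from_r2: "\<exists>z'. extremal J z'" if z: "z \<notin> J" "wt J r2 z" for z
  proof -
    define z1 where "z1 = fT I2 * z - fC (p - G) * z"
    define z3 where "z3 = fT I1 * z - fC E * z"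
    define z4 where "z4 = fT I2 * z3 - fC G * z3"
    have w1: "wt J r1 z1" unfolding z1_def by (rule edge(4)[OF J z(2)])
    have w3: "wt J r3 z3" unfolding z3_def by (rule edge(5)[OF J z(2)])
    have w4: "wt J r4 z4" unfolding z4_def by (rule edge(6)[OF J w3])
    show ?thesis
    proof (cases "z1 \<in> J \<and> z4 \<in> J")
      case False
      then show ?thesis using extremal_from_r1[OF J _ w1] from_r4[OF _ w4] by auto
    next
      case True
      have "1 + p * (p - G) - (p - G) * (p - G) = cG" "p - (p - G) = G" by (simp_all add: cG_def algebra_simps)
      then have "fT I2 * z1 - (fC G * z1 + fC cG * z) \<in> J" using edge_back[OF J z1_def] by simp
      then have "cG = 0" using scale_diff[OF L] True z(1) left_idealD(2)[OF J] by blast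
      then have s: "q ^ 4 = - 1" by (simp add: cG_zero_iff)
      have "type_C q J z"
        using True z unfolding type_C_def Let_def E_def[symmetric] z3_def[symmetric]
        by (simp add: r2_def z4_def z1_def G_special[OF s] p_minus)
      then have "extremal J z" using z s unfolding extremal_def by simp
      then show ?thesis ..
    qed
  qed
  from r consider "r = r0" | "r = r1" | "r = r2" | "r = r3" | "r = r4" | "r = r5" by auto
  then show ?thesis
  proof cases
    case 1 then show ?thesis using extremal_from_r0[OF J z] w by simp
  next
    case 2 then show ?thesis using extremal_from_r1[OF J z] w by simp
  next
    case 3 then show ?thesis using from_r2[OF z] w by simp
  next
    case 4
    define y where "y = fT I1 * z - fC (p - E) * z"
    have "wt J r2 y"
      unfolding y_def r_reflection(8)[symmetric]
    proof (rule wt_intertwiner[OF J r_char(4)])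
      show "wt J r3 z" using w 4 by simp
      show "(p - E) * (1 - r3 (- simple_root I1)) = q - inverse q"
        using q0 D1 D2 D3 unfolding r_defs p_eq E_def t_of_def
        by (simp add: power_int_minus divide_simps) (simp add: eval_nat_numeral algebra_simps)
    qed
    moreover have "y \<notin> J"
    proof -
      have "1 + p * (p - E) - (p - E) * (p - E) = cE" "p - (p - E) = E" by (simp_all add: cE_def algebra_simps)
      then have "fT I1 * y - (fC E * y + fC cE * z) \<in> J" using edge_back[OF J y_def] by simp
      then show ?thesis using scale_diff[OF L _ _ left_idealD(2)[OF J] cE_nonzero] z by blast
    qed
    ultimately show ?thesis using from_r2 by blast
  next
    case 5 then show ?thesis using from_r4[OF z] w by simp
  next
    case 6 then show ?thesis
      using hecke_param.extremal_from_r0[OF swap J' z] w extremal_swap[OF J] r_swap by metis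
  qed
qed

end

section \<open>The chain of weight vectors in the induced module\<close>

lemma free_algebra_closed:
  assumes "\<And>x y. x \<in> S \<Longrightarrow> y \<in> S \<Longrightarrow> x + y \<in> S" "0 \<in> S" "\<And>c x. x \<in> S \<Longrightarrow> fC c * x \<in> S"
    "\<And>i x. x \<in> S \<Longrightarrow> fT i * x \<in> S" "\<And>\<nu> x. x \<in> S \<Longrightarrow> fX \<nu> * x \<in> S" "x \<in> S"
  shows "a * x \<in> S"
proof -
  have word: "Poly_Mapping.single (Word gs) 1 * x \<in> S" for gs
  proof (induction gs)
    case Nil
    have "Poly_Mapping.single (Word []) 1 = (1::free_algebra)" by (simp flip: zero_gen_word_def)
    then show ?case using assms(6) by simp
  next
    case (Cons g gs)
    have "Poly_Mapping.single (Word (g # gs)) (1::complex) = Poly_Mapping.single (Word [g]) 1 * Poly_Mapping.single (Word gs) 1"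
      by (simp add: mult_single plus_gen_word_def)
    then show ?case using assms(4,5)[OF Cons] by (cases g) (simp_all add: fT_def fX_def mult.assoc)
  qed
  show ?thesis
  proof (induction a rule: poly_mapping_add_induct)
    case (single w c)
    have "Poly_Mapping.single w c = fC c * Poly_Mapping.single w 1" by (simp add: fC_def mult_single)
    then show ?case using assms(3)[OF word[of "letters w"], of c] by (simp add: mult.assoc)
  qed (simp_all add: assms distrib_right)
qed

context hecke_param begin

text \<open>The intertwiner for \<open>T\<^sub>1\<close> kills the generator of \<open>M\<close> but not the whole Jordan block of weight \<open>r0\<close>; \<open>b1\<close> is,
  up to a scalar, the image of the block, and the following vectors are obtained along the chain.\<close>

definition b1 :: free_algebra where "b1 = fT I1 * fT I2 - fC q * fT I2 - 1"
definition b2 :: free_algebra where "b2 = fT I2 * b1 - fC G * b1"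
definition b3 :: free_algebra where "b3 = fT I1 * b2 - fC E * b2"
definition b4 :: free_algebra where "b4 = fT I2 * b3 - fC G * b3"

end

locale induced_ideal = hecke_param +
  fixes J :: "free_algebra set"
  assumes J: "left_ideal q J" and A: "type_A q J 1"
begin

lemma L: "lin_space J" and XJ: "x_space q J"
  using left_idealD[OF J] by auto

lemma w0: "wt J r0 1"
  using A by (simp add: type_A_def r0_def)

lemma T1_one: "fT I1 - fC q \<in> J"
  using A by (simp add: type_A_def)

lemma ev_r0: "complex_scalars.ev r0 (divided_difference I2 \<nu>) = of_int (coroot_pairing \<nu> I2) * r0 \<nu>"
proof -
  have one: "r0 (0, - 1) = 1" by (simp add: r0_def t_of_def)
  have s: "r0 (simple_reflection I2 \<nu>) = r0 \<nu>" using r_reflection(11) by (metis comp_apply)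
  consider n where "coroot_pairing \<nu> I2 = int n" | n where "coroot_pairing \<nu> I2 = - int n"
    using int_cases2 by metis
  then show ?thesis
    using complex_scalars.ev_divided_difference_sum[OF r_char(1), of \<nu> I2] by cases (simp_all add: one s)
qed

text \<open>Parametrises the span of \<open>1\<close> and \<open>T\<^sub>2\<close> by dual numbers so that the lattice acts through \<open>x0\<close>
  (\<open>jordan_rwt\<close> below); the generator corresponds to the nilpotent element.\<close>

definition jordan :: "dual \<Rightarrow> free_algebra" where
  "jordan x = fC (eps x) + fC (std x / p) * fT I2"

lemma X_T2: "fX \<nu> * fT I2 - (fC (r0 \<nu>) * fT I2 + fC (p * (of_int (coroot_pairing \<nu> I2) * r0 \<nu>))) \<in> J"
proof -
  let ?s = "simple_reflection I2 \<nu>"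
  have "fX \<nu> * (fT I2 * 1) - (fT I2 * (fX ?s * 1) + fC (q - inverse q) * (group_algebra_lift (divided_difference I2 \<nu>) * 1)) \<in> J"
    by (rule left_idealD(1)[OF J hecke_ideal_relations(5)])
  moreover have "fT I2 * (fX ?s * 1 - fC (r0 ?s) * 1) \<in> J"
    using w0 by (intro left_idealD(2)[OF J]) (simp add: wt_def)
  moreover have "fC p * (group_algebra_lift (divided_difference I2 \<nu>) * (fC 1 * 1) - fC (complex_scalars.ev r0 (divided_difference I2 \<nu>) * 1) * 1) \<in> J"
    by (intro lin_spaceD(3)[OF L] complex_scalars.rwt_lift[OF L wt_rwt[OF w0 L]])
  moreover have "r0 ?s = r0 \<nu>" using r_reflection(11) by (metis comp_apply)
  ultimately have "fX \<nu> * (fT I2 * 1) - (fT I2 * (fX ?s * 1) + fC (q - inverse q) * (group_algebra_lift (divided_difference I2 \<nu>) * 1))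
    + fT I2 * (fX ?s * 1 - fC (r0 \<nu>) * 1)
    + fC p * (group_algebra_lift (divided_difference I2 \<nu>) * (fC 1 * 1) - fC (of_int (coroot_pairing \<nu> I2) * r0 \<nu> * 1) * 1) \<in> J"
    unfolding ev_r0 by (simp only: lin_spaceD(2)[OF L])
  then show ?thesis
    by (simp add: p_def[symmetric] fC_simps(1,2) fC_move fC_merge right_diff_distrib algebra_simps)
qed

lemma jordan_rwt: "dual_scalars.rwt J x0 jordan"
  unfolding dual_scalars.rwt_def
proof (intro conjI allI)
  show "jordan (x + y) = jordan x + jordan y" for x y
    by (simp add: jordan_def fC_simps add_divide_distrib algebra_simps)
  show "jordan (dC c * x) = fC c * jordan x" for c x
    by (simp add: jordan_def fC_merge distrib_left)
  fix \<nu> x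
  let ?d = "of_int (coroot_pairing \<nu> I2) :: complex"
  have "x0 \<nu> = Dual (r0 \<nu>) (r0 \<nu> * ?d)"
    by (simp add: x0_def theta_def r0_def coroot_pairing_def)
  then have e: "jordan (x0 \<nu> * x) = fC (r0 \<nu> * eps x + r0 \<nu> * ?d * std x) + fC (r0 \<nu> * std x / p) * fT I2"
    by (simp add: jordan_def)
  have "std x / p * (p * (?d * r0 \<nu>)) = r0 \<nu> * ?d * std x" using p0 by simp
  then have "fX \<nu> * jordan x - jordan (x0 \<nu> * x) = fC (eps x) * (fX \<nu> * 1 - fC (r0 \<nu>) * 1) +
    fC (std x / p) * (fX \<nu> * fT I2 - (fC (r0 \<nu>) * fT I2 + fC (p * (?d * r0 \<nu>))))"
    unfolding e unfolding jordan_def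
    by (simp only: fC_simps(3) fC_move fC_merge distrib_left right_diff_distrib mult_1_right mult_1_left)
      (simp add: mult.commute)
  also have "\<dots> \<in> J"
    using w0 X_T2 by (intro lin_spaceD(2,3)[OF L]) (simp_all add: wt_def)
  finally show "fX \<nu> * jordan x - jordan (x0 \<nu> * x) \<in> J" .
qed

text \<open>The intertwiner over the dual numbers, applied to the whole Jordan block. It sends the nilpotent element to zero
  since \<open>T\<^sub>1 = q\<close> on the generator, so the deformation of the weight disappears on the image.\<close>

lemma w1: "wt J r1 b1"
proof -
  define h where "h x = fT I1 * jordan x - jordan (d0 * x)" for x
  have "dual_scalars.rwt J (x0 \<circ> simple_reflection I1) h"
    unfolding h_def
    by (rule dual_scalars.intertwiner[OF J x_char(1) jordan_rwt]) (use edge_coefficients(1) p_def in simp)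
  then have h: "dual_scalars.rwt J x1 h" by (simp add: x_reflection(1))
  have heps: "h (Dual 0 1) \<in> J"
    using T1_one by (simp add: h_def jordan_def d0_def fC_simps(1,2))
  have h1: "h 1 = fC (1 / p) * b1"
    by (simp add: h_def jordan_def d0_def b1_def fC_simps(1) fC_move fC_merge right_diff_distrib)
  show ?thesis
    unfolding wt_def
  proof
    fix \<nu>
    obtain e where "x1 \<nu> = Dual (r1 \<nu>) e" by (simp add: x1_def theta_def r1_def)
    then have "x1 \<nu> = dC (r1 \<nu>) * 1 + dC e * Dual 0 1" by (simp add: dual_eq_iff)
    then have e: "h (x1 \<nu> * 1) = fC (r1 \<nu>) * h 1 + fC e * h (Dual 0 1)"
      using dual_scalars.rwt_simps[OF h] by (metis mult.right_neutral)
    have "fC (1 / p) * (fX \<nu> * b1 - fC (r1 \<nu>) * b1) = (fX \<nu> * h 1 - h (x1 \<nu> * 1)) + fC e * h (Dual 0 1)"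
      unfolding e unfolding h1 by (simp add: fC_move fC_swap right_diff_distrib)
    also have "\<dots> \<in> J" by (intro lin_spaceD(2,3)[OF L] heps dual_scalars.rwt_simps(6)[OF h])
    finally show "fX \<nu> * b1 - fC (r1 \<nu>) * b1 \<in> J"
      using p0 by (simp add: lin_space_scale_iff[OF L])
  qed
qed

lemma w2: "wt J r2 b2" and w3: "wt J r3 b3" and w4: "wt J r4 b4"
proof -
  show 2: "wt J r2 b2" unfolding b2_def by (rule edge(3)[OF J w1])
  show 3: "wt J r3 b3" unfolding b3_def by (rule edge(5)[OF J 2])
  show "wt J r4 b4" unfolding b4_def by (rule edge(6)[OF J 3])
qed

lemma T1_b1: "fT I1 * b1 - (fC (- inverse q) * b1 + fC (- (q + inverse q)) * 1) \<in> J"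
proof -
  have "fT I1 * b1 - (fC (- inverse q) * b1 + fC (- (q + inverse q)) * 1) =
    (fT I1 * (fT I1 * fT I2) - (fC (q - inverse q) * (fT I1 * fT I2) + fT I2)) - (fT I1 - fC q)"
    using q0 by (simp add: b1_def fC_simps fC_move algebra_simps) (simp add: fC_merge fC_simps(2) flip: mult.assoc)
  then show ?thesis
    using lin_spaceD(5)[OF L left_idealD(1)[OF J hecke_ideal_relations(3)] T1_one] by simp
qed

lemma mult_table:
  "fT I1 * fT I2 - (b1 + (fC q * fT I2 + fC 1 * 1)) \<in> J"
  "fT I1 * b2 - (fC E * b2 + b3) \<in> J" "fT I1 * b3 - (fC (p - E) * b3 + fC cE * b2) \<in> J"
  "fT I2 * fT I2 - (fC p * fT I2 + 1) \<in> J"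
  "fT I2 * b1 - (fC G * b1 + b2) \<in> J" "fT I2 * b2 - (fC (p - G) * b2 + fC cG * b1) \<in> J"
  "fT I2 * b3 - (fC G * b3 + b4) \<in> J" "fT I2 * b4 - (fC (p - G) * b4 + fC cG * b3) \<in> J"
proof -
  have "fT I1 * fT I2 - (b1 + (fC q * fT I2 + fC 1 * 1)) = 0" "fT I1 * b2 - (fC E * b2 + b3) = 0"
    "fT I2 * b1 - (fC G * b1 + b2) = 0" "fT I2 * b3 - (fC G * b3 + b4) = 0"
    by (simp add: b1_def fC_simps(2), simp add: b3_def, simp add: b2_def, simp add: b4_def)
  then show "fT I1 * fT I2 - (b1 + (fC q * fT I2 + fC 1 * 1)) \<in> J" "fT I1 * b2 - (fC E * b2 + b3) \<in> J"
    "fT I2 * b1 - (fC G * b1 + b2) \<in> J" "fT I2 * b3 - (fC G * b3 + b4) \<in> J"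
    by (simp_all only: lin_spaceD(1)[OF L])
  show "fT I1 * b3 - (fC (p - E) * b3 + fC cE * b2) \<in> J" "fT I2 * b2 - (fC (p - G) * b2 + fC cG * b1) \<in> J"
    "fT I2 * b4 - (fC (p - G) * b4 + fC cG * b3) \<in> J"
    unfolding cE_def cG_def by (rule edge_back[OF J], rule b3_def b2_def b4_def)+
  show "fT I2 * fT I2 - (fC p * fT I2 + 1) \<in> J"
    using left_idealD(1)[OF J hecke_ideal_relations(3)[of I2 1]] by (simp add: p_def)
qed

lemma cspan_mod: "x - y \<in> J \<Longrightarrow> y \<in> cspan J zs \<Longrightarrow> x \<in> cspan J zs"
  using lin_space_diff_iff[OF cspan_lin_space[OF L], of x y zs] cspan_base[OF L, of zs] by blast

lemma cspan_closed:
  assumes "\<And>z. z \<in> set zs \<Longrightarrow> fT i * z \<in> cspan J ys"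
  shows "x \<in> cspan J zs \<Longrightarrow> fT i * x \<in> cspan J ys"
  by (rule cspan_image_subset[where U = J and zs = zs, OF cspan_lin_space[OF L] _ assms])
    (use cspan_base[OF L, of ys] left_idealD(2)[OF J] in auto)

lemmas cspanI = cspan_mod[OF mult_table(1)] cspan_mod[OF mult_table(2)] cspan_mod[OF mult_table(3)]
  cspan_mod[OF mult_table(4)] cspan_mod[OF mult_table(5)] cspan_mod[OF mult_table(6)]
  cspan_mod[OF mult_table(7)] cspan_mod[OF mult_table(8)] cspan_mod[OF T1_b1]

lemma cspan_combI: "x \<in> cspan J zs \<Longrightarrow> y \<in> cspan J zs \<Longrightarrow> x + y \<in> cspan J zs"
  "x \<in> cspan J zs \<Longrightarrow> y \<in> cspan J zs \<Longrightarrow> x - y \<in> cspan J zs"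
  "x \<in> cspan J zs \<Longrightarrow> fC c * x \<in> cspan J zs"
  using lin_spaceD[OF cspan_lin_space[OF L]] by auto

lemma cspan_genI: "x \<in> set zs \<Longrightarrow> x \<in> cspan J zs"
  by (rule cspan_mem[OF L])

lemma T1_mem: "1 \<in> set zs \<Longrightarrow> fT I1 \<in> cspan J zs"
  using cspan_mod[OF T1_one] cspan_combI(3)[OF cspan_genI, of 1 zs q] by simp

lemma table_mem:
  "{fT I2, 1, b1} \<subseteq> set zs \<Longrightarrow> fT I1 * fT I2 \<in> cspan J zs"
  "{b2, b3} \<subseteq> set zs \<Longrightarrow> fT I1 * b2 \<in> cspan J zs"
  "{b2, b3} \<subseteq> set zs \<Longrightarrow> fT I1 * b3 \<in> cspan J zs"
  "{fT I2, 1} \<subseteq> set zs \<Longrightarrow> fT I2 * fT I2 \<in> cspan J zs"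
  "{b1, b2} \<subseteq> set zs \<Longrightarrow> fT I2 * b1 \<in> cspan J zs"
  "{b1, b2} \<subseteq> set zs \<Longrightarrow> fT I2 * b2 \<in> cspan J zs"
  "{b3, b4} \<subseteq> set zs \<Longrightarrow> fT I2 * b3 \<in> cspan J zs"
  "{b3, b4} \<subseteq> set zs \<Longrightarrow> fT I2 * b4 \<in> cspan J zs"
  "{b1, 1} \<subseteq> set zs \<Longrightarrow> fT I1 * b1 \<in> cspan J zs"
  by (rule cspanI; simp only: insert_subset cspan_combI cspan_genI)+

text \<open>By the braid relation \<open>T\<^sub>1b4 - q b4\<close> lies in the span of the earlier vectors. It has the weight \<open>r5\<close>, which does not
  occur among theirs, so it vanishes.\<close>

lemma T1_b4: "fT I1 * b4 - fC q * b4 \<in> J"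
proof -
  let ?U = "[fT I2, 1, b3, b2, b1]"
  have T1U: "fT I1 * x \<in> cspan J ?U" if "x \<in> cspan J ?U" for x
    using that by (rule cspan_closed[rotated]) (auto simp: table_mem T1_mem cspan_genI)
  define w where "w = fT I2 * (fT I1 * (fT I2 * (fT I1 * fT I2)))"
  have "fT I1 * fT I2 - b1 = fC q * fT I2 + 1" by (simp add: b1_def)
  then have 1: "fT I1 * fT I2 - b1 \<in> cspan J [fT I2, 1]"
    by (simp add: cspan_combI cspan_genI)
  have "fT I2 * (fT I1 * fT I2 - b1) \<in> cspan J [fT I2, 1, b1]"
    using 1 by (rule cspan_closed[rotated]) (auto simp: table_mem T1_mem cspan_genI)
  moreover have "fT I2 * (fT I1 * fT I2) - b2 = fT I2 * (fT I1 * fT I2 - b1) + fC G * b1"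
    by (simp add: b2_def algebra_simps)
  ultimately have 2: "fT I2 * (fT I1 * fT I2) - b2 \<in> cspan J [fT I2, 1, b1]"
    by (simp add: cspan_combI cspan_genI)
  have "fT I1 * (fT I2 * (fT I1 * fT I2) - b2) \<in> cspan J [fT I2, 1, b2, b1]"
    using 2 by (rule cspan_closed[rotated]) (auto simp: table_mem T1_mem cspan_genI)
  moreover have "fT I1 * (fT I2 * (fT I1 * fT I2)) - b3 = fT I1 * (fT I2 * (fT I1 * fT I2) - b2) + fC E * b2"
    by (simp add: b3_def algebra_simps)
  ultimately have 3: "fT I1 * (fT I2 * (fT I1 * fT I2)) - b3 \<in> cspan J [fT I2, 1, b2, b1]"
    by (simp add: cspan_combI cspan_genI)
  have "fT I2 * (fT I1 * (fT I2 * (fT I1 * fT I2)) - b3) \<in> cspan J ?U"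
    using 3 by (rule cspan_closed[rotated]) (auto simp: table_mem T1_mem cspan_genI)
  moreover have "w - b4 = fT I2 * (fT I1 * (fT I2 * (fT I1 * fT I2)) - b3) + fC G * b3"
    by (simp add: w_def b4_def algebra_simps)
  ultimately have wb: "w - b4 \<in> cspan J ?U"
    by (simp add: cspan_combI cspan_genI)
  have "fT I1 * w - fC q * w \<in> J"
  proof -
    have "fT I1 * w - fC q * w = (fT I1 * (fT I2 * (fT I1 * (fT I2 * (fT I1 * (fT I2 * 1))))) -
        fT I2 * (fT I1 * (fT I2 * (fT I1 * (fT I2 * (fT I1 * 1)))))) +
      fT I2 * (fT I1 * (fT I2 * (fT I1 * (fT I2 * (fT I1 - fC q)))))"
      by (simp add: w_def fC_move right_diff_distrib)
    also have "\<dots> \<in> J"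
      by (intro lin_spaceD(2)[OF L] left_idealD(1)[OF J hecke_ideal_relations(4)] left_idealD(2)[OF J] T1_one)
    finally show ?thesis .
  qed
  moreover have "fT I1 * b4 - fC q * b4 - (fC q * (w - b4) - fT I1 * (w - b4)) = fT I1 * w - fC q * w"
    by (simp add: algebra_simps)
  ultimately have "fT I1 * b4 - fC q * b4 \<in> cspan J ?U"
    by (intro cspan_mod[where y = "fC q * (w - b4) - fT I1 * (w - b4)", OF _ cspan_combI(2)[OF cspan_combI(3)[OF wb] T1U[OF wb]]])
      simp
  moreover have "flag J ([(fT I2, r0), (1, r0), (b3, r3), (b2, r2), (b1, r1)] @ [])"
  proof -
    have fl: "flag J [(1, r0), (b3, r3), (b2, r2), (b1, r1)]"
      by (rule flag_of_weight_vectors[OF L]) (use w0 w1 w2 w3 in auto)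
    have "wt (cspan J [1, b3, b2, b1]) r0 (fT I2)"
      unfolding wt_def
    proof
      fix \<nu>
      show "fX \<nu> * fT I2 - fC (r0 \<nu>) * fT I2 \<in> cspan J [1, b3, b2, b1]"
      proof (rule cspan_mod)
        show "fX \<nu> * fT I2 - fC (r0 \<nu>) * fT I2 - fC (p * (of_int (coroot_pairing \<nu> I2) * r0 \<nu>)) * 1 \<in> J"
          using X_T2[of \<nu>] by (simp only: diff_diff_eq mult_1_right)
        show "fC (p * (of_int (coroot_pairing \<nu> I2) * r0 \<nu>)) * 1 \<in> cspan J [1, b3, b2, b1]"
          by (intro cspan_combI cspan_genI) simp
      qed
    qed
    with fl show ?thesis by simp
  qed
  moreover have "wt J r5 (fT I1 * b4 - fC q * b4)" by (rule edge(7)[OF J w4])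
  ultimately show ?thesis
    using flag_drop[OF XJ, of "[(fT I2, r0), (1, r0), (b3, r3), (b2, r2), (b1, r1)]" "[]" r5] r_distinct by simp
qed

end

section \<open>Maximal left ideals\<close>

definition maximal_ideal :: "complex \<Rightarrow> free_algebra set \<Rightarrow> bool" where
  "maximal_ideal q J \<longleftrightarrow> left_ideal q J \<and> 1 \<notin> J \<and> (\<forall>J'. left_ideal q J' \<and> J \<subseteq> J' \<and> 1 \<notin> J' \<longrightarrow> J' = J)"

lemma maximal_ideal_swap: "maximal_ideal (- inverse q) = maximal_ideal q"
  by (simp add: fun_eq_iff maximal_ideal_def left_ideal_swap)

lemma left_ideal_Int: "left_ideal q I \<Longrightarrow> left_ideal q J \<Longrightarrow> left_ideal q (I \<inter> J)"
  by (auto simp: left_ideal_def)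

lemma left_ideal_sum:
  assumes I: "left_ideal q I" and J: "left_ideal q J"
  shows "left_ideal q {x + y | x y. x \<in> I \<and> y \<in> J}" (is "left_ideal q ?S")
    and "I \<subseteq> {x + y | x y. x \<in> I \<and> y \<in> J}" "J \<subseteq> {x + y | x y. x \<in> I \<and> y \<in> J}"
proof -
  note i = lin_spaceD[OF left_idealD(3)[OF I]] and j = lin_spaceD[OF left_idealD(3)[OF J]]
  show 1: "I \<subseteq> ?S" using j(1) by force
  show "J \<subseteq> ?S" using i(1) by force
  show "left_ideal q ?S" unfolding left_ideal_def
  proof (intro conjI ballI allI)
    show "hecke_ideal q \<subseteq> ?S" using 1 I by (auto simp: left_ideal_def)
    fix x a assume "x \<in> ?S"
    then obtain u v where x: "x = u + v" "u \<in> I" "v \<in> J" by blast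
    have "a * x = a * u + a * v" "a * u \<in> I" "a * v \<in> J"
      using x left_idealD(2)[OF I] left_idealD(2)[OF J] by (simp_all add: distrib_left)
    then show "a * x \<in> ?S" by blast
    fix y assume "y \<in> ?S"
    then obtain u' v' where y: "y = u' + v'" "u' \<in> I" "v' \<in> J" by blast
    have "x + y = (u + u') + (v + v')" using x y by (simp add: algebra_simps)
    then show "x + y \<in> ?S" using i(2)[OF x(2) y(2)] j(2)[OF x(3) y(3)] by blast
  qed
qed

lemma left_ideal_of_generators:
  assumes "x_space q U" "\<And>i x. x \<in> U \<Longrightarrow> fT i * x \<in> U"
  shows "left_ideal q U"
proof -
  note L = x_spaceD(2)[OF assms(1)]
  have "a * x \<in> U" if "x \<in> U" for a x
    by (rule free_algebra_closed) (use lin_spaceD[OF L] x_spaceD(3)[OF assms(1)] assms(2) that in auto)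
  then show ?thesis using x_spaceD(1)[OF assms(1)] lin_spaceD(2)[OF L] by (auto simp: left_ideal_def)
qed

text \<open>Take the shortest tail of the flag whose span contains a vector of \<open>B\<close> outside \<open>A\<close>. The lattice moves such
  a vector, up to its weight, into the span of a shorter tail, hence into \<open>A\<close>.\<close>

lemma weight_vector_in_difference:
  assumes U: "x_space q U" and B: "x_space q B" and A: "lin_space A" "U \<subseteq> A" and f: "flag U zs"
    and x: "x \<in> B" "x \<in> cspan U (map fst zs)" "x \<notin> A"
  shows "\<exists>z\<in>B. z \<notin> A \<and> (\<exists>s\<in>snd ` set zs. wt A s z)"
  using f x
proof (induction zs arbitrary: x)
  case Nil
  then show ?case using A by auto
next
  case (Cons a zs)
  obtain b s where a: "a = (b, s)" by (cases a)
  let ?W = "cspan U (map fst zs)"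
  have fl: "wt ?W s b" "flag U zs" using Cons.prems(1) by (simp_all add: a)
  show ?case
  proof (cases "\<exists>y\<in>B. y \<in> ?W \<and> y \<notin> A")
    case True
    then obtain y where y: "y \<in> B" "y \<in> ?W" "y \<notin> A" by blast
    from Cons.IH[OF fl(2) y] show ?thesis by auto
  next
    case False
    have X: "x_space q ?W" by (rule flag_x_space[OF U fl(2)])
    note LW = x_spaceD(2)[OF X] and LB = x_spaceD(2)[OF B]
    from Cons.prems(3) have "x \<in> cspan U (b # map fst zs)" by (simp add: a)
    then obtain c where c: "x - fC c * b \<in> ?W" by (rule cspan_ConsE)
    have "wt A s x"
      unfolding wt_def
    proof
      fix \<nu>
      have "fX \<nu> * x - fC (s \<nu>) * x = fX \<nu> * (x - fC c * b) - fC (s \<nu>) * (x - fC c * b) + fC c * (fX \<nu> * b - fC (s \<nu>) * b)"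
        by (simp add: fC_move right_diff_distrib fC_swap[of c])
      also have "\<dots> \<in> ?W"
      proof -
        have "fX \<nu> * b - fC (s \<nu>) * b \<in> ?W" using fl(1) by (simp add: wt_def)
        then show ?thesis
          by (rule lin_spaceD(2)[OF LW lin_spaceD(5)[OF LW x_spaceD(3)[OF X c] lin_spaceD(3)[OF LW c]] lin_spaceD(3)[OF LW]])
      qed
      finally have "fX \<nu> * x - fC (s \<nu>) * x \<in> ?W" .
      moreover have "fX \<nu> * x - fC (s \<nu>) * x \<in> B"
        by (rule lin_spaceD(5)[OF LB x_spaceD(3)[OF B Cons.prems(2)] lin_spaceD(3)[OF LB Cons.prems(2)]])
      ultimately show "fX \<nu> * x - fC (s \<nu>) * x \<in> A" using False by blast
    qed
    then show ?thesis using Cons.prems(2,4) by (auto simp: a)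
  qed
qed

lemma proper_scalar: "left_ideal q J \<Longrightarrow> 1 \<notin> J \<Longrightarrow> fC c \<in> J \<Longrightarrow> c = 0"
  using lin_space_scale_iff[OF left_idealD(3), of q J c 1] by auto

context induced_ideal begin

lemma flag_all: "flag J [(fT I2, r0), (1, r0), (b4, r4), (b3, r3), (b2, r2), (b1, r1)]"
proof -
  have fl: "flag J [(1, r0), (b4, r4), (b3, r3), (b2, r2), (b1, r1)]"
    by (rule flag_of_weight_vectors[OF L]) (use w0 w1 w2 w3 w4 in auto)
  have "wt (cspan J [1, b4, b3, b2, b1]) r0 (fT I2)"
    unfolding wt_def
  proof
    fix \<nu>
    show "fX \<nu> * fT I2 - fC (r0 \<nu>) * fT I2 \<in> cspan J [1, b4, b3, b2, b1]"
    proof (rule cspan_mod)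
      show "fX \<nu> * fT I2 - fC (r0 \<nu>) * fT I2 - fC (p * (of_int (coroot_pairing \<nu> I2) * r0 \<nu>)) * 1 \<in> J"
        using X_T2[of \<nu>] by (simp only: diff_diff_eq mult_1_right)
      show "fC (p * (of_int (coroot_pairing \<nu> I2) * r0 \<nu>)) * 1 \<in> cspan J [1, b4, b3, b2, b1]"
        by (intro cspan_combI cspan_genI) simp
    qed
  qed
  with fl show ?thesis by simp
qed

lemma T1_b4_mem: "b4 \<in> set zs \<Longrightarrow> fT I1 * b4 \<in> cspan J zs"
  by (rule cspan_mod[OF T1_b4]) (simp add: cspan_combI cspan_genI)

lemma span_all: "x \<in> cspan J [fT I2, 1, b4, b3, b2, b1]" (is "x \<in> ?S")
proof -
  have X: "x_space q ?S" using flag_x_space[OF XJ flag_all] by simp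
  have "left_ideal q ?S"
  proof (rule left_ideal_of_generators[OF X])
    fix i y assume y: "y \<in> ?S"
    have "fT i * z \<in> ?S" if "z \<in> set [fT I2, 1, b4, b3, b2, b1]" for z
      using that by (cases i) (auto simp: table_mem T1_mem cspan_genI T1_b4_mem)
    then show "fT i * y \<in> ?S" using y by (rule cspan_closed)
  qed
  moreover have "1 \<in> ?S" by (simp add: cspan_genI)
  ultimately show ?thesis using left_idealD(2)[of q ?S 1 x] by simp
qed

lemma b_weights: "(b, r) \<in> set [(b4, r4), (b3, r3), (b2, r2), (b1, r1)] \<Longrightarrow> wt J r b"
  using w1 w2 w3 w4 by auto

text \<open>The weight \<open>r0\<close> is separated from the weights \<open>r1, \<dots>, r4\<close> by \<open>X\<close> at the long simple root. An element
  with a nonzero component in the Jordan block of weight \<open>r0\<close> therefore generates everything.\<close>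

lemma proper_ideal_subset:
  assumes J': "left_ideal q J'" "J \<subseteq> J'" "1 \<notin> J'"
  shows "J' \<subseteq> cspan J [b4, b3, b2, b1]"
proof
  fix x assume x: "x \<in> J'"
  note L' = left_idealD(3)[OF J'(1)]
  obtain a where a: "x - fC a * fT I2 \<in> cspan J [1, b4, b3, b2, b1]"
    using span_all[of x] by (rule cspan_ConsE)
  then obtain b where b: "x - fC a * fT I2 - fC b * 1 \<in> cspan J [b4, b3, b2, b1]"
    by (rule cspan_ConsE)
  define d where "d = Dual (a * p) b"
  have jd: "jordan d = fC b + fC a * fT I2" using p0 by (simp add: jordan_def d_def)
  define z where "z = x - jordan d"
  have z: "z \<in> cspan J [b4, b3, b2, b1]" using b by (simp add: z_def jd algebra_simps)
  let ?k = "q ^ 6" and ?X = "fX (0, 1)"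
  \<comment> \<open>\<open>P\<close> kills \<open>b1, \<dots>, b4\<close>, while it is invertible on the Jordan block.\<close>
  define P where "P = (?X - fC ?k) * (?X - fC (inverse ?k))"
  have X_b: "(?X - fC c) * b' - fC (r (0, 1) - c) * b' \<in> J" if "wt J r b'" for r b' c
    using that unfolding wt_def by (simp add: fC_simps(6) left_diff_distrib)
  have val: "r1 (0, 1) = ?k" "r2 (0, 1) = inverse ?k" "r3 (0, 1) = ?k" "r4 (0, 1) = inverse ?k"
    by (simp_all add: r_defs t_of_def)
  have P_b: "P * b' \<in> J" if "wt J r b'" "r (0, 1) = ?k \<or> r (0, 1) = inverse ?k" for r b'
  proof -
    define y where "y = (?X - fC (inverse ?k)) * b' - fC (r (0, 1) - inverse ?k) * b'"
    have "P * b' = (?X - fC ?k) * y + fC (r (0, 1) - inverse ?k) * ((?X - fC ?k) * b' - fC (r (0, 1) - ?k) * b')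
        + fC ((r (0, 1) - inverse ?k) * (r (0, 1) - ?k)) * b'"
      by (simp add: P_def y_def fC_simps(6) fC_simps(4) fC_move left_diff_distrib right_diff_distrib mult.assoc fC_swap)
    moreover have "(r (0, 1) - inverse ?k) * (r (0, 1) - ?k) = 0" using that(2) by auto
    moreover have "y \<in> J" unfolding y_def by (rule X_b[OF that(1)])
    ultimately show ?thesis
      using X_b[OF that(1), of ?k] left_idealD(2)[OF J] lin_spaceD(2,3)[OF L] by (simp add: fC_simps(1))
  qed
  have Pz: "P * z \<in> J"
    by (rule cspan_image_subset[OF L left_idealD(2)[OF J] _ z])
      (use P_b[OF w1] P_b[OF w2] P_b[OF w3] P_b[OF w4] in \<open>auto simp: val\<close>)
  have jX: "(?X - fC c) * jordan y - jordan ((x0 (0, 1) - dC c) * y) \<in> J" for c y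
  proof -
    have "jordan ((x0 (0, 1) - dC c) * y) = jordan (x0 (0, 1) * y) - fC c * jordan y"
      by (simp only: left_diff_distrib dual_scalars.rwt_simps(4,5)[OF jordan_rwt])
    then show ?thesis
      using dual_scalars.rwt_simps(6)[OF jordan_rwt, of "(0, 1)" y] by (simp add: left_diff_distrib)
  qed
  define u where "u = (x0 (0, 1) - dC ?k) * ((x0 (0, 1) - dC (inverse ?k)) * d)"
  have "(?X - fC ?k) * ((?X - fC (inverse ?k)) * jordan d - jordan ((x0 (0, 1) - dC (inverse ?k)) * d)) \<in> J"
    by (rule left_idealD(2)[OF J jX])
  from lin_spaceD(2)[OF L this jX[of ?k "(x0 (0, 1) - dC (inverse ?k)) * d"]]
  moreover have "m * (n * y - v) + (m * v - w) = m * n * y - w" for m n y v w :: free_algebra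
    by (simp add: algebra_simps)
  ultimately have "P * jordan d - jordan u \<in> J" by (simp only: P_def u_def)
  moreover have "P * jordan d \<in> J'"
  proof -
    have "P * jordan d = P * x - P * z" by (simp add: z_def algebra_simps)
    then show ?thesis using left_idealD(2)[OF J'(1) x] Pz J'(2) lin_spaceD(5)[OF L'] by auto
  qed
  ultimately have ju: "jordan u \<in> J'"
    using lin_space_diff_iff[OF L'] J'(2) by blast
  have x01: "x0 (0, 1) = Dual 1 2" by (simp add: x0_def theta_def t_of_def)
  \<comment> \<open>The remaining nilpotent operator moves the component along \<open>T\<^sub>2\<close> to a multiple of \<open>1\<close>.\<close>
  have "std u = 0"
  proof -
    have "(x0 (0, 1) - dC 1) * u = Dual 0 (2 * std u)" by (simp add: x01 dual_eq_iff)
    then have "(?X - fC 1) * jordan u - fC (2 * std u) \<in> J'"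
      using jX[of 1 u] J'(2) by (auto simp: jordan_def[of "Dual 0 _"] fC_simps(1))
    then have "fC (2 * std u) \<in> J'"
      using lin_space_diff_iff[OF L'] left_idealD(2)[OF J'(1) ju] by blast
    then show ?thesis using proper_scalar[OF J'(1,3)] by fastforce
  qed
  moreover from this have "eps u = 0"
    using ju proper_scalar[OF J'(1,3)] by (simp add: jordan_def fC_simps(1))
  moreover have "1 - ?k \<noteq> 0" "1 - inverse ?k \<noteq> 0" using q6 by (auto simp: inverse_eq_1_iff)
  ultimately have "a * p = 0" "b = 0" by (auto simp: u_def x01 d_def)
  then show "x \<in> cspan J [b4, b3, b2, b1]" using b p0 by (simp add: fC_simps(1))
qed

lemma one_not_in_span:
  assumes "1 \<notin> J"
  shows "1 \<notin> cspan J [b4, b3, b2, b1]"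
proof
  assume "1 \<in> cspan J [b4, b3, b2, b1]"
  then have "1 \<in> cspan J (map fst ([(b4, r4), (b3, r3), (b2, r2), (b1, r1)] @ []))" by simp
  moreover have "flag J ([(b4, r4), (b3, r3), (b2, r2), (b1, r1)] @ [])"
    unfolding append_Nil2 by (rule flag_of_weight_vectors[OF L b_weights])
  ultimately show False
    using flag_drop[OF XJ _ w0, of "[(b4, r4), (b3, r3), (b2, r2), (b1, r1)]" "[]"] r_distinct assms by simp
qed

text \<open>All proper left ideals above \<open>J\<close> lie in the same subspace without \<open>1\<close>, so the sum of two of them is proper.\<close>

lemma maximal_unique:
  assumes "maximal_ideal q J1" "J \<subseteq> J1" "maximal_ideal q J2" "J \<subseteq> J2"
  shows "J1 = J2"
proof -
  let ?S = "{x + y | x y. x \<in> J1 \<and> y \<in> J2}" and ?Z = "cspan J [b4, b3, b2, b1]"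
  have l: "left_ideal q J1" "1 \<notin> J1" "left_ideal q J2" "1 \<notin> J2" using assms by (auto simp: maximal_ideal_def)
  have "J1 \<subseteq> ?Z" "J2 \<subseteq> ?Z"
    by (rule proper_ideal_subset[OF l(1) assms(2) l(2)], rule proper_ideal_subset[OF l(3) assms(4) l(4)])
  then have "?S \<subseteq> ?Z" using cspan_combI(1) by blast
  then have "1 \<notin> ?S" using one_not_in_span l assms(2) by blast
  then have S: "left_ideal q ?S \<and> J1 \<subseteq> ?S \<and> 1 \<notin> ?S" "left_ideal q ?S \<and> J2 \<subseteq> ?S \<and> 1 \<notin> ?S"
    using left_ideal_sum[OF l(1,3)] by simp_all
  have "\<forall>J'. left_ideal q J' \<and> J1 \<subseteq> J' \<and> 1 \<notin> J' \<longrightarrow> J' = J1" "\<forall>J'. left_ideal q J' \<and> J2 \<subseteq> J' \<and> 1 \<notin> J' \<longrightarrow> J' = J2"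
    using assms(1,3) by (simp_all add: maximal_ideal_def)
  from this(1)[rule_format, OF S(1)] this(2)[rule_format, OF S(2)] show ?thesis by simp
qed

text \<open>Going down an inner edge of the chain needs its scalar to be nonzero. The outer edge from \<open>b1\<close> to the generator
  can be crossed although its scalar is zero, because \<open>b1\<close> comes from a Jordan block.\<close>

lemma descend:
  assumes J': "left_ideal q J'" "J \<subseteq> J'"
  shows "b1 \<in> J' \<Longrightarrow> 1 \<in> J'" "b3 \<in> J' \<Longrightarrow> b2 \<in> J'" "b2 \<in> J' \<Longrightarrow> b3 \<in> J'"
    "cG \<noteq> 0 \<Longrightarrow> b2 \<in> J' \<Longrightarrow> b1 \<in> J'" "cG \<noteq> 0 \<Longrightarrow> b4 \<in> J' \<Longrightarrow> b3 \<in> J'"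
proof -
  note L' = left_idealD(3)[OF J'(1)]
  note d = scale_diff[OF L' subsetD[OF J'(2)] _ left_idealD(2)[OF J'(1)]]
  have nz: "- (q + inverse q) \<noteq> 0"
  proof
    assume "- (q + inverse q) = 0"
    then have "q * (q + inverse q) = 0" by (simp add: add_eq_0_iff)
    then show False using q0 D2 by (simp add: algebra_simps power2_eq_square)
  qed
  show "b1 \<in> J' \<Longrightarrow> 1 \<in> J'" by (rule d[OF T1_b1 _ _ nz])
  show "b3 \<in> J' \<Longrightarrow> b2 \<in> J'" by (rule d[OF mult_table(3) _ _ cE_nonzero])
  show "b2 \<in> J' \<Longrightarrow> b3 \<in> J'"
    using lin_spaceD(5)[OF L' left_idealD(2)[OF J'(1), of b2 "fT I1"] lin_spaceD(3)[OF L', of b2 E]]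
    unfolding b3_def by simp
  show "cG \<noteq> 0 \<Longrightarrow> b2 \<in> J' \<Longrightarrow> b1 \<in> J'" by (rule d[OF mult_table(6)])
  show "cG \<noteq> 0 \<Longrightarrow> b4 \<in> J' \<Longrightarrow> b3 \<in> J'" by (rule d[OF mult_table(8)])
qed

lemma weight_space_span:
  assumes "wt J r z" "z \<in> cspan J (map fst zs)" "set zs \<subseteq> set [(b4, r4), (b3, r3), (b2, r2), (b1, r1)]"
  shows "z \<in> cspan J (map fst (filter (\<lambda>(b, s). s = r) zs))"
  by (rule weight_vector_span[OF XJ _ assms(1,2)]) (use assms(3) b_weights in blast)

lemma singleton_span:
  assumes J': "left_ideal q J'" "J \<subseteq> J'" and z: "z \<in> J'" "z \<notin> J" "z \<in> cspan J [b]"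
  shows "b \<in> J'"
proof -
  obtain c where c: "z - fC c * b \<in> cspan J []" using z(3) by (rule cspan_ConsE)
  then have "c \<noteq> 0" using z(2) by (auto simp: fC_simps)
  moreover have "fC c * b \<in> J'"
    using lin_space_diff_iff[OF left_idealD(3)[OF J'(1)], of z "fC c * b"] c z(1) J'(2) by auto
  ultimately show ?thesis using lin_space_scale_iff[OF left_idealD(3)[OF J'(1)]] by simp
qed

text \<open>A larger proper left ideal contains a weight vector, hence one of the \<open>b\<^sub>k\<close>, and going down the chain
  leads to \<open>1\<close>.\<close>

lemma generic_maximal:
  assumes "q ^ 4 \<noteq> - 1" "1 \<notin> J"
  shows "maximal_ideal q J"
  unfolding maximal_ideal_def
proof (intro conjI allI impI J assms(2))
  fix J' assume "left_ideal q J' \<and> J \<subseteq> J' \<and> 1 \<notin> J'"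
  then have J': "left_ideal q J'" "J \<subseteq> J'" "1 \<notin> J'" by auto
  let ?zs = "[(b4, r4), (b3, r3), (b2, r2), (b1, r1)]"
  have c: "cG \<noteq> 0" using assms(1) cG_zero_iff by simp
  show "J' = J"
  proof (rule ccontr)
    assume "J' \<noteq> J"
    then obtain x where x: "x \<in> J'" "x \<notin> J" using J'(2) by blast
    have "\<exists>z\<in>J'. z \<notin> J \<and> (\<exists>s\<in>snd ` set ?zs. wt J s z)"
      by (rule weight_vector_in_difference[OF XJ left_idealD(4)[OF J'(1)] L subset_refl
            flag_of_weight_vectors[OF L b_weights] x(1) _ x(2)])
        (use proper_ideal_subset[OF J'] x in auto)
    then obtain z s where z: "z \<in> J'" "z \<notin> J" "wt J s z" "s \<in> {r4, r3, r2, r1}" by auto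
    have "z \<in> cspan J (map fst (filter (\<lambda>(b, r). r = s) ?zs))"
      by (rule weight_space_span[OF z(3)]) (use proper_ideal_subset[OF J'] z(1) in auto)
    then have "\<exists>b\<in>{b4, b3, b2, b1}. z \<in> cspan J [b]"
      using z(4) r_distinct by auto
    then obtain b where "b \<in> {b4, b3, b2, b1}" "b \<in> J'"
      using singleton_span[OF J'(1,2) z(1,2)] by blast
    then show False using descend[OF J'(1,2)] c J'(3) by auto
  qed
qed

end

section \<open>The remaining types of irreducible modules\<close>

context hecke_param begin

lemma type_B_maximal:
  assumes J: "left_ideal q J" and B: "type_B q J 1" and "1 \<notin> J"
  shows "maximal_ideal q J"
  unfolding maximal_ideal_def
proof (intro conjI allI impI J assms(3))
  note L = left_idealD(3)[OF J]
  have T: "fT i * 1 - fC q * 1 \<in> J" for i using B by (simp add: type_B_def)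
  have "left_ideal q (cspan J [1])"
  proof (rule left_ideal_of_generators)
    have "flag J [(1, r4)]" using B by (simp add: type_B_def r4_def)
    then show "x_space q (cspan J [1])" using flag_x_space[OF left_idealD(4)[OF J], of "[(1, r4)]"] by simp
    fix i x assume x: "x \<in> cspan J [1]"
    show "fT i * x \<in> cspan J [1]"
    proof (rule cspan_image_subset[OF cspan_lin_space[OF L] _ _ x])
      show "fT i * y \<in> cspan J [1]" if "y \<in> J" for y
        using left_idealD(2)[OF J that] cspan_base[OF L] by blast
      show "fT i * z \<in> cspan J [1]" if "z \<in> set [1]" for z
        using that T[of i] by (auto intro: cspan_ConsI[of _ q])
    qed
  qed
  then have all: "x \<in> cspan J [1]" for x
    using left_idealD(2)[of q "cspan J [1]" 1 x] cspan_mem[OF L, of 1 "[1]"] by simp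
  fix J' assume J': "left_ideal q J' \<and> J \<subseteq> J' \<and> 1 \<notin> J'"
  have "x \<in> J" if "x \<in> J'" for x
  proof -
    obtain c where c: "x - fC c * 1 \<in> cspan J []" using all[of x] by (rule cspan_ConsE)
    then have "fC c * 1 \<in> J'"
      using that J' lin_space_diff_iff[OF left_idealD(3)[of q J'], of x "fC c * 1"] by auto
    then have "c = 0" using proper_scalar[of q J' c] J' by simp
    then show ?thesis using c by (simp add: fC_simps)
  qed
  then show "J' = J" using J' by auto
qed

text \<open>The quotient is spanned by the generator and one vector of another weight, and the intertwiners of the middle
  edge lead from each of them to the other.\<close>

lemma type_C_maximal:
  assumes J: "left_ideal q J" and C: "type_C q J 1" and "1 \<notin> J"
  shows "maximal_ideal q J"
  unfolding maximal_ideal_def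
proof (intro conjI allI impI J assms(3))
  note L = left_idealD(3)[OF J] and X = left_idealD(4)[OF J]
  define y where "y = fT I1 * 1 - fC E * 1"
  have w: "wt J r2 1" and T2: "fT I2 * 1 - fC q * 1 \<in> J" and T2y: "fT I2 * y - fC (- inverse q) * y \<in> J"
    using C unfolding type_C_def Let_def E_def[symmetric] y_def by (simp_all add: r2_def)
  have wy: "wt J r3 y" unfolding y_def by (rule edge(5)[OF J w])
  have T1y: "fT I1 * y - (fC (p - E) * y + fC cE * 1) \<in> J"
    unfolding cE_def by (rule edge_back[OF J y_def])
  have LS: "lin_space (cspan J [y, 1])" by (rule cspan_lin_space[OF L])
  have m: "u \<in> cspan J [y, 1]" if "u - (fC a * y + fC b * 1) \<in> J" for u a b
    using that by (intro cspan_ConsI[of _ a] cspan_ConsI[of _ b]) (simp add: algebra_simps)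
  have fl: "flag J [(y, r3), (1, r2)]"
    by (rule flag_of_weight_vectors[OF L]) (use w wy in auto)
  have "left_ideal q (cspan J [y, 1])"
  proof (rule left_ideal_of_generators)
    show "x_space q (cspan J [y, 1])" using flag_x_space[OF X fl] by simp
    fix i x assume x: "x \<in> cspan J [y, 1]"
    show "fT i * x \<in> cspan J [y, 1]"
    proof (rule cspan_image_subset[OF LS _ _ x])
      show "fT i * z \<in> cspan J [y, 1]" if "z \<in> J" for z
        using left_idealD(2)[OF J that] cspan_base[OF L] by blast
      have "fT I1 * 1 \<in> cspan J [y, 1]" by (rule m[of _ 1 E]) (simp add: y_def fC_simps lin_spaceD(1)[OF L])
      moreover have "fT I2 * 1 \<in> cspan J [y, 1]" by (rule m[of _ 0 q]) (use T2 in \<open>simp add: fC_simps(1)\<close>)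
      moreover have "fT I1 * y \<in> cspan J [y, 1]" by (rule m[OF T1y])
      moreover have "fT I2 * y \<in> cspan J [y, 1]" by (rule m[of _ "- inverse q" 0]) (use T2y in \<open>simp add: fC_simps(1)\<close>)
      ultimately show "fT i * z \<in> cspan J [y, 1]" if "z \<in> set [y, 1]" for z
        using that by (cases i) auto
    qed
  qed
  then have all: "x \<in> cspan J [y, 1]" for x
    using left_idealD(2)[of q "cspan J [y, 1]" 1 x] cspan_mem[OF L, of 1 "[y, 1]"] by simp
  fix J' assume "left_ideal q J' \<and> J \<subseteq> J' \<and> 1 \<notin> J'"
  then have J': "left_ideal q J'" "J \<subseteq> J'" "1 \<notin> J'" by auto
  note L' = left_idealD(3)[OF J'(1)]
  have y: "y \<notin> J'"
    using scale_diff[OF L' subsetD[OF J'(2) T1y] _ left_idealD(2)[OF J'(1)] cE_nonzero] J'(3) by blast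
  show "J' = J"
  proof (rule ccontr)
    assume "J' \<noteq> J"
    then obtain x where x: "x \<in> J'" "x \<notin> J" using J'(2) by blast
    have "\<exists>z\<in>J'. z \<notin> J \<and> (\<exists>s\<in>snd ` set [(y, r3), (1, r2)]. wt J s z)"
      by (rule weight_vector_in_difference[OF X left_idealD(4)[OF J'(1)] L _ fl x(1) _ x(2)])
        (use all in simp_all)
    then obtain z s where z: "z \<in> J'" "z \<notin> J" "wt J s z" "s \<in> {r3, r2}" by auto
    have "z \<in> cspan J (map fst (filter (\<lambda>(b, r). r = s) [(y, r3), (1, r2)]))"
      by (rule weight_vector_span[OF X _ z(3)]) (use w wy all in auto)
    then have "\<exists>b\<in>{y, 1}. z \<in> cspan J [b]"
      using z(4) r_distinct by auto
    then obtain b where b: "b \<in> {y, 1}" "z \<in> cspan J [b]" by blast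
    obtain c where c: "z - fC c * b \<in> cspan J []" using b(2) by (rule cspan_ConsE)
    then have "c \<noteq> 0" using z(2) by (auto simp: fC_simps)
    moreover have "fC c * b \<in> J'"
      using lin_space_diff_iff[OF L', of z "fC c * b"] c z(1) J'(2) by auto
    ultimately have "b \<in> J'" using lin_space_scale_iff[OF L'] by simp
    then show False using b(1) y J'(3) by auto
  qed
qed

end

section \<open>Annihilators modulo a left ideal\<close>

text \<open>The annihilator of the vector \<open>w\<close> in the quotient by \<open>A\<close>.\<close>

definition colon :: "free_algebra set \<Rightarrow> free_algebra \<Rightarrow> free_algebra set" where
  "colon A w = {a. a * w \<in> A}"

lemma colon_left_ideal: "left_ideal q A \<Longrightarrow> left_ideal q (colon A w)"
  by (auto simp: left_ideal_def colon_def distrib_right mult.assoc hecke_ideal_closed(4))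

lemma mem_colon: "a \<in> colon A w \<longleftrightarrow> a * w \<in> A"
  by (simp add: colon_def)

lemma one_in_colon: "1 \<in> colon A w \<longleftrightarrow> w \<in> A"
  by (simp add: colon_def)

lemma wt_colon: "wt (colon A w) s 1 \<longleftrightarrow> wt A s w"
  by (simp add: wt_def colon_def left_diff_distrib)

lemma type_colon:
  "type_A q (colon A w) 1 \<longleftrightarrow> type_A q A w" "type_B q (colon A w) 1 \<longleftrightarrow> type_B q A w"
  "type_C q (colon A w) 1 \<longleftrightarrow> type_C q A w"
  by (auto simp: type_A_def type_B_def type_C_def Let_def mem_colon wt_colon left_diff_distrib
      right_diff_distrib mult.assoc)

lemma type_mono:
  assumes "J \<subseteq> J'"
  shows "type_A q J z \<Longrightarrow> type_A q J' z" "type_B q J z \<Longrightarrow> type_B q J' z" "type_C q J z \<Longrightarrow> type_C q J' z"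
  using assms by (auto simp: type_A_def type_B_def type_C_def Let_def intro: wt_mono)

lemma type_Int:
  assumes "type_A q I z" "type_A q J z" shows "type_A q (I \<inter> J) z"
  using assms by (auto simp: type_A_def wt_def)

lemma type_Int':
  "type_B q I z \<Longrightarrow> type_B q J z \<Longrightarrow> type_B q (I \<inter> J) z"
  "type_C q I z \<Longrightarrow> type_C q J z \<Longrightarrow> type_C q (I \<inter> J) z"
  by (auto simp: type_B_def type_C_def wt_def Let_def)

text \<open>The intersection of the two ideals satisfies the same relations. In types B and C this already makes it
  maximal; in type A it lies above the ideal presenting \<open>M\<close>, which is contained in only one maximal ideal.\<close>

lemma (in hecke_param) type_unique:
  assumes m: "maximal_ideal q J1" "maximal_ideal q J2"
    and "type_A q J1 1 \<and> type_A q J2 1 \<or> type_B q J1 1 \<and> type_B q J2 1 \<or> type_C q J1 1 \<and> type_C q J2 1"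
  shows "J1 = J2"
proof -
  let ?J = "J1 \<inter> J2"
  have J: "left_ideal q ?J" "1 \<notin> ?J" using m left_ideal_Int by (auto simp: maximal_ideal_def)
  have eq: "J1 = J2" if "maximal_ideal q ?J"
    using that m unfolding maximal_ideal_def by (metis inf_le1 inf_le2)
  from assms(3) consider "type_A q ?J 1" | "type_B q ?J 1" | "type_C q ?J 1"
    using type_Int type_Int' by blast
  then show ?thesis
  proof cases
    case 1
    then interpret induced_ideal q ?J using J by unfold_locales auto
    show ?thesis by (rule maximal_unique[OF m(1) _ m(2)]) auto
  next
    case 2 then show ?thesis using eq type_B_maximal[OF J(1) _ J(2)] by blast
  next
    case 3 then show ?thesis using eq type_C_maximal[OF J(1) _ J(2)] by blast
  qed
qed

section \<open>Submodules in the exceptional case\<close>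

context induced_ideal begin

lemma span_left_ideal:
  assumes zs: "set zs \<subseteq> set [(b4, r4), (b3, r3), (b2, r2), (b1, r1)]"
    and T: "\<And>i z. z \<in> set (map fst zs) \<Longrightarrow> fT i * z \<in> cspan J (map fst zs)"
  shows "left_ideal q (cspan J (map fst zs))"
proof (rule left_ideal_of_generators)
  have "flag J zs" by (rule flag_of_weight_vectors[OF L]) (use zs b_weights in blast)
  then show "x_space q (cspan J (map fst zs))" by (rule flag_x_space[OF XJ])
  show "fT i * x \<in> cspan J (map fst zs)" if "x \<in> cspan J (map fst zs)" for i x
    using T that by (rule cspan_closed)
qed

lemma special_table:
  assumes "cG = 0"
  shows "b4 \<in> set zs \<Longrightarrow> fT I2 * b4 \<in> cspan J zs" "b2 \<in> set zs \<Longrightarrow> fT I2 * b2 \<in> cspan J zs"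
proof -
  show "b4 \<in> set zs \<Longrightarrow> fT I2 * b4 \<in> cspan J zs"
    by (rule cspan_mod[of _ "fC (p - G) * b4"])
      (use mult_table(8) assms in \<open>simp_all add: fC_simps(1) cspan_combI cspan_genI\<close>)
  show "b2 \<in> set zs \<Longrightarrow> fT I2 * b2 \<in> cspan J zs"
    by (rule cspan_mod[of _ "fC (p - G) * b2"])
      (use mult_table(6) assms in \<open>simp_all add: fC_simps(1) cspan_combI cspan_genI\<close>)
qed

text \<open>If \<open>cG\<close> vanishes, \<open>T\<^sub>2\<close> leads neither from \<open>b4\<close> back to \<open>b3\<close> nor from \<open>b2\<close> back to \<open>b1\<close>.\<close>

lemma special_left_ideals:
  assumes "cG = 0"
  shows "left_ideal q (cspan J [b4])" "left_ideal q (cspan J [b4, b3, b2])"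
proof -
  have "fT i * z \<in> cspan J (map fst [(b4, r4)])" if "z \<in> set (map fst [(b4, r4)])" for i z
    using that by (cases i) (auto simp: special_table[OF assms] T1_b4_mem)
  from span_left_ideal[OF _ this] show "left_ideal q (cspan J [b4])" by simp
  have "fT i * z \<in> cspan J (map fst [(b4, r4), (b3, r3), (b2, r2)])"
    if "z \<in> set (map fst [(b4, r4), (b3, r3), (b2, r2)])" for i z
    using that by (cases i) (auto simp: special_table[OF assms] T1_b4_mem table_mem)
  from span_left_ideal[OF _ this] show "left_ideal q (cspan J [b4, b3, b2])" by simp
qed

lemma weight_space_in_all:
  assumes "wt J r z" "r \<noteq> r0"
  shows "z \<in> cspan J (map fst (filter (\<lambda>(b, s). s = r) [(b4, r4), (b3, r3), (b2, r2), (b1, r1)]))"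
proof -
  have "z \<in> cspan J (map fst [(b4, r4), (b3, r3), (b2, r2), (b1, r1)])"
    by (rule flag_drop[OF XJ _ assms(1), of "[(fT I2, r0), (1, r0)]"])
      (use flag_all span_all[of z] assms(2) in simp_all)
  from weight_space_span[OF assms(1) this subset_refl] show ?thesis .
qed

lemma weight_spaces:
  "{z. wt J r2 z} = cspan J [b2]" "{z. wt J r3 z} = cspan J [b3]" "{z. wt J r4 z} = cspan J [b4]"
proof -
  have c: "wt J r z" if w: "wt J r b" and z: "z \<in> cspan J [b]" for r b z
  proof -
    obtain c where c: "z - fC c * b \<in> cspan J []" using z by (rule cspan_ConsE)
    have "wt J r ((z - fC c * b) + fC c * b)"
      by (rule wt_add[OF L wt_zero[OF L _ XJ] wt_scale[OF L w]]) (use c in simp)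
    then show ?thesis by simp
  qed
  show "{z. wt J r2 z} = cspan J [b2]" "{z. wt J r3 z} = cspan J [b3]" "{z. wt J r4 z} = cspan J [b4]"
    using weight_space_in_all[of r2] weight_space_in_all[of r3] weight_space_in_all[of r4] c[OF w2] c[OF w3] c[OF w4] r_distinct
    by auto
qed

lemma chain_nonzero:
  assumes "b4 \<notin> J"
  shows "b2 \<notin> J" "b3 \<notin> J" "b2 \<notin> cspan J [b4]"
proof -
  note m = lin_spaceD(5)[OF L left_idealD(2)[OF J] lin_spaceD(3)[OF L]]
  show b3: "b3 \<notin> J" using assms m[of b3 b3] unfolding b4_def by blast
  show b2: "b2 \<notin> J" using b3 m[of b2 b2] unfolding b3_def by blast
  show "b2 \<notin> cspan J [b4]"
  proof
    assume "b2 \<in> cspan J [b4]"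
    then have "b2 \<in> cspan J (map fst ([(b4, r4)] @ []))" by simp
    then show False using flag_drop[OF XJ _ w2, of "[(b4, r4)]" "[]"] w4 r_distinct b2 by simp
  qed
qed

text \<open>The subquotient is spanned by two vectors of different weights, \<open>b3\<close> and \<open>b2\<close>, and \<open>T\<^sub>1\<close> leads from
  each of them to the other because the scalar of the middle edge is not zero.\<close>

lemma middle_irreducible:
  assumes J': "left_ideal q J'" "cspan J [b4] \<subseteq> J'" "J' \<subseteq> cspan J [b4, b3, b2]" and c: "cG = 0"
  shows "J' = cspan J [b4] \<or> J' = cspan J [b4, b3, b2]"
proof (rule ccontr)
  let ?A = "cspan J [b4]"
  assume n: "\<not> (J' = ?A \<or> J' = cspan J [b4, b3, b2])"
  have A: "left_ideal q ?A" by (rule special_left_ideals(1)[OF c])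
  note LA = left_idealD(3)[OF A]
  obtain x where x: "x \<in> J'" "x \<notin> ?A" using n J'(2) by blast
  have e: "cspan J [b4, b3, b2] = cspan ?A [b3, b2]"
  proof
    show "cspan J [b4, b3, b2] \<subseteq> cspan ?A [b3, b2]"
      by (rule cspan_subset[OF cspan_lin_space[OF LA]])
        (use cspan_base[OF LA, of "[b3, b2]"] cspan_base[OF L, of "[b4]"] cspan_genI[of b4 "[b4]"] cspan_mem[OF LA, of _ "[b3, b2]"] in auto)
    show "cspan ?A [b3, b2] \<subseteq> cspan J [b4, b3, b2]"
      by (rule cspan_subset[OF cspan_lin_space[OF L]])
        (use cspan_subset[OF cspan_lin_space[OF L, of "[b4, b3, b2]"] cspan_base[OF L], of "[b4]"] cspan_genI[of _ "[b4, b3, b2]"] in auto)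
  qed
  have w: "wt ?A r b" if "(b, r) \<in> set [(b3, r3), (b2, r2)]" for b r
    using that wt_mono[OF w3 cspan_base[OF L]] wt_mono[OF w2 cspan_base[OF L]] by auto
  have "\<exists>z\<in>J'. z \<notin> ?A \<and> (\<exists>s\<in>snd ` set [(b3, r3), (b2, r2)]. wt ?A s z)"
    by (rule weight_vector_in_difference[OF left_idealD(4)[OF A] left_idealD(4)[OF J'(1)] LA subset_refl
          flag_of_weight_vectors[OF LA w] x(1) _ x(2)]) (use J'(3) x(1) e in auto)
  then obtain z s where z: "z \<in> J'" "z \<notin> ?A" "wt ?A s z" "s \<in> {r3, r2}" by auto
  have "z \<in> cspan ?A (map fst (filter (\<lambda>(b, r). r = s) [(b3, r3), (b2, r2)]))"
    by (rule weight_vector_span[OF left_idealD(4)[OF A] w z(3)]) (use J'(3) z(1) e in auto)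
  then have "\<exists>b\<in>{b3, b2}. z \<in> cspan ?A [b]" using z(4) r_distinct by auto
  then obtain b where b: "b \<in> {b3, b2}" "z \<in> cspan ?A [b]" by blast
  obtain k where k: "z - fC k * b \<in> cspan ?A []" using b(2) by (rule cspan_ConsE)
  then have "k \<noteq> 0" using z(2) by (auto simp: fC_simps)
  moreover have "fC k * b \<in> J'"
    using lin_space_diff_iff[OF left_idealD(3)[OF J'(1)], of z "fC k * b"] k z(1) J'(2) by auto
  ultimately have "b \<in> J'" using lin_space_scale_iff[OF left_idealD(3)[OF J'(1)]] by simp
  moreover have JJ': "J \<subseteq> J'" using cspan_base[OF L, of "[b4]"] J'(2) by blast
  ultimately have "b3 \<in> J'" "b2 \<in> J'" using b(1) descend(2,3)[OF J'(1) JJ'] by auto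
  moreover have "b4 \<in> J'" using cspan_genI[of b4 "[b4]"] J'(2) by auto
  ultimately have "cspan J [b4, b3, b2] \<subseteq> J'"
    using cspan_subset[OF left_idealD(3)[OF J'(1)] JJ', of "[b4, b3, b2]"] by simp
  then show False using n J'(3) by blast
qed

lemma top_irreducible:
  assumes J': "left_ideal q J'" "cspan J [b4, b3, b2] \<subseteq> J'" and "1 \<notin> J'"
  shows "J' = cspan J [b4, b3, b2]"
proof (rule ccontr)
  let ?A = "cspan J [b4, b3, b2]"
  assume "J' \<noteq> ?A"
  then obtain x where x: "x \<in> J'" "x \<notin> ?A" using J'(2) by blast
  have JJ': "J \<subseteq> J'" using cspan_base[OF L, of "[b4, b3, b2]"] J'(2) by blast
  note L' = left_idealD(3)[OF J'(1)]
  have "cspan J [b4, b3, b2, b1] \<subseteq> cspan J [b1, b4, b3, b2]"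
    by (rule cspan_subset[OF cspan_lin_space[OF L] cspan_base[OF L]]) (auto simp: cspan_genI)
  then have "x \<in> cspan J [b1, b4, b3, b2]" using proper_ideal_subset[OF J'(1) JJ' assms(3)] x(1) by blast
  then obtain c where c: "x - fC c * b1 \<in> ?A" by (rule cspan_ConsE)
  then have "c \<noteq> 0" using x(2) by (auto simp: fC_simps)
  moreover have "fC c * b1 \<in> J'"
    using lin_space_diff_iff[OF L', of x "fC c * b1"] c x(1) J'(2) by auto
  ultimately have "b1 \<in> J'" using lin_space_scale_iff[OF L'] by simp
  then show False using descend(1)[OF J'(1) JJ'] assms(3) by simp
qed

lemma one_not_in_middle:
  assumes "1 \<notin> J"
  shows "1 \<notin> cspan J [b4, b3, b2]"
proof -
  have "cspan J [b4, b3, b2] \<subseteq> cspan J [b4, b3, b2, b1]"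
    by (rule cspan_subset[OF cspan_lin_space[OF L] cspan_base[OF L]]) (auto simp: cspan_genI)
  then show ?thesis using one_not_in_span[OF assms] by blast
qed

text \<open>These are the positions in the exceptional filtration of \<open>M\<close> where types B and C occur.\<close>

lemma middle_type:
  assumes "q ^ 4 = - 1"
  shows "type_B q J b4" "type_C q (cspan J [b4]) b2"
proof -
  have c: "cG = 0" using assms cG_zero_iff by simp
  note s = G_special[OF assms]
  have "fT i * b4 - fC q * b4 \<in> J" for i
    using T1_b4 mult_table(8) by (cases i) (simp_all add: c s p_minus fC_simps(1))
  then show "type_B q J b4" using w4 by (simp add: type_B_def r4_def)
  have "fT I2 * b3 - fC (- inverse q) * b3 \<in> cspan J [b4]"
    by (intro cspan_ConsI[of _ 1]) (use mult_table(7) in \<open>simp add: s fC_simps(2) algebra_simps\<close>)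
  moreover have "fT I2 * b2 - fC q * b2 \<in> cspan J [b4]"
    using mult_table(6) cspan_base[OF L, of "[b4]"] by (auto simp: c s p_minus fC_simps(1))
  ultimately show "type_C q (cspan J [b4]) b2"
    using wt_mono[OF w2 cspan_base[OF L]]
    unfolding type_C_def Let_def E_def[symmetric] b3_def[symmetric] by (simp add: r2_def)
qed

end

section \<open>Finite length\<close>

text \<open>For a subspace \<open>A\<close> containing \<open>U\<close> and contained in the span of \<open>zs\<close> and \<open>U\<close>, this is the dimension of \<open>A / U\<close>,
  computed along the filtration by the tails of \<open>zs\<close>. It serves as the measure for chains of left ideals.\<close>

fun jumps :: "free_algebra set \<Rightarrow> free_algebra set \<Rightarrow> free_algebra list \<Rightarrow> nat" where
  "jumps U A [] = 0"
| "jumps U A (z # zs) = jumps U A zs + (if A \<inter> cspan U (z # zs) \<subseteq> cspan U zs then 0 else 1)"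

lemma jumps_le: "jumps U A zs \<le> length zs"
  by (induction zs) auto

lemma jumps_mono: "A \<subseteq> B \<Longrightarrow> jumps U A zs \<le> jumps U B zs"
proof (induction zs)
  case (Cons z zs)
  then have "A \<inter> cspan U (z # zs) \<subseteq> cspan U zs" if "B \<inter> cspan U (z # zs) \<subseteq> cspan U zs"
    using that by blast
  then show ?case using Cons by (auto simp: add_mono)
qed simp

lemma jumps_strict:
  assumes "lin_space A" "lin_space B" "lin_space U" "U \<subseteq> A" "A \<subseteq> B"
  shows "jumps U A zs = jumps U B zs \<Longrightarrow> B \<inter> cspan U zs \<subseteq> A"
proof (induction zs)
  case (Cons z zs)
  let ?a = "A \<inter> cspan U (z # zs) \<subseteq> cspan U zs" and ?b = "B \<inter> cspan U (z # zs) \<subseteq> cspan U zs"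
  note LU = cspan_lin_space[OF assms(3), of zs]
  have "jumps U A zs \<le> jumps U B zs" "?b \<Longrightarrow> ?a" using jumps_mono assms(5) by blast+
  then have eq: "jumps U A zs = jumps U B zs" "?a \<longleftrightarrow> ?b" using Cons.prems by (auto split: if_splits)
  have IH: "B \<inter> cspan U zs \<subseteq> A" by (rule Cons.IH[OF eq(1)])
  show ?case
  proof
    fix x assume x: "x \<in> B \<inter> cspan U (z # zs)"
    show "x \<in> A"
    proof (cases ?b)
      case True
      then show ?thesis using x IH by blast
    next
      case False
      then obtain y where y: "y \<in> A" "y \<in> cspan U (z # zs)" "y \<notin> cspan U zs" using eq(2) by blast
      obtain c where c: "y - fC c * z \<in> cspan U zs" using y(2) by (rule cspan_ConsE)
      then have c0: "c \<noteq> 0" using y(3) by (auto simp: fC_simps)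
      from x have "x \<in> cspan U (z # zs)" by simp
      then obtain d where d: "x - fC d * z \<in> cspan U zs" by (rule cspan_ConsE)
      have "x - fC (d / c) * y = (x - fC d * z) - fC (d / c) * (y - fC c * z)"
        using c0 by (simp add: right_diff_distrib fC_merge)
      also have "\<dots> \<in> cspan U zs" by (rule lin_spaceD(5)[OF LU d lin_spaceD(3)[OF LU c]])
      finally have "x - fC (d / c) * y \<in> cspan U zs" .
      moreover have "fC (d / c) * y \<in> A" by (rule lin_spaceD(3)[OF assms(1) y(1)])
      moreover from this have "x - fC (d / c) * y \<in> B" using lin_spaceD(5)[OF assms(2)] x assms(5) by blast
      ultimately show ?thesis using IH lin_space_diff_iff[OF assms(1)] by blast
    qed
  qed
qed (use assms in auto)

text \<open>Finite dimension of the quotient, which is how finite length arises here.\<close>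

definition finite_length :: "free_algebra set \<Rightarrow> bool" where
  "finite_length I \<longleftrightarrow> (\<exists>zs. cspan I zs = UNIV)"

definition adjacent :: "complex \<Rightarrow> free_algebra set \<Rightarrow> free_algebra set \<Rightarrow> bool" where
  "adjacent q A B \<longleftrightarrow> left_ideal q A \<and> left_ideal q B \<and> A \<subset> B \<and>
     (\<forall>S. left_ideal q S \<and> A \<subseteq> S \<and> S \<subseteq> B \<longrightarrow> S = A \<or> S = B)"

lemma jumps_measure:
  assumes "cspan I zs = UNIV" "left_ideal q I" "left_ideal q A" "left_ideal q B" "I \<subseteq> A" "A \<subset> B"
  shows "jumps I A zs < jumps I B zs"
proof -
  have "jumps I A zs \<le> jumps I B zs" using assms(6) by (intro jumps_mono) auto
  moreover have "jumps I A zs \<noteq> jumps I B zs"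
    using jumps_strict[of A B I zs] assms left_idealD(3) by auto
  ultimately show ?thesis by simp
qed

lemma left_ideal_UNIV: "left_ideal q UNIV"
  by (simp add: left_ideal_def)

lemma composition_chain:
  assumes I: "left_ideal q I" and f: "finite_length I"
  shows "\<exists>n C. C 0 = I \<and> C n = UNIV \<and> (\<forall>i<n. adjacent q (C i) (C (Suc i)))"
proof -
  obtain zs where zs: "cspan I zs = UNIV" using f by (auto simp: finite_length_def)
  have "\<exists>n C. C 0 = A \<and> C n = UNIV \<and> (\<forall>i<n. adjacent q (C i) (C (Suc i)))"
    if "left_ideal q A" "I \<subseteq> A" for A
    using that
  proof (induction "length zs - jumps I A zs" arbitrary: A rule: less_induct)
    case less
    show ?case
    proof (cases "A = UNIV")
      case True
      then show ?thesis by (intro exI[of _ 0] exI[of _ "\<lambda>_. A"]) simp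
    next
      case False
      define P where "P B \<longleftrightarrow> left_ideal q B \<and> A \<subset> B" for B
      have "P UNIV" using False by (auto simp: P_def left_ideal_UNIV)
      then obtain B where B: "P B" "\<And>S. P S \<Longrightarrow> jumps I B zs \<le> jumps I S zs"
        using ex_has_least_nat[of P UNIV "\<lambda>B. jumps I B zs"] by blast
      have lt: "jumps I A zs < jumps I B zs"
        using jumps_measure[OF zs I less.prems(1) _ less.prems(2)] B(1) by (auto simp: P_def)
      have adj: "adjacent q A B"
        unfolding adjacent_def
      proof (intro conjI allI impI)
        fix S assume S: "left_ideal q S \<and> A \<subseteq> S \<and> S \<subseteq> B"
        show "S = A \<or> S = B"
        proof (rule ccontr)
          assume n: "\<not> (S = A \<or> S = B)"
          then have "jumps I B zs \<le> jumps I S zs" using S by (intro B(2)) (auto simp: P_def)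
          moreover have "jumps I S zs < jumps I B zs"
            using jumps_measure[OF zs I, of S B] S n B(1) less.prems(2) by (auto simp: P_def)
          ultimately show False by simp
        qed
      qed (use B(1) less.prems in \<open>auto simp: P_def\<close>)
      have "length zs - jumps I B zs < length zs - jumps I A zs"
        using lt jumps_le[of I B zs] by simp
      then obtain n C where C: "C 0 = B" "C n = UNIV" "\<forall>i<n. adjacent q (C i) (C (Suc i))"
        using less.hyps[of B] B(1) less.prems(2) by (auto simp: P_def)
      let ?C = "\<lambda>i. case i of 0 \<Rightarrow> A | Suc j \<Rightarrow> C j"
      have "?C 0 = A \<and> ?C (Suc n) = UNIV \<and> (\<forall>i<Suc n. adjacent q (?C i) (?C (Suc i)))"
        using C adj by (auto split: nat.split)
      then show ?thesis by blast
    qed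
  qed
  then show ?thesis using I by blast
qed

text \<open>Let \<open>A'\<close> be maximal among the left ideals above \<open>A\<close> that avoid \<open>w\<close>. Then every left ideal above \<open>A'\<close> other than
  \<open>A'\<close> contains \<open>w\<close>, so \<open>w\<close> generates an irreducible submodule of the quotient by \<open>A'\<close>.\<close>

lemma maximal_colon_exists:
  assumes I: "left_ideal q I" and f: "finite_length I" and A: "left_ideal q A" "I \<subseteq> A" "w \<notin> A"
  shows "\<exists>A'. left_ideal q A' \<and> A \<subseteq> A' \<and> maximal_ideal q (colon A' w)"
proof -
  obtain zs where zs: "cspan I zs = UNIV" using f by (auto simp: finite_length_def)
  define P where "P B \<longleftrightarrow> left_ideal q B \<and> A \<subseteq> B \<and> w \<notin> B" for B
  have "P A" using A by (simp add: P_def)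
  then obtain B where B: "P B" "\<And>S. P S \<Longrightarrow> jumps I S zs \<le> jumps I B zs"
    using ex_has_greatest_nat[of P A "\<lambda>B. jumps I B zs" "Suc (length zs)"] jumps_le[of I _ zs]
    by (auto simp: less_Suc_eq_le)
  have lB: "left_ideal q B" "A \<subseteq> B" "w \<notin> B" using B(1) by (auto simp: P_def)
  have "maximal_ideal q (colon B w)"
    unfolding maximal_ideal_def
  proof (intro conjI allI impI)
    show "left_ideal q (colon B w)" by (rule colon_left_ideal[OF lB(1)])
    show "1 \<notin> colon B w" using lB(3) by (simp add: one_in_colon)
    fix J' assume "left_ideal q J' \<and> colon B w \<subseteq> J' \<and> 1 \<notin> J'"
    then have J': "left_ideal q J'" "colon B w \<subseteq> J'" "1 \<notin> J'" by auto
    let ?S = "{b + j * w | b j. b \<in> B \<and> j \<in> J'}"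
    note LB = left_idealD(3)[OF lB(1)] and LJ = left_idealD(3)[OF J'(1)]
    have BS: "B \<subseteq> ?S" using lin_spaceD(1)[OF LJ] by force
    have S: "left_ideal q ?S"
      unfolding left_ideal_def
    proof (intro conjI ballI allI)
      show "hecke_ideal q \<subseteq> ?S" using BS lB(1) by (auto simp: left_ideal_def)
      fix x a assume "x \<in> ?S"
      then obtain b j where x: "x = b + j * w" "b \<in> B" "j \<in> J'" by blast
      have "a * x = a * b + (a * j) * w" using x by (simp add: distrib_left mult.assoc)
      then show "a * x \<in> ?S" using left_idealD(2)[OF lB(1) x(2)] left_idealD(2)[OF J'(1) x(3)] by blast
      fix y assume "y \<in> ?S"
      then obtain b' j' where y: "y = b' + j' * w" "b' \<in> B" "j' \<in> J'" by blast
      have "x + y = (b + b') + (j + j') * w" using x y by (simp add: algebra_simps)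
      then show "x + y \<in> ?S" using lin_spaceD(2)[OF LB x(2) y(2)] lin_spaceD(2)[OF LJ x(3) y(3)] by blast
    qed
    have "w \<notin> ?S"
    proof
      assume "w \<in> ?S"
      then obtain b j where w: "w = b + j * w" "b \<in> B" "j \<in> J'" by blast
      then have "(1 - j) * w \<in> B" by (metis add_diff_cancel_right' left_diff_distrib mult_1_left)
      then have "1 - j \<in> J'" using J'(2) by (auto simp: colon_def)
      then have "(1 - j) + j \<in> J'" using w(3) by (rule lin_spaceD(2)[OF LJ])
      then show False using J'(3) by simp
    qed
    then have "P ?S" using S BS lB(2) by (auto simp: P_def)
    then have "jumps I ?S zs \<le> jumps I B zs" by (rule B(2))
    moreover have "I \<subseteq> B" using lB(2) A(2) by blast
    ultimately have "\<not> B \<subset> ?S" using jumps_measure[OF zs I lB(1) S] by linarith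
    then have "?S = B" using BS by blast
    then have "j * w \<in> B" if "j \<in> J'" for j
      using that lin_spaceD(1)[OF LB] by force
    then show "J' = colon B w" using J'(2) by (auto simp: colon_def)
  qed
  then show ?thesis using lB by blast
qed

section \<open>Modules generated by a weight vector\<close>

fun other :: "idx \<Rightarrow> idx" where "other I1 = I2" | "other I2 = I1"

lemma other_cases: "i = j \<or> i = other j" and other_other: "other (other i) = i"
  by (cases i; cases j; simp)+

fun letter :: "nat \<Rightarrow> idx \<Rightarrow> idx" where
  "letter 0 i = i"
| "letter (Suc k) i = other (letter k i)"

text \<open>Multiplying an alternating word by the generator it does not begin with gives a longer one, and multiplying by
  the other gives shorter ones by the quadratic relation. The braid relation closes the list at length six.\<close>

fun alt_word :: "nat \<Rightarrow> idx \<Rightarrow> free_algebra" where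
  "alt_word 0 i = 1"
| "alt_word (Suc k) i = fT (letter k i) * alt_word k i"

fun alt_words :: "nat \<Rightarrow> free_algebra list" where
  "alt_words 0 = [1]"
| "alt_words (Suc k) = alt_word (Suc k) I1 # alt_word (Suc k) I2 # alt_words k"

lemma alt_word_mem: "j \<le> k \<Longrightarrow> alt_word j i \<in> set (alt_words k)"
proof (induction k)
  case (Suc k)
  then show ?case by (cases "j = Suc k"; cases i) auto
qed simp

lemma alt_words_set: "z \<in> set (alt_words k) \<Longrightarrow> \<exists>j\<le>k. \<exists>i. z = alt_word j i"
proof (induction k)
  case (Suc k)
  have "z = alt_word (Suc k) I1 \<or> z = alt_word (Suc k) I2 \<or> z \<in> set (alt_words k)" using Suc.prems by auto
  then show ?case using Suc.IH le_SucI by blast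
qed simp

lemma lin_space_mod:
  "lin_space U \<Longrightarrow> I \<subseteq> U \<Longrightarrow> x - y \<in> I \<Longrightarrow> y \<in> U \<Longrightarrow> x \<in> U"
  using lin_space_diff_iff[of U x y] by (simp add: subset_iff)

context
  fixes q :: complex and I :: "free_algebra set"
  assumes I: "left_ideal q I"
begin

lemma ideal_spaces: "lin_space I" "x_space q I"
  using left_idealD[OF I] by auto

lemma word_span: "lin_space (cspan I zs)" "I \<subseteq> cspan I zs" "z \<in> set zs \<Longrightarrow> z \<in> cspan I zs"
  by (rule cspan_lin_space[OF ideal_spaces(1)], rule cspan_base[OF ideal_spaces(1)], rule cspan_mem[OF ideal_spaces(1)])

lemma word_span_mod: "x - y \<in> I \<Longrightarrow> y \<in> cspan I zs \<Longrightarrow> x \<in> cspan I zs"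
  by (rule lin_space_mod[OF word_span(1,2)])

lemma word_span_comb:
  assumes "x - (fC c * y + z) \<in> I" "y \<in> cspan I zs" "z \<in> cspan I zs"
  shows "x \<in> cspan I zs"
  by (rule word_span_mod[OF assms(1) lin_spaceD(2)[OF word_span(1) lin_spaceD(3)[OF word_span(1) assms(2)] assms(3)]])

lemma alt_word_step: "fT i * alt_word j i' \<in> cspan I (alt_words (Suc j))"
proof (cases "i = letter j i'")
  case True
  then show ?thesis using word_span(3)[OF alt_word_mem[of "Suc j" "Suc j" i']] by simp
next
  case False
  show ?thesis
  proof (cases j)
    case 0
    then show ?thesis using word_span(3)[OF alt_word_mem[of "Suc 0" "Suc j" i]] by simp
  next
    case (Suc k)
    have i: "i = letter k i'" using False Suc other_cases[of i "letter k i'"] by simp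
    have "fT i * alt_word j i' - (fC (q - inverse q) * alt_word j i' + alt_word k i') \<in> I"
      using left_idealD(1)[OF I hecke_ideal_relations(3)[of i "alt_word k i'"]] by (simp add: Suc i)
    moreover have "alt_word j i' \<in> cspan I (alt_words (Suc j))" "alt_word k i' \<in> cspan I (alt_words (Suc j))"
      by (rule word_span(3), rule alt_word_mem, simp add: Suc)+
    ultimately show ?thesis by (rule word_span_comb)
  qed
qed

lemma alt_words_mono: "j \<le> k \<Longrightarrow> cspan I (alt_words j) \<subseteq> cspan I (alt_words k)"
proof (rule cspan_subset[OF word_span(1) word_span(2)], rule subsetI)
  fix z assume "j \<le> k" "z \<in> set (alt_words j)"
  then obtain l i where "l \<le> k" "z = alt_word l i" using alt_words_set by (meson le_trans)
  then show "z \<in> cspan I (alt_words k)" by (simp add: word_span(3) alt_word_mem)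
qed

lemma alt_words_T: "x \<in> cspan I (alt_words k) \<Longrightarrow> fT i * x \<in> cspan I (alt_words (Suc k))"
proof (rule cspan_image_subset[OF word_span(1)])
  show "fT i * x \<in> cspan I (alt_words (Suc k))" if "x \<in> I" for x
    using left_idealD(2)[OF I that] word_span(2) by blast
  fix z assume "z \<in> set (alt_words k)"
  then obtain j i' where "j \<le> k" "z = alt_word j i'" using alt_words_set by blast
  then show "fT i * z \<in> cspan I (alt_words (Suc k))"
    using alt_word_step[of i j i'] alt_words_mono[of "Suc j" "Suc k"] by auto
qed

lemma alt_words_all: "cspan I (alt_words 6) = UNIV" if one: "x_space q (cspan I (alt_words 6))"
proof -
  let ?S = "cspan I (alt_words 6)"
  have six: "alt_word 6 I2 - alt_word 6 I1 \<in> I"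
    using left_idealD(1)[OF I hecke_ideal_relations(4)[of 1]] by (simp add: eval_nat_numeral)
  have T6: "fT i * alt_word 6 i' \<in> ?S" for i i'
  proof -
    have *: "fT j * alt_word 6 j \<in> ?S" if that: "alt_word 6 j - alt_word 6 (other j) \<in> I" for j
    proof -
      have "fT j * alt_word 6 j - fT j * alt_word 6 (other j) \<in> I"
        using left_idealD(2)[OF I that, of "fT j"] by (simp add: right_diff_distrib)
      moreover have "fT j * alt_word 6 (other j) \<in> ?S"
      proof -
        have e: "alt_word 6 (other j) = fT j * alt_word 5 (other j)"
          by (simp add: eval_nat_numeral other_other)
        have "fT j * alt_word 6 (other j) - (fC (q - inverse q) * alt_word 6 (other j) + alt_word 5 (other j)) \<in> I"
          using left_idealD(1)[OF I hecke_ideal_relations(3)[of j "alt_word 5 (other j)"]] by (simp add: e)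
        moreover have "alt_word 6 (other j) \<in> ?S" "alt_word 5 (other j) \<in> ?S"
          by (rule word_span(3), rule alt_word_mem, simp)+
        ultimately show ?thesis by (rule word_span_comb)
      qed
      ultimately show ?thesis by (rule word_span_mod)
    qed
    have minus: "alt_word 6 I1 - alt_word 6 I2 \<in> I" using lin_spaceD(4)[OF ideal_spaces(1) six] by simp
    have d: "alt_word 6 j - alt_word 6 (other j) \<in> I" for j
      using six minus by (cases j) simp_all
    have same: "fT j * alt_word 6 j \<in> ?S" for j by (rule *[OF d])
    have opp: "fT j * alt_word 6 (other j) \<in> ?S" for j
    proof (rule word_span_mod[OF _ same[of j]])
      have "fT j * (alt_word 6 (other j) - alt_word 6 j) \<in> I"
        using left_idealD(2)[OF I d[of "other j"]] by (simp add: other_other)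
      then show "fT j * alt_word 6 (other j) - fT j * alt_word 6 j \<in> I" by (simp add: right_diff_distrib)
    qed
    show ?thesis
    proof (cases "i' = i")
      case True
      then show ?thesis using same by simp
    next
      case False
      then have "i' = other i" using other_cases by blast
      then show ?thesis using opp by simp
    qed
  qed
  have "left_ideal q ?S"
  proof (rule left_ideal_of_generators[OF one])
    fix i x assume x: "x \<in> ?S"
    show "fT i * x \<in> ?S"
    proof (rule cspan_image_subset[OF word_span(1) _ _ x])
      show "fT i * y \<in> ?S" if "y \<in> I" for y using left_idealD(2)[OF I that] word_span(2) by blast
      fix z assume "z \<in> set (alt_words 6)"
      then obtain j i' where j: "j \<le> 6" "z = alt_word j i'" using alt_words_set by blast
      show "fT i * z \<in> ?S"
      proof (cases "j = 6")
        case True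
        then show ?thesis using T6 j by simp
      next
        case False
        then show ?thesis using j alt_word_step[of i j i'] alt_words_mono[of "Suc j" 6] by auto
      qed
    qed
  qed
  moreover have "1 \<in> ?S" using word_span(3)[OF alt_word_mem[of 0 6]] by simp
  ultimately show ?thesis using left_idealD(2)[of q ?S 1] by auto
qed

lemma weight_of_image:
  assumes U: "lin_space U" and U': "x_space q U'" and z: "wt U s z" "z \<in> U'"
    and TU: "\<And>x. x \<in> U \<Longrightarrow> fT i * x \<in> U'"
  shows "wt U' (s \<circ> simple_reflection i) (fT i * z)"
  unfolding wt_def
proof
  fix \<nu>
  let ?s = "simple_reflection i"
  note L = x_spaceD(2)[OF U']
  define A where "A = fX \<nu> * (fT i * z) - (fT i * (fX (?s \<nu>) * z) + fC (q - inverse q) * (group_algebra_lift (divided_difference i \<nu>) * z))"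
  define B where "B = fX (?s \<nu>) * z - fC (s (?s \<nu>)) * z"
  have lift: "group_algebra_lift f * z \<in> U'" for f
  proof (induction f rule: poly_mapping_add_induct)
    case (single \<mu> c)
    have "group_algebra_lift (Poly_Mapping.single \<mu> c) = fC c * fX \<mu>"
      unfolding group_algebra_lift_pm_extend by (rule pm_extend_single) (simp add: fC_simps)
    then show ?case using lin_spaceD(3)[OF L x_spaceD(3)[OF U' z(2)]] by (simp add: mult.assoc)
  next
    case (add f g)
    have "group_algebra_lift (f + g) = group_algebra_lift f + group_algebra_lift g"
      unfolding group_algebra_lift_pm_extend by (rule pm_extend_add) (simp_all add: fC_simps distrib_right)
    then show ?case using add lin_spaceD(2)[OF L] by (simp add: distrib_right)
  qed (simp add: group_algebra_lift_pm_extend lin_spaceD(1)[OF L])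
  have "fX \<nu> * (fT i * z) - fC ((s \<circ> ?s) \<nu>) * (fT i * z) =
    A + fT i * B + fC (q - inverse q) * (group_algebra_lift (divided_difference i \<nu>) * z)"
    by (simp add: A_def B_def right_diff_distrib fC_move)
  moreover have "A \<in> U'" unfolding A_def by (rule x_spaceD(1)[OF U' hecke_ideal_relations(5)])
  moreover have "fT i * B \<in> U'" using z(1) unfolding B_def by (intro TU) (simp add: wt_def)
  ultimately show "fX \<nu> * (fT i * z) - fC ((s \<circ> ?s) \<nu>) * (fT i * z) \<in> U'"
    using lift lin_spaceD(2,3)[OF L] by simp
qed

text \<open>The alternating words, ordered by length, form a flag: by the cross relation each \<open>T\<^sub>i\<close> reflects the weight of
  the word to its right, modulo shorter words.\<close>

lemma weight_flag:
  assumes w: "wt I s 1" "s \<in> Om" and Om: "\<And>s i. s \<in> Om \<Longrightarrow> s \<circ> simple_reflection i \<in> Om"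
  shows "\<exists>zs. flag I zs \<and> cspan I (map fst zs) = UNIV \<and> snd ` set zs \<subseteq> Om"
proof -
  have "\<exists>zs. map fst zs = alt_words k \<and> flag I zs \<and> snd ` set zs \<subseteq> Om \<and>
      (\<forall>i. \<exists>r\<in>Om. wt (if k = 0 then I else cspan I (alt_words (k - 1))) r (alt_word k i))" for k
  proof (induction k)
    case 0
    show ?case using w by (intro exI[of _ "[(1, s)]"]) auto
  next
    case (Suc k)
    then obtain zs where zs: "map fst zs = alt_words k" "flag I zs" "snd ` set zs \<subseteq> Om"
      and step: "\<And>i. \<exists>r\<in>Om. wt (if k = 0 then I else cspan I (alt_words (k - 1))) r (alt_word k i)" by blast
    have X: "x_space q (cspan I (alt_words k))" using flag_x_space[OF ideal_spaces(2) zs(2)] zs(1) by simp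
    have new: "\<exists>r\<in>Om. wt (cspan I (alt_words k)) r (alt_word (Suc k) i)" for i
    proof -
      obtain r where r: "r \<in> Om" "wt (if k = 0 then I else cspan I (alt_words (k - 1))) r (alt_word k i)"
        using step by blast
      have "wt (cspan I (alt_words k)) (r \<circ> simple_reflection (letter k i)) (fT (letter k i) * alt_word k i)"
      proof (rule weight_of_image[OF _ X r(2)])
        show "lin_space (if k = 0 then I else cspan I (alt_words (k - 1)))" using ideal_spaces word_span by simp
        show "alt_word k i \<in> cspan I (alt_words k)" by (rule word_span(3)[OF alt_word_mem]) simp
        show "fT (letter k i) * x \<in> cspan I (alt_words k)" if "x \<in> (if k = 0 then I else cspan I (alt_words (k - 1)))" for x
        proof (cases k)
          case 0
          then show ?thesis using that left_idealD(2)[OF I] word_span(2) by auto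
        next
          case (Suc j)
          then show ?thesis using that alt_words_T[of x j] by (simp del: alt_words.simps)
        qed
      qed
      then show ?thesis using Om[OF r(1)] by auto
    qed
    obtain r1 r2 where r: "r1 \<in> Om" "wt (cspan I (alt_words k)) r1 (alt_word (Suc k) I1)"
      "r2 \<in> Om" "wt (cspan I (alt_words k)) r2 (alt_word (Suc k) I2)" using new by meson
    let ?zs = "(alt_word (Suc k) I1, r1) # (alt_word (Suc k) I2, r2) # zs"
    have "set (alt_words k) \<subseteq> cspan I (alt_word (Suc k) I2 # alt_words k)"
      by (rule subsetI, rule word_span(3)) simp
    then have "wt (cspan I (alt_word (Suc k) I2 # alt_words k)) r1 (alt_word (Suc k) I1)"
      by (rule wt_mono[OF r(2) cspan_subset[OF word_span(1,2)]])
    then have "flag I ?zs" using r(4) zs(1,2) by (simp del: alt_word.simps)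
    moreover have "map fst ?zs = alt_words (Suc k)" using zs(1) by (simp del: alt_word.simps)
    moreover have "snd ` set ?zs \<subseteq> Om" using r zs(3) by auto
    ultimately show ?case using new by (intro exI[of _ ?zs]) (simp del: alt_word.simps)
  qed
  from this[of 6] obtain zs where zs: "map fst zs = alt_words 6" "flag I zs" "snd ` set zs \<subseteq> Om" by blast
  then have "cspan I (map fst zs) = UNIV" using alt_words_all flag_x_space[OF ideal_spaces(2) zs(2)] by simp
  then show ?thesis using zs by blast
qed

end

context hecke_param begin

definition orbit :: "(lattice \<Rightarrow> complex) set" where "orbit = {r0, r1, r2, r3, r4, r5}"

lemma orbit_reflection: "s \<in> orbit \<Longrightarrow> s \<circ> simple_reflection i \<in> orbit"
  unfolding orbit_def by (cases i) (auto simp: r_reflection)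

lemma orbit_flag:
  assumes "left_ideal q I" "wt I s 1" "s \<in> orbit"
  shows "\<exists>zs. flag I zs \<and> cspan I (map fst zs) = UNIV \<and> snd ` set zs \<subseteq> orbit"
  by (rule weight_flag[OF assms]) (rule orbit_reflection)

section \<open>Consequences of the module of dimension twelve\<close>

definition e0 :: "dual \<times> dual \<times> dual \<times> dual \<times> dual \<times> dual" where "e0 = (Dual 0 1, 0, 0, 0, 0, 0)"

lemma act_all: "\<exists>a. V.act a e0 = v"
proof -
  let ?S = "{v. \<exists>a. V.act a e0 = v}"
  have "v \<in> ?S"
  proof (rule generation12)
    show "(Dual 0 1, 0, 0, 0, 0, 0) \<in> ?S"
      using V.act_generators(4)[of e0] unfolding e0_def[symmetric] by blast
    show "v + w \<in> ?S" if v: "v \<in> ?S" and w: "w \<in> ?S" for v w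
    proof -
      from v w obtain a b where "V.act a e0 = v" "V.act b e0 = w" by blast
      then have "V.act (a + b) e0 = v + w" by (simp add: V.act_add)
      then show ?thesis by blast
    qed
    show "sc12 k v \<in> ?S" if v: "v \<in> ?S" for k v
    proof -
      from v obtain a where "V.act a e0 = v" by blast
      then have "V.act (fC k * a) e0 = sc12 k v" by (simp add: V.act_mult V.act_generators)
      then show ?thesis by blast
    qed
    show "T12 i v \<in> ?S" if v: "v \<in> ?S" for i v
    proof -
      from v obtain a where "V.act a e0 = v" by blast
      then have "V.act (fT i * a) e0 = T12 i v" by (simp add: V.act_mult V.act_generators)
      then show ?thesis by blast
    qed
  qed
  then show ?thesis by blast
qed

lemma model_left_ideal:
  assumes "0 \<in> K" "\<And>v w. v \<in> K \<Longrightarrow> w \<in> K \<Longrightarrow> v + w \<in> K" "\<And>c v. v \<in> K \<Longrightarrow> sc12 c v \<in> K"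
    "\<And>i v. v \<in> K \<Longrightarrow> T12 i v \<in> K" "\<And>\<nu> v. v \<in> K \<Longrightarrow> X12 \<nu> v \<in> K"
  shows "left_ideal q {a. V.act a e0 \<in> K}"
proof -
  let ?S = "{a. V.act a e0 \<in> K}"
  have "a * x \<in> ?S" if "x \<in> ?S" for a x
    by (rule free_algebra_closed) (use that assms in \<open>auto simp: V.act_add V.act_zero V.act_mult V.act_generators\<close>)
  then show ?thesis
    using assms(1,2) by (auto simp: left_ideal_def V.act_add V.act_hecke_ideal)
qed

text \<open>The submodule of the model whose quotient is \<open>M\<close>. It is stable because the scalars of the outer edges are
  nilpotent.\<close>

definition K :: "(dual \<times> dual \<times> dual \<times> dual \<times> dual \<times> dual) set" where
  "K = {(a, b, c, d, e, f). a = 0 \<and> std b = 0 \<and> std c = 0 \<and> std d = 0 \<and> std e = 0}"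

text \<open>If \<open>cG\<close> vanishes, \<open>T\<^sub>2\<close> does not lead from the third coordinate back to the second one, and \<open>K\<close> can be made
  smaller.\<close>

definition K2 :: "(dual \<times> dual \<times> dual \<times> dual \<times> dual \<times> dual) set" where
  "K2 = {(a, b, c, d, e, f). a = 0 \<and> b = 0 \<and> std c = 0 \<and> std d = 0 \<and> std e = 0}"

lemma K_iff:
  "(a, b, c, d, e, f) \<in> K \<longleftrightarrow> a = 0 \<and> std b = 0 \<and> std c = 0 \<and> std d = 0 \<and> std e = 0" "0 \<in> K"
  "(a, b, c, d, e, f) \<in> K2 \<longleftrightarrow> a = 0 \<and> b = 0 \<and> std c = 0 \<and> std d = 0 \<and> std e = 0" "0 \<in> K2"
  "(0, Dual 0 1, 0) \<in> K" "(0, 0, Dual 0 1, 0) \<in> K2"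
  unfolding K_def K2_def zero_prod_def by simp_all

lemma std_eps: "std x = 0 \<Longrightarrow> std y = 0 \<Longrightarrow> x * y = 0"
  by (simp add: dual_eq_iff)

lemma off_std: "std (off d0) = 0" "std (off d4) = 0" "std (off d1) = cG" "std (off d3) = cG"
  using q0 p0 by (simp_all add: off_def d0_def d4_def d1_def d3_def cG_def p_def field_simps)

lemma K_left_ideal: "left_ideal q {a. V.act a e0 \<in> K}"
proof (rule model_left_ideal)
  show "T12 i v \<in> K" if "v \<in> K" for i v
    using that by (cases v; cases i) (auto simp: K_iff std_eps off_std simp flip: zero_dual_def)
qed (auto simp: K_iff)

lemma K2_left_ideal:
  assumes "cG = 0"
  shows "left_ideal q {a. V.act a e0 \<in> K2}"
proof (rule model_left_ideal)
  show "T12 i v \<in> K2" if "v \<in> K2" for i v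
    using that by (cases v; cases i) (auto simp: K_iff std_eps off_std assms simp flip: zero_dual_def)
qed (auto simp: K_iff)

lemma std_x: "std (x0 \<nu>) = r0 \<nu>" "std (x1 \<nu>) = r1 \<nu>" "std (x5 \<nu>) = r5 \<nu>"
  by (simp_all add: x_defs r_defs theta_def)

text \<open>The first basis vector generates a copy of \<open>M\<close> in the quotient of the model by \<open>K\<close>, and there the last vector
  of the chain is visibly nonzero.\<close>

lemma model_A:
  "\<exists>J. left_ideal q J \<and> type_A q J 1 \<and> 1 \<notin> J \<and> b4 \<notin> J"
proof (intro exI conjI)
  let ?J = "{a. V.act a e0 \<in> K}"
  show "left_ideal q ?J" by (rule K_left_ideal)
  have "x0 \<nu> * Dual 0 1 - dC (r0 \<nu>) * Dual 0 1 = 0" for \<nu> by (simp add: dual_eq_iff std_x)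
  then have "wt ?J r0 1"
    by (simp add: wt_def V.act_diff V.act_mult V.act_generators e0_def K_iff)
  moreover have "d0 * Dual 0 1 = dC q * Dual 0 1" by (simp add: dual_eq_iff d0_def)
  then have "fT I1 * 1 - fC q * 1 \<in> ?J"
    by (simp add: V.act_diff V.act_mult V.act_generators e0_def K_iff)
  ultimately show "type_A q ?J 1" by (simp add: type_A_def r0_def)
  show "1 \<notin> ?J" by (simp add: V.act_generators e0_def K_iff zero_dual_def)
  show "b4 \<notin> ?J"
    using p0 by (simp add: b4_def b3_def b2_def b1_def V.act_diff V.act_mult V.act_generators e0_def K_iff dual_eq_iff)
qed

text \<open>The last coordinate of the model contains a vector with the relations of the generator of \<open>N\<close>.\<close>

lemma model_swapped_A:
  "\<exists>A w. left_ideal q A \<and> wt A r0 1 \<and> w \<notin> A \<and> type_A (- inverse q) A w"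
proof -
  obtain w where w: "V.act w e0 = (0, 0, 0, 0, 0, Dual 0 1)" using act_all by blast
  let ?A = "{a. V.act a e0 \<in> {0}}"
  have "left_ideal q ?A"
    by (rule model_left_ideal) (auto simp: linear12 zero_prod_def V.act_zero T12.simps(1), case_tac i, auto simp flip: zero_dual_def)
  moreover have "x0 \<nu> * Dual 0 1 - dC (r0 \<nu>) * Dual 0 1 = 0" for \<nu> by (simp add: dual_eq_iff std_x)
  then have "wt ?A r0 1"
    by (simp add: wt_def V.act_diff V.act_mult V.act_generators e0_def zero_prod_def)
  moreover have "w \<notin> ?A" by (simp add: w zero_prod_def zero_dual_def)
  moreover have "x5 \<nu> * Dual 0 1 - dC (r5 \<nu>) * Dual 0 1 = 0" for \<nu> by (simp add: dual_eq_iff std_x)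
  then have "wt ?A r5 w"
    by (simp add: wt_def V.act_diff V.act_mult V.act_generators w zero_prod_def)
  moreover have "off d4 * Dual 0 1 = 0" by (simp add: dual_eq_iff off_std)
  moreover have "(dC p - d4) * Dual 0 1 - dC (- inverse q) * Dual 0 1 = 0" by (simp add: dual_eq_iff d4_def p_def)
  ultimately have "left_ideal q ?A \<and> wt ?A r0 1 \<and> w \<notin> ?A \<and> type_A (- inverse q) ?A w"
    by (simp add: type_A_def r5_def power_inverse V.act_diff V.act_mult V.act_generators w zero_prod_def)
  then show ?thesis by blast
qed

text \<open>If \<open>cG\<close> vanishes, the nilpotent vector in the second coordinate becomes, modulo \<open>K2\<close>, an eigenvector of both
  generators.\<close>

lemma model_swapped_B:
  assumes "q ^ 4 = - 1"
  shows "\<exists>A w. left_ideal q A \<and> wt A r0 1 \<and> w \<notin> A \<and> type_B (- inverse q) A w"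
proof -
  have c: "cG = 0" using assms cG_zero_iff by simp
  obtain w where w: "V.act w e0 = (0, Dual 0 1, 0, 0, 0, 0)" using act_all by blast
  let ?A = "{a. V.act a e0 \<in> K2}"
  have "left_ideal q ?A" by (rule K2_left_ideal[OF c])
  moreover have "x0 \<nu> * Dual 0 1 - dC (r0 \<nu>) * Dual 0 1 = 0" for \<nu> by (simp add: dual_eq_iff std_x)
  then have "wt ?A r0 1"
    by (simp add: wt_def V.act_diff V.act_mult V.act_generators e0_def K_iff)
  moreover have "w \<notin> ?A" by (simp add: w K_iff zero_dual_def)
  moreover have "x1 \<nu> * Dual 0 1 - dC (r1 \<nu>) * Dual 0 1 = 0" for \<nu> by (simp add: dual_eq_iff std_x)
  then have "wt ?A r1 w"
    by (simp add: wt_def V.act_diff V.act_mult V.act_generators w K_iff)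
  moreover have "off d0 * Dual 0 1 = 0" by (simp add: dual_eq_iff off_std)
  moreover have "(dC p - d0) * Dual 0 1 - dC (- inverse q) * Dual 0 1 = 0" by (simp add: dual_eq_iff d0_def p_def)
  moreover have "d1 * Dual 0 1 - dC (- inverse q) * Dual 0 1 = 0"
    by (simp add: dual_eq_iff d1_def G_special[OF assms])
  ultimately have "left_ideal q ?A \<and> wt ?A r0 1 \<and> w \<notin> ?A \<and> (fT I1 * w - fC (- inverse q) * w \<in> ?A)
      \<and> (fT I2 * w - fC (- inverse q) * w \<in> ?A) \<and> wt ?A r1 w"
    by (simp add: V.act_diff V.act_mult V.act_generators w K_iff flip: zero_dual_def)
  moreover have "(\<forall>i. P i) \<longleftrightarrow> P I1 \<and> P I2" for P by (metis idx.exhaust)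
  ultimately have "left_ideal q ?A \<and> wt ?A r0 1 \<and> w \<notin> ?A \<and> type_B (- inverse q) ?A w"
    by (simp add: type_B_def r1_def power_inverse)
  then show ?thesis by blast
qed

end

section \<open>Presenting modules by left ideals\<close>

definition cl :: "complex \<Rightarrow> free_algebra \<Rightarrow> hecke" where
  "cl q a = hecke_ideal q +>\<^bsub>type_ring\<^esub> a"

lemma cl_generators: "hC q c = cl q (fC c)" "hT q i = cl q (fT i)" "hX q \<nu> = cl q (fX \<nu>)"
  by (simp_all add: hC_def hT_def hX_def cl_def)

lemma cl_altdef: "cl q a = {x + a | x. x \<in> hecke_ideal q}"
  by (auto simp: cl_def a_r_coset_def r_coset_def type_ring_def)

lemma hecke_carrier: "carrier (hecke_algebra q) = range (cl q)"
  by (auto simp: hecke_algebra_def FactRing_def A_RCOSETS_def RCOSETS_def cl_def a_r_coset_def type_ring_def)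

lemma cl_closed: "cl q a \<in> carrier (hecke_algebra q)"
  by (simp add: hecke_carrier)

lemma cl_ring:
  "cl q a \<oplus>\<^bsub>hecke_algebra q\<^esub> cl q b = cl q (a + b)"
  "cl q a \<otimes>\<^bsub>hecke_algebra q\<^esub> cl q b = cl q (a * b)"
  "\<one>\<^bsub>hecke_algebra q\<^esub> = cl q 1" "\<zero>\<^bsub>hecke_algebra q\<^esub> = cl q 0"
proof -
  interpret ideal "hecke_ideal q" type_ring by (rule ideal_hecke_ideal)
  show "cl q a \<oplus>\<^bsub>hecke_algebra q\<^esub> cl q b = cl q (a + b)"
    using a_rcos_sum[of a b] by (simp add: hecke_algebra_def FactRing_def cl_def type_ring_def)
  show "cl q a \<otimes>\<^bsub>hecke_algebra q\<^esub> cl q b = cl q (a * b)"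
    using rcoset_mult_add[of a b] by (simp add: hecke_algebra_def FactRing_def cl_def type_ring_def)
  show "\<one>\<^bsub>hecke_algebra q\<^esub> = cl q 1" by (simp add: hecke_algebra_def FactRing_def cl_def type_ring_def)
  show "\<zero>\<^bsub>hecke_algebra q\<^esub> = cl q 0" by (simp add: hecke_algebra_def FactRing_def cl_altdef)
qed

lemma cl_eq_iff: "cl q a = cl q b \<longleftrightarrow> a - b \<in> hecke_ideal q"
proof
  assume "cl q a = cl q b"
  moreover have "a \<in> cl q a" using hecke_ideal_closed(1)[of q] by (force simp: cl_altdef)
  ultimately show "a - b \<in> hecke_ideal q" by (auto simp: cl_altdef)
next
  assume d: "a - b \<in> hecke_ideal q"
  have m: "- (a - b) \<in> hecke_ideal q" using hecke_ideal_closed(3)[OF d, of "- 1"] by simp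
  have "x + a \<in> cl q b" if "x \<in> hecke_ideal q" for x
    unfolding cl_altdef using hecke_ideal_closed(2)[OF that d] by (force intro: exI[of _ "x + (a - b)"])
  moreover have "x + b \<in> cl q a" if "x \<in> hecke_ideal q" for x
    unfolding cl_altdef using hecke_ideal_closed(2)[OF that m] by (force intro: exI[of _ "x + - (a - b)"])
  ultimately show "cl q a = cl q b" by (auto simp: cl_altdef[of q a] cl_altdef[of q b])
qed

lemma cl_minus: "\<ominus>\<^bsub>hecke_algebra q\<^esub> cl q a = cl q (- a)"
proof -
  interpret ring "hecke_algebra q" by (rule ring_hecke_algebra)
  have "cl q (- a) \<oplus>\<^bsub>hecke_algebra q\<^esub> cl q a = \<zero>\<^bsub>hecke_algebra q\<^esub>" by (simp add: cl_ring)
  then show ?thesis using minus_equality cl_closed by blast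
qed

text \<open>The map \<open>\<rho>\<close> identifies \<open>D\<close> with the subquotient \<open>B / A\<close> of the free algebra. All modules below are handled
  through such presentations, where computations are done with representatives in a ring type.\<close>

definition presents :: "complex \<Rightarrow> free_algebra set \<Rightarrow> free_algebra set \<Rightarrow> (hecke, 'm) module \<Rightarrow> (free_algebra \<Rightarrow> 'm) \<Rightarrow> bool" where
  "presents q B A D \<rho> \<longleftrightarrow> left_ideal q A \<and> left_ideal q B \<and> A \<subseteq> B \<and> \<rho> ` B = carrier D \<and> \<zero>\<^bsub>D\<^esub> = \<rho> 0 \<and>
     (\<forall>x\<in>B. \<forall>y\<in>B. \<rho> (x + y) = \<rho> x \<oplus>\<^bsub>D\<^esub> \<rho> y) \<and> (\<forall>a. \<forall>x\<in>B. \<rho> (a * x) = cl q a \<odot>\<^bsub>D\<^esub> \<rho> x) \<and>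
     (\<forall>x\<in>B. \<rho> x = \<rho> 0 \<longleftrightarrow> x \<in> A)"

lemma left_module_of_surjection:
  assumes B: "left_ideal q B" and im: "\<rho> ` B = carrier D" and z: "\<zero>\<^bsub>D\<^esub> = \<rho> 0"
    and add: "\<And>x y. x \<in> B \<Longrightarrow> y \<in> B \<Longrightarrow> \<rho> (x + y) = \<rho> x \<oplus>\<^bsub>D\<^esub> \<rho> y"
    and sm: "\<And>a x. x \<in> B \<Longrightarrow> \<rho> (a * x) = cl q a \<odot>\<^bsub>D\<^esub> \<rho> x"
  shows "left_module (hecke_algebra q) D"
proof -
  note L = lin_spaceD[OF left_idealD(3)[OF B]]
  have c: "\<rho> x \<in> carrier D" if "x \<in> B" for x using im that by blast
  have ab: "abelian_group D"
  proof (rule abelian_groupI)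
    fix u v w assume "u \<in> carrier D" "v \<in> carrier D" "w \<in> carrier D"
    then obtain x y y' where [simp]: "u = \<rho> x" "v = \<rho> y" "w = \<rho> y'" and m: "x \<in> B" "y \<in> B" "y' \<in> B"
      unfolding im[symmetric] by blast
    show "u \<oplus>\<^bsub>D\<^esub> v \<in> carrier D" using m c L(2) by (simp flip: add)
    show "u \<oplus>\<^bsub>D\<^esub> v \<oplus>\<^bsub>D\<^esub> w = u \<oplus>\<^bsub>D\<^esub> (v \<oplus>\<^bsub>D\<^esub> w)" using m L(2) by (simp add: add.assoc flip: add)
    show "u \<oplus>\<^bsub>D\<^esub> v = v \<oplus>\<^bsub>D\<^esub> u" using m by (simp add: add.commute flip: add)
    show "\<zero>\<^bsub>D\<^esub> \<oplus>\<^bsub>D\<^esub> u = u" using m L(1) by (simp add: z flip: add)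
    have "\<rho> (- x) \<oplus>\<^bsub>D\<^esub> u = \<zero>\<^bsub>D\<^esub>" using m L(4) by (simp add: z flip: add)
    then show "\<exists>v\<in>carrier D. v \<oplus>\<^bsub>D\<^esub> u = \<zero>\<^bsub>D\<^esub>" using c L(4) m by blast
  next
    show "\<zero>\<^bsub>D\<^esub> \<in> carrier D" using c L(1) by (simp add: z)
  qed
  show ?thesis
  proof (intro left_module.intro left_module_axioms.intro ring_hecke_algebra ab)
    fix r s u v assume "r \<in> carrier (hecke_algebra q)" "u \<in> carrier D"
    then obtain a x where [simp]: "r = cl q a" "u = \<rho> x" and x: "x \<in> B"
      unfolding hecke_carrier im[symmetric] by blast
    show "r \<odot>\<^bsub>D\<^esub> u \<in> carrier D" using x c left_idealD(2)[OF B] by (simp flip: sm)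
    show "r \<odot>\<^bsub>D\<^esub> (u \<oplus>\<^bsub>D\<^esub> v) = r \<odot>\<^bsub>D\<^esub> u \<oplus>\<^bsub>D\<^esub> r \<odot>\<^bsub>D\<^esub> v" if "v \<in> carrier D"
    proof -
      from that obtain y where [simp]: "v = \<rho> y" and y: "y \<in> B" unfolding im[symmetric] by blast
      have "r \<odot>\<^bsub>D\<^esub> (u \<oplus>\<^bsub>D\<^esub> v) = \<rho> (a * (x + y))" using x y L(2) by (simp add: sm add)
      also have "\<dots> = \<rho> (a * x + a * y)" by (simp add: distrib_left)
      also have "\<dots> = r \<odot>\<^bsub>D\<^esub> u \<oplus>\<^bsub>D\<^esub> r \<odot>\<^bsub>D\<^esub> v" using x y left_idealD(2)[OF B] by (simp add: sm add)
      finally show ?thesis .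
    qed
    assume "s \<in> carrier (hecke_algebra q)"
    then obtain b where [simp]: "s = cl q b" unfolding hecke_carrier by blast
    have "(r \<oplus>\<^bsub>hecke_algebra q\<^esub> s) \<odot>\<^bsub>D\<^esub> u = \<rho> (a * x + b * x)"
      using x by (simp add: cl_ring flip: sm distrib_right)
    also have "\<dots> = r \<odot>\<^bsub>D\<^esub> u \<oplus>\<^bsub>D\<^esub> s \<odot>\<^bsub>D\<^esub> u" using x left_idealD(2)[OF B] by (simp add: sm add)
    finally show "(r \<oplus>\<^bsub>hecke_algebra q\<^esub> s) \<odot>\<^bsub>D\<^esub> u = r \<odot>\<^bsub>D\<^esub> u \<oplus>\<^bsub>D\<^esub> s \<odot>\<^bsub>D\<^esub> u" .
    have "(r \<otimes>\<^bsub>hecke_algebra q\<^esub> s) \<odot>\<^bsub>D\<^esub> u = \<rho> (a * (b * x))"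
      using x by (simp add: cl_ring mult.assoc flip: sm)
    also have "\<dots> = r \<odot>\<^bsub>D\<^esub> (s \<odot>\<^bsub>D\<^esub> u)" using x left_idealD(2)[OF B] by (simp add: sm)
    finally show "(r \<otimes>\<^bsub>hecke_algebra q\<^esub> s) \<odot>\<^bsub>D\<^esub> u = r \<odot>\<^bsub>D\<^esub> (s \<odot>\<^bsub>D\<^esub> u)" .
  next
    fix u assume "u \<in> carrier D"
    then obtain x where [simp]: "u = \<rho> x" and x: "x \<in> B" unfolding im[symmetric] by blast
    show "\<one>\<^bsub>hecke_algebra q\<^esub> \<odot>\<^bsub>D\<^esub> u = u" using x by (simp add: cl_ring flip: sm)
  qed
qed

lemma presentsD:
  assumes "presents q B A D \<rho>"
  shows "left_ideal q A" "left_ideal q B" "A \<subseteq> B" "\<rho> ` B = carrier D" "\<zero>\<^bsub>D\<^esub> = \<rho> 0"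
    "x \<in> B \<Longrightarrow> y \<in> B \<Longrightarrow> \<rho> (x + y) = \<rho> x \<oplus>\<^bsub>D\<^esub> \<rho> y" "x \<in> B \<Longrightarrow> \<rho> (a * x) = cl q a \<odot>\<^bsub>D\<^esub> \<rho> x"
    "x \<in> B \<Longrightarrow> \<rho> x = \<rho> 0 \<longleftrightarrow> x \<in> A" "x \<in> B \<Longrightarrow> \<rho> x \<in> carrier D"
  using assms by (auto simp: presents_def)

lemma presents_left_module: "presents q B A D \<rho> \<Longrightarrow> left_module (hecke_algebra q) D"
  by (rule left_module_of_surjection[of q B \<rho> D]) (auto dest: presentsD)

lemma presents_eq_iff:
  assumes P: "presents q B A D \<rho>" and "x \<in> B" "y \<in> B"
  shows "\<rho> x = \<rho> y \<longleftrightarrow> x - y \<in> A"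
proof -
  note L = lin_spaceD[OF left_idealD(3)[OF presentsD(2)[OF P]]]
  interpret left_module "hecke_algebra q" D by (rule presents_left_module[OF P])
  have y: "- y \<in> B" and d: "x - y \<in> B" using L assms by auto
  have "\<rho> x = \<rho> (x - y) \<oplus>\<^bsub>D\<^esub> \<rho> y" using presentsD(6)[OF P d assms(3)] by simp
  moreover have "\<rho> (x - y) \<in> carrier D" "\<rho> y \<in> carrier D" using presentsD(9)[OF P] d assms(3) by auto
  ultimately have "\<rho> x = \<rho> y \<longleftrightarrow> \<rho> (x - y) = \<zero>\<^bsub>D\<^esub>"
    using M.add.r_cancel_one by metis
  then show ?thesis using presentsD(5)[OF P] presentsD(8)[OF P d] by simp
qed

lemma submoduleD':
  assumes "submodule S R M"
  shows "S \<subseteq> carrier M" "\<zero>\<^bsub>M\<^esub> \<in> S" "x \<in> S \<Longrightarrow> y \<in> S \<Longrightarrow> x \<oplus>\<^bsub>M\<^esub> y \<in> S" "a \<in> carrier R \<Longrightarrow> x \<in> S \<Longrightarrow> a \<odot>\<^bsub>M\<^esub> x \<in> S"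
proof -
  interpret S: submodule S R M by (rule assms)
  show "S \<subseteq> carrier M" "\<zero>\<^bsub>M\<^esub> \<in> S" "x \<in> S \<Longrightarrow> y \<in> S \<Longrightarrow> x \<oplus>\<^bsub>M\<^esub> y \<in> S" "a \<in> carrier R \<Longrightarrow> x \<in> S \<Longrightarrow> a \<odot>\<^bsub>M\<^esub> x \<in> S"
    using S.subset S.one_closed S.m_closed S.smult_closed by auto
qed

lemma presents_submodule:
  assumes P: "presents q B A D \<rho>" and S: "left_ideal q S" "A \<subseteq> S" "S \<subseteq> B"
  shows "submodule (\<rho> ` S) (hecke_algebra q) D"
proof -
  interpret left_module "hecke_algebra q" D by (rule presents_left_module[OF P])
  note L = lin_spaceD[OF left_idealD(3)[OF S(1)]]
  have sub: "\<rho> ` S \<subseteq> carrier D" using presentsD(9)[OF P] S(3) by auto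
  have add: "u \<oplus>\<^bsub>D\<^esub> v \<in> \<rho> ` S" if "u \<in> \<rho> ` S" "v \<in> \<rho> ` S" for u v
  proof -
    from that obtain x y where xy: "u = \<rho> x" "v = \<rho> y" "x \<in> S" "y \<in> S" by blast
    moreover from this have "x \<in> B" "y \<in> B" using S(3) by auto
    ultimately have "u \<oplus>\<^bsub>D\<^esub> v = \<rho> (x + y)" using presentsD(6)[OF P, of x y] by simp
    then show ?thesis using L(2) xy by blast
  qed
  have "subgroup (\<rho> ` S) (add_monoid D)"
  proof (rule M.add.subgroupI)
    show "\<rho> ` S \<subseteq> carrier D" "\<rho> ` S \<noteq> {}" using sub L(1) by auto
    show "\<ominus>\<^bsub>D\<^esub> u \<in> \<rho> ` S" if "u \<in> \<rho> ` S" for u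
    proof -
      from that obtain x where x: "u = \<rho> x" "x \<in> S" by blast
      then have b: "x \<in> B" "- x \<in> B" "- x \<in> S" using S(3) L(4) by auto
      have "\<rho> (- x) \<oplus>\<^bsub>D\<^esub> \<rho> x = \<zero>\<^bsub>D\<^esub>" using presentsD(6)[OF P b(2,1)] presentsD(5)[OF P] by simp
      then have "\<ominus>\<^bsub>D\<^esub> u = \<rho> (- x)" using presentsD(9)[OF P] b x(1) by (simp add: M.minus_equality)
      then show ?thesis using b(3) by blast
    qed
  qed (use add in auto)
  moreover have "r \<odot>\<^bsub>D\<^esub> u \<in> \<rho> ` S" if "r \<in> carrier (hecke_algebra q)" "u \<in> \<rho> ` S" for r u
  proof -
    from that obtain a x where ax: "r = cl q a" "u = \<rho> x" "x \<in> S" by (auto simp: hecke_carrier)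
    moreover from this have "x \<in> B" using S(3) by auto
    ultimately have "r \<odot>\<^bsub>D\<^esub> u = \<rho> (a * x)" using presentsD(7)[OF P, of x a] by simp
    then show ?thesis using left_idealD(2)[OF S(1) ax(3)] by blast
  qed
  ultimately show ?thesis by (simp add: submodule_def submodule_axioms_def)
qed

lemma presents_preimage:
  assumes P: "presents q B A D \<rho>" and S: "submodule S (hecke_algebra q) D"
  shows "left_ideal q {x \<in> B. \<rho> x \<in> S}" "A \<subseteq> {x \<in> B. \<rho> x \<in> S}" "\<rho> ` {x \<in> B. \<rho> x \<in> S} = S"
proof -
  note s = submoduleD'[OF S] and L = lin_spaceD[OF left_idealD(3)[OF presentsD(2)[OF P]]]
  show A: "A \<subseteq> {x \<in> B. \<rho> x \<in> S}"
  proof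
    fix x assume "x \<in> A"
    then show "x \<in> {x \<in> B. \<rho> x \<in> S}" using presentsD(3,5)[OF P] presentsD(8)[OF P, of x] s(2) by auto
  qed
  show "\<rho> ` {x \<in> B. \<rho> x \<in> S} = S" using s(1) unfolding presentsD(4)[OF P, symmetric] by auto
  show "left_ideal q {x \<in> B. \<rho> x \<in> S}"
    unfolding left_ideal_def
  proof (intro conjI ballI allI)
    show "hecke_ideal q \<subseteq> {x \<in> B. \<rho> x \<in> S}" using A presentsD(1)[OF P] by (auto simp: left_ideal_def)
    fix x a assume x: "x \<in> {x \<in> B. \<rho> x \<in> S}"
    then show "a * x \<in> {x \<in> B. \<rho> x \<in> S}"
      using left_idealD(2)[OF presentsD(2)[OF P], of x a] presentsD(7)[OF P, of x a] s(4)[OF cl_closed, of "\<rho> x" a] by simp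
    fix y assume "y \<in> {x \<in> B. \<rho> x \<in> S}"
    then show "x + y \<in> {x \<in> B. \<rho> x \<in> S}"
      using x L(2)[of x y] presentsD(6)[OF P, of x y] s(3)[of "\<rho> x" "\<rho> y"] by simp
  qed
qed

lemma presents_restrict:
  assumes P: "presents q B A D \<rho>" and S: "left_ideal q S" "A \<subseteq> S" "S \<subseteq> B"
  shows "presents q S A (D\<lparr>carrier := \<rho> ` S\<rparr>) \<rho>"
proof -
  have "\<rho> x = \<rho> 0 \<longleftrightarrow> x \<in> A" if "x \<in> S" for x using presentsD(8)[OF P] S(3) that by blast
  moreover have "\<rho> (x + y) = \<rho> x \<oplus>\<^bsub>D\<^esub> \<rho> y" if "x \<in> S" "y \<in> S" for x y using presentsD(6)[OF P] S(3) that by blast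
  moreover have "\<rho> (a * x) = cl q a \<odot>\<^bsub>D\<^esub> \<rho> x" if "x \<in> S" for a x using presentsD(7)[OF P] S(3) that by blast
  ultimately show ?thesis using presentsD(1,5)[OF P] S(1,2) by (simp add: presents_def)
qed

lemma presents_quotient:
  assumes P: "presents q B A D \<rho>" and S: "left_ideal q S" "A \<subseteq> S" "S \<subseteq> B"
  shows "presents q B S (quot_module D (\<rho> ` S)) (\<lambda>b. \<rho> ` S +>\<^bsub>D\<^esub> \<rho> b)"
proof -
  note L = lin_spaceD[OF left_idealD(3)[OF S(1)]] and LB = lin_spaceD[OF left_idealD(3)[OF presentsD(2)[OF P]]]
  define \<tau> where "\<tau> b = \<rho> ` S +>\<^bsub>D\<^esub> \<rho> b" for b
  have add: "\<rho> (x + y) = \<rho> x \<oplus>\<^bsub>D\<^esub> \<rho> y" if "x \<in> B" "y \<in> B" for x y using presentsD(6)[OF P] that .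
  have \<tau>: "\<tau> b = (\<lambda>x. \<rho> (x + b)) ` S" if b: "b \<in> B" for b
  proof -
    have "\<tau> b = (\<lambda>x. \<rho> x \<oplus>\<^bsub>D\<^esub> \<rho> b) ` S" by (auto simp: \<tau>_def a_r_coset_def r_coset_def)
    also have "\<dots> = (\<lambda>x. \<rho> (x + b)) ` S" using add b S(3) by (intro image_cong) auto
    finally show ?thesis .
  qed
  have \<tau>0: "\<tau> 0 = \<rho> ` S" using \<tau>[OF LB(1)] by simp
  have mem: "\<rho> y \<in> \<tau> b \<longleftrightarrow> y - b \<in> S" if b: "b \<in> B" and y: "y \<in> B" for b y
  proof
    assume "\<rho> y \<in> \<tau> b"
    then obtain x where x: "x \<in> S" "\<rho> y = \<rho> (x + b)" unfolding \<tau>[OF b] by auto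
    then have "x + b \<in> B" using LB(2) b S(3) by blast
    then have "y - (x + b) \<in> A" using presents_eq_iff[OF P y] x(2) by blast
    then have "(y - (x + b)) + x \<in> S" using S(2) x(1) L(2) by blast
    then show "y - b \<in> S" by (simp add: algebra_simps)
  next
    assume "y - b \<in> S"
    then show "\<rho> y \<in> \<tau> b" unfolding \<tau>[OF b] by (intro image_eqI[of _ _ "y - b"]) simp_all
  qed
  have sub: "\<tau> b \<subseteq> \<rho> ` B" if "b \<in> B" for b using \<tau>[OF that] LB(2) that S(3) by auto
  have eqI: "\<tau> x = \<tau> y" if "x \<in> B" "y \<in> B" "x - y \<in> S" for x y
  proof -
    have "u \<in> \<tau> x \<longleftrightarrow> u \<in> \<tau> y" if "u \<in> \<rho> ` B" for u
    proof -
      from that obtain b where b: "u = \<rho> b" "b \<in> B" by blast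
      have "(b - x) - (b - y) \<in> S" using L(4)[OF \<open>x - y \<in> S\<close>] by simp
      then show ?thesis
        unfolding b(1) mem[OF \<open>x \<in> B\<close> b(2)] mem[OF \<open>y \<in> B\<close> b(2)]
        by (rule lin_space_diff_iff[OF left_idealD(3)[OF S(1)]])
    qed
    then show ?thesis using sub that by blast
  qed
  have "\<tau> x = \<tau> 0 \<longleftrightarrow> x \<in> S" if "x \<in> B" for x
  proof
    assume "\<tau> x = \<tau> 0"
    moreover have "\<rho> x \<in> \<tau> x" using mem[OF that that] L(1) by simp
    ultimately show "x \<in> S" using mem[OF LB(1) that] by simp
  qed (use eqI[OF that LB(1)] in simp)
  moreover have "\<tau> (x + y) = \<tau> x <+>\<^bsub>D\<^esub> \<tau> y" if "x \<in> B" "y \<in> B" for x y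
  proof -
    have "\<tau> x <+>\<^bsub>D\<^esub> \<tau> y = (\<Union>u\<in>S. \<Union>v\<in>S. {\<rho> (u + x) \<oplus>\<^bsub>D\<^esub> \<rho> (v + y)})"
      unfolding \<tau>[OF that(1)] \<tau>[OF that(2)] by (auto simp: set_add_def set_mult_def)
    also have "\<dots> = (\<Union>u\<in>S. \<Union>v\<in>S. {\<rho> ((u + v) + (x + y))})"
    proof (intro SUP_cong refl)
      fix u v assume "u \<in> S" "v \<in> S"
      then have "\<rho> (u + x) \<oplus>\<^bsub>D\<^esub> \<rho> (v + y) = \<rho> ((u + x) + (v + y))"
        using add LB(2) that S(3) by (metis subset_iff)
      then show "{\<rho> (u + x) \<oplus>\<^bsub>D\<^esub> \<rho> (v + y)} = {\<rho> ((u + v) + (x + y))}" by (simp add: algebra_simps)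
    qed
    also have "\<dots> = (\<lambda>w. \<rho> (w + (x + y))) ` S"
    proof (intro equalityI subsetI)
      fix m assume "m \<in> (\<lambda>w. \<rho> (w + (x + y))) ` S"
      then obtain w where "w \<in> S" "m = \<rho> ((w + 0) + (x + y))" by auto
      then show "m \<in> (\<Union>u\<in>S. \<Union>v\<in>S. {\<rho> ((u + v) + (x + y))})" using L(1) by blast
    qed (use L(2) in blast)
    also have "\<dots> = \<tau> (x + y)" using \<tau>[of "x + y"] LB(2) that by simp
    finally show ?thesis by simp
  qed
  moreover have "\<tau> (a * x) = (\<Union>m\<in>\<tau> x. \<rho> ` S +>\<^bsub>D\<^esub> (cl q a \<odot>\<^bsub>D\<^esub> m))" if x: "x \<in> B" for a x
  proof -
    have aB: "a * x \<in> B" using left_idealD(2)[OF presentsD(2)[OF P] x] .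
    have "\<rho> ` S +>\<^bsub>D\<^esub> (cl q a \<odot>\<^bsub>D\<^esub> \<rho> (u + x)) = \<tau> (a * x)" if u: "u \<in> S" for u
    proof -
      have uB: "u + x \<in> B" using u x S(3) LB(2) by blast
      have "\<rho> ` S +>\<^bsub>D\<^esub> (cl q a \<odot>\<^bsub>D\<^esub> \<rho> (u + x)) = \<tau> (a * (u + x))"
        using presentsD(7)[OF P uB] by (simp add: \<tau>_def)
      also have "\<dots> = \<tau> (a * x)"
        using left_idealD(2)[OF S(1) u] left_idealD(2)[OF presentsD(2)[OF P] uB]
        by (intro eqI aB) (simp_all add: distrib_left)
      finally show ?thesis .
    qed
    then show ?thesis using L(1) unfolding \<tau>[OF x] by auto
  qed
  moreover have "\<tau> ` B = carrier (quot_module D (\<rho> ` S))"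
    unfolding \<tau>_def quot_module_def A_RCOSETS_def RCOSETS_def a_r_coset_def
    by (auto simp: presentsD(4)[OF P, symmetric])
  ultimately show ?thesis
    unfolding \<tau>_def[symmetric] using \<tau>0 S presentsD(2)[OF P]
    by (simp add: presents_def quot_module_def)
qed

text \<open>The correspondence between submodules of \<open>D\<close> and left ideals between \<open>A\<close> and \<open>B\<close>.\<close>

lemma presents_irreducible_iff:
  assumes P: "presents q B A D \<rho>"
  shows "irreducible_module (hecke_algebra q) D \<longleftrightarrow> adjacent q A B"
proof -
  have zero: "\<rho> ` A = {\<zero>\<^bsub>D\<^esub>}"
  proof -
    have "\<rho> x = \<zero>\<^bsub>D\<^esub>" if "x \<in> A" for x
      using presentsD(3,5)[OF P] presentsD(8)[OF P, of x] that by auto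
    moreover have "0 \<in> A" by (rule lin_spaceD(1)[OF left_idealD(3)[OF presentsD(1)[OF P]]])
    ultimately show ?thesis by (auto intro: rev_image_eqI)
  qed
  have eq: "S = S'" if "\<rho> ` S = \<rho> ` S'" "left_ideal q S" "left_ideal q S'" "A \<subseteq> S" "S \<subseteq> B" "A \<subseteq> S'" "S' \<subseteq> B" for S S'
  proof -
    have "S \<subseteq> S'" if im: "\<rho> ` S \<subseteq> \<rho> ` S'" and l: "left_ideal q S'" and B: "S \<subseteq> B" "A \<subseteq> S'" "S' \<subseteq> B" for S S'
    proof
      fix x assume x: "x \<in> S"
      then have "\<rho> x \<in> \<rho> ` S'" using im by blast
      then obtain y where y: "y \<in> S'" "\<rho> x = \<rho> y" by blast
      have "x \<in> B" "y \<in> B" using x y(1) B by auto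
      then have "x - y \<in> S'" using presents_eq_iff[OF P] y(2) B(2) by blast
      then show "x \<in> S'" using lin_space_diff_iff[OF left_idealD(3)[OF l]] y(1) by blast
    qed
    from this[of S S'] this[of S' S] show ?thesis using that by simp
  qed
  have im0: "\<rho> ` A = {\<zero>\<^bsub>D\<^esub>}" by (rule zero)
  note lA = presentsD(1)[OF P] and lB = presentsD(2)[OF P] and AB = presentsD(3)[OF P] and im = presentsD(4)[OF P]
  show ?thesis
  proof
    assume irr: "irreducible_module (hecke_algebra q) D"
    then have ne: "carrier D \<noteq> {\<zero>\<^bsub>D\<^esub>}"
      and mid: "\<And>S. submodule S (hecke_algebra q) D \<Longrightarrow> S = {\<zero>\<^bsub>D\<^esub>} \<or> S = carrier D"
      by (simp_all add: irreducible_module_def)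
    have "A \<noteq> B" using ne im im0 by auto
    moreover have "S = A \<or> S = B" if S: "left_ideal q S" "A \<subseteq> S" "S \<subseteq> B" for S
    proof -
      have "\<rho> ` S = \<rho> ` A \<or> \<rho> ` S = \<rho> ` B"
        using mid[OF presents_submodule[OF P S]] unfolding im0 im .
      then show ?thesis using eq[OF _ S(1) lA S(2,3) subset_refl AB] eq[OF _ S(1) lB S(2,3) AB subset_refl] by blast
    qed
    ultimately show "adjacent q A B" using lA lB AB unfolding adjacent_def by blast
  next
    assume "adjacent q A B"
    then have ne: "A \<noteq> B" and mid: "\<And>S. left_ideal q S \<Longrightarrow> A \<subseteq> S \<Longrightarrow> S \<subseteq> B \<Longrightarrow> S = A \<or> S = B"
      by (auto simp: adjacent_def)
    have ne': "carrier D \<noteq> {\<zero>\<^bsub>D\<^esub>}"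
      using eq[OF _ lA lB subset_refl AB AB subset_refl] ne unfolding im0[symmetric] im[symmetric] by metis
    have "S = {\<zero>\<^bsub>D\<^esub>} \<or> S = carrier D" if S: "submodule S (hecke_algebra q) D" for S
    proof -
      note pre = presents_preimage[OF P S]
      have "{x \<in> B. \<rho> x \<in> S} = A \<or> {x \<in> B. \<rho> x \<in> S} = B"
        by (rule mid[OF pre(1,2)]) simp
      then show ?thesis
      proof
        assume "{x \<in> B. \<rho> x \<in> S} = A"
        then have "S = \<rho> ` A" using pre(3) by simp
        then show ?thesis using im0 by simp
      next
        assume "{x \<in> B. \<rho> x \<in> S} = B"
        then have "S = \<rho> ` B" using pre(3) by simp
        then show ?thesis using im by simp
      qed
    qed
    then show "irreducible_module (hecke_algebra q) D"
      using presents_left_module[OF P] ne' by (simp add: irreducible_module_def)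
  qed
qed

lemma adjacent_UNIV_iff: "left_ideal q J \<Longrightarrow> adjacent q J UNIV \<longleftrightarrow> maximal_ideal q J"
proof -
  assume J: "left_ideal q J"
  have "S = UNIV \<longleftrightarrow> 1 \<in> S" if "left_ideal q S" for S
    using left_idealD(2)[OF that, of 1] by auto
  then show ?thesis
    using J unfolding adjacent_def maximal_ideal_def by (auto simp: left_ideal_UNIV psubset_eq)
qed

text \<open>Every vector of an irreducible module other than zero generates it, with a maximal annihilator.\<close>

lemma adjacent_colon:
  assumes "adjacent q A B" "w \<in> B" "w \<notin> A"
  shows "maximal_ideal q (colon A w)" "B = {x + a * w | x a. x \<in> A}"
proof -
  have l: "left_ideal q A" "left_ideal q B" "A \<subseteq> B"
    and mid: "\<And>S. left_ideal q S \<Longrightarrow> A \<subseteq> S \<Longrightarrow> S \<subseteq> B \<Longrightarrow> S = A \<or> S = B"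
    using assms(1) by (auto simp: adjacent_def)
  note LA = lin_spaceD[OF left_idealD(3)[OF l(1)]] and LB = lin_spaceD[OF left_idealD(3)[OF l(2)]]
  have gen: "{x + a * v | x a. x \<in> A} = B" if v: "v \<in> B" "v \<notin> A" for v
  proof -
    let ?S = "{x + a * v | x a. x \<in> A}"
    have AS: "A \<subseteq> ?S" by (force intro: exI[of _ "0::free_algebra"])
    have "left_ideal q ?S"
      unfolding left_ideal_def
    proof (intro conjI ballI allI)
      show "hecke_ideal q \<subseteq> ?S" using AS l(1) by (auto simp: left_ideal_def)
      fix s c assume "s \<in> ?S"
      then obtain x a where s: "s = x + a * v" "x \<in> A" by blast
      have "c * s = c * x + (c * a) * v" by (simp add: s distrib_left mult.assoc)
      then show "c * s \<in> ?S" using left_idealD(2)[OF l(1) s(2)] by blast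
      fix s' assume "s' \<in> ?S"
      then obtain x' a' where s': "s' = x' + a' * v" "x' \<in> A" by blast
      have "s + s' = (x + x') + (a + a') * v" by (simp add: s s' algebra_simps)
      then show "s + s' \<in> ?S" using LA(2)[OF s(2) s'(2)] by blast
    qed
    moreover have "?S \<subseteq> B" using l(3) LB(2) left_idealD(2)[OF l(2) v(1)] by auto
    moreover have "v \<in> ?S" using LA(1) by (force intro: exI[of _ "1::free_algebra"])
    ultimately show ?thesis using mid[of ?S] AS v(2) by blast
  qed
  show "B = {x + a * w | x a. x \<in> A}" using gen[OF assms(2,3)] by simp
  show "maximal_ideal q (colon A w)"
    unfolding maximal_ideal_def
  proof (intro conjI allI impI)
    show "left_ideal q (colon A w)" by (rule colon_left_ideal[OF l(1)])
    show "1 \<notin> colon A w" using assms(3) by (simp add: one_in_colon)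
    fix J' assume J': "left_ideal q J' \<and> colon A w \<subseteq> J' \<and> 1 \<notin> J'"
    have "j \<in> colon A w" if j: "j \<in> J'" for j
    proof (rule ccontr)
      assume "j \<notin> colon A w"
      then have "j * w \<notin> A" by (simp add: mem_colon)
      moreover have "j * w \<in> B" by (rule left_idealD(2)[OF l(2) assms(2)])
      ultimately obtain x a where "w = x + a * (j * w)" "x \<in> A" using gen[of "j * w"] assms(2) by blast
      then have "w - a * (j * w) \<in> A" by (metis add_diff_cancel_right')
      then have "(1 - a * j) * w \<in> A" by (simp add: left_diff_distrib mult.assoc)
      then have "1 - a * j \<in> J'" using J' by (auto simp: mem_colon)
      then have "(1 - a * j) + a * j \<in> J'"
        using J' j left_idealD(2) lin_spaceD(2)[OF left_idealD(3)] by blast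
      then show False using J' by simp
    qed
    then show "J' = colon A w" using J' by auto
  qed
qed

text \<open>Choosing another generator of an irreducible module replaces its presentation by the one modulo the annihilator
  of that generator. This is the way in which a convenient vector is put in place of \<open>1\<close>.\<close>

lemma presents_colon:
  assumes P: "presents q B A D \<rho>" and adj: "adjacent q A B" and w: "w \<in> B" "w \<notin> A"
  shows "presents q UNIV (colon A w) D (\<lambda>a. \<rho> (a * w))"
proof -
  note l = presentsD(1-3)[OF P]
  have aw: "a * w \<in> B" for a by (rule left_idealD(2)[OF l(2) w(1)])
  have im: "range (\<lambda>a. \<rho> (a * w)) = carrier D"
  proof (intro equalityI subsetI)
    fix u assume "u \<in> carrier D"
    then obtain b where b: "u = \<rho> b" "b \<in> B" unfolding presentsD(4)[OF P, symmetric] by (rule imageE)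
    obtain x a where xa: "b = x + a * w" "x \<in> A" using b(2) adjacent_colon(2)[OF adj w] by blast
    have "\<rho> b = \<rho> (a * w)" using presents_eq_iff[OF P b(2) aw[of a]] xa by simp
    then show "u \<in> range (\<lambda>a. \<rho> (a * w))" using b(1) by simp
  next
    fix u assume "u \<in> range (\<lambda>a. \<rho> (a * w))"
    then obtain a where "u = \<rho> (a * w)" by (rule rangeE)
    then show "u \<in> carrier D" using presentsD(9)[OF P aw[of a]] by simp
  qed
  show ?thesis
    unfolding presents_def
  proof (intro conjI ballI allI)
    show "\<rho> ((x + y) * w) = \<rho> (x * w) \<oplus>\<^bsub>D\<^esub> \<rho> (y * w)" for x y
      using presentsD(6)[OF P aw[of x] aw[of y]] by (simp add: distrib_right)
    show "\<rho> (a * x * w) = cl q a \<odot>\<^bsub>D\<^esub> \<rho> (x * w)" for a x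
      using presentsD(7)[OF P aw[of x], of a] by (simp add: mult.assoc)
    show "\<rho> (x * w) = \<rho> (0 * w) \<longleftrightarrow> x \<in> colon A w" for x
      using presentsD(8)[OF P aw[of x]] by (simp add: mem_colon)
    show "\<zero>\<^bsub>D\<^esub> = \<rho> (0 * w)" using presentsD(5)[OF P] by simp
  qed (use im colon_left_ideal[OF l(1)] in \<open>simp_all add: left_ideal_UNIV\<close>)
qed

lemma presents_iso:
  assumes P: "presents q B J D \<rho>" and P': "presents q B J D' \<rho>'"
  shows "module_iso (hecke_algebra q) D D'"
proof -
  define \<phi> where "\<phi> u = \<rho>' (SOME x. x \<in> B \<and> \<rho> x = u)" for u
  have \<phi>: "\<phi> (\<rho> x) = \<rho>' x" if "x \<in> B" for x
  proof -
    have "(SOME y. y \<in> B \<and> \<rho> y = \<rho> x) \<in> B \<and> \<rho> (SOME y. y \<in> B \<and> \<rho> y = \<rho> x) = \<rho> x"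
      by (rule someI[of _ x]) (use that in simp)
    then show ?thesis unfolding \<phi>_def using presents_eq_iff[OF P _ that] presents_eq_iff[OF P' _ that] by blast
  qed
  note c = presentsD(4)[OF P, symmetric] and c' = presentsD(4)[OF P', symmetric]
  have "bij_betw \<phi> (carrier D) (carrier D')"
    unfolding bij_betw_def inj_on_def c c'
    using presents_eq_iff[OF P] presents_eq_iff[OF P'] by (force simp: \<phi> image_iff)
  moreover have "\<phi> (u \<oplus>\<^bsub>D\<^esub> v) = \<phi> u \<oplus>\<^bsub>D'\<^esub> \<phi> v" if "u \<in> carrier D" "v \<in> carrier D" for u v
  proof -
    from that obtain x y where "u = \<rho> x" "v = \<rho> y" "x \<in> B" "y \<in> B" unfolding c by blast
    then show ?thesis
      using presentsD(6)[OF P] presentsD(6)[OF P'] lin_spaceD(2)[OF left_idealD(3)[OF presentsD(2)[OF P]]]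
      by (metis \<phi>)
  qed
  moreover have "\<phi> (r \<odot>\<^bsub>D\<^esub> u) = r \<odot>\<^bsub>D'\<^esub> \<phi> u" if "r \<in> carrier (hecke_algebra q)" "u \<in> carrier D" for r u
  proof -
    from that obtain a x where "r = cl q a" "u = \<rho> x" "x \<in> B" unfolding c hecke_carrier by blast
    then show ?thesis
      using presentsD(7)[OF P] presentsD(7)[OF P'] left_idealD(2)[OF presentsD(2)[OF P]]
      by (metis \<phi>)
  qed
  ultimately show ?thesis unfolding module_iso_def by blast
qed

lemma module_iso_trans:
  assumes "module_iso R L D" "module_iso R D E"
  shows "module_iso R L E"
proof -
  obtain f g where f: "bij_betw f (carrier L) (carrier D)"
      "\<And>x y. x \<in> carrier L \<Longrightarrow> y \<in> carrier L \<Longrightarrow> f (x \<oplus>\<^bsub>L\<^esub> y) = f x \<oplus>\<^bsub>D\<^esub> f y"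
      "\<And>r x. r \<in> carrier R \<Longrightarrow> x \<in> carrier L \<Longrightarrow> f (r \<odot>\<^bsub>L\<^esub> x) = r \<odot>\<^bsub>D\<^esub> f x"
    and g: "bij_betw g (carrier D) (carrier E)"
      "\<And>x y. x \<in> carrier D \<Longrightarrow> y \<in> carrier D \<Longrightarrow> g (x \<oplus>\<^bsub>D\<^esub> y) = g x \<oplus>\<^bsub>E\<^esub> g y"
      "\<And>r x. r \<in> carrier R \<Longrightarrow> x \<in> carrier D \<Longrightarrow> g (r \<odot>\<^bsub>D\<^esub> x) = r \<odot>\<^bsub>E\<^esub> g x"
    using assms unfolding module_iso_def by blast
  have "f x \<in> carrier D" if "x \<in> carrier L" for x using f(1) that by (auto simp: bij_betw_def)
  then show ?thesis
    unfolding module_iso_def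
    by (intro exI[of _ "g \<circ> f"] conjI bij_betw_trans[OF f(1) g(1)]) (simp_all add: f g)
qed

lemma composition_factor_iso:
  "module_iso R L D \<Longrightarrow> composition_factor R W D \<Longrightarrow> composition_factor R W L"
  unfolding composition_factor_def using module_iso_trans by blast

lemma irreducible_presentation:
  assumes L: "irreducible_module (hecke_algebra q) L" and m: "m \<in> carrier L" "m \<noteq> \<zero>\<^bsub>L\<^esub>"
  shows "\<exists>J. presents q UNIV J L (\<lambda>a. cl q a \<odot>\<^bsub>L\<^esub> m)" "{a. cl q a \<odot>\<^bsub>L\<^esub> m = \<zero>\<^bsub>L\<^esub>} = J \<Longrightarrow> presents q UNIV J L (\<lambda>a. cl q a \<odot>\<^bsub>L\<^esub> m)"
proof -
  interpret left_module "hecke_algebra q" L using L by (simp add: irreducible_module_def)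
  define \<rho> where "\<rho> a = cl q a \<odot>\<^bsub>L\<^esub> m" for a
  have c: "\<rho> a \<in> carrier L" for a by (simp add: \<rho>_def cl_closed lsmult_closed m(1))
  have add: "\<rho> (a + b) = \<rho> a \<oplus>\<^bsub>L\<^esub> \<rho> b" for a b
    using lsmult_l_distr[of "cl q a" "cl q b" m] by (simp add: \<rho>_def cl_closed m(1) cl_ring)
  have sm: "\<rho> (a * b) = cl q a \<odot>\<^bsub>L\<^esub> \<rho> b" for a b
    using lsmult_assoc[of "cl q a" "cl q b" m] by (simp add: \<rho>_def cl_closed m(1) cl_ring)
  have one: "\<rho> 1 = m" using lsmult_one[OF m(1)] by (simp add: \<rho>_def cl_ring)
  have zero: "\<rho> 0 = \<zero>\<^bsub>L\<^esub>"
  proof -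
    have "\<rho> 0 = \<rho> 0 \<oplus>\<^bsub>L\<^esub> \<rho> 0" using add[of 0 0] by simp
    then show ?thesis using M.add.r_cancel_one[OF c c] by metis
  qed
  have sub: "submodule (range \<rho>) (hecke_algebra q) L"
  proof -
    have "subgroup (range \<rho>) (add_monoid L)"
    proof (rule M.add.subgroupI)
      fix u assume "u \<in> range \<rho>"
      then obtain a where a: "u = \<rho> a" by blast
      have "\<rho> (- a) \<oplus>\<^bsub>L\<^esub> \<rho> a = \<zero>\<^bsub>L\<^esub>" using add[of "- a" a] zero by simp
      then have "\<ominus>\<^bsub>L\<^esub> u = \<rho> (- a)" using c by (simp add: a M.minus_equality)
      then show "\<ominus>\<^bsub>L\<^esub> u \<in> range \<rho>" by (simp only: rangeI)
      fix v assume "v \<in> range \<rho>"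
      then obtain b where "v = \<rho> b" by blast
      then have "u \<oplus>\<^bsub>L\<^esub> v = \<rho> (a + b)" using add[of a b] a by simp
      then show "u \<oplus>\<^bsub>L\<^esub> v \<in> range \<rho>" by (simp only: rangeI)
    qed (use c in auto)
    moreover have "r \<odot>\<^bsub>L\<^esub> u \<in> range \<rho>" if r: "r \<in> carrier (hecke_algebra q)" and u: "u \<in> range \<rho>" for r u
    proof -
      obtain a b where "r = cl q a" "u = \<rho> b" using r u unfolding hecke_carrier by blast
      then have "r \<odot>\<^bsub>L\<^esub> u = \<rho> (a * b)" using sm[of a b] by simp
      then show ?thesis by (simp only: rangeI)
    qed
    ultimately show ?thesis by (simp add: submodule_def submodule_axioms_def)
  qed
  have "range \<rho> \<noteq> {\<zero>\<^bsub>L\<^esub>}" using rangeI[of \<rho> 1] m(2) unfolding one by blast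
  moreover have "\<forall>S. submodule S (hecke_algebra q) L \<longrightarrow> S = {\<zero>\<^bsub>L\<^esub>} \<or> S = carrier L"
    using L by (simp add: irreducible_module_def)
  ultimately have im: "range \<rho> = carrier L" using sub by blast
  define K where "K = {a. \<rho> a = \<zero>\<^bsub>L\<^esub>}"
  have "left_ideal q K"
    unfolding left_ideal_def
  proof (intro conjI ballI allI subsetI)
    fix a assume "a \<in> hecke_ideal q"
    then have "cl q a = cl q 0" by (simp add: cl_eq_iff)
    then show "a \<in> K" using zero by (simp add: K_def \<rho>_def)
  next
    fix x a assume x: "x \<in> K"
    then have "\<rho> x = \<rho> 0" using zero by (simp add: K_def)
    then have "\<rho> (a * x) = \<rho> (a * 0)" unfolding sm[of a x] sm[of a 0] by simp
    then show "a * x \<in> K" using zero by (simp add: K_def)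
    fix y assume "y \<in> K"
    then have "\<rho> (x + y) = \<rho> (0 + 0)" using \<open>\<rho> x = \<rho> 0\<close> zero unfolding add[of x y] add[of 0 0] by (simp add: K_def)
    then show "x + y \<in> K" using zero by (simp add: K_def)
  qed
  then have P: "presents q UNIV K L \<rho>"
    unfolding presents_def
  proof (intro conjI ballI allI)
    show "\<rho> (x + y) = \<rho> x \<oplus>\<^bsub>L\<^esub> \<rho> y" for x y by (rule add)
    show "\<rho> (a * x) = cl q a \<odot>\<^bsub>L\<^esub> \<rho> x" for a x by (rule sm)
    show "\<rho> x = \<rho> 0 \<longleftrightarrow> x \<in> K" for x unfolding zero by (simp add: K_def)
  qed (use im zero in \<open>simp_all add: left_ideal_UNIV\<close>)
  then show "\<exists>J. presents q UNIV J L (\<lambda>a. cl q a \<odot>\<^bsub>L\<^esub> m)" unfolding \<rho>_def by blast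
  show "presents q UNIV J L (\<lambda>a. cl q a \<odot>\<^bsub>L\<^esub> m)" if J: "{a. cl q a \<odot>\<^bsub>L\<^esub> m = \<zero>\<^bsub>L\<^esub>} = J"
    using P unfolding K_def \<rho>_def J .
qed

text \<open>The argument behind the Jordan-Hoelder theorem: an irreducible subquotient is isomorphic to the first
  factor of a given composition series that it meets, because both have the same annihilator, which is a
  maximal left ideal.\<close>

lemma composition_factorI:
  assumes W: "presents q UNIV I W \<pi>" and fin: "finite_length I"
    and D: "presents q UNIV J D \<rho>" and A: "left_ideal q A" "I \<subseteq> A" "colon A w = J" and J: "maximal_ideal q J"
  shows "composition_factor (hecke_algebra q) W D"
proof -
  obtain n C where C: "C 0 = I" "C n = UNIV" and adj: "\<And>i. i < n \<Longrightarrow> adjacent q (C i) (C (Suc i))"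
    using composition_chain[OF presentsD(1)[OF W] fin] by blast
  have lC: "left_ideal q (C i)" if "i \<le> n" for i
    using adj[of i] C(2) that left_ideal_UNIV by (cases "i = n") (auto simp: adjacent_def)
  have IC: "I \<subseteq> C i" if "i \<le> n" for i
    using that
  proof (induction i)
    case (Suc i)
    then have "I \<subseteq> C i" "C i \<subset> C (Suc i)" using adj[of i] by (auto simp: adjacent_def)
    then show ?case by blast
  qed (simp add: C(1))
  define V where "V i = \<pi> ` C i" for i
  have step: "presents q (C (Suc i)) (C i) (quot_module (W\<lparr>carrier := V (Suc i)\<rparr>) (V i))
      (\<lambda>b. V i +>\<^bsub>W\<lparr>carrier := V (Suc i)\<rparr>\<^esub> \<pi> b)" if "i < n" for i
    unfolding V_def
    by (rule presents_quotient[OF presents_restrict[OF W]])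
      (use that lC[of i] lC[of "Suc i"] IC[of i] IC[of "Suc i"] adj[OF that] in \<open>auto simp: adjacent_def\<close>)
  have series: "composition_series (hecke_algebra q) W n V"
    unfolding composition_series_def
  proof (intro conjI allI impI)
    have "\<pi> x = \<zero>\<^bsub>W\<^esub>" if "x \<in> I" for x using presentsD(5,8)[OF W] that by simp
    moreover have "0 \<in> I" using lin_spaceD(1)[OF left_idealD(3)[OF presentsD(1)[OF W]]] .
    ultimately show "V 0 = {\<zero>\<^bsub>W\<^esub>}" unfolding V_def C(1) by auto
    show "V n = carrier W" unfolding V_def C(2) by (rule presentsD(4)[OF W])
    show "submodule (V i) (hecke_algebra q) W" if "i \<le> n" for i
      unfolding V_def by (rule presents_submodule[OF W lC[OF that] IC[OF that]]) simp
    show "V i \<subseteq> V (Suc i)" if "i < n" for i using adj[OF that] by (auto simp: V_def adjacent_def)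
    show "irreducible_module (hecke_algebra q) (quot_module (W\<lparr>carrier := V (Suc i)\<rparr>) (V i))" if "i < n" for i
      using presents_irreducible_iff[OF step[OF that]] adj[OF that] by simp
  qed
  \<comment> \<open>\<open>S / A\<close> is the irreducible subquotient; \<open>i\<close> is the first step of the series at which it is met.\<close>
  define S where "S = {x + a * w | x a. x \<in> A}"
  define P where "P i \<longleftrightarrow> (\<exists>v\<in>S. v \<in> C i \<and> v \<notin> A)" for i
  have "w \<notin> A" using J A(3) by (auto simp: maximal_ideal_def one_in_colon)
  moreover have "w \<in> S"
    unfolding S_def using lin_spaceD(1)[OF left_idealD(3)[OF A(1)]] by (force intro: exI[of _ "1::free_algebra"])
  ultimately have Pn: "P n" by (auto simp: P_def C(2))
  define k where "k = (LEAST i. P i)"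
  have k: "P k" "\<And>i. i < k \<Longrightarrow> \<not> P i" "k \<le> n"
    unfolding k_def using LeastI[of P, OF Pn] not_less_Least[of _ P] Least_le[of P, OF Pn] by blast+
  have "\<not> P 0" using A(2) by (auto simp: P_def C(1))
  then obtain i where i: "k = Suc i" using k(1) by (cases k) auto
  obtain v where v: "v \<in> S" "v \<in> C (Suc i)" "v \<notin> A" using k(1) by (auto simp: P_def i)
  obtain x a where xa: "v = x + a * w" "x \<in> A" using v(1) by (auto simp: S_def)
  have il: "i < n" using k(3) i by simp
  have nP: "\<not> P i" using k(2) i by simp
  have vC: "v \<notin> C i" using nP v by (auto simp: P_def)
  have col: "colon A v = colon J a"
  proof -
    have "b * v \<in> A \<longleftrightarrow> b * (a * w) \<in> A" for b
      using lin_space_diff_iff[OF left_idealD(3)[OF A(1)], of "b * v" "b * (a * w)"] left_idealD(2)[OF A(1) xa(2), of b]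
      by (simp add: xa(1) distrib_left)
    then show ?thesis by (auto simp: mem_colon A(3)[symmetric] mult.assoc)
  qed
  have "colon (C i) v \<subseteq> colon A v"
  proof
    fix b assume "b \<in> colon (C i) v"
    moreover have "b * v = b * x + (b * a) * w" by (simp add: xa(1) distrib_left mult.assoc)
    then have "b * v \<in> S" using left_idealD(2)[OF A(1) xa(2), of b] unfolding S_def by blast
    ultimately show "b \<in> colon A v" using nP by (auto simp: mem_colon P_def)
  qed
  then have eq: "colon (C i) v = colon J a"
    using adjacent_colon(1)[OF adj[OF il] v(2) vC] colon_left_ideal[OF A(1), of v] v(3)
    unfolding col[symmetric] maximal_ideal_def by (metis one_in_colon)
  have "a \<notin> J"
  proof
    assume "a \<in> J"
    then have "a * w \<in> A" by (simp add: A(3)[symmetric] mem_colon)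
    then show False using lin_spaceD(2)[OF left_idealD(3)[OF A(1)] xa(2)] v(3) xa(1) by simp
  qed
  moreover have "adjacent q J UNIV" using J adjacent_UNIV_iff by (auto simp: maximal_ideal_def)
  ultimately have "presents q UNIV (colon J a) D (\<lambda>b. \<rho> (b * a))"
    by (intro presents_colon[OF D]) auto
  moreover have "presents q UNIV (colon J a) (quot_module (W\<lparr>carrier := V (Suc i)\<rparr>) (V i))
      (\<lambda>b. V i +>\<^bsub>W\<lparr>carrier := V (Suc i)\<rparr>\<^esub> \<pi> (b * v))"
    using presents_colon[OF step[OF il] adj[OF il] v(2) vC] unfolding eq .
  ultimately have "module_iso (hecke_algebra q) D (quot_module (W\<lparr>carrier := V (Suc i)\<rparr>) (V i))"
    by (rule presents_iso)
  then show ?thesis unfolding composition_factor_def using series il by blast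
qed

section \<open>Characters of subalgebras\<close>

lemma subalgebra_induct [consumes 1, case_names scalar gen one minus add mult]:
  assumes "x \<in> subalgebra_generated q S" "\<And>c. P (hC q c)" "\<And>x. x \<in> S \<Longrightarrow> P x" "P \<one>\<^bsub>hecke_algebra q\<^esub>"
    "\<And>x. x \<in> subalgebra_generated q S \<Longrightarrow> P x \<Longrightarrow> P (\<ominus>\<^bsub>hecke_algebra q\<^esub> x)"
    "\<And>x y. x \<in> subalgebra_generated q S \<Longrightarrow> y \<in> subalgebra_generated q S \<Longrightarrow> P x \<Longrightarrow> P y \<Longrightarrow> P (x \<oplus>\<^bsub>hecke_algebra q\<^esub> y)"
    "\<And>x y. x \<in> subalgebra_generated q S \<Longrightarrow> y \<in> subalgebra_generated q S \<Longrightarrow> P x \<Longrightarrow> P y \<Longrightarrow> P (x \<otimes>\<^bsub>hecke_algebra q\<^esub> y)"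
  shows "P x"
  using assms(1) unfolding subalgebra_generated_def
proof (induction rule: generate_ring.induct)
  case (incl h)
  then show ?case using assms(2,3) by blast
qed (use assms(4-7) in \<open>simp_all add: subalgebra_generated_def\<close>)

lemma subalgebra_closed:
  shows "hC q c \<in> subalgebra_generated q S" "x \<in> S \<Longrightarrow> x \<in> subalgebra_generated q S"
    "\<one>\<^bsub>hecke_algebra q\<^esub> \<in> subalgebra_generated q S"
    "x \<in> subalgebra_generated q S \<Longrightarrow> \<ominus>\<^bsub>hecke_algebra q\<^esub> x \<in> subalgebra_generated q S"
    "x \<in> subalgebra_generated q S \<Longrightarrow> y \<in> subalgebra_generated q S \<Longrightarrow> x \<oplus>\<^bsub>hecke_algebra q\<^esub> y \<in> subalgebra_generated q S"
    "x \<in> subalgebra_generated q S \<Longrightarrow> y \<in> subalgebra_generated q S \<Longrightarrow> x \<otimes>\<^bsub>hecke_algebra q\<^esub> y \<in> subalgebra_generated q S"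
  unfolding subalgebra_generated_def
  by (blast intro: generate_ring.incl, blast intro: generate_ring.incl, rule generate_ring.one,
      erule generate_ring.a_inv, erule (1) generate_ring.eng_add, erule (1) generate_ring.eng_mult)

text \<open>A left ideal in which every generator is congruent to a scalar determines a character.\<close>

definition evaluates :: "complex \<Rightarrow> free_algebra set \<Rightarrow> hecke \<Rightarrow> complex \<Rightarrow> bool" where
  "evaluates q J x z \<longleftrightarrow> (\<exists>a. x = cl q a \<and> a - fC z \<in> J)"

context
  fixes q :: complex and J :: "free_algebra set"
  assumes J: "left_ideal q J"
begin

lemma evaluates_cl: "evaluates q J (cl q a) z \<longleftrightarrow> a - fC z \<in> J"
proof
  assume "evaluates q J (cl q a) z"
  then obtain b where b: "a - b \<in> hecke_ideal q" "b - fC z \<in> J" by (auto simp: evaluates_def cl_eq_iff)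
  have "(a - b) + (b - fC z) \<in> J" by (rule lin_spaceD(2)[OF left_idealD(3)[OF J] left_idealD(1)[OF J b(1)] b(2)])
  then show "a - fC z \<in> J" by simp
qed (auto simp: evaluates_def)

lemma evaluates_ops:
  shows "evaluates q J (hC q c) c" "evaluates q J \<one>\<^bsub>hecke_algebra q\<^esub> 1"
    "evaluates q J x z \<Longrightarrow> evaluates q J (\<ominus>\<^bsub>hecke_algebra q\<^esub> x) (- z)"
    "evaluates q J x z \<Longrightarrow> evaluates q J y w \<Longrightarrow> evaluates q J (x \<oplus>\<^bsub>hecke_algebra q\<^esub> y) (z + w)"
    "evaluates q J x z \<Longrightarrow> evaluates q J y w \<Longrightarrow> evaluates q J (x \<otimes>\<^bsub>hecke_algebra q\<^esub> y) (z * w)"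
proof -
  note L = lin_spaceD[OF left_idealD(3)[OF J]]
  show "evaluates q J (hC q c) c" by (simp add: cl_generators evaluates_cl L(1))
  show "evaluates q J \<one>\<^bsub>hecke_algebra q\<^esub> 1" by (simp add: cl_ring evaluates_cl fC_simps(2) L(1))
  show "evaluates q J (\<ominus>\<^bsub>hecke_algebra q\<^esub> x) (- z)" if x: "evaluates q J x z"
  proof -
    obtain a where a: "x = cl q a" "a - fC z \<in> J" using x by (auto simp: evaluates_def)
    have "- (a - fC z) \<in> J" by (rule L(4)[OF a(2)])
    then show ?thesis by (simp add: a(1) cl_minus evaluates_cl fC_simps(5))
  qed
  fix x y z w assume x: "evaluates q J x z" and y: "evaluates q J y w"
  obtain a where a: "x = cl q a" "a - fC z \<in> J" using x by (auto simp: evaluates_def)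
  obtain b where b: "y = cl q b" "b - fC w \<in> J" using y by (auto simp: evaluates_def)
  have "(a - fC z) + (b - fC w) \<in> J" by (rule L(2)[OF a(2) b(2)])
  then show "evaluates q J (x \<oplus>\<^bsub>hecke_algebra q\<^esub> y) (z + w)"
    by (simp add: a(1) b(1) cl_ring evaluates_cl fC_simps(3) algebra_simps)
  have "a * (b - fC w) + fC w * (a - fC z) \<in> J"
    by (rule L(2)[OF left_idealD(2)[OF J b(2)] L(3)[OF a(2)]])
  moreover have "a * (b - fC w) + fC w * (a - fC z) = a * b - fC (z * w)"
    by (simp add: right_diff_distrib fC_central[of a w] fC_merge(1) mult.commute)
  ultimately show "evaluates q J (x \<otimes>\<^bsub>hecke_algebra q\<^esub> y) (z * w)"
    by (simp add: a(1) b(1) cl_ring evaluates_cl)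
qed

lemma subalgebra_evaluates:
  assumes "\<And>x. x \<in> S \<Longrightarrow> \<exists>z. evaluates q J x z" "x \<in> subalgebra_generated q S"
  shows "\<exists>z. evaluates q J x z"
  using assms(2)
  by (induction rule: subalgebra_induct) (use assms(1) evaluates_ops in blast)+

lemma evaluates_unique:
  assumes "1 \<notin> J" "evaluates q J x z" "evaluates q J x w"
  shows "z = w"
proof -
  obtain a where a: "x = cl q a" "a - fC z \<in> J" using assms(2) by (auto simp: evaluates_def)
  have "a - fC w \<in> J" using assms(3) by (simp add: a(1) evaluates_cl)
  then have "(a - fC w) - (a - fC z) \<in> J" using a(2) lin_spaceD(5)[OF left_idealD(3)[OF J]] by blast
  then have "fC (z - w) \<in> J" by (simp add: fC_simps)
  then show ?thesis using proper_scalar[OF J assms(1), of "z - w"] by simp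
qed

text \<open>The value of the character at \<open>x\<close> is the scalar to which \<open>x\<close> is congruent. It is unique because \<open>J\<close> is proper,
  and congruences to scalars are compatible with sums and products since \<open>J\<close> is a left ideal.\<close>

lemma character_exists:
  assumes S: "\<And>x. x \<in> S \<Longrightarrow> \<exists>z. evaluates q J x z" and "1 \<notin> J"
  shows "\<exists>\<chi>\<in>characters q (subalgebra_generated q S). \<forall>x\<in>subalgebra_generated q S. evaluates q J x (\<chi> x)"
proof -
  let ?A = "subalgebra_generated q S"
  define \<chi> where "\<chi> = restrict (\<lambda>x. SOME z. evaluates q J x z) ?A"
  have e: "evaluates q J x (\<chi> x)" if "x \<in> ?A" for x
    using someI_ex[OF subalgebra_evaluates[OF S that]] that by (simp add: \<chi>_def)
  note u = evaluates_unique[OF assms(2) e]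
  have "\<chi> \<in> characters q ?A"
    unfolding characters_def
  proof (intro CollectI conjI allI ring_hom_memI)
    show "\<chi> \<in> extensional ?A" by (simp add: \<chi>_def)
    show "\<chi> (hC q c) = c" for c by (rule u[OF _ evaluates_ops(1)]) (rule subalgebra_closed)
    fix x y assume xy: "x \<in> carrier ((hecke_algebra q)\<lparr>carrier := ?A\<rparr>)" "y \<in> carrier ((hecke_algebra q)\<lparr>carrier := ?A\<rparr>)"
    then have xy: "x \<in> ?A" "y \<in> ?A" by simp_all
    have "\<chi> (x \<otimes>\<^bsub>hecke_algebra q\<^esub> y) = \<chi> x * \<chi> y"
      by (rule u[OF subalgebra_closed(6)[OF xy] evaluates_ops(5)[OF e[OF xy(1)] e[OF xy(2)]]])
    then show "\<chi> (x \<otimes>\<^bsub>(hecke_algebra q)\<lparr>carrier := ?A\<rparr>\<^esub> y) = \<chi> x \<otimes>\<^bsub>type_ring\<^esub> \<chi> y" by (simp add: type_ring_def)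
    have "\<chi> (x \<oplus>\<^bsub>hecke_algebra q\<^esub> y) = \<chi> x + \<chi> y"
      by (rule u[OF subalgebra_closed(5)[OF xy] evaluates_ops(4)[OF e[OF xy(1)] e[OF xy(2)]]])
    then show "\<chi> (x \<oplus>\<^bsub>(hecke_algebra q)\<lparr>carrier := ?A\<rparr>\<^esub> y) = \<chi> x \<oplus>\<^bsub>type_ring\<^esub> \<chi> y" by (simp add: type_ring_def)
  next
    have "\<chi> \<one>\<^bsub>hecke_algebra q\<^esub> = 1" by (rule u[OF subalgebra_closed(3) evaluates_ops(2)])
    then show "\<chi> \<one>\<^bsub>(hecke_algebra q)\<lparr>carrier := ?A\<rparr>\<^esub> = \<one>\<^bsub>type_ring\<^esub>" by (simp add: type_ring_def)
  qed (simp add: type_ring_def)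
  then show ?thesis using e by blast
qed

end

lemma subalgebra_carrier:
  assumes "S \<subseteq> carrier (hecke_algebra q)"
  shows "subalgebra_generated q S \<subseteq> carrier (hecke_algebra q)"
proof -
  interpret ring "hecke_algebra q" by (rule ring_hecke_algebra)
  show ?thesis
    unfolding subalgebra_generated_def
    by (rule generate_ring_incl) (use assms in \<open>auto simp: cl_generators cl_closed\<close>)
qed

lemma character_agree:
  assumes c: "\<chi> \<in> characters q A" "\<psi> \<in> characters q A" and A: "subalgebra_generated q S \<subseteq> A"
    and S: "S \<subseteq> carrier (hecke_algebra q)"
    and g: "\<And>x. x \<in> S \<Longrightarrow> \<chi> x = \<psi> x" and x: "x \<in> subalgebra_generated q S"
  shows "\<chi> x = \<psi> x"
proof -
  note sub = subsetD[OF A]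
  have ops: "f (hC q k) = k" "f \<one>\<^bsub>hecke_algebra q\<^esub> = 1"
    "u \<in> A \<Longrightarrow> v \<in> A \<Longrightarrow> f (u \<oplus>\<^bsub>hecke_algebra q\<^esub> v) = f u + f v"
    "u \<in> A \<Longrightarrow> v \<in> A \<Longrightarrow> f (u \<otimes>\<^bsub>hecke_algebra q\<^esub> v) = f u * f v" if "f \<in> characters q A" for f k u v
    using that unfolding characters_def ring_hom_def by (auto simp: type_ring_def)
  show ?thesis
    using x
  proof (induction rule: subalgebra_induct)
    case (scalar k) then show ?case using ops(1)[OF c(1)] ops(1)[OF c(2)] by simp
  next
    case (gen x) then show ?case by (rule g)
  next
    case one then show ?case using ops(2)[OF c(1)] ops(2)[OF c(2)] by simp
  next
    case (minus x)
    obtain a where a: "x = cl q a" using subalgebra_carrier[OF S] minus(1) by (auto simp: hecke_carrier)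
    have "\<ominus>\<^bsub>hecke_algebra q\<^esub> x = hC q (- 1) \<otimes>\<^bsub>hecke_algebra q\<^esub> x"
      by (simp add: a cl_minus cl_generators cl_ring fC_simps)
    then show ?case
      using ops(4)[OF c(1) sub[OF subalgebra_closed(1)] sub[OF minus(1)]]
        ops(4)[OF c(2) sub[OF subalgebra_closed(1)] sub[OF minus(1)]] ops(1)[OF c(1)] ops(1)[OF c(2)] minus(2) by simp
  next
    case (add x y)
    then show ?case using ops(3)[OF c(1) sub sub] ops(3)[OF c(2) sub sub] by simp
  next
    case (mult x y)
    then show ?case using ops(4)[OF c(1) sub sub] ops(4)[OF c(2) sub sub] by simp
  qed
qed

section \<open>Presentations of the induced modules\<close>

text \<open>The induced module is the algebra modulo the left ideal generated by the elements \<open>a - \<chi>(a)\<close>: the map sending \<open>a\<close> to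
  the class of \<open>a \<otimes> 1\<close> is surjective because scalars can be moved to the left factor, and its kernel contains the
  left ideal by balancedness. Conversely, evaluating formal sums modulo the left ideal kills all relations of the
  tensor product, so the kernel is not larger.\<close>

lemma induced_presents:
  assumes A: "A \<subseteq> carrier (hecke_algebra q)" and I: "left_ideal q I"
    and scal: "\<And>c. hC q c \<in> A" "\<And>c. \<chi> (hC q c) = c"
    and ev: "\<And>x. x \<in> A \<Longrightarrow> evaluates q I x (\<chi> x)"
    and least: "\<And>J. left_ideal q J \<Longrightarrow> (\<And>x. x \<in> A \<Longrightarrow> evaluates q J x (\<chi> x)) \<Longrightarrow> I \<subseteq> J"
  shows "\<exists>\<pi>. presents q UNIV I (induced_module (hecke_algebra q) A (line_module \<chi>)) \<pi>"
proof -
  let ?H = "hecke_algebra q" and ?V = "line_module \<chi> :: (hecke, complex) module"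
  define F where "F = free_Abelian_group (carrier ?H \<times> carrier ?V)"
  define R where "R = balanced_relations ?H A ?V"
  define K where "K = balanced_subgroup ?H A ?V"
  define l where "l = (left_mult_frag ?H :: _ \<Rightarrow> (hecke \<times> complex \<Rightarrow>\<^sub>0 int) \<Rightarrow> _)"
  define W where "W = induced_module ?H A ?V"
  have Vs: "carrier ?V = UNIV" "\<And>x y. x \<oplus>\<^bsub>?V\<^esub> y = x + y" "\<And>a x. a \<odot>\<^bsub>?V\<^esub> x = \<chi> a * x"
    by (simp_all add: line_module_def)
  interpret H: ring ?H by (rule ring_hecke_algebra)
  interpret W: left_module ?H W
    unfolding W_def by (rule left_module_induced_module[OF ring_hecke_algebra A]) (simp_all add: Vs)
  interpret F: comm_group F unfolding F_def by (rule abelian_free_Abelian_group)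
  have Kg: "K = generate F R" by (simp add: K_def F_def R_def balanced_subgroup_def)
  have Fc: "carrier F = {c. Poly_Mapping.keys c \<subseteq> carrier ?H \<times> UNIV}"
    and Fm: "\<And>x y. x \<otimes>\<^bsub>F\<^esub> y = x + y" and F1: "\<one>\<^bsub>F\<^esub> = 0"
    by (auto simp: F_def free_Abelian_group_def Vs)
  have Fi: "inv\<^bsub>F\<^esub> x = - x" if "x \<in> carrier F" for x using that by (simp add: F_def)
  have fo: "frag_of (g, v) \<in> carrier F" if "g \<in> carrier ?H" for g v using that by (simp add: Fc)
  have Fd: "x - y \<in> carrier F" if "x \<in> carrier F" "y \<in> carrier F" for x y
    using F.m_closed[OF that(1) F.inv_closed[OF that(2)]] that by (simp add: Fm Fi)
  have Fa: "x + y \<in> carrier F" if "x \<in> carrier F" "y \<in> carrier F" for x y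
    using F.m_closed[OF that] by (simp add: Fm)
  have AH: "a \<in> carrier ?H" if "a \<in> A" for a using A that by blast
  have RF: "R \<subseteq> carrier F"
    unfolding R_def balanced_relations_def by (auto simp: AH intro!: Fd fo H.a_closed H.m_closed)
  have K: "subgroup K F" unfolding Kg by (rule F.generate_is_subgroup[OF RF])
  interpret K: normal K F by (rule F.subgroup_imp_normal[OF K])
  have RK: "r \<in> K" if "r \<in> R" for r unfolding Kg using that by (rule generate.incl)
  have Wc: "carrier W = rcosets\<^bsub>F\<^esub> K" and W0: "\<zero>\<^bsub>W\<^esub> = K" and Wa: "add W = set_mult F"
    and Ws: "\<And>r C. r \<odot>\<^bsub>W\<^esub> C = (\<Union>c\<in>C. K #>\<^bsub>F\<^esub> l r c)"
    by (simp_all add: W_def induced_module_def Let_def F_def K_def l_def)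
  have coset_iff: "K #>\<^bsub>F\<^esub> x = K #>\<^bsub>F\<^esub> y \<longleftrightarrow> x - y \<in> K" if "x \<in> carrier F" "y \<in> carrier F" for x y
  proof
    assume "K #>\<^bsub>F\<^esub> x = K #>\<^bsub>F\<^esub> y"
    then have "x \<in> K #>\<^bsub>F\<^esub> y" using F.rcos_self[OF that(1) K] by simp
    then show "x - y \<in> K" by (auto simp: r_coset_def Fm)
  next
    assume "x - y \<in> K"
    then have "x \<in> K #>\<^bsub>F\<^esub> y" by (auto simp: r_coset_def Fm intro!: bexI[of _ "x - y"])
    then show "K #>\<^bsub>F\<^esub> x = K #>\<^bsub>F\<^esub> y" using F.repr_independence[OF _ that(2) K] by simp
  qed
  have repI: "K #>\<^bsub>F\<^esub> c \<in> carrier W" if "c \<in> carrier F" for c using that by (auto simp: Wc RCOSETS_def)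
  have plus: "(K #>\<^bsub>F\<^esub> c) \<oplus>\<^bsub>W\<^esub> (K #>\<^bsub>F\<^esub> d) = K #>\<^bsub>F\<^esub> (c + d)" if "c \<in> carrier F" "d \<in> carrier F" for c d
    using K.rcos_sum[OF that] by (simp add: Wa Fm)
  have K0: "K #>\<^bsub>F\<^esub> 0 = K" using F.coset_mult_one[of K] K.subset by (simp add: F1)
  have l1: "l r (frag_of (g, v)) = frag_of (r \<otimes>\<^bsub>?H\<^esub> g, v)" for r g v
    by (simp add: l_def left_mult_frag_simps)
  \<comment> \<open>A coset is determined by any of its elements, so the union defining the action collapses.\<close>
  have act: "r \<odot>\<^bsub>W\<^esub> (K #>\<^bsub>F\<^esub> frag_of (g, v)) = K #>\<^bsub>F\<^esub> frag_of (r \<otimes>\<^bsub>?H\<^esub> g, v)"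
    if r: "r \<in> carrier ?H" and g: "g \<in> carrier ?H" for r g v
  proof -
    have rg: "frag_of (r \<otimes>\<^bsub>?H\<^esub> g, v) \<in> carrier F" using r g by (intro fo) simp
    have "r \<odot>\<^bsub>W\<^esub> (K #>\<^bsub>F\<^esub> frag_of (g, v)) \<in> rcosets\<^bsub>F\<^esub> K"
      using W.lsmult_closed[OF r repI[OF fo[OF g]]] by (simp add: Wc)
    then obtain c where c: "c \<in> carrier F" "r \<odot>\<^bsub>W\<^esub> (K #>\<^bsub>F\<^esub> frag_of (g, v)) = K #>\<^bsub>F\<^esub> c" by (auto simp: RCOSETS_def)
    have "frag_of (g, v) \<in> K #>\<^bsub>F\<^esub> frag_of (g, v)" by (rule F.rcos_self[OF fo[OF g] K])
    moreover have "frag_of (r \<otimes>\<^bsub>?H\<^esub> g, v) \<in> K #>\<^bsub>F\<^esub> l r (frag_of (g, v))"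
      unfolding l1 by (rule F.rcos_self[OF rg K])
    ultimately have "frag_of (r \<otimes>\<^bsub>?H\<^esub> g, v) \<in> K #>\<^bsub>F\<^esub> c" unfolding c(2)[symmetric] Ws by blast
    then show ?thesis unfolding c(2) using F.repr_independence[OF _ c(1) K] by simp
  qed
  define \<pi> where "\<pi> a = K #>\<^bsub>F\<^esub> frag_of (cl q a, 1)" for a
  have R1: "frag_of (g \<oplus>\<^bsub>?H\<^esub> h, v) - frag_of (g, v) - frag_of (h, v) \<in> K" if "g \<in> carrier ?H" "h \<in> carrier ?H" for g h v
    by (rule RK, unfold R_def balanced_relations_def Vs) (use that in blast)
  have R3: "frag_of (g \<otimes>\<^bsub>?H\<^esub> a, v) - frag_of (g, \<chi> a * v) \<in> K" if "g \<in> carrier ?H" "a \<in> A" for g a v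
    by (rule RK, unfold R_def balanced_relations_def Vs) (use that in blast)
  have \<pi>_add: "\<pi> (a + b) = \<pi> a \<oplus>\<^bsub>W\<^esub> \<pi> b" for a b
  proof -
    have "frag_of (cl q (a + b), 1) - (frag_of (cl q a, 1) + frag_of (cl q b, 1)) \<in> K"
      using R1[OF cl_closed cl_closed, of a b 1] by (simp add: cl_ring algebra_simps)
    then show ?thesis
      unfolding \<pi>_def plus[OF fo[OF cl_closed] fo[OF cl_closed]]
      by (subst coset_iff) (auto intro: fo cl_closed Fa)
  qed
  have \<pi>_sm: "\<pi> (a * b) = cl q a \<odot>\<^bsub>W\<^esub> \<pi> b" for a b
    unfolding \<pi>_def act[OF cl_closed cl_closed] by (simp add: cl_ring)
  have \<pi>_0: "\<pi> 0 = \<zero>\<^bsub>W\<^esub>"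
  proof -
    have "\<pi> 0 \<in> carrier W" unfolding \<pi>_def by (rule repI[OF fo[OF cl_closed]])
    then show ?thesis using \<pi>_add[of 0 0] W.M.add.r_cancel_one[of "\<pi> 0" "\<pi> 0"] by simp
  qed
  have \<pi>_scal: "K #>\<^bsub>F\<^esub> frag_of (cl q g, z) = \<pi> (g * fC z)" for g z
  proof -
    have "frag_of (cl q (g * fC z), 1) - frag_of (cl q g, z) \<in> K"
      using R3[OF cl_closed scal(1), of g z 1] by (simp add: cl_generators cl_ring scal(2)[unfolded cl_generators])
    then show ?thesis
      unfolding \<pi>_def by (subst eq_commute, subst coset_iff) (auto intro: fo cl_closed)
  qed
  have \<pi>_minus: "K #>\<^bsub>F\<^esub> (c - d) = \<pi> (a - b)" if "c \<in> carrier F" "d \<in> carrier F" "K #>\<^bsub>F\<^esub> c = \<pi> a" "K #>\<^bsub>F\<^esub> d = \<pi> b" for a b c d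
  proof -
    have d: "c - d \<in> carrier F" by (rule Fd[OF that(1,2)])
    have "(K #>\<^bsub>F\<^esub> (c - d)) \<oplus>\<^bsub>W\<^esub> \<pi> b = \<pi> a" unfolding that(4)[symmetric] plus[OF d that(2)] using that(3) by simp
    moreover have "\<pi> (a - b) \<oplus>\<^bsub>W\<^esub> \<pi> b = \<pi> a" using \<pi>_add[of "a - b" b] by simp
    moreover have "\<pi> b \<in> carrier W" "\<pi> (a - b) \<in> carrier W" unfolding \<pi>_def by (rule repI[OF fo[OF cl_closed]])+
    ultimately show ?thesis using W.M.add.right_cancel[of "\<pi> b" "K #>\<^bsub>F\<^esub> (c - d)" "\<pi> (a - b)"] repI[OF d] by simp
  qed
  have surj: "\<exists>a. K #>\<^bsub>F\<^esub> c = \<pi> a" if "c \<in> carrier F" for c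
  proof -
    have "Poly_Mapping.keys c \<subseteq> carrier ?H \<times> UNIV" using that by (simp add: Fc)
    then have "c \<in> carrier F \<and> (\<exists>a. K #>\<^bsub>F\<^esub> c = \<pi> a)"
    proof (induction c rule: frag_induction)
      case zero
      have "K #>\<^bsub>F\<^esub> 0 = \<pi> 0" unfolding K0 \<pi>_0 W0 by simp
      then show ?case using F.one_closed by (auto simp: F1)
    next
      case (one x)
      then obtain a z where "x = (cl q a, z)" by (cases x) (auto simp: hecke_carrier)
      then show ?case using \<pi>_scal[of a z] fo[OF cl_closed] by blast
    next
      case (diff c d)
      then obtain a b where "K #>\<^bsub>F\<^esub> c = \<pi> a" "K #>\<^bsub>F\<^esub> d = \<pi> b" "c \<in> carrier F" "d \<in> carrier F" by blast
      then show ?case using \<pi>_minus[of c d a b] Fd[of c d] by blast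
    qed
    then show ?thesis by blast
  qed
  have im: "range \<pi> = carrier W"
    using surj repI[OF fo[OF cl_closed]] by (auto simp: \<pi>_def Wc RCOSETS_def image_iff)
  \<comment> \<open>The universal property, in the form needed: evaluating a formal sum in the free algebra modulo \<open>I\<close>
    kills the relations.\<close>
  define rep where "rep g = (SOME a. g = cl q a)" for g
  have rep: "cl q (rep g) = g" if "g \<in> carrier ?H" for g
  proof -
    have "\<exists>a. g = cl q a" using that by (auto simp: hecke_carrier)
    from someI_ex[OF this] show ?thesis unfolding rep_def by (rule sym)
  qed
  define \<psi> where "\<psi> = (\<lambda>(g, z). rep g * fC z)"
  define \<sigma> where "\<sigma> = pm_extend (\<lambda>x (n::int). of_int n * \<psi> x)"
  have \<sigma>_add: "\<sigma> (c + d) = \<sigma> c + \<sigma> d" for c d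
    unfolding \<sigma>_def by (rule pm_extend_add) (simp_all add: distrib_right)
  have \<sigma>0: "\<sigma> 0 = 0" by (simp add: \<sigma>_def)
  have \<sigma>_minus: "\<sigma> (- c) = - \<sigma> c" for c using \<sigma>_add[of "- c" c] \<sigma>0 by (simp add: eq_neg_iff_add_eq_0)
  have \<sigma>_diff: "\<sigma> (c - d) = \<sigma> c - \<sigma> d" for c d using \<sigma>_add[of c "- d"] \<sigma>_minus by simp
  have \<sigma>_of: "\<sigma> (frag_of (g, z)) = rep g * fC z" for g z
    unfolding \<sigma>_def by (subst pm_extend_single) (simp_all add: \<psi>_def)
  note LI = lin_spaceD[OF left_idealD(3)[OF I]]
  have hI: "x * fC z \<in> I" if "x \<in> I" for x z
    using LI(3)[OF that, of z] by (simp add: fC_central)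
  have \<sigma>R: "\<sigma> r \<in> I" if rR: "r \<in> R" for r
  proof -
    consider (1) g h v where "r = frag_of (g \<oplus>\<^bsub>?H\<^esub> h, v) - frag_of (g, v) - frag_of (h, v)" "g \<in> carrier ?H" "h \<in> carrier ?H"
      | (2) g v w where "r = frag_of (g, v + w) - frag_of (g, v) - frag_of (g, w)"
      | (3) g a v where "r = frag_of (g \<otimes>\<^bsub>?H\<^esub> a, v) - frag_of (g, \<chi> a * v)" "g \<in> carrier ?H" "a \<in> A"
      using rR unfolding R_def balanced_relations_def Vs by blast
    then show ?thesis
    proof cases
      case 1
      have "cl q (rep (g \<oplus>\<^bsub>?H\<^esub> h)) = cl q (rep g + rep h)"
        using rep 1 H.a_closed by (simp flip: cl_ring)
      then have "rep (g \<oplus>\<^bsub>?H\<^esub> h) - (rep g + rep h) \<in> I" using left_idealD(1)[OF I] by (simp add: cl_eq_iff)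
      then have "(rep (g \<oplus>\<^bsub>?H\<^esub> h) - (rep g + rep h)) * fC v \<in> I" by (rule hI)
      then show ?thesis by (simp add: 1(1) \<sigma>_add \<sigma>_diff \<sigma>_of algebra_simps)
    next
      case 2
      have "\<sigma> r = 0" by (simp add: 2 \<sigma>_add \<sigma>_diff \<sigma>_of fC_simps(3) distrib_left)
      then show ?thesis using LI(1) by simp
    next
      case 3
      have aH: "a \<in> carrier ?H" using A 3(3) by blast
      have "cl q (rep (g \<otimes>\<^bsub>?H\<^esub> a)) = cl q (rep g * rep a)"
        using rep 3(2) aH H.m_closed by (simp flip: cl_ring)
      then have i1: "rep (g \<otimes>\<^bsub>?H\<^esub> a) - rep g * rep a \<in> I" using left_idealD(1)[OF I] by (simp add: cl_eq_iff)
      have "evaluates q I (cl q (rep a)) (\<chi> a)" using ev[OF 3(3)] rep[OF aH] by simp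
      then have i2: "rep g * (rep a - fC (\<chi> a)) \<in> I" using evaluates_cl[OF I] left_idealD(2)[OF I] by blast
      have "\<sigma> r = (rep (g \<otimes>\<^bsub>?H\<^esub> a) - rep g * rep a) * fC v + (rep g * (rep a - fC (\<chi> a))) * fC v"
        by (simp add: 3(1) \<sigma>_diff \<sigma>_of fC_simps(4) left_diff_distrib right_diff_distrib mult.assoc)
      then show ?thesis using LI(2)[OF hI[OF i1] hI[OF i2]] by simp
    qed
  qed
  have \<sigma>K: "\<sigma> k \<in> I" if "k \<in> K" for k
    using that unfolding Kg
  proof (induction rule: generate.induct)
    case one then show ?case by (simp add: F1 \<sigma>0 LI(1))
  next
    case (incl h) then show ?case by (rule \<sigma>R)
  next
    case (inv h)
    then have "inv\<^bsub>F\<^esub> h = - h" using RF Fi by blast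
    then show ?case using LI(4)[OF \<sigma>R[OF inv]] by (simp add: \<sigma>_minus)
  next
    case (eng h1 h2) then show ?case using LI(2) by (simp add: Fm \<sigma>_add)
  qed
  have ker1: "a \<in> I" if "\<pi> a = \<pi> 0" for a
  proof -
    have "frag_of (cl q a, 1) - frag_of (cl q 0, 1) \<in> K"
      using that unfolding \<pi>_def by (subst (asm) coset_iff) (auto intro: fo cl_closed)
    from \<sigma>K[OF this] have "rep (cl q a) - rep (cl q 0) \<in> I" by (simp add: \<sigma>_diff \<sigma>_of fC_simps)
    moreover have "rep (cl q b) - b \<in> I" for b
      using rep[OF cl_closed, of b] left_idealD(1)[OF I] by (simp add: cl_eq_iff)
    ultimately have "(rep (cl q a) - rep (cl q 0)) - (rep (cl q a) - a) + (rep (cl q 0) - 0) \<in> I"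
      using LI(2,5) by blast
    then show ?thesis by simp
  qed
  have "I \<subseteq> {a. \<pi> a = \<pi> 0}"
  proof (rule least)
    show "left_ideal q {a. \<pi> a = \<pi> 0}"
      unfolding left_ideal_def
    proof (intro conjI ballI allI subsetI)
      fix a assume "a \<in> hecke_ideal q"
      then have "cl q a = cl q 0" by (simp add: cl_eq_iff)
      then show "a \<in> {a. \<pi> a = \<pi> 0}" by (simp add: \<pi>_def)
    next
      fix x a assume x: "x \<in> {a. \<pi> a = \<pi> 0}"
      have "\<pi> (a * x) = \<pi> (a * 0)" using x unfolding \<pi>_sm[of a x] \<pi>_sm[of a 0] by simp
      then show "a * x \<in> {a. \<pi> a = \<pi> 0}" by simp
      fix y assume "y \<in> {a. \<pi> a = \<pi> 0}"
      then have "\<pi> (x + y) = \<pi> (0 + 0)" using x unfolding \<pi>_add[of x y] \<pi>_add[of 0 0] by simp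
      then show "x + y \<in> {a. \<pi> a = \<pi> 0}" by simp
    qed
    fix x assume x: "x \<in> A"
    then obtain a where a: "x = cl q a" using AH[OF x] by (auto simp: hecke_carrier)
    have "frag_of (\<one>\<^bsub>?H\<^esub> \<otimes>\<^bsub>?H\<^esub> cl q a, 1) - frag_of (\<one>\<^bsub>?H\<^esub>, \<chi> x * 1) \<in> K"
      unfolding a[symmetric] by (rule R3[OF H.one_closed x])
    then have "frag_of (cl q a, 1) - frag_of (cl q 1, \<chi> x) \<in> K" by (simp add: cl_ring)
    then have "\<pi> a = \<pi> (1 * fC (\<chi> x))"
      unfolding \<pi>_scal[symmetric] unfolding \<pi>_def by (subst coset_iff) (auto intro: fo cl_closed)
    then have "\<pi> (a - fC (\<chi> x)) = \<pi> 0"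
    proof -
      assume e: "\<pi> a = \<pi> (1 * fC (\<chi> x))"
      have c: "frag_of (cl q a, 1) \<in> carrier F" "frag_of (cl q (fC (\<chi> x)), 1) \<in> carrier F" by (rule fo[OF cl_closed])+
      have "K #>\<^bsub>F\<^esub> (frag_of (cl q a, 1) - frag_of (cl q (fC (\<chi> x)), 1)) = \<pi> (a - fC (\<chi> x))"
        by (rule \<pi>_minus[OF c]) (simp_all add: \<pi>_def)
      moreover have "K #>\<^bsub>F\<^esub> (frag_of (cl q a, 1) - frag_of (cl q (fC (\<chi> x)), 1)) = \<pi> (fC (\<chi> x) - fC (\<chi> x))"
        by (rule \<pi>_minus[OF c]) (use e in \<open>simp_all add: \<pi>_def\<close>)
      ultimately show ?thesis by simp
    qed
    then show "evaluates q {a. \<pi> a = \<pi> 0} x (\<chi> x)" using a by (auto simp: evaluates_def)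
  qed
  then have "\<pi> a = \<pi> 0 \<longleftrightarrow> a \<in> I" for a using ker1 by blast
  then have "presents q UNIV I W \<pi>"
    unfolding presents_def using I left_ideal_UNIV im \<pi>_0 \<pi>_add \<pi>_sm by (auto simp: \<pi>_0)
  then show ?thesis unfolding W_def by blast
qed

section \<open>The left ideals presenting the induced modules\<close>

text \<open>The left ideals generated by the relations of the vector \<open>1 \<otimes> 1\<close> in the two kinds of induced modules.\<close>

definition X_ideal :: "complex \<Rightarrow> (lattice \<Rightarrow> complex) \<Rightarrow> free_algebra set" where
  "X_ideal q s = \<Inter>{J. left_ideal q J \<and> wt J s 1}"

definition par_ideal :: "complex \<Rightarrow> complex \<Rightarrow> (lattice \<Rightarrow> complex) \<Rightarrow> free_algebra set" where
  "par_ideal q c s = \<Inter>{J. left_ideal q J \<and> wt J s 1 \<and> fT I1 - fC c \<in> J}"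

lemma left_ideal_Inter:
  assumes "\<And>J. J \<in> F \<Longrightarrow> left_ideal q J"
  shows "left_ideal q (\<Inter>F)"
  using assms unfolding left_ideal_def by (simp add: subset_iff)

lemma X_ideal:
  shows "left_ideal q (X_ideal q s)" "wt (X_ideal q s) s 1" "left_ideal q J \<Longrightarrow> wt J s 1 \<Longrightarrow> X_ideal q s \<subseteq> J"
proof -
  show "left_ideal q (X_ideal q s)" unfolding X_ideal_def by (rule left_ideal_Inter) simp
  show "wt (X_ideal q s) s 1" by (simp add: X_ideal_def wt_def)
qed (auto simp: X_ideal_def)

lemma par_ideal:
  shows "left_ideal q (par_ideal q c s)" "wt (par_ideal q c s) s 1" "fT I1 - fC c \<in> par_ideal q c s"
    "left_ideal q J \<Longrightarrow> wt J s 1 \<Longrightarrow> fT I1 - fC c \<in> J \<Longrightarrow> par_ideal q c s \<subseteq> J"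
proof -
  show "left_ideal q (par_ideal q c s)" unfolding par_ideal_def by (rule left_ideal_Inter) simp
  show "wt (par_ideal q c s) s 1" by (simp add: par_ideal_def wt_def)
qed (auto simp: par_ideal_def)

lemma evaluates_generators:
  assumes "left_ideal q J"
  shows "evaluates q J (hX q \<nu>) z \<longleftrightarrow> fX \<nu> - fC z \<in> J" "evaluates q J (hT q i) z \<longleftrightarrow> fT i - fC z \<in> J"
  by (simp_all add: cl_generators evaluates_cl[OF assms])

lemma wt_one: "wt J s 1 \<longleftrightarrow> (\<forall>\<nu>. fX \<nu> - fC (s \<nu>) \<in> J)"
  by (simp add: wt_def)

lemma generators_closed: "range (hX q) \<subseteq> carrier (hecke_algebra q)" "hT q i \<in> carrier (hecke_algebra q)"
  by (auto simp: cl_generators cl_closed)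

lemma H_X_sub: "H_X q \<subseteq> carrier (hecke_algebra q)" "hX q \<nu> \<in> H_X q"
  unfolding H_X_def by (rule subalgebra_carrier[OF generators_closed(1)], rule subalgebra_closed(2), simp)

lemma H_par_sub: "H_par q i \<subseteq> carrier (hecke_algebra q)" "H_X q \<subseteq> H_par q i" "hT q i \<in> H_par q i"
  unfolding H_par_def using H_X_sub(1) generators_closed(2)
  by (intro subalgebra_carrier, simp) (auto intro: subalgebra_closed(2))

text \<open>That the character with the prescribed values exists is part of the claim; it follows from the existence of a
  proper left ideal containing the relations.\<close>

lemma principal_series_presents:
  assumes J: "left_ideal q J" "wt J s 1" "1 \<notin> J"
  shows "\<exists>\<pi>. presents q UNIV (X_ideal q s) (principal_series q s) \<pi>"
proof -
  let ?I = "X_ideal q s"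
  note I = X_ideal(1,2)[of q s]
  have one: "1 \<notin> ?I" using X_ideal(3)[OF J(1,2)] J(3) by blast
  have X: "evaluates q ?I (hX q \<nu>) (s \<nu>)" for \<nu>
    using I(2) by (simp add: evaluates_generators[OF I(1)] wt_one)
  have "\<exists>\<chi>\<in>characters q (H_X q). \<forall>x\<in>H_X q. evaluates q ?I x (\<chi> x)"
    unfolding H_X_def by (rule character_exists[OF I(1) _ one]) (use X in blast)
  then obtain \<chi> where \<chi>: "\<chi> \<in> characters q (H_X q)" "\<And>x. x \<in> H_X q \<Longrightarrow> evaluates q ?I x (\<chi> x)" by blast
  have \<chi>X: "\<chi> (hX q \<nu>) = s \<nu>" for \<nu> by (rule evaluates_unique[OF I(1) one \<chi>(2)[OF H_X_sub(2)] X])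
  have "(THE \<psi>. \<psi> \<in> characters q (H_X q) \<and> (\<forall>\<nu>. \<psi> (hX q \<nu>) = s \<nu>)) = \<chi>"
  proof (rule the_equality)
    show "\<chi> \<in> characters q (H_X q) \<and> (\<forall>\<nu>. \<chi> (hX q \<nu>) = s \<nu>)" using \<chi>(1) \<chi>X by simp
    fix \<psi> assume \<psi>: "\<psi> \<in> characters q (H_X q) \<and> (\<forall>\<nu>. \<psi> (hX q \<nu>) = s \<nu>)"
    have "\<psi> x = \<chi> x" if "x \<in> H_X q" for x
      by (rule character_agree[where S = "range (hX q)", OF conjunct1[OF \<psi>] \<chi>(1) _ generators_closed(1)])
        (use \<psi> \<chi>X that in \<open>auto simp: H_X_def\<close>)
    then show "\<psi> = \<chi>" using \<psi> \<chi>(1) by (intro extensionalityI[of \<psi> "H_X q" \<chi>]) (auto simp: characters_def)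
  qed
  then have line: "line_X q s = line_module \<chi>" by (simp add: line_X_def)
  show ?thesis
    unfolding principal_series_def line
  proof (rule induced_presents[OF H_X_sub(1) I(1)])
    show "hC q c \<in> H_X q" for c unfolding H_X_def by (rule subalgebra_closed)
    show "\<chi> (hC q c) = c" for c using \<chi>(1) by (simp add: characters_def)
    show "evaluates q ?I x (\<chi> x)" if "x \<in> H_X q" for x by (rule \<chi>(2)[OF that])
    fix J assume J: "left_ideal q J" "\<And>x. x \<in> H_X q \<Longrightarrow> evaluates q J x (\<chi> x)"
    have "evaluates q J (hX q \<nu>) (s \<nu>)" for \<nu> using J(2)[OF H_X_sub(2)] by (simp add: \<chi>X)
    then show "?I \<subseteq> J" by (intro X_ideal(3) J(1)) (simp add: wt_one evaluates_generators[OF J(1)])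
  qed
qed

lemma parabolic_presents:
  assumes J: "left_ideal q J" "wt J s 1" "fT I1 - fC c \<in> J" "1 \<notin> J"
  shows "\<exists>\<pi>. presents q UNIV (par_ideal q c s) (induced_module (hecke_algebra q) (H_par q I1) (line_par q I1 c s)) \<pi>"
proof -
  let ?I = "par_ideal q c s" and ?A = "H_par q I1"
  note I = par_ideal(1,2)[of q c s] par_ideal(3)[of c q s]
  have one: "1 \<notin> ?I" using par_ideal(4)[OF J(1-3)] J(4) by blast
  have X: "evaluates q ?I (hX q \<nu>) (s \<nu>)" for \<nu>
    using I(2) by (simp add: evaluates_generators[OF I(1)] wt_one)
  have T: "evaluates q ?I (hT q I1) c" using I(3) by (simp add: evaluates_generators[OF I(1)])
  have HX: "\<exists>z. evaluates q ?I x z" if "x \<in> H_X q" for x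
    by (rule subalgebra_evaluates[OF I(1) _ that[unfolded H_X_def]]) (use X in blast)
  have "\<exists>\<chi>\<in>characters q ?A. \<forall>x\<in>?A. evaluates q ?I x (\<chi> x)"
    unfolding H_par_def by (rule character_exists[OF I(1) _ one]) (use HX T in blast)
  then obtain \<chi> where \<chi>: "\<chi> \<in> characters q ?A" "\<And>x. x \<in> ?A \<Longrightarrow> evaluates q ?I x (\<chi> x)" by blast
  have XA: "hX q \<nu> \<in> ?A" for \<nu> using H_X_sub(2) H_par_sub(2) by blast
  have \<chi>X: "\<chi> (hX q \<nu>) = s \<nu>" for \<nu> by (rule evaluates_unique[OF I(1) one \<chi>(2)[OF XA] X])
  have \<chi>T: "\<chi> (hT q I1) = c" by (rule evaluates_unique[OF I(1) one \<chi>(2)[OF H_par_sub(3)] T])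
  have "(THE \<psi>. \<psi> \<in> characters q ?A \<and> \<psi> (hT q I1) = c \<and> (\<forall>\<nu>. \<psi> (hX q \<nu>) = s \<nu>)) = \<chi>"
  proof (rule the_equality)
    show "\<chi> \<in> characters q ?A \<and> \<chi> (hT q I1) = c \<and> (\<forall>\<nu>. \<chi> (hX q \<nu>) = s \<nu>)" using \<chi>(1) \<chi>X \<chi>T by simp
    fix \<psi> assume \<psi>: "\<psi> \<in> characters q ?A \<and> \<psi> (hT q I1) = c \<and> (\<forall>\<nu>. \<psi> (hX q \<nu>) = s \<nu>)"
    have 1: "\<psi> x = \<chi> x" if "x \<in> H_X q" for x
      by (rule character_agree[where S = "range (hX q)", OF conjunct1[OF \<psi>] \<chi>(1) _ generators_closed(1)])
        (use \<psi> \<chi>X that H_par_sub(2)[of q I1] in \<open>auto simp: H_X_def\<close>)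
    have 2: "\<psi> x = \<chi> x" if "x \<in> ?A" for x
      by (rule character_agree[where S = "insert (hT q I1) (H_X q)", OF conjunct1[OF \<psi>] \<chi>(1)])
        (use \<psi> \<chi>T 1 that H_X_sub(1) generators_closed(2) in \<open>auto simp: H_par_def\<close>)
    show "\<psi> = \<chi>" using \<psi> \<chi>(1) 2 by (intro extensionalityI[of \<psi> "?A" \<chi>]) (auto simp: characters_def)
  qed
  then have line: "line_par q I1 c s = line_module \<chi>" by (simp add: line_par_def)
  show ?thesis
    unfolding line
  proof (rule induced_presents[OF H_par_sub(1) I(1)])
    show "hC q k \<in> ?A" for k unfolding H_par_def by (rule subalgebra_closed)
    show "\<chi> (hC q k) = k" for k using \<chi>(1) by (simp add: characters_def)
    show "evaluates q ?I x (\<chi> x)" if "x \<in> ?A" for x by (rule \<chi>(2)[OF that])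
    fix J assume J: "left_ideal q J" "\<And>x. x \<in> ?A \<Longrightarrow> evaluates q J x (\<chi> x)"
    have "evaluates q J (hX q \<nu>) (s \<nu>)" for \<nu> using J(2)[OF XA] by (simp add: \<chi>X)
    moreover have "evaluates q J (hT q I1) c" using J(2)[OF H_par_sub(3)] by (simp add: \<chi>T)
    ultimately show "?I \<subseteq> J" by (intro par_ideal(4) J(1)) (simp_all add: wt_one evaluates_generators[OF J(1)])
  qed
qed

section \<open>Weights of presented modules\<close>

lemma weight_space_presents:
  assumes P: "presents q UNIV I D \<pi>"
  shows "weight_space q D s = \<pi> ` {a. wt I s a}"
proof -
  have "hX q \<nu> \<odot>\<^bsub>D\<^esub> \<pi> a = hC q (s \<nu>) \<odot>\<^bsub>D\<^esub> \<pi> a \<longleftrightarrow> fX \<nu> * a - fC (s \<nu>) * a \<in> I" for a \<nu>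
    unfolding cl_generators presentsD(7)[OF P UNIV_I, symmetric] by (rule presents_eq_iff[OF P UNIV_I UNIV_I])
  then have "(\<forall>\<nu>. hX q \<nu> \<odot>\<^bsub>D\<^esub> \<pi> a = hC q (s \<nu>) \<odot>\<^bsub>D\<^esub> \<pi> a) \<longleftrightarrow> wt I s a" for a by (simp only: wt_def)
  then show ?thesis unfolding weight_space_def presentsD(4)[OF P, symmetric] by blast
qed

lemma cl_power: "cl q a [^]\<^bsub>hecke_algebra q\<^esub> (k::nat) = cl q (a ^ k)"
proof -
  interpret ring "hecke_algebra q" by (rule ring_hecke_algebra)
  show ?thesis by (induction k) (simp_all add: cl_ring power_commutes)
qed

lemma cl_diff: "cl q a \<ominus>\<^bsub>hecke_algebra q\<^esub> cl q b = cl q (a - b)"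
proof -
  interpret ring "hecke_algebra q" by (rule ring_hecke_algebra)
  show ?thesis by (simp add: a_minus_def cl_minus cl_ring)
qed

lemma power_kills:
  fixes u b :: free_algebra
  assumes "b \<notin> J" "u ^ k * b \<in> J"
  shows "\<exists>j<k. u ^ j * b \<notin> J \<and> u * (u ^ j * b) \<in> J"
proof -
  have z: "\<not> u ^ 0 * b \<in> J" using assms(1) by simp
  obtain j where "j < k" "\<forall>i\<le>j. \<not> u ^ i * b \<in> J" "u ^ Suc j * b \<in> J"
    using ex_least_nat_less[of "\<lambda>k. u ^ k * b \<in> J" k, OF assms(2) z] by auto
  then show ?thesis by (auto simp: mult.assoc intro!: exI[of _ j])
qed

text \<open>A nonzero generalised weight vector yields a weight vector: the operators of the two
  basis elements of the lattice commute, so their nilpotent parts can be killed successively.\<close>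

lemma gen_weight_vector:
  assumes P: "presents q UNIV J D \<rho>" and s: "s \<in> torus" and m: "m \<in> gen_weight_space q D s" "m \<noteq> \<zero>\<^bsub>D\<^esub>"
  shows "\<exists>b. b \<notin> J \<and> wt J s b"
proof -
  note J = presentsD(1)[OF P]
  note L = lin_spaceD[OF left_idealD(3)[OF J]]
  define u where "u \<nu> = fX \<nu> - fC (s \<nu>)" for \<nu>
  have mult: "s (\<nu> + \<mu>) = s \<nu> * s \<mu>" and nz: "s \<nu> \<noteq> 0" for \<nu> \<mu> using s by (auto simp: torus_def)
  have s0: "s 0 = 1" using lattice_charD(1)[OF torus_char[OF s]] .
  have "m \<in> \<rho> ` UNIV" using m(1) presentsD(4)[OF P] by (auto simp: gen_weight_space_def)
  then obtain b where b: "m = \<rho> b" by blast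
  have bJ: "b \<notin> J" using m(2) presentsD(5,8)[OF P] b by simp
  have pow: "\<exists>k. u \<nu> ^ k * b \<in> J" for \<nu>
  proof -
    obtain k where k: "((hX q \<nu> \<ominus>\<^bsub>hecke_algebra q\<^esub> hC q (s \<nu>)) [^]\<^bsub>hecke_algebra q\<^esub> (k::nat)) \<odot>\<^bsub>D\<^esub> m = \<zero>\<^bsub>D\<^esub>"
      using m(1) by (auto simp: gen_weight_space_def)
    have "\<rho> (u \<nu> ^ k * b) = \<rho> 0"
      using k unfolding cl_generators cl_diff cl_power b u_def presentsD(7)[OF P UNIV_I, symmetric] presentsD(5)[OF P] .
    then show ?thesis using presentsD(8)[OF P] by blast
  qed
  have hecke_lin: "lin_space (hecke_ideal q)" unfolding lin_space_def using hecke_ideal_closed(1-3) by blast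
  have XX: "fX \<nu> * (fX \<mu> * x) - fX \<mu> * (fX \<nu> * x) \<in> hecke_ideal q" for \<nu> \<mu> x
  proof -
    have "(fX \<nu> * (fX \<mu> * x) - fX (\<nu> + \<mu>) * x) - (fX \<mu> * (fX \<nu> * x) - fX (\<mu> + \<nu>) * x) \<in> hecke_ideal q"
      by (rule lin_spaceD(5)[OF hecke_lin hecke_ideal_relations(2) hecke_ideal_relations(2)])
    then show ?thesis by (simp add: add.commute)
  qed
  have comm: "u \<nu> * (u \<mu> * x) - u \<mu> * (u \<nu> * x) \<in> hecke_ideal q" for \<nu> \<mu> x
    using XX[of \<nu> \<mu> x] by (simp add: u_def algebra_simps fC_move fC_swap)
  have comm_pow: "u \<nu> ^ k * (u \<mu> * x) - u \<mu> * (u \<nu> ^ k * x) \<in> J" for \<nu> \<mu> x k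
  proof (induction k arbitrary: x)
    case (Suc k)
    have "u \<nu> ^ k * (u \<nu> * (u \<mu> * x) - u \<mu> * (u \<nu> * x)) \<in> J"
      by (rule left_idealD(2)[OF J left_idealD(1)[OF J comm]])
    from L(2)[OF this Suc[of "u \<nu> * x"]] show ?case
      by (simp add: right_diff_distrib power_Suc2 mult.assoc del: power_Suc)
  qed (simp add: L(1))
  have transfer: "u \<nu> ^ k * (u \<mu> ^ j * x) \<in> J" if "u \<nu> ^ k * x \<in> J" for \<nu> \<mu> k j x
  proof (induction j)
    case (Suc j)
    have "u \<mu> * (u \<nu> ^ k * (u \<mu> ^ j * x)) \<in> J" by (rule left_idealD(2)[OF J Suc])
    then show ?case
      using lin_space_diff_iff[OF left_idealD(3)[OF J] comm_pow[of \<nu> k \<mu> "u \<mu> ^ j * x"]] by (simp add: mult.assoc)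
  qed (use that in simp)
  obtain k where k: "u (1, 0) ^ k * b \<in> J" using pow by blast
  from power_kills[OF bJ k] obtain j where j: "u (1, 0) ^ j * b \<notin> J" "u (1, 0) * (u (1, 0) ^ j * b) \<in> J" by blast
  define c where "c = u (1, 0) ^ j * b"
  obtain l where l: "u (0, 1) ^ l * b \<in> J" using pow by blast
  have "u (0, 1) ^ l * c \<in> J" unfolding c_def by (rule transfer[OF l])
  from power_kills[OF j(1)[folded c_def] this]
  obtain i where i: "u (0, 1) ^ i * c \<notin> J" "u (0, 1) * (u (0, 1) ^ i * c) \<in> J" by blast
  define d where "d = u (0, 1) ^ i * c"
  have d1: "u (1, 0) * d \<in> J" unfolding d_def using transfer[of "(1, 0)" 1 c] j(2) by (simp add: c_def)
  have d2: "u (0, 1) * d \<in> J" unfolding d_def by (rule i(2))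
  have step: "u (\<nu> + \<mu>) * d \<in> J" if "u \<nu> * d \<in> J" "u \<mu> * d \<in> J" for \<nu> \<mu>
  proof -
    have "fX \<nu> * (fX \<mu> * d) - fX (\<nu> + \<mu>) * d \<in> J" by (rule left_idealD(1)[OF J hecke_ideal_relations(2)])
    moreover have "fX \<nu> * (u \<mu> * d) + fC (s \<mu>) * (u \<nu> * d) \<in> J" by (rule L(2)[OF left_idealD(2)[OF J that(2)] L(3)[OF that(1)]])
    ultimately have "(fX \<nu> * (u \<mu> * d) + fC (s \<mu>) * (u \<nu> * d)) - (fX \<nu> * (fX \<mu> * d) - fX (\<nu> + \<mu>) * d) \<in> J" using L(5) by blast
    moreover have "(fX \<nu> * (u \<mu> * d) + fC (s \<mu>) * (u \<nu> * d)) - (fX \<nu> * (fX \<mu> * d) - fX (\<nu> + \<mu>) * d) = u (\<nu> + \<mu>) * d"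
      by (simp add: u_def mult fC_simps algebra_simps fC_move fC_swap)
    ultimately show ?thesis by simp
  qed
  have neg: "u (- \<nu>) * d \<in> J" if "u \<nu> * d \<in> J" for \<nu>
  proof -
    have a: "fX (- \<nu>) * (fX \<nu> * d) - fX (- \<nu> + \<nu>) * d \<in> J" by (rule left_idealD(1)[OF J hecke_ideal_relations(2)])
    have b: "fX 0 * d - d \<in> J" by (rule left_idealD(1)[OF J hecke_ideal_relations(1)])
    have c: "fX (- \<nu>) * (u \<nu> * d) \<in> J" by (rule left_idealD(2)[OF J that])
    have inv: "s (- \<nu>) * s \<nu> = 1" using mult[of "- \<nu>" \<nu>] s0 by simp
    have "fC (s (- \<nu>)) * (((fX (- \<nu>) * (fX \<nu> * d) - fX (- \<nu> + \<nu>) * d) + (fX 0 * d - d)) - fX (- \<nu>) * (u \<nu> * d)) \<in> J"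
      by (rule L(3)[OF L(5)[OF L(2)[OF a b] c]])
    moreover have "fC (s (- \<nu>)) * (((fX (- \<nu>) * (fX \<nu> * d) - fX (- \<nu> + \<nu>) * d) + (fX 0 * d - d)) - fX (- \<nu>) * (u \<nu> * d))
       = fC (s (- \<nu>)) * (fC (s \<nu>) * (fX (- \<nu>) * d)) - fC (s (- \<nu>)) * d"
      by (simp add: u_def algebra_simps fC_move)
    moreover have "\<dots> = u (- \<nu>) * d" by (simp add: fC_merge inv fC_simps u_def left_diff_distrib)
    ultimately show ?thesis by simp
  qed
  have zero: "u 0 * d \<in> J"
    using left_idealD(1)[OF J hecke_ideal_relations(1), of d] by (simp add: u_def s0 fC_simps left_diff_distrib)
  have line: "u (lattice_scale n \<nu>) * d \<in> J" if "u \<nu> * d \<in> J" for n \<nu>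
  proof (induction n rule: int_induct[where k = 0])
    case base then show ?case using zero by (simp add: lattice_scale_def zero_prod_def)
  next
    case (step1 n)
    have "lattice_scale (n + 1) \<nu> = lattice_scale n \<nu> + \<nu>" by (simp add: lattice_scale_def prod_eq_iff algebra_simps)
    then show ?case using step[OF step1(2) that] by simp
  next
    case (step2 n)
    have "lattice_scale (n - 1) \<nu> = lattice_scale n \<nu> + - \<nu>" by (simp add: lattice_scale_def prod_eq_iff algebra_simps)
    then show ?case using step[OF step2(2) neg[OF that]] by simp
  qed
  have "u \<nu> * d \<in> J" for \<nu>
  proof -
    have "\<nu> = lattice_scale (fst \<nu>) (1, 0) + lattice_scale (snd \<nu>) (0, 1)" by (simp add: lattice_scale_def prod_eq_iff)
    then show ?thesis using step[OF line[OF d1] line[OF d2]] by metis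
  qed
  then have "wt J s d" by (simp add: wt_def u_def left_diff_distrib)
  then show ?thesis using i(1) d_def by blast
qed

lemma weight_in_gen:
  assumes P: "presents q UNIV J D \<rho>" and w: "wt J s b" "b \<notin> J" and s: "s \<in> torus"
  shows "s \<in> weights q D"
proof -
  have "\<rho> b \<in> weight_space q D s" using w(1) by (simp add: weight_space_presents[OF P])
  have "((hX q \<nu> \<ominus>\<^bsub>hecke_algebra q\<^esub> hC q (s \<nu>)) [^]\<^bsub>hecke_algebra q\<^esub> (1::nat)) \<odot>\<^bsub>D\<^esub> \<rho> b = \<zero>\<^bsub>D\<^esub>" for \<nu>
    unfolding cl_generators cl_diff cl_power presentsD(7)[OF P UNIV_I, symmetric] presentsD(5)[OF P]
    using presentsD(8)[OF P] w(1) by (simp add: wt_def left_diff_distrib)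
  then have "\<rho> b \<in> gen_weight_space q D s"
    unfolding gen_weight_space_def using presentsD(9)[OF P, of b] by (auto intro!: exI[of _ "1::nat"])
  moreover have "\<rho> b \<noteq> \<zero>\<^bsub>D\<^esub>" using w(2) presentsD(5,8)[OF P] by simp
  ultimately show ?thesis using s by (auto simp: weights_def)
qed

lemma weight_vector_of_weight:
  assumes P: "presents q UNIV J D \<rho>" and s: "s \<in> weights q D"
  shows "\<exists>b. b \<notin> J \<and> wt J s b"
proof -
  have st: "s \<in> torus" "gen_weight_space q D s \<noteq> {\<zero>\<^bsub>D\<^esub>}" using s by (auto simp: weights_def)
  interpret left_module "hecke_algebra q" D by (rule presents_left_module[OF P])
  have "\<zero>\<^bsub>D\<^esub> \<in> gen_weight_space q D s"
  proof -
    have "cl q a \<odot>\<^bsub>D\<^esub> \<zero>\<^bsub>D\<^esub> = \<zero>\<^bsub>D\<^esub>" for a unfolding presentsD(5)[OF P] using presentsD(7)[OF P, of 0 a] by simp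
    then show ?thesis unfolding gen_weight_space_def cl_generators cl_diff cl_power by (auto intro!: exI[of _ "1::nat"])
  qed
  then obtain m where "m \<in> gen_weight_space q D s" "m \<noteq> \<zero>\<^bsub>D\<^esub>" using st(2) by blast
  then show ?thesis by (rule gen_weight_vector[OF P st(1)])
qed

lemma weyl_act_reflection:
  assumes "bij w"
  shows "(simple_reflection i \<circ> w) \<cdot>\<^sub>W t = (w \<cdot>\<^sub>W t) \<circ> simple_reflection i"
proof -
  have s: "simple_reflection i \<circ> simple_reflection i = id" by (simp add: fun_eq_iff simple_reflection_involution)
  then have "bij (simple_reflection i)" using o_bij by blast
  moreover have "inv_into UNIV (simple_reflection i) = simple_reflection i" by (rule inv_unique_comp[OF s s])
  ultimately show ?thesis using assms by (simp add: weyl_act_def o_inv_distrib comp_assoc)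
qed

lemma bij_reflection: "bij (simple_reflection i)"
  by (rule o_bij[of "simple_reflection i"]) (simp_all add: fun_eq_iff simple_reflection_involution)

lemma weyl_act_id: "id \<cdot>\<^sub>W t = t" "simple_reflection i \<cdot>\<^sub>W t = t \<circ> simple_reflection i"
  using weyl_act_reflection[of id i t] by (simp_all add: weyl_act_def)

lemma weyl_group_mult: "v \<in> weyl_group \<Longrightarrow> w \<in> weyl_group \<Longrightarrow> bij v \<Longrightarrow> bij w \<Longrightarrow> v \<circ> w \<in> weyl_group"
  unfolding weyl_group_def using generate.eng[of v "BijGroup UNIV" "{s1, s2}" w]
  by (simp add: BijGroup_def Bij_def compose_def restrict_def comp_def)

lemma weyl_group_invariant:
  assumes Om: "\<And>s i. s \<in> Om \<Longrightarrow> s \<circ> simple_reflection i \<in> Om" and w: "w \<in> weyl_group"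
  shows "bij w \<and> (\<forall>s\<in>Om. w \<cdot>\<^sub>W s \<in> Om)"
proof -
  interpret B: group "BijGroup (UNIV :: lattice set)" by (rule group_BijGroup)
  have refl: "bij h \<and> (\<forall>s\<in>Om. h \<cdot>\<^sub>W s \<in> Om)" if "h \<in> {s1, s2}" for h
    using that Om bij_reflection by (auto simp: weyl_act_id)
  have inv: "inv\<^bsub>BijGroup UNIV\<^esub> (simple_reflection i) = simple_reflection i" for i
    by (rule B.inv_equality)
      (use bij_reflection in \<open>auto simp: BijGroup_def Bij_def compose_def restrict_def fun_eq_iff simple_reflection_involution\<close>)
  show ?thesis
    using w unfolding weyl_group_def
  proof (induction rule: generate.induct)
    case one
    have "\<one>\<^bsub>BijGroup UNIV\<^esub> = (id :: lattice \<Rightarrow> lattice)" by (simp add: BijGroup_def fun_eq_iff)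
    moreover have "bij (id :: lattice \<Rightarrow> lattice) \<and> (\<forall>s\<in>Om. id \<cdot>\<^sub>W s \<in> Om)" by (simp only: weyl_act_id bij_id) blast
    ultimately show ?case by metis
  next
    case (incl h) then show ?case by (rule refl)
  next
    case (inv h) then show ?case using refl[OF inv] inv by (auto simp: \<open>\<And>i. inv\<^bsub>BijGroup UNIV\<^esub> (simple_reflection i) = simple_reflection i\<close>)
  next
    case (eng h1 h2)
    then have m: "h1 \<otimes>\<^bsub>BijGroup UNIV\<^esub> h2 = h1 \<circ> h2"
      by (simp add: BijGroup_def Bij_def compose_def restrict_def comp_def)
    have a: "(h1 \<circ> h2) \<cdot>\<^sub>W s = h1 \<cdot>\<^sub>W (h2 \<cdot>\<^sub>W s)" for s using eng by (simp add: weyl_act_def o_inv_distrib comp_assoc)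
    have "(h1 \<circ> h2) \<cdot>\<^sub>W s \<in> Om" if "s \<in> Om" for s unfolding a using eng that by blast
    moreover have "bij (h1 \<circ> h2)" using eng by (blast intro: bij_comp)
    ultimately show ?case unfolding m by blast
  qed
qed

context hecke_param begin

lemma weyl_orbit: "weyl_orbit r0 = orbit"
proof
  show "weyl_orbit r0 \<subseteq> orbit"
    using weyl_group_invariant[of orbit, OF orbit_reflection] by (auto simp: weyl_orbit_def) (simp add: orbit_def)
  have "s1 \<in> weyl_group" "s2 \<in> weyl_group" unfolding weyl_group_def by (auto intro: generate.incl)
  then have g: "simple_reflection i \<in> weyl_group" for i by (cases i) auto
  have step: "s \<circ> simple_reflection i \<in> weyl_orbit r0" if s: "s \<in> weyl_orbit r0" for s i
  proof -
    from s obtain w where w: "w \<in> weyl_group" "s = w \<cdot>\<^sub>W r0" by (auto simp: weyl_orbit_def)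
    have b: "bij w" using weyl_group_invariant[of UNIV w] w(1) by simp
    have "s \<circ> simple_reflection i = (simple_reflection i \<circ> w) \<cdot>\<^sub>W r0" using weyl_act_reflection[OF b] w(2) by simp
    moreover have "simple_reflection i \<circ> w \<in> weyl_group" by (rule weyl_group_mult[OF g w(1) bij_reflection b])
    ultimately show ?thesis by (auto simp: weyl_orbit_def)
  qed
  have "s2 \<cdot>\<^sub>W r0 \<in> weyl_orbit r0" using g by (simp add: weyl_orbit_def)
  then have 0: "r0 \<in> weyl_orbit r0" by (simp add: weyl_act_id r_reflection)
  have 1: "r1 \<in> weyl_orbit r0" using step[OF 0, of I1] by (simp add: r_reflection)
  have 2: "r2 \<in> weyl_orbit r0" using step[OF 1, of I2] by (simp add: r_reflection)
  have 3: "r3 \<in> weyl_orbit r0" using step[OF 2, of I1] by (simp add: r_reflection)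
  have 4: "r4 \<in> weyl_orbit r0" using step[OF 3, of I2] by (simp add: r_reflection)
  have 5: "r5 \<in> weyl_orbit r0" using step[OF 4, of I1] by (simp add: r_reflection)
  show "orbit \<subseteq> weyl_orbit r0" using 0 1 2 3 4 5 by (simp add: orbit_def)
qed

lemma weyl_act_r0:
  "s1 \<cdot>\<^sub>W r0 = r1" "(s2 \<circ> s1) \<cdot>\<^sub>W r0 = r2" "(s1 \<circ> s2 \<circ> s1) \<cdot>\<^sub>W r0 = r3" "(s2 \<circ> s1 \<circ> s2 \<circ> s1) \<cdot>\<^sub>W r0 = r4"
  "(s1 \<circ> s2 \<circ> s1 \<circ> s2 \<circ> s1 \<circ> s2) \<cdot>\<^sub>W r0 = r5"
  by (simp_all add: weyl_act_reflection weyl_act_id r_reflection comp_assoc[of "simple_reflection _"] bij_reflection bij_comp)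

lemma r_torus: "r0 \<in> torus" "r5 \<in> torus"
  using q0 by (simp_all add: r_defs t_of_simps)

lemma central_character:
  assumes P: "presents q UNIV I D \<pi>" and w: "wt I s 1" "s \<in> orbit" "s \<in> torus" "1 \<notin> I"
  shows "has_central_character q D r0"
proof -
  have "s \<in> weights q D" by (rule weight_in_gen[OF P w(1,4,3)])
  moreover have "x \<in> orbit" if x: "x \<in> weights q D" for x
  proof (rule ccontr)
    assume n: "x \<notin> orbit"
    obtain b where b: "b \<notin> I" "wt I x b" using weight_vector_of_weight[OF P x] by blast
    obtain zs where zs: "flag I zs" "cspan I (map fst zs) = UNIV" "snd ` set zs \<subseteq> orbit"
      using orbit_flag[OF presentsD(1)[OF P] w(1,2)] by blast
    have "b \<in> cspan I (map fst ([] :: (free_algebra \<times> (lattice \<Rightarrow> complex)) list))"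
    proof (rule flag_drop[OF left_idealD(4)[OF presentsD(1)[OF P]] _ b(2)])
      show "flag I (zs @ [])" using zs(1) by simp
      show "b \<in> cspan I (map fst (zs @ []))" using zs(2) by simp
      show "x \<notin> snd ` set zs" using zs(3) n by blast
    qed
    then show False using b(1) by simp
  qed
  ultimately show ?thesis by (auto simp: has_central_character_def weyl_orbit)
qed

end

section \<open>The filtration at a primitive fourth root of unity\<close>

text \<open>The filtration consists of the left ideals spanned over \<open>J\<close> by \<open>b4\<close> and by \<open>b4, b3, b2\<close>. The
  weight spaces of weights \<open>r4, r3, r2\<close> are spanned by \<open>b4, b3, b2\<close>.\<close>

lemma (in induced_ideal) weight_filtration:
  fixes D :: "(hecke, 'm) module"
  assumes P: "presents q UNIV J D \<pi>" and one: "1 \<notin> J" and b4: "b4 \<notin> J" and q: "q ^ 4 = - 1"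
  shows "let D1 = weight_space q D r4; Q = quot_module D D1;
      D' = (\<lambda>m. D1 +>\<^bsub>D\<^esub> m) ` (weight_space q D r3 <+>\<^bsub>D\<^esub> weight_space q D r2)
    in submodule D1 (hecke_algebra q) D \<and> one_dimensional q D D1 \<and>
       submodule D' (hecke_algebra q) Q \<and> irreducible_module (hecke_algebra q) (Q\<lparr>carrier := D'\<rparr>) \<and>
       irreducible_module (hecke_algebra q) (quot_module Q D')"
proof -
  let ?B = "cspan J [b4]" and ?C = "cspan J [b4, b3, b2]"
  have cG: "cG = 0" using q by (simp add: cG_zero_iff)
  note B = special_left_ideals(1)[OF cG] and C = special_left_ideals(2)[OF cG]
  have JB: "J \<subseteq> ?B" by (rule cspan_base[OF L])
  have lin: "lin_space (cspan J zs)" for zs by (rule cspan_lin_space[OF L])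
  have BC: "?B \<subseteq> ?C" by (rule cspan_subset[OF lin cspan_base[OF L]]) (simp add: cspan_mem[OF L])
  define D1 where "D1 = weight_space q D r4"
  have D1: "D1 = \<pi> ` ?B" unfolding D1_def weight_space_presents[OF P] weight_spaces(3) ..
  define Q where "Q = quot_module D D1"
  define \<rho> where "\<rho> b = D1 +>\<^bsub>D\<^esub> \<pi> b" for b
  have PQ: "presents q UNIV ?B Q \<rho>"
    unfolding Q_def \<rho>_def D1 by (rule presents_quotient[OF P B JB subset_UNIV])
  define D' where "D' = (\<lambda>m. D1 +>\<^bsub>D\<^esub> m) ` (weight_space q D r3 <+>\<^bsub>D\<^esub> weight_space q D r2)"
  have sum: "weight_space q D r3 <+>\<^bsub>D\<^esub> weight_space q D r2 = \<pi> ` {x + y | x y. x \<in> cspan J [b3] \<and> y \<in> cspan J [b2]}"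
    unfolding weight_space_presents[OF P] weight_spaces set_add_def set_mult_def
    using presentsD(6)[OF P UNIV_I UNIV_I] by (force simp: image_iff)
  have D': "D' = \<rho> ` ?C"
  proof
    have "x + y \<in> ?C" if "x \<in> cspan J [b3]" "y \<in> cspan J [b2]" for x y
    proof -
      have "cspan J [b3] \<subseteq> ?C" "cspan J [b2] \<subseteq> ?C"
        by (rule cspan_subset[OF lin cspan_base[OF L]], simp add: cspan_mem[OF L])+
      then show ?thesis using that by (intro lin_spaceD(2)[OF lin]) auto
    qed
    then show "D' \<subseteq> \<rho> ` ?C" unfolding D'_def sum \<rho>_def by blast
    show "\<rho> ` ?C \<subseteq> D'"
    proof
      fix u assume "u \<in> \<rho> ` ?C"
      then obtain z where z: "u = \<rho> z" "z \<in> ?C" by blast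
      obtain c where c: "z - fC c * b4 \<in> cspan J [b3, b2]" using z(2) by (rule cspan_ConsE)
      obtain d where d: "z - fC c * b4 - fC d * b3 \<in> cspan J [b2]" using c by (rule cspan_ConsE)
      have b: "b3 \<in> cspan J [b3]" "b4 \<in> ?B" by (rule cspan_mem[OF L], simp)+
      have "\<rho> z = \<rho> (fC d * b3 + (z - fC c * b4 - fC d * b3))"
        by (subst presents_eq_iff[OF PQ UNIV_I UNIV_I]) (simp add: lin_spaceD(3)[OF lin b(2)])
      moreover have "fC d * b3 \<in> cspan J [b3]" by (rule lin_spaceD(3)[OF lin b(1)])
      ultimately show "u \<in> D'" unfolding D'_def sum z(1) \<rho>_def using d by blast
    qed
  qed
  have PM: "presents q ?C ?B (Q\<lparr>carrier := D'\<rparr>) \<rho>"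
    unfolding D' by (rule presents_restrict[OF PQ C BC subset_UNIV])
  have PT: "presents q UNIV ?C (quot_module Q D') (\<lambda>b. D' +>\<^bsub>Q\<^esub> \<rho> b)"
    unfolding D' by (rule presents_quotient[OF PQ C BC subset_UNIV])
  have "b2 \<in> ?C" by (rule cspan_mem[OF L]) simp
  then have "adjacent q ?B ?C"
    unfolding adjacent_def using B C BC chain_nonzero(3)[OF b4] middle_irreducible[OF _ _ _ cG] by blast
  then have irr1: "irreducible_module (hecke_algebra q) (Q\<lparr>carrier := D'\<rparr>)"
    by (simp add: presents_irreducible_iff[OF PM])
  have "maximal_ideal q ?C"
    unfolding maximal_ideal_def using C one_not_in_middle[OF one] top_irreducible by blast
  then have irr2: "irreducible_module (hecke_algebra q) (quot_module Q D')"
    by (simp add: presents_irreducible_iff[OF PT] adjacent_UNIV_iff[OF C])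
  have "one_dimensional q D D1"
    unfolding one_dimensional_def
  proof (intro bexI conjI)
    show "\<pi> b4 \<in> D1" unfolding D1 by (rule imageI, rule cspan_mem[OF L]) simp
    show "\<pi> b4 \<noteq> \<zero>\<^bsub>D\<^esub>" using b4 presentsD(5,8)[OF P] by simp
    have "\<exists>c. \<pi> z = hC q c \<odot>\<^bsub>D\<^esub> \<pi> b4" if zB: "z \<in> ?B" for z
    proof -
      obtain c where "z - fC c * b4 \<in> cspan J []" using zB by (rule cspan_ConsE)
      then have "\<pi> z = \<pi> (fC c * b4)" by (simp add: presents_eq_iff[OF P])
      then show ?thesis using presentsD(7)[OF P UNIV_I] by (auto simp: cl_generators)
    qed
    moreover have "hC q c \<odot>\<^bsub>D\<^esub> \<pi> b4 \<in> D1" for c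
      unfolding D1 cl_generators presentsD(7)[OF P UNIV_I, symmetric]
      by (rule imageI, rule lin_spaceD(3)[OF lin], rule cspan_mem[OF L]) simp
    ultimately show "D1 = {hC q c \<odot>\<^bsub>D\<^esub> \<pi> b4 | c. True}" unfolding D1 by blast
  qed
  moreover have "submodule D1 (hecke_algebra q) D"
    unfolding D1 by (rule presents_submodule[OF P B JB subset_UNIV])
  moreover have "submodule D' (hecke_algebra q) Q"
    unfolding D' by (rule presents_submodule[OF PQ C BC subset_UNIV])
  ultimately show ?thesis
    using irr1 irr2 unfolding Let_def D1_def[symmetric] Q_def[symmetric] D'_def[symmetric] by blast
qed

section \<open>The parameter \<open>-1/q\<close>\<close>

text \<open>The defining relations involve \<open>q\<close> only through \<open>q - q\<^sup>-\<^sup>1\<close>, which is unchanged if \<open>q\<close> is replaced by \<open>-q\<^sup>-\<^sup>1\<close>.\<close>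

lemma algebra_swap:
  "hecke_algebra (- inverse q) = hecke_algebra q" "hC (- inverse q) = hC q" "hX (- inverse q) = hX q" "hT (- inverse q) = hT q"
  by (simp_all add: fun_eq_iff hecke_algebra_def hC_def hX_def hT_def hecke_ideal_swap)

lemma module_swap:
  "H_par (- inverse q) = H_par q" "line_par (- inverse q) = line_par q" "presents (- inverse q) = presents q"
  "weight_space (- inverse q) = weight_space q" "one_dimensional (- inverse q) = one_dimensional q"
  "has_central_character (- inverse q) = has_central_character q" "par_ideal (- inverse q) = par_ideal q"
  by (simp_all add: fun_eq_iff H_par_def H_X_def subalgebra_generated_def algebra_swap line_par_def characters_def
      presents_def left_ideal_swap cl_def hecke_ideal_swap weight_space_def one_dimensional_def
      has_central_character_def weights_def gen_weight_space_def par_ideal_def)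

section \<open>Composition factors\<close>

context hecke_param begin

text \<open>The possible annihilators of a suitably chosen vector of an irreducible subquotient.\<close>

definition simple_ideal :: "free_algebra set \<Rightarrow> bool" where
  "simple_ideal J \<longleftrightarrow> maximal_ideal q J \<and> (type_A q J 1 \<or> type_A (- inverse q) J 1 \<or>
     q ^ 4 = - 1 \<and> (type_B q J 1 \<or> type_B (- inverse q) J 1 \<or> type_C q J 1))"

text \<open>The annihilator of an extremal vector has one of the types, and the vector generates because the module is
  irreducible.\<close>

lemma simple_presentation:
  assumes P: "presents q UNIV J D \<rho>" and J: "maximal_ideal q J" and z: "z \<notin> J" "wt J r z" "r \<in> orbit"
  shows "\<exists>J' \<rho>'. presents q UNIV J' D \<rho>' \<and> simple_ideal J'"
proof -
  have lJ: "left_ideal q J" using J by (simp add: maximal_ideal_def)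
  obtain z' where z': "extremal J z'" using extremal_exists[OF lJ z(1,2)] z(3) by (auto simp: orbit_def)
  then have n: "z' \<notin> J" by (simp add: extremal_def)
  have adj: "adjacent q J UNIV" using J by (simp add: adjacent_UNIV_iff[OF lJ])
  have "maximal_ideal q (colon J z')" by (rule adjacent_colon(1)[OF adj UNIV_I n])
  then have "simple_ideal (colon J z')" using z' by (simp add: simple_ideal_def extremal_def type_colon)
  moreover have "presents q UNIV (colon J z') D (\<lambda>a. \<rho> (a * z'))" by (rule presents_colon[OF P adj UNIV_I n])
  ultimately show ?thesis by blast
qed

text \<open>A module generated by a weight vector has a flag with weights in the orbit, so each of its subquotients contains a
  weight vector with weight in the orbit, to which the previous lemma applies.\<close>

lemma composition_factor_simple:
  fixes W :: "(hecke, 'm) module" and L :: "(hecke, 'l) module"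
  assumes W: "presents q UNIV I W \<pi>" and w: "wt I s 1" "s \<in> orbit"
    and L: "composition_factor (hecke_algebra q) W L"
  shows "\<exists>(D :: (hecke, 'm set) module) J \<rho>. module_iso (hecke_algebra q) L D \<and> presents q UNIV J D \<rho> \<and> simple_ideal J"
proof -
  obtain n V i where V: "composition_series (hecke_algebra q) W n V" and i: "i < n"
    and iso: "module_iso (hecke_algebra q) L (quot_module (W\<lparr>carrier := V (Suc i)\<rparr>) (V i))"
    using L by (auto simp: composition_factor_def)
  define D where "D = quot_module (W\<lparr>carrier := V (Suc i)\<rparr>) (V i)"
  have sub: "submodule (V i) (hecke_algebra q) W" "submodule (V (Suc i)) (hecke_algebra q) W" "V i \<subseteq> V (Suc i)"
    and irr: "irreducible_module (hecke_algebra q) D"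
    using V i by (auto simp: composition_series_def D_def)
  define A where "A = {x \<in> UNIV. \<pi> x \<in> V i}"
  define B where "B = {x \<in> UNIV. \<pi> x \<in> V (Suc i)}"
  note a = presents_preimage[OF W sub(1), folded A_def] and b = presents_preimage[OF W sub(2), folded B_def]
  have AB: "A \<subseteq> B" using sub(3) by (auto simp: A_def B_def)
  obtain \<sigma> where D: "presents q B A D \<sigma>"
    using presents_quotient[OF presents_restrict[OF W b(1,2) subset_UNIV] a(1,2) AB] unfolding a(3) b(3) D_def by blast
  have adj: "adjacent q A B" using irr by (simp add: presents_irreducible_iff[OF D])
  then obtain x where x: "x \<in> B" "x \<notin> A" by (auto simp: adjacent_def)
  obtain zs where zs: "flag I zs" "cspan I (map fst zs) = UNIV" "snd ` set zs \<subseteq> orbit"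
    using orbit_flag[OF presentsD(1)[OF W] w] by blast
  obtain z r where z: "z \<in> B" "z \<notin> A" "r \<in> orbit" "wt A r z"
    using weight_vector_in_difference[OF left_idealD(4)[OF presentsD(1)[OF W]] left_idealD(4)[OF b(1)]
        left_idealD(3)[OF a(1)] a(2) zs(1) x(1) _ x(2)] zs(2,3) by blast
  have "presents q UNIV (colon A z) D (\<lambda>c. \<sigma> (c * z))" by (rule presents_colon[OF D adj z(1,2)])
  moreover have "maximal_ideal q (colon A z)" by (rule adjacent_colon(1)[OF adj z(1,2)])
  moreover have "wt (colon A z) r 1" "1 \<notin> colon A z" using z by (simp_all add: wt_colon one_in_colon)
  ultimately obtain J \<rho> where "presents q UNIV J D \<rho>" "simple_ideal J"
    using simple_presentation z(3) by blast
  then show ?thesis using iso unfolding D_def by blast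
qed

text \<open>A vector of some type outside \<open>A\<close> survives in an irreducible subquotient, where it still satisfies the relations
  of its type; these determine the annihilator.\<close>

lemma occurs:
  assumes W: "presents q UNIV I W \<pi>" "finite_length I" and D: "presents q UNIV J D \<rho>" "maximal_ideal q J"
    and A: "left_ideal q A" "I \<subseteq> A" "w \<notin> A"
    and t: "type_A c A w \<and> type_A c J 1 \<or> type_B c A w \<and> type_B c J 1 \<or> type_C c A w \<and> type_C c J 1"
    and c: "c \<in> {q, - inverse q}"
  shows "composition_factor (hecke_algebra q) W D"
proof -
  obtain A' where A': "left_ideal q A'" "A \<subseteq> A'" "maximal_ideal q (colon A' w)"
    using maximal_colon_exists[OF presentsD(1)[OF W(1)] W(2) A] by blast
  have "type_A c (colon A' w) 1 \<and> type_A c J 1 \<or> type_B c (colon A' w) 1 \<and> type_B c J 1 \<or>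
      type_C c (colon A' w) 1 \<and> type_C c J 1"
    using t type_mono[OF A'(2)] unfolding type_colon by blast
  moreover have "hecke_param c" using c swap hecke_param_axioms by blast
  moreover have "maximal_ideal c = maximal_ideal q" using c maximal_ideal_swap by auto
  ultimately have "colon A' w = J"
    using hecke_param.type_unique[of c "colon A' w" J] A'(3) D(2) by simp
  then show ?thesis using composition_factorI[OF W D(1) A'(1) _ _ D(2)] A(2) A'(2) by blast
qed

abbreviation I_M :: "free_algebra set" where "I_M \<equiv> par_ideal q q r0"

lemma induced_ideal_M: "induced_ideal q I_M"
proof
  show "left_ideal q I_M" by (rule par_ideal)
  show "type_A q I_M 1" using par_ideal(2)[of q q r0] par_ideal(3)[of q q r0] by (simp add: type_A_def r0_def)
qed

lemma proper_M: "b4 \<notin> I_M" "1 \<notin> I_M"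
proof -
  obtain J where J: "left_ideal q J" "type_A q J 1" "1 \<notin> J" "b4 \<notin> J" using model_A by blast
  have "I_M \<subseteq> J" using J(2) by (intro par_ideal(4)[OF J(1)]) (simp_all add: type_A_def r0_def)
  then show "b4 \<notin> I_M" "1 \<notin> I_M" using J(3,4) by auto
qed

lemma presents_M:
  "\<exists>\<pi>. presents q UNIV I_M (induced_module (hecke_algebra q) (H_par q I1) (line_par q I1 q r0)) \<pi>"
  by (rule parabolic_presents[OF par_ideal(1,2,3) proper_M(2)])

lemma finite_length_of_weight:
  assumes "left_ideal q I" "wt I s 1" "s \<in> orbit"
  shows "finite_length I"
proof -
  obtain zs where "flag I zs \<and> cspan I (map fst zs) = UNIV \<and> snd ` set zs \<subseteq> orbit"
    using orbit_flag[OF assms] by (rule exE)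
  then have "cspan I (map fst zs) = UNIV" by (rule conjunct1[OF conjunct2])
  then show ?thesis unfolding finite_length_def by (rule exI)
qed

text \<open>The composition factors of types A, B and C for \<open>q\<close> are generated by \<open>1\<close>, \<open>b4\<close> and \<open>b2\<close>.\<close>

lemma types_in_M:
  assumes W: "presents q UNIV I W \<pi>" "finite_length I" "I \<subseteq> I_M" and D: "presents q UNIV J D \<rho>" "maximal_ideal q J"
    and t: "type_A q J 1 \<or> q ^ 4 = - 1 \<and> (type_B q J 1 \<or> type_C q J 1)"
  shows "composition_factor (hecke_algebra q) W D"
proof -
  interpret M: induced_ideal q I_M by (rule induced_ideal_M)
  have c: "q \<in> {q, - inverse q}" by simp
  consider "type_A q J 1" | "q ^ 4 = - 1" "type_B q J 1" | "q ^ 4 = - 1" "type_C q J 1" using t by blast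
  then show ?thesis
  proof cases
    case 1
    show ?thesis by (rule occurs[OF W(1,2) D M.J W(3) proper_M(2) _ c]) (use 1 M.A in blast)
  next
    case 2
    show ?thesis by (rule occurs[OF W(1,2) D M.J W(3) proper_M(1) _ c]) (use 2 M.middle_type(1) in blast)
  next
    case 3
    have cG: "cG = 0" using 3 by (simp add: cG_zero_iff)
    have "I \<subseteq> cspan I_M [b4]" using W(3) cspan_base[OF M.L] by blast
    then show ?thesis
      by (rule occurs[OF W(1,2) D M.special_left_ideals(1)[OF cG] _ M.chain_nonzero(3)[OF proper_M(1)] _ c])
        (use 3 M.middle_type(2) in blast)
  qed
qed

lemma q4_swap: "(- inverse q) ^ 4 = - 1 \<longleftrightarrow> q ^ 4 = - 1"
  using q0 by (simp add: power_inverse) (metis inverse_eq_iff_eq inverse_inverse_eq inverse_minus_eq inverse_1)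

text \<open>Each side is described by the types of vectors that occur in the modules: types A, B and C for \<open>q\<close> occur in
  \<open>M\<close>, types A and B for \<open>-q\<^sup>-\<^sup>1\<close> in \<open>N\<close>, and all of them in \<open>P\<close>, which surjects onto \<open>M\<close> and onto the quotients of
  the model.\<close>

lemma principal_series_factors:
  fixes P :: "(hecke, 'm) module" and M :: "(hecke, 'n) module" and N :: "(hecke, 'k) module" and L :: "(hecke, 'l) module"
  assumes P: "presents q UNIV (X_ideal q r0) P \<pi>" and M: "presents q UNIV I_M M \<mu>"
    and N: "presents q UNIV (par_ideal q (- inverse q) r5) N \<nu>"
  shows "composition_factor (hecke_algebra q) P L \<longleftrightarrow>
    composition_factor (hecke_algebra q) M L \<or> composition_factor (hecke_algebra q) N L"
proof -
  have or: "r0 \<in> orbit" "r5 \<in> orbit" by (auto simp: orbit_def)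
  note fP = finite_length_of_weight[OF X_ideal(1,2) or(1)]
  note fM = finite_length_of_weight[OF par_ideal(1,2) or(1)]
  note fN = finite_length_of_weight[OF par_ideal(1,2) or(2)]
  have XM: "X_ideal q r0 \<subseteq> I_M" by (rule X_ideal(3)[OF par_ideal(1,2)])
  have inP: "composition_factor (hecke_algebra q) P D" if D: "presents q UNIV J D \<rho>" and J: "simple_ideal J"
    for J \<rho> and D :: "(hecke, 'd) module"
  proof -
    have m: "maximal_ideal q J" using J by (simp add: simple_ideal_def)
    consider "type_A q J 1 \<or> q ^ 4 = - 1 \<and> (type_B q J 1 \<or> type_C q J 1)" | "type_A (- inverse q) J 1" |
      "q ^ 4 = - 1" "type_B (- inverse q) J 1"
      using J by (auto simp: simple_ideal_def)
    then show ?thesis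
    proof cases
      case 1 then show ?thesis by (rule types_in_M[OF P fP XM D m])
    next
      case 2
      obtain A w where A: "left_ideal q A" "wt A r0 1" "w \<notin> A" "type_A (- inverse q) A w"
        using model_swapped_A by blast
      show ?thesis
        by (rule occurs[OF P fP D m A(1) X_ideal(3)[OF A(1,2)] A(3), of "- inverse q"]) (use A(4) 2 in auto)
    next
      case 3
      obtain A w where A: "left_ideal q A" "wt A r0 1" "w \<notin> A" "type_B (- inverse q) A w"
        using model_swapped_B[OF 3(1)] by blast
      show ?thesis
        by (rule occurs[OF P fP D m A(1) X_ideal(3)[OF A(1,2)] A(3), of "- inverse q"]) (use A(4) 3 in auto)
    qed
  qed
  have inMN: "composition_factor (hecke_algebra q) M D \<or> composition_factor (hecke_algebra q) N D"
    if D: "presents q UNIV J D \<rho>" and J: "simple_ideal J" for J \<rho> and D :: "(hecke, 'd) module"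
  proof -
    have m: "maximal_ideal q J" using J by (simp add: simple_ideal_def)
    consider "type_A q J 1 \<or> q ^ 4 = - 1 \<and> (type_B q J 1 \<or> type_C q J 1)" |
      "type_A (- inverse q) J 1 \<or> q ^ 4 = - 1 \<and> type_B (- inverse q) J 1"
      using J by (auto simp: simple_ideal_def)
    then show ?thesis
    proof cases
      case 1 then show ?thesis using types_in_M[OF M fM subset_refl D m] by blast
    next
      case 2
      have "composition_factor (hecke_algebra (- inverse q)) N D"
      proof (rule hecke_param.types_in_M[OF swap])
        show "presents (- inverse q) UNIV (par_ideal q (- inverse q) r5) N \<nu>" using N by (simp add: module_swap)
        show "par_ideal q (- inverse q) r5 \<subseteq> par_ideal (- inverse q) (- inverse q) (hecke_param.r0 (- inverse q))"
          by (simp add: module_swap r_swap)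
        show "presents (- inverse q) UNIV J D \<rho>" using D by (simp add: module_swap)
        show "maximal_ideal (- inverse q) J" using m by (simp add: maximal_ideal_swap)
        show "type_A (- inverse q) J 1 \<or> (- inverse q) ^ 4 = - 1 \<and> (type_B (- inverse q) J 1 \<or> type_C (- inverse q) J 1)"
          using 2 unfolding q4_swap by blast
      qed (rule fN)
      then show ?thesis by (simp add: algebra_swap)
    qed
  qed
  show ?thesis
  proof
    assume "composition_factor (hecke_algebra q) P L"
    from composition_factor_simple[OF P X_ideal(2) or(1) this]
    obtain J \<rho> and D :: "(hecke, 'm set) module" where
      D: "module_iso (hecke_algebra q) L D" "presents q UNIV J D \<rho>" "simple_ideal J" by blast
    show "composition_factor (hecke_algebra q) M L \<or> composition_factor (hecke_algebra q) N L"
      using inMN[OF D(2,3)] by (rule disj_forward) (erule composition_factor_iso[OF D(1)])+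
  next
    assume "composition_factor (hecke_algebra q) M L \<or> composition_factor (hecke_algebra q) N L"
    then show "composition_factor (hecke_algebra q) P L"
    proof
      assume "composition_factor (hecke_algebra q) M L"
      from composition_factor_simple[OF M par_ideal(2) or(1) this]
      obtain J \<rho> and D :: "(hecke, 'n set) module" where
        D: "module_iso (hecke_algebra q) L D" "presents q UNIV J D \<rho>" "simple_ideal J" by blast
      show ?thesis by (rule composition_factor_iso[OF D(1) inP[OF D(2,3)]])
    next
      assume "composition_factor (hecke_algebra q) N L"
      from composition_factor_simple[OF N par_ideal(2) or(2) this]
      obtain J \<rho> and D :: "(hecke, 'k set) module" where
        D: "module_iso (hecke_algebra q) L D" "presents q UNIV J D \<rho>" "simple_ideal J" by blast
      show ?thesis by (rule composition_factor_iso[OF D(1) inP[OF D(2,3)]])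
    qed
  qed
qed

text \<open>Generically \<open>I_M\<close> is maximal, and it is the only maximal left ideal of type A.\<close>

lemma generic:
  assumes P: "presents q UNIV I_M M \<pi>" and q: "q ^ 4 \<noteq> - 1"
  shows "irreducible_module (hecke_algebra q) M" "has_central_character q M r0"
    "presents q UNIV J L \<rho> \<Longrightarrow> maximal_ideal q J \<Longrightarrow> type_A q J 1 \<Longrightarrow> module_iso (hecke_algebra q) L M"
proof -
  interpret M: induced_ideal q I_M by (rule induced_ideal_M)
  have m: "maximal_ideal q I_M" by (rule M.generic_maximal[OF q proper_M(2)])
  then show "irreducible_module (hecke_algebra q) M"
    by (simp add: presents_irreducible_iff[OF P] adjacent_UNIV_iff[OF M.J])
  show "has_central_character q M r0"
    by (rule central_character[OF P M.w0 _ r_torus(1) proper_M(2)]) (simp add: orbit_def)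
  assume L: "presents q UNIV J L \<rho>" and J: "maximal_ideal q J" "type_A q J 1"
  have "I_M \<subseteq> J"
    by (rule par_ideal(4)) (use J in \<open>auto simp: maximal_ideal_def type_A_def r0_def\<close>)
  then have "J = I_M" using m J(1) unfolding maximal_ideal_def by metis
  then show "module_iso (hecke_algebra q) L M" using L P by (blast intro: presents_iso)
qed

end

section \<open>Roots of unity\<close>

lemma hecke_param_of_roots:
  assumes "q \<noteq> 0" "q\<^sup>2 \<noteq> 1" "q\<^sup>2 \<noteq> - 1" "\<not> primitive_root_of_unity 3 (q\<^sup>2)"
  shows "hecke_param q"
proof
  show "q \<noteq> 0" "q ^ 2 - 1 \<noteq> 0" using assms by simp_all
  show "q ^ 2 + 1 \<noteq> 0" using assms(3) by (simp only: eq_neg_iff_add_eq_0) simp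
  show "q ^ 4 + q ^ 2 + 1 \<noteq> 0"
  proof
    define u where "u = q\<^sup>2"
    assume "q ^ 4 + q ^ 2 + 1 = 0"
    then have e: "u ^ 2 + u + 1 = 0" by (simp add: u_def flip: power_mult)
    have "u ^ 3 - 1 = (u - 1) * (u ^ 2 + u + 1)" by (simp add: eval_nat_numeral algebra_simps)
    then have "u ^ 3 = 1" using e by simp
    moreover have "u ^ 2 \<noteq> 1"
    proof
      assume s: "u ^ 2 = 1"
      then have "2 + u = 0" using e by simp
      then have "u = - 2" by (simp only: add_eq_0_iff)
      then show False using s by simp
    qed
    moreover have "u \<noteq> 1" using assms(2) by (simp add: u_def)
    moreover have "m = 1 \<or> m = 2" if "0 < m" "m < 3" for m :: nat using that by auto
    ultimately have "primitive_root_of_unity 3 u" unfolding primitive_root_of_unity_def by (metis power_one_right)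
    then show False using assms(4) by (simp add: u_def)
  qed
qed

lemma primitive_fourth_root_iff:
  assumes "q\<^sup>2 \<noteq> 1" "q\<^sup>2 \<noteq> - 1"
  shows "primitive_root_of_unity 4 (q\<^sup>2) \<longleftrightarrow> q ^ 4 = (- 1 :: complex)"
proof -
  define u where "u = q\<^sup>2"
  have u: "u \<noteq> 1" "u \<noteq> - 1" using assms by (simp_all add: u_def)
  have q4: "q ^ 4 = u ^ 2" by (simp add: u_def flip: power_mult)
  have u4: "u ^ 4 = u ^ 2 * u ^ 2" and u3: "u ^ 3 = u ^ 2 * u" by (simp_all add: eval_nat_numeral)
  have s: "u ^ 2 \<noteq> 1" using u unfolding power2_eq_1_iff by blast
  have "primitive_root_of_unity 4 u \<longleftrightarrow> u ^ 2 = - 1"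
  proof
    assume "primitive_root_of_unity 4 u"
    then have "u ^ 2 * u ^ 2 = 1" using u4 unfolding primitive_root_of_unity_def by metis
    then show "u ^ 2 = - 1" using s unfolding square_eq_1_iff by blast
  next
    assume e: "u ^ 2 = - 1"
    have "u ^ 4 = 1" unfolding u4 e by simp
    moreover have "u ^ m \<noteq> 1" if "0 < m" "m < 4" for m
    proof -
      have "m = 1 \<or> m = 2 \<or> m = 3" using that by arith
      moreover have "u ^ 3 = - u" unfolding u3 e by simp
      then have "u ^ 3 \<noteq> 1" using u(2) by (simp add: minus_equation_iff[of u])
      ultimately show ?thesis using u(1) s by (elim disjE) simp_all
    qed
    ultimately show "primitive_root_of_unity 4 u" unfolding primitive_root_of_unity_def by blast
  qed
  then show ?thesis unfolding q4 u_def .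
qed

section \<open>The irreducible modules with central character \<open>t\<close>\<close>

theorem proposition29:
  fixes q :: complex
    and t :: "lattice \<Rightarrow> complex"
    and w0 :: "lattice \<Rightarrow> lattice"
    and M N :: "(hecke, (hecke \<times> complex \<Rightarrow>\<^sub>0 int) set) module"
  assumes q_nonzero: "q \<noteq> 0"
    and q2: "q\<^sup>2 \<noteq> 1" "q\<^sup>2 \<noteq> -1"
    and not_third: "\<not> primitive_root_of_unity 3 (q\<^sup>2)"
    and t: "t = t_of (q\<^sup>2) 1"
    and w0: "w0 = s1 \<circ> s2 \<circ> s1 \<circ> s2 \<circ> s1 \<circ> s2"
    and M: "M = induced_module (hecke_algebra q) (H_par q I1) (line_par q I1 q t)"
    and N: "N = induced_module (hecke_algebra q) (H_par q I1) (line_par q I1 (- inverse q) (w0 \<cdot>\<^sub>W t))"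
  shows
    "(primitive_root_of_unity 4 (q\<^sup>2) \<longrightarrow>
       (let M1 = weight_space q M ((s2 \<circ> s1 \<circ> s2 \<circ> s1) \<cdot>\<^sub>W t);
            Q = quot_module M M1;
            M' = (\<lambda>m. M1 +>\<^bsub>M\<^esub> m) `
                   (weight_space q M ((s1 \<circ> s2 \<circ> s1) \<cdot>\<^sub>W t) <+>\<^bsub>M\<^esub>
                    weight_space q M ((s2 \<circ> s1) \<cdot>\<^sub>W t))
        in submodule M1 (hecke_algebra q) M \<and> one_dimensional q M M1 \<and>
           submodule M' (hecke_algebra q) Q \<and> irreducible_module (hecke_algebra q) (Q\<lparr>carrier := M'\<rparr>) \<and>
           irreducible_module (hecke_algebra q) (quot_module Q M')))
     \<and>
     (primitive_root_of_unity 4 (q\<^sup>2) \<longrightarrow>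
       (let N1 = weight_space q N (s1 \<cdot>\<^sub>W t);
            Q = quot_module N N1;
            N' = (\<lambda>m. N1 +>\<^bsub>N\<^esub> m) `
                   (weight_space q N ((s2 \<circ> s1) \<cdot>\<^sub>W t) <+>\<^bsub>N\<^esub>
                    weight_space q N ((s1 \<circ> s2 \<circ> s1) \<cdot>\<^sub>W t))
        in submodule N1 (hecke_algebra q) N \<and> one_dimensional q N N1 \<and>
           submodule N' (hecke_algebra q) Q \<and> irreducible_module (hecke_algebra q) (Q\<lparr>carrier := N'\<rparr>) \<and>
           irreducible_module (hecke_algebra q) (quot_module Q N')))
     \<and>
     (\<forall>L :: (hecke, 'l) module.
        composition_factor (hecke_algebra q) (principal_series q t) L \<longleftrightarrow>
        composition_factor (hecke_algebra q) M L \<or> composition_factor (hecke_algebra q) N L)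
     \<and>
     (\<not> primitive_root_of_unity 3 (q\<^sup>2) \<and> \<not> primitive_root_of_unity 4 (q\<^sup>2) \<longrightarrow>
        irreducible_module (hecke_algebra q) M \<and> has_central_character q M t \<and>
        irreducible_module (hecke_algebra q) N \<and> has_central_character q N t \<and>
        (\<forall>L :: (hecke, 'l) module.
           irreducible_module (hecke_algebra q) L \<and> has_central_character q L t \<longrightarrow>
           module_iso (hecke_algebra q) L M \<or> module_iso (hecke_algebra q) L N))"
proof -
  let ?p = "- inverse q"
  interpret hecke_param q by (rule hecke_param_of_roots[OF q_nonzero q2 not_third])
  note prim = primitive_fourth_root_iff[OF q2]
  have tr: "t = r0" by (simp add: t r0_def)
  note weights = weyl_act_r0[folded tr]
  have t5: "w0 \<cdot>\<^sub>W t = r5" unfolding w0 weights ..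
  obtain \<mu> where PM: "presents q UNIV I_M M \<mu>" using presents_M unfolding M tr by blast
  obtain \<nu> where PN: "presents q UNIV (par_ideal q ?p r5) N \<nu>"
    using hecke_param.presents_M[OF swap] unfolding N t5 module_swap algebra_swap r_swap by blast
  then have PN': "presents ?p UNIV (par_ideal ?p ?p (hecke_param.r0 ?p)) N \<nu>" by (simp add: module_swap r_swap)
  have "X_ideal q r0 \<subseteq> I_M" by (rule X_ideal(3)[OF par_ideal(1,2)])
  then obtain \<pi> where PP: "presents q UNIV (X_ideal q r0) (principal_series q t) \<pi>"
    using principal_series_presents[OF par_ideal(1,2) proper_M(2)] unfolding tr by blast
  show ?thesis
  proof (intro conjI impI allI)
    assume "primitive_root_of_unity 4 (q\<^sup>2)"
    then have q: "q ^ 4 = - 1" by (simp add: prim)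
    show "let M1 = weight_space q M ((s2 \<circ> s1 \<circ> s2 \<circ> s1) \<cdot>\<^sub>W t);
            Q = quot_module M M1;
            M' = (\<lambda>m. M1 +>\<^bsub>M\<^esub> m) `
                   (weight_space q M ((s1 \<circ> s2 \<circ> s1) \<cdot>\<^sub>W t) <+>\<^bsub>M\<^esub>
                    weight_space q M ((s2 \<circ> s1) \<cdot>\<^sub>W t))
        in submodule M1 (hecke_algebra q) M \<and> one_dimensional q M M1 \<and>
           submodule M' (hecke_algebra q) Q \<and> irreducible_module (hecke_algebra q) (Q\<lparr>carrier := M'\<rparr>) \<and>
           irreducible_module (hecke_algebra q) (quot_module Q M')"
      unfolding weights by (rule induced_ideal.weight_filtration[OF induced_ideal_M PM proper_M(2,1) q])
    have q': "?p ^ 4 = - 1" using q by (simp only: q4_swap)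
    note hp = hecke_param.induced_ideal_M[OF swap] hecke_param.proper_M[OF swap]
    show "let N1 = weight_space q N (s1 \<cdot>\<^sub>W t);
            Q = quot_module N N1;
            N' = (\<lambda>m. N1 +>\<^bsub>N\<^esub> m) `
                   (weight_space q N ((s2 \<circ> s1) \<cdot>\<^sub>W t) <+>\<^bsub>N\<^esub>
                    weight_space q N ((s1 \<circ> s2 \<circ> s1) \<cdot>\<^sub>W t))
        in submodule N1 (hecke_algebra q) N \<and> one_dimensional q N N1 \<and>
           submodule N' (hecke_algebra q) Q \<and> irreducible_module (hecke_algebra q) (Q\<lparr>carrier := N'\<rparr>) \<and>
           irreducible_module (hecke_algebra q) (quot_module Q N')"
      unfolding weights
      by (rule induced_ideal.weight_filtration[OF hp(1) PN' hp(3,2) q', unfolded r_swap module_swap algebra_swap])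
  next
    fix L :: "(hecke, 'l) module"
    show "composition_factor (hecke_algebra q) (principal_series q t) L \<longleftrightarrow>
        composition_factor (hecke_algebra q) M L \<or> composition_factor (hecke_algebra q) N L"
      by (rule principal_series_factors[OF PP PM PN])
  next
    assume "\<not> primitive_root_of_unity 3 (q\<^sup>2) \<and> \<not> primitive_root_of_unity 4 (q\<^sup>2)"
    then have q: "q ^ 4 \<noteq> - 1" by (simp add: prim)
    then have q': "?p ^ 4 \<noteq> - 1" by (simp only: q4_swap) simp
    note gM = generic[OF PM q] and gN = hecke_param.generic[OF swap PN' q', unfolded algebra_swap module_swap r_swap maximal_ideal_swap]
    show "irreducible_module (hecke_algebra q) M" "has_central_character q M t" "irreducible_module (hecke_algebra q) N"
      using gM(1,2) gN(1) by (simp_all add: tr)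
    have or: "r5 \<in> orbit" by (simp add: orbit_def)
    have one: "1 \<notin> par_ideal q ?p r5" using hecke_param.proper_M(2)[OF swap] by (simp add: module_swap r_swap)
    show "has_central_character q N t"
      unfolding tr by (rule central_character[OF PN par_ideal(2) or r_torus(2) one])
    fix L :: "(hecke, 'l) module"
    assume L: "irreducible_module (hecke_algebra q) L \<and> has_central_character q L t"
    then obtain s where s: "s \<in> weights q L" "s \<in> orbit"
      unfolding has_central_character_def tr weyl_orbit by blast
    obtain m where m: "m \<in> carrier L" "m \<noteq> \<zero>\<^bsub>L\<^esub>"
    proof -
      interpret left_module "hecke_algebra q" L using L by (simp add: irreducible_module_def)
      show ?thesis using L that M.zero_closed unfolding irreducible_module_def by blast
    qed
    obtain J where PL: "presents q UNIV J L (\<lambda>a. cl q a \<odot>\<^bsub>L\<^esub> m)" using irreducible_presentation(1)[OF conjunct1[OF L] m] by blast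
    have J: "maximal_ideal q J"
      using L presents_irreducible_iff[OF PL] adjacent_UNIV_iff[OF presentsD(1)[OF PL]] by simp
    obtain z where z: "z \<notin> J" "wt J s z" using weight_vector_of_weight[OF PL s(1)] by blast
    obtain J' \<rho> where L': "presents q UNIV J' L \<rho>" "simple_ideal J'" using simple_presentation[OF PL J z s(2)] by blast
    then have "maximal_ideal q J'" "type_A q J' 1 \<or> type_A ?p J' 1" using q by (auto simp: simple_ideal_def)
    then show "module_iso (hecke_algebra q) L M \<or> module_iso (hecke_algebra q) L N"
      using gM(3)[OF L'(1)] gN(3)[OF L'(1)] by blast
  qed
qed


end
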